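(* Let $N\ge 3$, $0<\gamma<1<p<2^{\ast}-1$, $0<a\in L^{\frac{2}{1+\gamma}}(\mathbb{R}^N)$, $b\in L^\infty(\mathbb{R}^N)$ with $b^+\neq 0$, and let $V:\mathbb{R}^N\to\mathbb{R}$ be a positive continuous function with $\inf_{\mathbb{R}^N}V>0$ satisfying at least one of: (i) $\lim_{|x|\to\infty}V(x)=\infty$; (ii) $1/V\in L^1(\mathbb{R}^N)$; (iii) $|\{x\in\mathbb{R}^N: V(x)\le M\}|<\infty$ for each $M>0$. If $b>0$ in $\mathbb{R}^N$, assume moreover that $[a/b]^{\frac{1}{p+\gamma}}\notin X$. Assume in addition that there exists a smooth bounded open set $\Omega\subset\mathbb{R}^N$ such that $b>0$ in $\Omega$ and $a\in L^\infty(\Omega)$. Then there exists $\lambda^\ast>0$ such that the problem $(P_\lambda)$ has no solution for $\lambda>\lambda^\ast$. Moreover, $$0<\lambda_\ast<\lambda^\ast=\lambda_1^{\frac{p+\gamma}{p-1}}\Big(\frac{\gamma+1}{p-1}\Big)^{\frac{\gamma+1}{p-1}}\Big(\frac{p-1}{p+\gamma}\Big)^{\frac{p+\gamma}{p-1}},$$ where $\lambda_1>0$ is the first eigenvalue of the problem $-\Delta u+V(x)u=\lambda m(x)u$ in $\Omega$, $u\in H_0^1(\Omega)$, $u>0$ in $\Omega$, with $m(x)=\min\{a(x),b(x)\}$.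
   Context: $2^\ast=2N/(N-2)$; $b^+=\max\{b,0\}$. $X=\{u\in H^1(\mathbb{R}^N):\int_{\mathbb{R}^N}V(x)u^2\,dx<\infty\}$ with norm $\|u\|^2=\int_{\mathbb{R}^N}|\nabla u|^2+V(x)u^2\,dx$. Problem $(P_\lambda)$, $\lambda>0$: $-\Delta u+V(x)u=\lambda a(x)u^{-\gamma}+b(x)u^p$ in $\mathbb{R}^N$, $u>0$ in $\mathbb{R}^N$, $u\in X$. A solution is a function $u\in X$, $u>0$ (a.e.), such that $\int_{\mathbb{R}^N}\nabla u\nabla\psi+V(x)u\psi\,dx=\lambda\int_{\mathbb{R}^N}a(x)u^{-\gamma}\psi\,dx+\int_{\mathbb{R}^N}b(x)u^p\psi\,dx$ for all $\psi\in X$ (in particular the integrals are well defined). $$\lambda_\ast=\Big(\tfrac{1+\gamma}{p+\gamma}\Big)^{\frac{1+\gamma}{p-1}}\Big(\tfrac{p-1}{p+\gamma}\Big)\inf\frac{(\|u\|^2)^{\frac{p+\gamma}{p-1}}}{\big[\int_{\mathbb{R}^N} b|u|^{p+1}\big]^{\frac{1+\gamma}{p-1}}\big[\int_{\mathbb{R}^N} a|u|^{1-\gamma}\big]},$$ the infimum being over all $u\in X$, $u\ge0$, $u\not\equiv0$, with $\int_{\mathbb{R}^N} b|u|^{p+1}>0$. *)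

theory Defs
  imports "HOL-Analysis.Analysis"
begin

section \<open>Smooth functions, test functions, smooth domains\<close>

text \<open>\<open>Ck_on k S f\<close> is meant for open \<open>S\<close>: \<open>f\<close> is \<open>k\<close> times continuously differentiable on \<open>S\<close>.\<close>

primrec Ck_on :: "nat \<Rightarrow> 'a::euclidean_space set \<Rightarrow> ('a \<Rightarrow> real) \<Rightarrow> bool" where
  "Ck_on 0 S f \<longleftrightarrow> continuous_on S f"
| "Ck_on (Suc k) S f \<longleftrightarrow>
     (\<forall>x\<in>S. f differentiable (at x)) \<and>
     (\<forall>i\<in>Basis. Ck_on k S (\<lambda>x. frechet_derivative f (at x) i))"

definition smooth_on :: "'a::euclidean_space set \<Rightarrow> ('a \<Rightarrow> real) \<Rightarrow> bool" where
  "smooth_on S f \<longleftrightarrow> (\<forall>k. Ck_on k S f)"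

definition test_functions :: "'a::euclidean_space set \<Rightarrow> ('a \<Rightarrow> real) set" where
  "test_functions S =
     {\<phi>. smooth_on UNIV \<phi> \<and> compact (closure {x. \<phi> x \<noteq> 0}) \<and> closure {x. \<phi> x \<noteq> 0} \<subseteq> S}"

text \<open>Smoothness of the boundary, by local defining functions: near each boundary point the set
  is a strict sublevel set \<open>{\<rho> < 0}\<close> of a smooth \<open>\<rho>\<close> without critical points (so it lies locally
  on one side of its boundary, which is a smooth hypersurface).  No connectedness is required.\<close>

definition smooth_bounded_open :: "'a::euclidean_space set \<Rightarrow> bool" where
  "smooth_bounded_open \<Omega> \<longleftrightarrow>
     open \<Omega> \<and> bounded \<Omega> \<and> \<Omega> \<noteq> {} \<and>
     (\<forall>x0\<in>frontier \<Omega>. \<exists>U \<rho>. open U \<and> x0 \<in> U \<and> smooth_on U \<rho> \<and>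
        (\<forall>x\<in>U. \<exists>i\<in>Basis. frechet_derivative \<rho> (at x) i \<noteq> 0) \<and>
        \<Omega> \<inter> U = {x\<in>U. \<rho> x < 0})"


section \<open>Lebesgue and Sobolev spaces\<close>

text \<open>Functions are not identified when they agree almost everywhere; all the notions below are
  invariant under changes on null sets.\<close>

definition in_Lp :: "real \<Rightarrow> 'a::euclidean_space set \<Rightarrow> ('a \<Rightarrow> 'b::euclidean_space) \<Rightarrow> bool" where
  "in_Lp q S f \<longleftrightarrow>
     f \<in> borel_measurable (lebesgue_on S) \<and> integrable (lebesgue_on S) (\<lambda>x. norm (f x) powr q)"

definition in_Linf :: "'a::euclidean_space set \<Rightarrow> ('a \<Rightarrow> real) \<Rightarrow> bool" where
  "in_Linf S f \<longleftrightarrow>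
     f \<in> borel_measurable (lebesgue_on S) \<and> (\<exists>C. AE x in lebesgue_on S. \<bar>f x\<bar> \<le> C)"

definition locally_integrable :: "'a::euclidean_space set \<Rightarrow> ('a \<Rightarrow> 'b::euclidean_space) \<Rightarrow> bool" where
  "locally_integrable S f \<longleftrightarrow> (\<forall>K. compact K \<and> K \<subseteq> S \<longrightarrow> set_integrable lebesgue K f)"

definition has_weak_grad ::
    "'a::euclidean_space set \<Rightarrow> ('a \<Rightarrow> real) \<Rightarrow> ('a \<Rightarrow> 'a) \<Rightarrow> bool" where
  "has_weak_grad S u g \<longleftrightarrow>
     locally_integrable S u \<and> locally_integrable S g \<and>
     (\<forall>\<phi>\<in>test_functions S. \<forall>i\<in>Basis.
        (\<integral>x. u x * frechet_derivative \<phi> (at x) i \<partial>lebesgue_on S)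
          = - (\<integral>x. (g x \<bullet> i) * \<phi> x \<partial>lebesgue_on S))"

text \<open>For open \<open>S\<close> the weak gradient is unique up to null sets; \<open>weak_grad\<close> picks a representative.\<close>

definition weak_grad :: "'a::euclidean_space set \<Rightarrow> ('a \<Rightarrow> real) \<Rightarrow> 'a \<Rightarrow> 'a" where
  "weak_grad S u = (SOME g. has_weak_grad S u g)"

definition H1 :: "'a::euclidean_space set \<Rightarrow> ('a \<Rightarrow> real) set" where
  "H1 S = {u. in_Lp 2 S u \<and> (\<exists>g. has_weak_grad S u g \<and> in_Lp 2 S g)}"

definition H1_norm :: "'a::euclidean_space set \<Rightarrow> ('a \<Rightarrow> real) \<Rightarrow> real" where
  "H1_norm S u = sqrt (\<integral>x. (norm (weak_grad S u x))\<^sup>2 + (u x)\<^sup>2 \<partial>lebesgue_on S)"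

text \<open>The closure of the test functions in \<open>H1 S\<close>.\<close>

definition H10 :: "'a::euclidean_space set \<Rightarrow> ('a \<Rightarrow> real) set" where
  "H10 S = {u\<in>H1 S. \<forall>\<epsilon>>0. \<exists>\<phi>\<in>test_functions S. H1_norm S (\<lambda>x. u x - \<phi> x) < \<epsilon>}"


section \<open>The space X, the problem, and the two thresholds\<close>

definition X_space :: "('a::euclidean_space \<Rightarrow> real) \<Rightarrow> ('a \<Rightarrow> real) set" where
  "X_space V = {u\<in>H1 UNIV. integrable lebesgue (\<lambda>x. V x * (u x)\<^sup>2)}"

definition X_norm_sq :: "('a::euclidean_space \<Rightarrow> real) \<Rightarrow> ('a \<Rightarrow> real) \<Rightarrow> real" where
  "X_norm_sq V u = (\<integral>x. (norm (weak_grad UNIV u x))\<^sup>2 + V x * (u x)\<^sup>2 \<partial>lebesgue)"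

definition is_solution ::
    "('a::euclidean_space \<Rightarrow> real) \<Rightarrow> ('a \<Rightarrow> real) \<Rightarrow> ('a \<Rightarrow> real) \<Rightarrow> real \<Rightarrow> real \<Rightarrow> real \<Rightarrow>
      ('a \<Rightarrow> real) \<Rightarrow> bool" where
  "is_solution V a b \<gamma> p lam u \<longleftrightarrow>
     u \<in> X_space V \<and> (AE x in lebesgue. 0 < u x) \<and>
     (\<forall>\<psi>\<in>X_space V.
        integrable lebesgue (\<lambda>x. a x * u x powr (- \<gamma>) * \<psi> x) \<and>
        integrable lebesgue (\<lambda>x. b x * u x powr p * \<psi> x) \<and>
        (\<integral>x. weak_grad UNIV u x \<bullet> weak_grad UNIV \<psi> x + V x * u x * \<psi> x \<partial>lebesgue)
          = lam * (\<integral>x. a x * u x powr (- \<gamma>) * \<psi> x \<partial>lebesgue)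
            + (\<integral>x. b x * u x powr p * \<psi> x \<partial>lebesgue))"

definition lambda_lower ::
    "('a::euclidean_space \<Rightarrow> real) \<Rightarrow> ('a \<Rightarrow> real) \<Rightarrow> ('a \<Rightarrow> real) \<Rightarrow> real \<Rightarrow> real \<Rightarrow> real" where
  "lambda_lower V a b \<gamma> p =
     ((1 + \<gamma>) / (p + \<gamma>)) powr ((1 + \<gamma>) / (p - 1)) * ((p - 1) / (p + \<gamma>)) *
     Inf {X_norm_sq V u powr ((p + \<gamma>) / (p - 1)) /
            ((\<integral>x. b x * \<bar>u x\<bar> powr (p + 1) \<partial>lebesgue) powr ((1 + \<gamma>) / (p - 1)) *
             (\<integral>x. a x * \<bar>u x\<bar> powr (1 - \<gamma>) \<partial>lebesgue)) | u.
          u \<in> X_space V \<and> (AE x in lebesgue. 0 \<le> u x) \<and> \<not> (AE x in lebesgue. u x = 0) \<and>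
          0 < (\<integral>x. b x * \<bar>u x\<bar> powr (p + 1) \<partial>lebesgue)}"

text \<open>Eigenfunctions of the Dirichlet problem \<open>-\<Delta> u + V u = l m u\<close> in \<open>\<Omega>\<close>, in the weak sense,
  without sign condition.\<close>

definition is_eigenfunction ::
    "'a::euclidean_space set \<Rightarrow> ('a \<Rightarrow> real) \<Rightarrow> ('a \<Rightarrow> real) \<Rightarrow> real \<Rightarrow> ('a \<Rightarrow> real) \<Rightarrow> bool" where
  "is_eigenfunction \<Omega> V m l u \<longleftrightarrow>
     u \<in> H10 \<Omega> \<and> \<not> (AE x in lebesgue_on \<Omega>. u x = 0) \<and>
     (\<forall>\<psi>\<in>H10 \<Omega>.
        (\<integral>x. weak_grad \<Omega> u x \<bullet> weak_grad \<Omega> \<psi> x + V x * u x * \<psi> x \<partial>lebesgue_on \<Omega>)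
          = l * (\<integral>x. m x * u x * \<psi> x \<partial>lebesgue_on \<Omega>))"

text \<open>The first eigenvalue is the least one, and it has a positive eigenfunction.  If \<open>\<Omega>\<close> is
  disconnected, an eigenfunction of the least eigenvalue may have to vanish on some of the
  components, so then only \<open>u \<ge> 0\<close> (together with \<open>u \<noteq> 0\<close>) is asked for.\<close>

definition is_first_eigenvalue ::
    "'a::euclidean_space set \<Rightarrow> ('a \<Rightarrow> real) \<Rightarrow> ('a \<Rightarrow> real) \<Rightarrow> real \<Rightarrow> bool" where
  "is_first_eigenvalue \<Omega> V m l \<longleftrightarrow>
     (\<exists>u. is_eigenfunction \<Omega> V m l u \<and>
          (AE x in lebesgue_on \<Omega>. 0 \<le> u x) \<and>
          (connected \<Omega> \<longrightarrow> (AE x in lebesgue_on \<Omega>. 0 < u x))) \<and>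
     (\<forall>\<mu> u. is_eigenfunction \<Omega> V m \<mu> u \<longrightarrow> l \<le> \<mu>)"

end

theory Submission
  imports Defs "HOL-Complex_Analysis.Great_Picard" "HOL-Library.Diagonal_Subsequence"
begin

text \<open>Let \<open>\<phi>\<close> be a nonnegative first eigenfunction on \<open>\<Omega>\<close>, extended by zero. It is a subsolution on the
  whole space, so testing a solution \<open>u\<close> of the problem with \<open>\<phi>\<close> gives
  \<open>\<integral> (\<lambda> a u powr (-\<gamma>) + b u powr p) \<phi> \<le> \<lambda>\<^sub>1 \<integral> m u \<phi>\<close>. For \<open>\<lambda>\<close> above the upper constant the scalar
  inequality \<open>\<lambda> t powr (-\<gamma>) + t powr p > \<lambda>\<^sub>1 t\<close> holds for all \<open>t > 0\<close>, which is a contradiction.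

  The numerical factors in the two constants coincide, so the strict inequality between them says that
  the infimum in the lower one is less than \<open>\<lambda>\<^sub>1 powr ((p + \<gamma>) / (p - 1))\<close>. The normalised \<open>\<phi>\<close> itself shows this by
  Hoelder's inequality, which is strict: equality would make \<open>\<phi>\<close> a multiple of an indicator function, and
  no nonzero such function of bounded support has a weak gradient in \<open>L\<^sup>2\<close>. The infimum is positive by
  Hoelder's inequality and the subcritical Sobolev inequality.\<close>

section \<open>Smooth functions and test functions\<close>

text \<open>The zero extension of the ground state is an admissible test function for the singular
  problem, but a solution is not admissible in the eigenvalue equation, because it does not vanish
  on the boundary of \<Omega>. Integration by parts would produce a normal derivative and require
  boundary regularity. The sign is obtained instead by comparing Rayleigh quotients: pushing a
  near-minimiser down by a small multiple of a nonnegative function and truncating leaves a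
  competitor in \<Omega>, and the first-order change has the required sign.

  The upper constant is the threshold in the weighted inequality of arithmetic and geometric means.
  The weights \<open>(p - 1) / (p + \<gamma>)\<close> and
  \<open>(\<gamma> + 1) / (p + \<gamma>)\<close> are the only ones that turn the powers -\<gamma>
  and p of t into the power 1. Multiplied by t, the same identity interpolates the exponent 2
  between 1 - \<gamma> and p + 1, which is the Hoelder inequality behind the lower constant. A
  function normalised by the weight \<open>m\<close> therefore relates both constants to the same
  eigenvalue.\<close>

lemma frechet_derivative_eq:
  "(f has_derivative f') (at x) \<Longrightarrow> frechet_derivative f (at x) v = f' v"
  using frechet_derivative_at by metis

lemma frechet_works: "f differentiable (at x) \<Longrightarrow> (f has_derivative frechet_derivative f (at x)) (at x)"
  by (simp add: frechet_derivative_works)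

text \<open>The product rule leaves one factor undifferentiated, so closure under products at order
  \<open>Suc k\<close> also uses both factors at order \<open>k\<close>.\<close>

lemma Ck_on_SucD: "Ck_on (Suc k) UNIV f \<Longrightarrow> Ck_on k UNIV f"
proof (induction k arbitrary: f)
  case 0
  then show ?case
    by (auto simp: continuous_on_eq_continuous_at differentiable_imp_continuous_within)
next
  case (Suc k)
  then show ?case by (metis Ck_on.simps(2))
qed

lemma Ck_on_add: "Ck_on k UNIV f \<Longrightarrow> Ck_on k UNIV g \<Longrightarrow> Ck_on k UNIV (\<lambda>x. f x + g x)"
proof (induction k arbitrary: f g)
  case (Suc k)
  then have d: "f differentiable (at x)" "g differentiable (at x)" for x by auto
  have eq: "frechet_derivative (\<lambda>x. f x + g x) (at x) i
        = frechet_derivative f (at x) i + frechet_derivative g (at x) i" for x i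
    by (rule frechet_derivative_eq) (intro has_derivative_add frechet_works d)
  have "Ck_on k UNIV (\<lambda>x. frechet_derivative f (at x) i + frechet_derivative g (at x) i)"
    if "i \<in> Basis" for i
    using Suc.prems that by (intro Suc.IH) auto
  then show ?case using d by (auto simp: eq)
qed (auto intro: continuous_intros)

lemma Ck_on_mult: "Ck_on k UNIV f \<Longrightarrow> Ck_on k UNIV g \<Longrightarrow> Ck_on k UNIV (\<lambda>x. f x * g x)"
proof (induction k arbitrary: f g)
  case (Suc k)
  then have d: "f differentiable (at x)" "g differentiable (at x)" for x by auto
  have eq: "frechet_derivative (\<lambda>x. f x * g x) (at x) i
        = f x * frechet_derivative g (at x) i + frechet_derivative f (at x) i * g x" for x i
    by (rule frechet_derivative_eq) (intro has_derivative_mult frechet_works d)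
  have "Ck_on k UNIV (\<lambda>x. f x * frechet_derivative g (at x) i + frechet_derivative f (at x) i * g x)"
    if "i \<in> Basis" for i
    using Suc.prems that Ck_on_SucD[OF Suc.prems(1)] Ck_on_SucD[OF Suc.prems(2)]
    by (intro Ck_on_add Suc.IH) auto
  then show ?case using d by (auto simp: eq)
qed (auto intro: continuous_intros)

lemma Ck_on_const: "Ck_on k UNIV (\<lambda>x. c)"
proof (induction k arbitrary: c)
  case (Suc k)
  have eq: "frechet_derivative (\<lambda>x. c) (at x) i = 0" for x i :: 'a
    by (rule frechet_derivative_eq) (rule has_derivative_const)
  show ?case using Suc by (auto simp: eq)
qed auto

lemma smooth_differentiable: "smooth_on UNIV f \<Longrightarrow> f differentiable (at x)"
  using Ck_on.simps(2)[of 0 UNIV f] by (auto simp: smooth_on_def simp del: Ck_on.simps)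

lemma smooth_has_derivative:
  "smooth_on UNIV f \<Longrightarrow> (f has_derivative frechet_derivative f (at x)) (at x)"
  by (simp add: frechet_works smooth_differentiable)

lemma smooth_onI:
  assumes "\<And>x. f differentiable (at x)"
    "\<And>i. i \<in> Basis \<Longrightarrow> smooth_on UNIV (\<lambda>x. frechet_derivative f (at x) i)"
  shows "smooth_on UNIV f"
  unfolding smooth_on_def
proof
  fix k show "Ck_on k UNIV f"
    using assms by (cases k)
      (auto simp: smooth_on_def continuous_on_eq_continuous_at differentiable_imp_continuous_within)
qed

lemma smooth_partial:
  assumes "smooth_on UNIV f" "i \<in> Basis"
  shows "smooth_on UNIV (\<lambda>x. frechet_derivative f (at x) i)"
  unfolding smooth_on_def using assms Ck_on.simps(2)[of _ UNIV f]
  by (auto simp: smooth_on_def simp del: Ck_on.simps)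

lemma smooth_continuous: "smooth_on UNIV f \<Longrightarrow> continuous_on UNIV f"
  by (meson Ck_on.simps(1) smooth_on_def)

lemma smooth_add: "smooth_on UNIV f \<Longrightarrow> smooth_on UNIV g \<Longrightarrow> smooth_on UNIV (\<lambda>x. f x + g x)"
  by (auto simp: smooth_on_def intro: Ck_on_add)

lemma smooth_mult: "smooth_on UNIV f \<Longrightarrow> smooth_on UNIV g \<Longrightarrow> smooth_on UNIV (\<lambda>x. f x * g x)"
  by (auto simp: smooth_on_def intro: Ck_on_mult)

lemma smooth_const: "smooth_on UNIV (\<lambda>x. c)"
  by (auto simp: smooth_on_def intro: Ck_on_const)

lemma smooth_cmult: "smooth_on UNIV f \<Longrightarrow> smooth_on UNIV (\<lambda>x. c * f x)"
  by (intro smooth_mult smooth_const)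

lemma smooth_diff: "smooth_on UNIV f \<Longrightarrow> smooth_on UNIV g \<Longrightarrow> smooth_on UNIV (\<lambda>x. f x - g x)"
  using smooth_add[of f "\<lambda>x. (-1) * g x"] smooth_cmult[of g "-1"] by simp

lemma smooth_sum: "(\<And>i. i \<in> I \<Longrightarrow> smooth_on UNIV (f i)) \<Longrightarrow> smooth_on UNIV (\<lambda>x. \<Sum>i\<in>I. f i x)"
  by (induction I rule: infinite_finite_induct) (auto intro: smooth_const smooth_add)

lemma smooth_inner: "smooth_on UNIV (\<lambda>x. (x::'a::euclidean_space) \<bullet> v)"
proof (rule smooth_onI)
  have *: "((\<lambda>x. x \<bullet> v) has_derivative (\<lambda>h. h \<bullet> v)) (at x)" for x :: 'a
    by (rule bounded_linear_imp_has_derivative) (rule bounded_linear_inner_left)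
  then show "(\<lambda>x. x \<bullet> v) differentiable (at x)" for x :: 'a
    by (rule differentiableI)
  show "smooth_on UNIV (\<lambda>x. frechet_derivative (\<lambda>x. x \<bullet> v) (at x) i)" for i :: 'a
    by (simp add: frechet_derivative_eq[OF *] smooth_const)
qed

lemma smooth_affine:
  assumes "smooth_on UNIV f" shows "smooth_on UNIV (\<lambda>x. f (c *\<^sub>R x + d))"
proof -
  have "Ck_on k UNIV (\<lambda>x. f (c *\<^sub>R x + d))" if "Ck_on k UNIV f" for k f
    using that
  proof (induction k arbitrary: f)
    case 0
    then have "continuous_on UNIV f" by simp
    then show ?case by (simp, intro continuous_on_compose2[of UNIV f UNIV "\<lambda>x. c *\<^sub>R x + d"])
        (auto intro!: continuous_on_add continuous_on_scaleR)
  next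
    case (Suc k)
    have D: "((\<lambda>x. f (c *\<^sub>R x + d)) has_derivative
        (\<lambda>h. frechet_derivative f (at (c *\<^sub>R x + d)) (c *\<^sub>R h))) (at x)" for x
    proof -
      have "(f has_derivative frechet_derivative f (at (c *\<^sub>R x + d))) (at (c *\<^sub>R x + d))"
        using Suc.prems by (auto intro: frechet_works)
      moreover have "((\<lambda>x. c *\<^sub>R x + d) has_derivative (\<lambda>h. c *\<^sub>R h)) (at x)"
        by (auto intro!: derivative_eq_intros)
      ultimately show ?thesis using diff_chain_at[of "\<lambda>x. c *\<^sub>R x + d" _ x f] by (simp add: o_def)
    qed
    have lin: "frechet_derivative f (at y) (c *\<^sub>R h) = c * frechet_derivative f (at y) h" for y h
    proof -
      have "f differentiable (at y)" using Suc.prems by auto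
      then have "linear (frechet_derivative f (at y))" by (rule linear_frechet_derivative)
      then show ?thesis by (simp add: linear_scale)
    qed
    have "Ck_on k UNIV (\<lambda>x. c * frechet_derivative f (at (c *\<^sub>R x + d)) i)" if "i \<in> Basis" for i
      using Suc.prems that Suc.IH[of "\<lambda>x. frechet_derivative f (at x) i"]
      by (intro Ck_on_mult Ck_on_const) auto
    then show ?case
      using D by (auto intro: differentiableI simp: frechet_derivative_eq[OF D] lin)
  qed
  with assms show ?thesis by (auto simp: smooth_on_def)
qed

lemma frechet_comp_real:
  assumes "f differentiable (at x)" "(G has_real_derivative G') (at (f x))"
  shows "((\<lambda>x. G (f x)) has_derivative (\<lambda>h. G' * frechet_derivative f (at x) h)) (at x)"
  using diff_chain_at[of f _ x G] frechet_works[OF assms(1)] assms(2)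
  by (simp add: o_def has_field_derivative_def)

text \<open>The outer function enters as the whole sequence \<open>G\<close> of its successive
  derivatives. The chain rule then only raises the index \<open>j\<close>, and the induction on the
  order runs with \<open>j\<close> arbitrary.\<close>

lemma smooth_compose:
  assumes G: "\<And>j y. y \<in> T \<Longrightarrow> (G j has_real_derivative G (Suc j) y) (at y)"
    and f: "smooth_on UNIV f" and T: "\<And>x. f x \<in> T"
  shows "smooth_on UNIV (\<lambda>x. G j (f x))"
proof -
  have D: "((\<lambda>x. G j (f x)) has_derivative (\<lambda>h. G (Suc j) (f x) * frechet_derivative f (at x) h)) (at x)" for j x
    by (intro frechet_comp_real smooth_differentiable f G T)
  have "Ck_on k UNIV (\<lambda>x. G j (f x))" for k j
  proof (induction k arbitrary: j)
    case 0
    have "continuous (at x) (\<lambda>x. G j (f x))" for x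
      using D has_derivative_continuous by blast
    then show ?case by (simp add: continuous_on_eq_continuous_at)
  next
    case (Suc k)
    have "Ck_on k UNIV (\<lambda>x. G (Suc j) (f x) * frechet_derivative f (at x) i)" if "i \<in> Basis" for i
      using smooth_partial[OF f that] by (intro Ck_on_mult Suc) (auto simp: smooth_on_def)
    then show ?case using D by (auto intro: differentiableI simp: frechet_derivative_eq[OF D])
  qed
  then show ?thesis by (auto simp: smooth_on_def)
qed

lemma smooth_powr:
  assumes f: "smooth_on UNIV f" and pos: "\<And>x. 0 < f x"
  shows "smooth_on UNIV (\<lambda>x. f x powr s)"
proof -
  \<comment> \<open>The \<open>j\<close>-th derivative of the power, with its falling factorial as
    coefficient.\<close>
  define G where "G j y = (\<Prod>i<j. s - real i) * y powr (s - real j)" for j and y :: real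
  have "smooth_on UNIV (\<lambda>x. G 0 (f x))"
  proof (rule smooth_compose[where T="{0<..}" and G=G and f=f])
    fix j and y :: real assume "y \<in> {0<..}"
    then have "((\<lambda>y. (\<Prod>i<j. s - real i) * y powr (s - real j)) has_real_derivative
        (\<Prod>i<j. s - real i) * ((s - real j) * y powr (s - real j - 1))) (at y)"
      by (auto intro!: derivative_eq_intros has_real_derivative_powr)
    moreover have "s - real j - 1 = s - real (Suc j)" by simp
    ultimately show "(G j has_real_derivative G (Suc j) y) (at y)"
      unfolding G_def by (simp add: mult.assoc)
  qed (use f pos in auto)
  then show ?thesis by (simp add: G_def)
qed

text \<open>\<open>flatd 0\<close> is \<open>exp (- 1 / t)\<close> extended by \<open>0\<close> to \<open>t \<le> 0\<close>, and \<open>flatd j\<close> is its \<open>j\<close>-th derivative.\<close>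

definition flat :: "real poly \<Rightarrow> real \<Rightarrow> real" where
  "flat P t = (if t > 0 then poly P (1/t) * exp (- (1/t)) else 0)"

text \<open>After the substitution \<open>y = 1/t\<close> this is the behaviour at 0 from the right,
  the only point where smoothness of the profile is in question.\<close>

lemma flat_tendsto_0: "((\<lambda>y::real. poly P y * exp (-y)) \<longlongrightarrow> 0) at_top"
proof (induction P)
  case (pCons a P)
  have "((\<lambda>y::real. a * exp (-y)) \<longlongrightarrow> a * 0) at_top"
    by (intro tendsto_mult tendsto_const filterlim_compose[OF exp_at_bot filterlim_uminus_at_bot_at_top])
  moreover have "((\<lambda>y::real. y * (poly P y * exp (-y))) \<longlongrightarrow> 0) at_top"
  proof -
    have "((\<lambda>y::real. y ^ k / exp y) \<longlongrightarrow> 0) at_top" for k by (rule tendsto_power_div_exp_0)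
    then have "((\<lambda>y::real. \<Sum>i\<le>degree P. coeff P i * (y ^ Suc i / exp y)) \<longlongrightarrow> (\<Sum>i\<le>degree P. coeff P i * 0)) at_top"
      by (intro tendsto_sum tendsto_mult tendsto_const)
    moreover have "(\<Sum>i\<le>degree P. coeff P i * (y ^ Suc i / exp y)) = y * (poly P y * exp (-y))" for y
      unfolding poly_altdef sum_distrib_right sum_distrib_left
      by (rule sum.cong) (simp_all add: exp_minus divide_inverse)
    ultimately show ?thesis by simp
  qed
  ultimately have "((\<lambda>y::real. a * exp (-y) + y * (poly P y * exp (-y))) \<longlongrightarrow> a * 0 + 0) at_top"
    by (rule tendsto_add)
  then show ?case by (simp add: algebra_simps)
qed simp

text \<open>With s = 1/t one has d/dt = - s^2 d/ds, which sends P(s) exp(-s) to s^2 (P(s) - P'(s))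
  exp(-s). The class is thus closed under differentiation, and iterating the operation on
  polynomials yields every derivative.\<close>

lemma flat_has_derivative:
  "(flat P has_real_derivative flat ([:0,0,1:] * (P - pderiv P)) t) (at t)"
proof -
  consider "t > 0" | "t < 0" | "t = 0" by linarith
  then show ?thesis
  proof cases
    case 1
    have "((\<lambda>t. poly P (1/t) * exp (- (1/t))) has_real_derivative
       poly ([:0,0,1:] * (P - pderiv P)) (1/t) * exp (- (1/t))) (at t)"
      using 1 by (auto intro!: derivative_eq_intros DERIV_chain2[OF poly_DERIV] simp: algebra_simps power2_eq_square divide_simps)
    moreover have "\<forall>\<^sub>F s in nhds t. s \<in> {0<..}" using 1 by (intro eventually_nhds_in_open) auto
    then have "\<forall>\<^sub>F s in nhds t. flat P s = poly P (1/s) * exp (- (1/s))"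
      by eventually_elim (auto simp: flat_def)
    ultimately show ?thesis using 1 by (subst DERIV_cong_ev[OF refl _ refl]) (auto simp: flat_def)
  next
    case 2
    have "\<forall>\<^sub>F s in nhds t. s \<in> {..<0}" using 2 by (intro eventually_nhds_in_open) auto
    then have "\<forall>\<^sub>F s in nhds t. flat P s = 0"
      by eventually_elim (auto simp: flat_def)
    then show ?thesis using 2 by (subst DERIV_cong_ev[OF refl _ refl]) (auto simp: flat_def)
  next
    case 3
    \<comment> \<open>Division of \<open>flat P h\<close> by \<open>h\<close> multiplies the
      polynomial in 1/h by its variable, hence the factor \<open>[:0,1:]\<close>.\<close>
    have "((\<lambda>y::real. poly ([:0,1:] * P) y * exp (-y)) \<longlongrightarrow> 0) at_top" by (rule flat_tendsto_0)
    then have "((\<lambda>h::real. poly ([:0,1:] * P) (inverse h) * exp (-(inverse h))) \<longlongrightarrow> 0) (at_right 0)"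
      by (rule filterlim_compose[OF _ filterlim_inverse_at_top_right])
    moreover have "\<forall>\<^sub>F h in at_right (0::real). poly ([:0,1:] * P) (inverse h) * exp (-(inverse h)) = (flat P (0 + h) - flat P 0) / h"
      unfolding eventually_at_right[OF zero_less_one] by (auto simp: flat_def field_simps intro!: exI[of _ 1])
    ultimately have r: "((\<lambda>h. (flat P (0 + h) - flat P 0) / h) \<longlongrightarrow> 0) (at_right 0)"
      by (rule Lim_transform_eventually)
    have "\<forall>\<^sub>F h in at_left (0::real). (flat P (0 + h) - flat P 0) / h = 0"
      unfolding eventually_at_left[OF neg_less_0_iff_less[THEN iffD2, OF zero_less_one]]
      by (auto simp: flat_def intro!: exI[of _ "-1"])
    then have l: "((\<lambda>h. (flat P (0 + h) - flat P 0) / h) \<longlongrightarrow> 0) (at_left 0)"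
      by (rule tendsto_eventually)
    from l r show ?thesis using 3
      by (simp add: DERIV_def filterlim_at_split flat_def)
  qed
qed

definition flat_iter :: "nat \<Rightarrow> real poly" where
  "flat_iter j = ((\<lambda>P. [:0,0,1:] * (P - pderiv P)) ^^ j) 1"

definition flatd :: "nat \<Rightarrow> real \<Rightarrow> real" where "flatd j = flat (flat_iter j)"

lemma flatd_has_derivative: "(flatd j has_real_derivative flatd (Suc j) t) (at t)"
  using flat_has_derivative[of "flat_iter j" t] by (simp add: flatd_def flat_iter_def)

lemma flatd_nonpos [simp]: "t \<le> 0 \<Longrightarrow> flatd j t = 0"
  by (simp add: flatd_def flat_def)

lemma flatd_0: "0 < t \<Longrightarrow> flatd 0 t = exp (-(1/t))"
  by (simp add: flatd_def flat_def flat_iter_def)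

lemma flatd_1: "0 < t \<Longrightarrow> flatd (Suc 0) t = exp (-(1/t)) / t\<^sup>2"
  by (simp add: flatd_def flat_def flat_iter_def power2_eq_square)

lemma flatd_0_nonneg: "0 \<le> flatd 0 t" by (cases "t > 0") (auto simp: flatd_0)
lemma flatd_1_nonneg: "0 \<le> flatd (Suc 0) t" by (cases "t > 0") (auto simp: flatd_1)

text \<open>For t > 0 the right side is the left side divided by t^2. The comparison later replaces
  a term carrying the profile by one carrying the mollifier.\<close>

lemma flatd_0_le_1: "t \<le> 1 \<Longrightarrow> flatd 0 t \<le> flatd (Suc 0) t"
proof (cases "t > 0")
  case True
  assume "t \<le> 1"
  with True have "t\<^sup>2 \<le> 1" by (simp add: power_le_one)
  with True show ?thesis by (simp add: flatd_0 flatd_1 field_simps)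
qed simp

lemma flatd_continuous: "continuous_on UNIV (flatd j)"
  using flatd_has_derivative DERIV_isCont by (metis continuous_on_eq_continuous_at open_UNIV)

lemma smooth_flatd: "smooth_on UNIV f \<Longrightarrow> smooth_on UNIV (\<lambda>x. flatd j (f x))"
  by (rule smooth_compose[where T=UNIV and G=flatd and f=f]) (auto intro: flatd_has_derivative)

lemma flatd_bounded: "\<exists>C\<ge>0. \<forall>t\<le>1. \<bar>flatd j t\<bar> \<le> C"
proof -
  have "compact (flatd j ` {0..1})"
    by (intro compact_continuous_image continuous_on_subset[OF flatd_continuous]) auto
  then have "bounded (flatd j ` {0..1})" by (rule compact_imp_bounded)
  then obtain C where C: "\<And>t. t \<in> {0..1} \<Longrightarrow> \<bar>flatd j t\<bar> \<le> C" unfolding bounded_iff by (metis imageI real_norm_def)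
  have "\<bar>flatd j t\<bar> \<le> max C 0" if "t \<le> 1" for t
  proof (cases "t \<ge> 0")
    case True then show ?thesis using C[of t] that by auto
  qed simp
  then show ?thesis by (intro exI[of _ "max C 0"]) auto
qed

section \<open>Gradients of smooth functions\<close>

definition grad :: "('a::euclidean_space \<Rightarrow> real) \<Rightarrow> 'a \<Rightarrow> 'a" where
  "grad f x = (\<Sum>i\<in>Basis. frechet_derivative f (at x) i *\<^sub>R i)"

lemma grad_inner_Basis: "i \<in> Basis \<Longrightarrow> grad f x \<bullet> i = frechet_derivative f (at x) i"
  unfolding grad_def by (simp add: inner_sum_left inner_Basis if_distrib sum.If_cases cong: if_cong)

lemma frechet_eq_grad:
  assumes "f differentiable (at x)"
  shows "frechet_derivative f (at x) h = grad f x \<bullet> h"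
proof -
  have lin: "linear (frechet_derivative f (at x))" by (rule linear_frechet_derivative[OF assms])
  have "frechet_derivative f (at x) h = frechet_derivative f (at x) (\<Sum>i\<in>Basis. (h \<bullet> i) *\<^sub>R i)"
    by (simp add: euclidean_representation)
  also have "\<dots> = (\<Sum>i\<in>Basis. (h \<bullet> i) * frechet_derivative f (at x) i)"
    by (simp add: linear_sum[OF lin] linear_scale[OF lin])
  also have "\<dots> = grad f x \<bullet> h"
    by (simp add: grad_def inner_sum_left mult.commute inner_commute[of h])
  finally show ?thesis .
qed

lemma smooth_has_grad: "smooth_on UNIV f \<Longrightarrow> (f has_derivative (\<lambda>h. grad f x \<bullet> h)) (at x)"
  using smooth_has_derivative[of f x] frechet_eq_grad[OF smooth_differentiable, of f x]
  by (metis (no_types, lifting) ext)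

lemma grad_eqI:
  assumes "(f has_derivative (\<lambda>h. v \<bullet> h)) (at x)" shows "grad f x = v"
  by (rule euclidean_eqI) (simp add: grad_inner_Basis frechet_derivative_eq[OF assms])

lemma grad_add: "smooth_on UNIV f \<Longrightarrow> smooth_on UNIV g \<Longrightarrow> grad (\<lambda>x. f x + g x) x = grad f x + grad g x"
  by (rule grad_eqI) (auto simp: inner_add_left intro!: has_derivative_add smooth_has_grad)

lemma grad_cmult: "smooth_on UNIV f \<Longrightarrow> grad (\<lambda>x. c * f x) x = c *\<^sub>R grad f x"
  by (rule grad_eqI) (auto intro!: has_derivative_mult_right smooth_has_grad)

lemma grad_comp:
  assumes "smooth_on UNIV f" "(G has_real_derivative G') (at (f x))"
  shows "grad (\<lambda>x. G (f x)) x = G' *\<^sub>R grad f x"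
  using frechet_comp_real[OF smooth_differentiable[OF assms(1)] assms(2)]
  by (intro grad_eqI) (simp add: frechet_eq_grad smooth_differentiable assms)

text \<open>Any compact set outside which the function vanishes contains the closed support, since
  it is closed. Such a set is easier to exhibit than the support and survives sums, products and
  derivatives.\<close>

lemma test_functions_iff:
  "\<phi> \<in> test_functions S \<longleftrightarrow>
     smooth_on UNIV \<phi> \<and> (\<exists>K. compact K \<and> K \<subseteq> S \<and> (\<forall>x. x \<notin> K \<longrightarrow> \<phi> x = 0))"
proof
  assume "\<phi> \<in> test_functions S"
  then show "smooth_on UNIV \<phi> \<and> (\<exists>K. compact K \<and> K \<subseteq> S \<and> (\<forall>x. x \<notin> K \<longrightarrow> \<phi> x = 0))"
    using closure_subset[of "{x. \<phi> x \<noteq> 0}"] unfolding test_functions_def by blast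
next
  assume "smooth_on UNIV \<phi> \<and> (\<exists>K. compact K \<and> K \<subseteq> S \<and> (\<forall>x. x \<notin> K \<longrightarrow> \<phi> x = 0))"
  then obtain K where K: "smooth_on UNIV \<phi>" "compact K" "K \<subseteq> S" "\<forall>x. x \<notin> K \<longrightarrow> \<phi> x = 0" by auto
  then have "closure {x. \<phi> x \<noteq> 0} \<subseteq> K"
    by (intro closure_minimal compact_imp_closed) auto
  moreover have "bounded {x. \<phi> x \<noteq> 0}"
    using K by (intro bounded_subset[OF compact_imp_bounded[OF K(2)]]) auto
  ultimately show "\<phi> \<in> test_functions S" using K by (simp add: test_functions_def)
qed

lemma test_smooth: "\<phi> \<in> test_functions S \<Longrightarrow> smooth_on UNIV \<phi>"
  by (simp add: test_functions_def)

lemma test_mono: "\<phi> \<in> test_functions S \<Longrightarrow> S \<subseteq> T \<Longrightarrow> \<phi> \<in> test_functions T"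
  by (auto simp: test_functions_def)

lemma test_UNIV: "\<phi> \<in> test_functions S \<Longrightarrow> \<phi> \<in> test_functions UNIV"
  by (auto simp: test_functions_def)

lemma test_outside: "\<phi> \<in> test_functions S \<Longrightarrow> x \<notin> S \<Longrightarrow> \<phi> x = 0"
  by (auto simp: test_functions_iff)

lemma frechet_zero_open:
  assumes "open U" "x \<in> U" "\<And>y. y \<in> U \<Longrightarrow> f y = (0::real)"
  shows "frechet_derivative f (at x) v = 0"
proof -
  have "((\<lambda>_. 0::real) has_derivative (\<lambda>_. 0)) (at x)" by (rule has_derivative_const)
  then have "(f has_derivative (\<lambda>_. 0)) (at x)"
    using assms by (intro has_derivative_transform_within_open[of "\<lambda>_. 0" _ x UNIV U f]) auto
  then show ?thesis by (rule frechet_derivative_eq)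
qed

lemma test_add:
  assumes "\<phi> \<in> test_functions S" "\<psi> \<in> test_functions S"
  shows "(\<lambda>x. \<phi> x + \<psi> x) \<in> test_functions S"
proof -
  obtain K L where "compact K" "K \<subseteq> S" "\<forall>x. x \<notin> K \<longrightarrow> \<phi> x = 0"
    "compact L" "L \<subseteq> S" "\<forall>x. x \<notin> L \<longrightarrow> \<psi> x = 0" using assms unfolding test_functions_iff by auto
  then show ?thesis using assms unfolding test_functions_iff
    by (auto intro!: smooth_add exI[of _ "K \<union> L"])
qed

lemma test_mult:
  "\<phi> \<in> test_functions S \<Longrightarrow> smooth_on UNIV f \<Longrightarrow> (\<lambda>x. f x * \<phi> x) \<in> test_functions S"
  unfolding test_functions_iff by (auto intro!: smooth_mult)

lemma test_cmult: "\<phi> \<in> test_functions S \<Longrightarrow> (\<lambda>x. c * \<phi> x) \<in> test_functions S"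
  by (intro test_mult smooth_const)

lemma test_zero: "(\<lambda>x. 0) \<in> test_functions S"
  unfolding test_functions_iff by (auto intro: smooth_const)

lemma test_sum: "(\<And>i. i \<in> I \<Longrightarrow> f i \<in> test_functions S) \<Longrightarrow> (\<lambda>x. \<Sum>i\<in>I. f i x) \<in> test_functions S"
  by (induction I rule: infinite_finite_induct) (auto intro: test_zero test_add)

lemma test_partial:
  assumes "\<phi> \<in> test_functions S" "i \<in> Basis"
  shows "(\<lambda>x. frechet_derivative \<phi> (at x) i) \<in> test_functions S"
proof -
  obtain K where K: "compact K" "K \<subseteq> S" "\<And>x. x \<notin> K \<Longrightarrow> \<phi> x = 0" using assms(1) unfolding test_functions_iff by auto
  have "frechet_derivative \<phi> (at x) i = 0" if "x \<notin> K" for x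
    by (rule frechet_zero_open[of "- K"]) (use K that in \<open>auto simp: compact_imp_closed open_Compl\<close>)
  then show ?thesis using K assms unfolding test_functions_iff by (auto intro!: smooth_partial)
qed

lemma test_grad_outside:
  assumes "\<phi> \<in> test_functions S" "x \<notin> S" shows "grad \<phi> x = 0"
  using test_outside[OF test_partial[OF assms(1)] assms(2)] by (simp add: grad_def)

lemma test_affine:
  assumes "\<phi> \<in> test_functions UNIV" "c \<noteq> 0"
  shows "(\<lambda>x. \<phi> (c *\<^sub>R x + d)) \<in> test_functions UNIV"
proof -
  obtain K where K: "compact K" "\<And>x. x \<notin> K \<Longrightarrow> \<phi> x = 0" using assms unfolding test_functions_iff by auto
  have "compact ((\<lambda>y. (1/c) *\<^sub>R (y - d)) ` K)"
    by (intro compact_continuous_image K continuous_intros)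
  moreover have "\<phi> (c *\<^sub>R x + d) = 0" if "x \<notin> (\<lambda>y. (1/c) *\<^sub>R (y - d)) ` K" for x
  proof (rule K(2))
    have "x = (1/c) *\<^sub>R ((c *\<^sub>R x + d) - d)" using assms by simp
    then show "c *\<^sub>R x + d \<notin> K" using that by blast
  qed
  ultimately show ?thesis using assms unfolding test_functions_iff by (auto intro!: smooth_affine)
qed

lemma test_continuous: "\<phi> \<in> test_functions S \<Longrightarrow> continuous_on UNIV \<phi>"
  by (simp add: test_smooth smooth_continuous)

lemma test_bounded:
  assumes "\<phi> \<in> test_functions S" shows "\<exists>C\<ge>0. \<forall>x. \<bar>\<phi> x\<bar> \<le> C"
proof -
  obtain K where K: "compact K" "\<And>x. x \<notin> K \<Longrightarrow> \<phi> x = 0" using assms unfolding test_functions_iff by auto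
  have "compact (\<phi> ` K)"
    by (intro compact_continuous_image K continuous_on_subset[OF test_continuous[OF assms]]) auto
  then have "bounded (\<phi> ` K)" by (rule compact_imp_bounded)
  then obtain C where C: "\<And>t. t \<in> K \<Longrightarrow> \<bar>\<phi> t\<bar> \<le> C" unfolding bounded_iff by (metis imageI real_norm_def)
  have "\<bar>\<phi> t\<bar> \<le> max C 0" for t using C[of t] K(2)[of t] by (cases "t \<in> K") auto
  then show ?thesis by (intro exI[of _ "max C 0"]) auto
qed

lemma grad_bounded:
  assumes "\<phi> \<in> test_functions S" shows "\<exists>C\<ge>0. \<forall>x. norm (grad \<phi> x) \<le> C"
proof -
  have "\<forall>i\<in>Basis. \<exists>C\<ge>0. \<forall>x. \<bar>frechet_derivative \<phi> (at x) i\<bar> \<le> C"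
    using test_bounded[OF test_partial[OF assms]] by auto
  then obtain C where C: "\<And>i. i \<in> Basis \<Longrightarrow> C i \<ge> 0" "\<And>i x. i \<in> Basis \<Longrightarrow> \<bar>frechet_derivative \<phi> (at x) i\<bar> \<le> C i"
    by metis
  have "norm (grad \<phi> x) \<le> sum C Basis" for x
    unfolding grad_def by (intro order_trans[OF norm_sum] sum_mono) (auto simp: C)
  then show ?thesis using C by (intro exI[of _ "sum C Basis"]) (auto intro: sum_nonneg)
qed

lemma test_lipschitz:
  assumes "\<phi> \<in> test_functions S" shows "\<exists>C\<ge>0. \<forall>x y. \<bar>\<phi> x - \<phi> y\<bar> \<le> C * norm (x - y)"
proof -
  obtain C where C: "C \<ge> 0" "\<And>x. norm (grad \<phi> x) \<le> C" using grad_bounded[OF assms] by auto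
  have "norm (\<phi> x - \<phi> y) \<le> C * norm (x - y)" for x y
  proof (rule differentiable_bound[of UNIV \<phi> "\<lambda>x h. grad \<phi> x \<bullet> h"])
    show "onorm (\<lambda>h. grad \<phi> x \<bullet> h) \<le> C" for x
      by (rule onorm_bound) (use C in \<open>auto intro!: order_trans[OF Cauchy_Schwarz_ineq2] mult_right_mono\<close>)
  qed (auto intro: smooth_has_grad test_smooth assms)
  then show ?thesis using C by auto
qed

lemma grad_lipschitz:
  assumes "\<phi> \<in> test_functions S" shows "\<exists>C\<ge>0. \<forall>x y. norm (grad \<phi> x - grad \<phi> y) \<le> C * norm (x - y)"
proof -
  have "\<forall>i\<in>Basis. \<exists>C\<ge>0. \<forall>x y. \<bar>frechet_derivative \<phi> (at x) i - frechet_derivative \<phi> (at y) i\<bar> \<le> C * norm (x - y)"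
    using test_lipschitz[OF test_partial[OF assms]] by auto
  then obtain C where C: "\<And>i. i \<in> Basis \<Longrightarrow> C i \<ge> 0"
    "\<And>i x y. i \<in> Basis \<Longrightarrow> \<bar>frechet_derivative \<phi> (at x) i - frechet_derivative \<phi> (at y) i\<bar> \<le> C i * norm (x - y)"
    by metis
  have "norm (grad \<phi> x - grad \<phi> y) \<le> sum C Basis * norm (x - y)" for x y
  proof -
    have "grad \<phi> x - grad \<phi> y = (\<Sum>i\<in>Basis. (frechet_derivative \<phi> (at x) i - frechet_derivative \<phi> (at y) i) *\<^sub>R i)"
      by (simp add: grad_def sum_subtractf scaleR_diff_left)
    also have "norm \<dots> \<le> (\<Sum>i\<in>Basis. C i * norm (x - y))"
      by (intro order_trans[OF norm_sum] sum_mono) (auto simp: C)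
    finally show ?thesis by (simp add: sum_distrib_right)
  qed
  then show ?thesis using C by (intro exI[of _ "sum C Basis"]) (auto intro: sum_nonneg)
qed

lemma grad_continuous: "smooth_on UNIV \<phi> \<Longrightarrow> continuous_on UNIV (grad \<phi>)"
  unfolding grad_def by (intro continuous_intros smooth_continuous smooth_partial)

text \<open>The mean value inequality is applied to the function minus its linearisation at
  \<open>z\<close>, whose gradient is at most a constant times the distance to \<open>z\<close>. The
  constant is uniform in \<open>z\<close>, which allows differentiation of convolutions with merely
  square-integrable functions.\<close>

lemma test_taylor:
  assumes "\<phi> \<in> test_functions S"
  shows "\<exists>C\<ge>0. \<forall>z h. \<bar>\<phi> (z + h) - \<phi> z - grad \<phi> z \<bullet> h\<bar> \<le> C * (norm h)\<^sup>2"
proof -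
  obtain C where C: "C \<ge> 0" "\<And>x y. norm (grad \<phi> x - grad \<phi> y) \<le> C * norm (x - y)"
    using grad_lipschitz[OF assms] by auto
  have "\<bar>\<phi> (z + h) - \<phi> z - grad \<phi> z \<bullet> h\<bar> \<le> C * (norm h)\<^sup>2" for z h
  proof -
    let ?f = "\<lambda>x. \<phi> x - grad \<phi> z \<bullet> x"
    have "norm (?f (z + h) - ?f z) \<le> (C * norm h) * norm ((z + h) - z)"
    proof (rule differentiable_bound[of "cball z (norm h)" ?f "\<lambda>x h. (grad \<phi> x - grad \<phi> z) \<bullet> h"])
      fix x assume x: "x \<in> cball z (norm h)"
      show "(?f has_derivative (\<lambda>h. (grad \<phi> x - grad \<phi> z) \<bullet> h)) (at x within cball z (norm h))"
        unfolding inner_diff_left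
        by (intro has_derivative_diff has_derivative_at_withinI[OF smooth_has_grad] test_smooth[OF assms]
            bounded_linear_imp_has_derivative bounded_linear_inner_right)
      have "norm (grad \<phi> x - grad \<phi> z) \<le> C * norm h"
        using C(2)[of x z] x C(1) by (auto simp: dist_norm norm_minus_commute intro: order_trans mult_left_mono)
      then show "onorm (\<lambda>h. (grad \<phi> x - grad \<phi> z) \<bullet> h) \<le> C * norm h"
        using C(1) by (intro onorm_bound) (auto intro!: order_trans[OF Cauchy_Schwarz_ineq2] mult_right_mono)
    qed (auto simp: dist_norm)
    then show ?thesis by (simp add: inner_add_right power2_eq_square algebra_simps)
  qed
  then show ?thesis using C by auto
qed

section \<open>Radial bump functions\<close>

lemma smooth_dist_sq: "smooth_on UNIV (\<lambda>y::'a::euclidean_space. (norm (y - x0))\<^sup>2)"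
proof -
  have "(\<lambda>y. (norm (y - x0))\<^sup>2) = (\<lambda>y. \<Sum>i\<in>Basis. (y \<bullet> i - x0 \<bullet> i) * (y \<bullet> i - x0 \<bullet> i))"
    by (rule ext) (subst power2_norm_eq_inner, subst euclidean_inner, simp only: inner_diff_left)
  moreover have "smooth_on UNIV (\<lambda>y. y \<bullet> i - x0 \<bullet> i)" for i :: 'a
    by (intro smooth_diff smooth_inner smooth_const)
  ultimately show ?thesis by (simp only: smooth_sum smooth_mult)
qed

text \<open>The index counts derivatives of the profile, not of the bump: differentiating in
  \<open>y\<close> raises \<open>j\<close> by one and brings out the factor -2 (y - x0) / r^2.
  Gradients and Laplacians of bumps are therefore expressed by bumps again.\<close>

definition bump :: "nat \<Rightarrow> 'a::euclidean_space \<Rightarrow> real \<Rightarrow> 'a \<Rightarrow> real" where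
  "bump j x0 r y = flatd j (1 - (norm (y - x0))\<^sup>2 / r\<^sup>2)"

lemma bump_outside: "0 < r \<Longrightarrow> y \<notin> ball x0 r \<Longrightarrow> bump j x0 r y = 0"
  unfolding bump_def
  by (rule flatd_nonpos) (simp add: dist_norm norm_minus_commute divide_simps power_mono)

lemma smooth_bump: "smooth_on UNIV (bump j x0 r)"
proof -
  have "smooth_on UNIV (\<lambda>y. flatd j (1 - (1 / r\<^sup>2) * (norm (y - x0))\<^sup>2))"
    by (intro smooth_flatd smooth_diff smooth_const smooth_cmult smooth_dist_sq)
  then show ?thesis unfolding bump_def[abs_def] by simp
qed

lemma test_bump:
  assumes "0 < r" "cball x0 r \<subseteq> S" shows "bump j x0 r \<in> test_functions S"
  unfolding test_functions_iff
proof (intro conjI smooth_bump exI[of _ "cball x0 r"] allI impI)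
  fix y assume "y \<notin> cball x0 r"
  then have "y \<notin> ball x0 r" by simp
  then show "bump j x0 r y = 0" by (rule bump_outside[OF assms(1)])
qed (use assms in auto)

lemma bump_pos:
  assumes "0 < r" "y \<in> ball x0 r" shows "0 < bump 0 x0 r y" "0 < bump (Suc 0) x0 r y"
proof -
  have "(norm (y - x0))\<^sup>2 < r\<^sup>2" using assms by (intro power_strict_mono) (auto simp: dist_norm norm_minus_commute)
  then have p: "0 < 1 - (norm (y - x0))\<^sup>2 / r\<^sup>2" using assms by (simp add: divide_simps)
  then show "0 < bump 0 x0 r y" "0 < bump (Suc 0) x0 r y"
    unfolding bump_def flatd_0[OF p] flatd_1[OF p]
    by (intro exp_gt_zero divide_pos_pos zero_less_power p)+
qed

lemma bump_nonneg: "0 \<le> bump 0 x0 r y" "0 \<le> bump (Suc 0) x0 r y"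
  by (simp_all add: bump_def flatd_0_nonneg flatd_1_nonneg)

lemma bump_0_le_1: "bump 0 x0 r y \<le> bump (Suc 0) x0 r y"
  unfolding bump_def by (intro flatd_0_le_1) auto

section \<open>Square-integrable functions\<close>

text \<open>Borel functions and \<open>lborel\<close> serve as the working setting, in which
  translations, reflections and iterated integrals stay measurable. Lebesgue measurable functions
  are replaced by Borel representatives once, when the spaces of the theorem are entered. The
  companion \<open>n2\<close> is the squared norm.\<close>

definition L2 :: "('a::euclidean_space \<Rightarrow> 'b::euclidean_space) \<Rightarrow> bool" where
  "L2 f \<longleftrightarrow> f \<in> borel_measurable borel \<and> integrable lborel (\<lambda>x. (norm (f x))\<^sup>2)"

definition n2 :: "('a::euclidean_space \<Rightarrow> 'b::euclidean_space) \<Rightarrow> real" where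
  "n2 f = (\<integral>x. (norm (f x))\<^sup>2 \<partial>lborel)"

lemma L2_measurable [measurable_dest]: "L2 f \<Longrightarrow> f \<in> borel_measurable borel" by (simp add: L2_def)

lemma L2_integrable: "L2 f \<Longrightarrow> integrable lborel (\<lambda>x. (norm (f x))\<^sup>2)" by (simp add: L2_def)

lemma n2_nonneg [simp]: "0 \<le> n2 f" unfolding n2_def by (rule Bochner_Integration.integral_nonneg) simp

lemma n2_nn: "L2 f \<Longrightarrow> (\<integral>\<^sup>+x. ennreal ((norm (f x))\<^sup>2) \<partial>lborel) = ennreal (n2 f)"
  unfolding n2_def by (intro nn_integral_eq_integral L2_integrable) auto

lemma L2_from_nn:
  assumes "f \<in> borel_measurable borel" "(\<integral>\<^sup>+x. ennreal ((norm (f x))\<^sup>2) \<partial>lborel) \<le> ennreal c" "0 \<le> c"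
  shows "L2 f" "n2 f \<le> c"
proof -
  have "(\<integral>\<^sup>+x. ennreal ((norm (f x))\<^sup>2) \<partial>lborel) < \<infinity>" using assms(2) by (simp add: order_le_less_trans)
  then have "integrable lborel (\<lambda>x. (norm (f x))\<^sup>2)"
    using assms(1) by (intro integrableI_bounded) auto
  then show "L2 f" using assms(1) by (simp add: L2_def)
  then show "n2 f \<le> c" using n2_nn assms by (metis ennreal_le_iff)
qed

lemma young_norm: "norm (a::'b::real_normed_vector) * norm (b::'c::real_normed_vector) \<le> ((norm a)\<^sup>2 + (norm b)\<^sup>2) / 2"
  using sum_squares_bound[of "norm a" "norm b"] by simp

lemma L2_norm_mult_integrable:
  assumes [measurable]: "L2 f" "L2 g" shows "integrable lborel (\<lambda>x. norm (f x) * norm (g x))"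
proof (rule Bochner_Integration.integrable_bound)
  show "integrable lborel (\<lambda>x. (norm (f x))\<^sup>2 + (norm (g x))\<^sup>2)" using assms by (simp add: L2_integrable)
  have "norm (norm (f x) * norm (g x)) \<le> norm ((norm (f x))\<^sup>2 + (norm (g x))\<^sup>2)" for x
  proof -
    have "norm (f x) * norm (g x) \<le> (norm (f x))\<^sup>2 + (norm (g x))\<^sup>2"
      by (rule order_trans[OF young_norm]) simp
    then show ?thesis by simp
  qed
  then show "AE x in lborel. norm (norm (f x) * norm (g x)) \<le> norm ((norm (f x))\<^sup>2 + (norm (g x))\<^sup>2)" by simp
qed measurable

lemma L2_inner_integrable:
  assumes [measurable]: "L2 f" "L2 g" shows "integrable lborel (\<lambda>x. f x \<bullet> g x)"
  by (rule Bochner_Integration.integrable_bound[OF L2_norm_mult_integrable[OF assms]])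
    (auto intro: Cauchy_Schwarz_ineq2)

lemma L2_mult_integrable: "L2 f \<Longrightarrow> L2 g \<Longrightarrow> integrable lborel (\<lambda>x. f x * g x :: real)"
  using L2_inner_integrable[of f g] by simp

lemma L2_scaleR_integrable:
  assumes [measurable]: "L2 f" "L2 g" shows "integrable lborel (\<lambda>x. f x *\<^sub>R g x)"
  by (rule Bochner_Integration.integrable_bound[OF L2_norm_mult_integrable[OF assms]]) auto

lemma L2_bound:
  assumes "g \<in> borel_measurable borel" "L2 f" "\<And>x. norm (g x) \<le> c * norm (f x)"
  shows "L2 g"
proof -
  have "integrable lborel (\<lambda>x. (norm (g x))\<^sup>2)"
  proof (rule Bochner_Integration.integrable_bound)
    show "integrable lborel (\<lambda>x. c\<^sup>2 * (norm (f x))\<^sup>2)" using L2_integrable[OF assms(2)] by simp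
    have "(norm (g x))\<^sup>2 \<le> c\<^sup>2 * (norm (f x))\<^sup>2" for x
      using power_mono[OF assms(3)[of x], of 2] by (simp add: power_mult_distrib)
    then show "AE x in lborel. norm ((norm (g x))\<^sup>2) \<le> norm (c\<^sup>2 * (norm (f x))\<^sup>2)" by simp
  qed (use assms in measurable)
  then show ?thesis using assms by (simp add: L2_def)
qed

lemma L2_norm: "L2 f \<Longrightarrow> L2 (\<lambda>x. norm (f x))"
  by (rule L2_bound[where c=1 and f=f]) (auto dest: L2_measurable)

lemma L2_scale: "L2 f \<Longrightarrow> L2 (\<lambda>x. c *\<^sub>R f x)"
  by (rule L2_bound[where c="\<bar>c\<bar>" and f=f]) (auto dest: L2_measurable)

lemma L2_cmult: "L2 f \<Longrightarrow> L2 (\<lambda>x. c * f x :: real)"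
  using L2_scale[of f c] by simp

lemma L2_bmult:
  assumes "L2 f" "w \<in> borel_measurable borel" "\<And>x. \<bar>w x\<bar> \<le> c" shows "L2 (\<lambda>x. w x *\<^sub>R f x)"
  by (rule L2_bound[where c=c and f=f]) (use assms in \<open>auto dest: L2_measurable intro!: mult_right_mono\<close>)

lemma L2_inner: "L2 f \<Longrightarrow> L2 (\<lambda>x. f x \<bullet> v)"
  by (rule L2_bound[where c="norm v" and f=f])
    (auto dest: L2_measurable intro: order_trans[OF Cauchy_Schwarz_ineq2] simp: mult.commute)

lemma norm_add_sq: "(norm (a + b :: 'b::real_inner))\<^sup>2 = (norm a)\<^sup>2 + 2 * (a \<bullet> b) + (norm b)\<^sup>2"
  by (simp add: power2_norm_eq_inner inner_add_left inner_add_right inner_commute)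

lemma norm_add_sq_le: "(norm (a + b :: 'b::real_inner))\<^sup>2 \<le> 2 * (norm a)\<^sup>2 + 2 * (norm b)\<^sup>2"
  using norm_add_sq[of a b] norm_add_sq[of a "-b"] zero_le_power2[of "norm (a - b)"] by simp

lemma L2_add: assumes "L2 f" "L2 g" shows "L2 (\<lambda>x. f x + g x)"
  using assms L2_inner_integrable[OF assms] unfolding L2_def norm_add_sq by auto

lemma L2_diff: assumes "L2 f" "L2 g" shows "L2 (\<lambda>x. f x - g x)"
  using L2_add[OF assms(1) L2_scale[OF assms(2), of "-1"]] by simp

lemma n2_add: assumes "L2 f" "L2 g"
  shows "n2 (\<lambda>x. f x + g x) = n2 f + 2 * (\<integral>x. f x \<bullet> g x \<partial>lborel) + n2 g"
  using assms L2_inner_integrable[OF assms] unfolding n2_def norm_add_sq by (simp add: L2_integrable)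

lemma n2_scale: "n2 (\<lambda>x. c *\<^sub>R f x) = c\<^sup>2 * n2 f"
  unfolding n2_def by (simp add: power_mult_distrib)

lemma n2_cmult: "n2 (\<lambda>x. c * f x :: real) = c\<^sup>2 * n2 f"
  unfolding n2_def by (simp add: power_mult_distrib)

lemma n2_diff: assumes "L2 f" "L2 g"
  shows "n2 (\<lambda>x. f x - g x) = n2 f - 2 * (\<integral>x. f x \<bullet> g x \<partial>lborel) + n2 g"
  using n2_add[OF assms(1) L2_scale[OF assms(2), of "-1"]] n2_scale[of "-1" g] by simp

lemma n2_minus_commute: "n2 (\<lambda>x. f x - g x) = n2 (\<lambda>x. g x - f x)"
  unfolding n2_def by (simp add: norm_minus_commute)

lemma n2_real: "n2 (f::_ \<Rightarrow> real) = (\<integral>x. (f x)\<^sup>2 \<partial>lborel)"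
  unfolding n2_def by simp

lemma n2_mono:
  assumes "L2 f" "AE x in lborel. norm (g x) \<le> norm (f x)" shows "n2 g \<le> n2 f"
  unfolding n2_def
proof (rule integral_mono_AE')
  show "integrable lborel (\<lambda>x. (norm (f x))\<^sup>2)" using assms by (simp add: L2_integrable)
  show "AE x in lborel. (norm (g x))\<^sup>2 \<le> (norm (f x))\<^sup>2"
    using assms(2) by eventually_elim (simp add: power_mono)
qed auto

lemma L2_CS_norm:
  assumes "L2 f" "L2 g"
  shows "(\<integral>x. norm (f x) * norm (g x) \<partial>lborel) \<le> sqrt (n2 f) * sqrt (n2 g)"
proof -
  note [measurable] = L2_measurable[OF assms(1)] L2_measurable[OF assms(2)]
  let ?I = "\<integral>x. norm (f x) * norm (g x) \<partial>lborel"
  have I: "(\<integral>\<^sup>+x. ennreal (norm (f x)) * ennreal (norm (g x)) \<partial>lborel) = ennreal ?I"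
    using nn_integral_eq_integral[OF L2_norm_mult_integrable[OF assms]] by (simp add: ennreal_mult)
  have "(\<integral>\<^sup>+x. ennreal (norm (f x)) * ennreal (norm (g x)) \<partial>lborel)\<^sup>2
      \<le> (\<integral>\<^sup>+x. (ennreal (norm (f x)))\<^sup>2 \<partial>lborel) * (\<integral>\<^sup>+x. (ennreal (norm (g x)))\<^sup>2 \<partial>lborel)"
    by (rule Cauchy_Schwarz_nn_integral) auto
  then have "(ennreal ?I)\<^sup>2 \<le> ennreal (n2 f) * ennreal (n2 g)"
    by (simp add: I ennreal_power n2_nn assms)
  moreover have I0: "0 \<le> ?I" by simp
  ultimately have "?I\<^sup>2 \<le> n2 f * n2 g"
    by (simp add: ennreal_power ennreal_mult[symmetric])
  then show ?thesis by (simp add: real_le_rsqrt flip: real_sqrt_mult)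
qed

lemma L2_CS:
  assumes "L2 f" "L2 g"
  shows "\<bar>\<integral>x. f x \<bullet> g x \<partial>lborel\<bar> \<le> sqrt (n2 f) * sqrt (n2 g)"
proof -
  have "\<bar>\<integral>x. f x \<bullet> g x \<partial>lborel\<bar> \<le> (\<integral>x. \<bar>f x \<bullet> g x\<bar> \<partial>lborel)" by (rule integral_abs_bound)
  also have "\<dots> \<le> (\<integral>x. norm (f x) * norm (g x) \<partial>lborel)"
    using L2_inner_integrable[OF assms] L2_norm_mult_integrable[OF assms]
    by (intro integral_mono) (auto intro: Cauchy_Schwarz_ineq2)
  also note L2_CS_norm[OF assms]
  finally show ?thesis .
qed

lemma n2_add_le: assumes "L2 f" "L2 g"
  shows "n2 (\<lambda>x. f x + g x) \<le> 2 * n2 f + 2 * n2 g"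
proof -
  have "n2 (\<lambda>x. f x + g x) \<le> (\<integral>x. 2 * (norm (f x))\<^sup>2 + 2 * (norm (g x))\<^sup>2 \<partial>lborel)"
    unfolding n2_def using assms L2_add[OF assms]
    by (intro integral_mono norm_add_sq_le) (auto simp: L2_integrable)
  then show ?thesis using assms by (simp add: n2_def L2_integrable)
qed

lemma n2_diff_le: assumes "L2 f" "L2 g"
  shows "n2 (\<lambda>x. f x - g x) \<le> 2 * n2 f + 2 * n2 g"
  using n2_add_le[OF assms(1) L2_scale[OF assms(2), of "-1"]] n2_scale[of "-1" g] by simp

lemma n2_tri: assumes "L2 f" "L2 g" "L2 h"
  shows "n2 (\<lambda>x. f x - h x) \<le> 2 * n2 (\<lambda>x. f x - g x) + 2 * n2 (\<lambda>x. g x - h x)"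
  using n2_add_le[OF L2_diff[OF assms(1,2)] L2_diff[OF assms(2,3)]] by simp

lemma n2_bmult:
  assumes "L2 f" "w \<in> borel_measurable borel" "\<And>x. \<bar>w x\<bar> \<le> c"
  shows "n2 (\<lambda>x. w x *\<^sub>R f x) \<le> c\<^sup>2 * n2 f"
proof -
  have c0: "0 \<le> c" using assms(3) abs_ge_zero order_trans by blast
  have "n2 (\<lambda>x. w x *\<^sub>R f x) \<le> n2 (\<lambda>x. c *\<^sub>R f x)"
    using assms c0 by (intro n2_mono L2_scale) (auto intro!: AE_I2 mult_right_mono)
  then show ?thesis by (simp add: n2_scale)
qed

lemma n2_zero_AE: assumes "L2 f" "n2 f \<le> 0" shows "AE x in lborel. f x = 0"
proof -
  have "n2 f = 0" using assms by (simp add: antisym)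
  then have "AE x in lborel. (norm (f x))\<^sup>2 = 0"
    unfolding n2_def using L2_integrable[OF assms(1)] by (subst (asm) integral_nonneg_eq_0_iff_AE) auto
  then show ?thesis by simp
qed

lemma n2_cong_AE: "f \<in> borel_measurable borel \<Longrightarrow> g \<in> borel_measurable borel \<Longrightarrow> AE x in lborel. f x = g x \<Longrightarrow> n2 f = n2 g"
  unfolding n2_def by (rule integral_cong_AE) auto

lemma L2_cong_AE:
  assumes "L2 f" "g \<in> borel_measurable borel" "AE x in lborel. f x = g x" shows "L2 g"
proof -
  note [measurable] = L2_measurable[OF assms(1)] assms(2)
  have "integrable lborel (\<lambda>x. (norm (g x))\<^sup>2)"
    by (rule integrable_cong_AE_imp[OF L2_integrable[OF assms(1)]]) (use assms(3) in auto)
  then show ?thesis using assms by (simp add: L2_def)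
qed

lemma L2_tendsto_inner:
  assumes F: "\<And>n. L2 (F n)" "L2 f" "(\<lambda>n. n2 (\<lambda>x. F n x - f x)) \<longlonglongrightarrow> 0"
    and G: "\<And>n. L2 (G n)" "L2 g" "(\<lambda>n. n2 (\<lambda>x. G n x - g x)) \<longlonglongrightarrow> 0"
  shows "(\<lambda>n. \<integral>x. F n x \<bullet> G n x \<partial>lborel) \<longlonglongrightarrow> (\<integral>x. f x \<bullet> g x \<partial>lborel)"
proof -
  have z: "(\<lambda>n. sqrt (n2 (\<lambda>x. F n x - f x)) * sqrt (n2 (\<lambda>x. G n x - g x)) + sqrt (n2 (\<lambda>x. F n x - f x)) * sqrt (n2 g)
     + sqrt (n2 f) * sqrt (n2 (\<lambda>x. G n x - g x))) \<longlonglongrightarrow> sqrt 0 * sqrt 0 + sqrt 0 * sqrt (n2 g) + sqrt (n2 f) * sqrt 0"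
    by (intro tendsto_intros F G)
  have "norm ((\<integral>x. F n x \<bullet> G n x \<partial>lborel) - (\<integral>x. f x \<bullet> g x \<partial>lborel)) \<le>
    sqrt (n2 (\<lambda>x. F n x - f x)) * sqrt (n2 (\<lambda>x. G n x - g x)) + sqrt (n2 (\<lambda>x. F n x - f x)) * sqrt (n2 g)
     + sqrt (n2 f) * sqrt (n2 (\<lambda>x. G n x - g x))" for n
  proof -
    have i: "integrable lborel (\<lambda>x. (F n x - f x) \<bullet> (G n x - g x))" "integrable lborel (\<lambda>x. (F n x - f x) \<bullet> g x)"
      "integrable lborel (\<lambda>x. f x \<bullet> (G n x - g x))" "integrable lborel (\<lambda>x. F n x \<bullet> G n x)" "integrable lborel (\<lambda>x. f x \<bullet> g x)"
      by (intro L2_inner_integrable L2_diff F G)+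
    have "(\<integral>x. F n x \<bullet> G n x \<partial>lborel) - (\<integral>x. f x \<bullet> g x \<partial>lborel)
      = (\<integral>x. F n x \<bullet> G n x - f x \<bullet> g x \<partial>lborel)"
      using i by simp
    also have "\<dots> = (\<integral>x. (F n x - f x) \<bullet> (G n x - g x) + (F n x - f x) \<bullet> g x + f x \<bullet> (G n x - g x) \<partial>lborel)"
      by (rule Bochner_Integration.integral_cong) (auto simp: inner_diff_left inner_diff_right)
    also have "\<dots> = (\<integral>x. (F n x - f x) \<bullet> (G n x - g x) \<partial>lborel) + (\<integral>x. (F n x - f x) \<bullet> g x \<partial>lborel)
       + (\<integral>x. f x \<bullet> (G n x - g x) \<partial>lborel)"
      using i by simp
    finally show ?thesis
      using L2_CS[OF L2_diff[OF F(1)[of n] F(2)] L2_diff[OF G(1)[of n] G(2)]]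
        L2_CS[OF L2_diff[OF F(1)[of n] F(2)] G(2)] L2_CS[OF F(2) L2_diff[OF G(1)[of n] G(2)]]
      unfolding real_norm_def by linarith
  qed
  moreover have "sqrt 0 * sqrt 0 + sqrt 0 * sqrt (n2 g) + sqrt (n2 f) * sqrt 0 = 0" by simp
  ultimately have "(\<lambda>n. (\<integral>x. F n x \<bullet> G n x \<partial>lborel) - (\<integral>x. f x \<bullet> g x \<partial>lborel)) \<longlonglongrightarrow> 0"
    by (intro Lim_null_comparison[OF always_eventually z[unfolded \<open>sqrt 0 * sqrt 0 + sqrt 0 * sqrt (n2 g) + sqrt (n2 f) * sqrt 0 = 0\<close>]] allI)
  then show ?thesis by (simp add: LIM_zero_iff)
qed

lemma L2_const: assumes "L2 f" shows "(\<lambda>n::nat. n2 (\<lambda>x. f x - f x)) \<longlonglongrightarrow> 0"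
  by (simp add: n2_def)

lemma n2_eq_inner: "n2 f = (\<integral>x. f x \<bullet> f x \<partial>lborel)"
  by (simp add: n2_def power2_norm_eq_inner)

lemma L2_tendsto_n2:
  assumes "\<And>n. L2 (F n)" "L2 f" "(\<lambda>n. n2 (\<lambda>x. F n x - f x)) \<longlonglongrightarrow> 0"
  shows "(\<lambda>n. n2 (F n)) \<longlonglongrightarrow> n2 f"
  unfolding n2_eq_inner[of "F _"] n2_eq_inner[of f] by (rule L2_tendsto_inner[OF assms assms])

text \<open>Riesz-Fischer: a rapidly converging subsequence converges almost everywhere, and Fatou's
  lemma identifies its pointwise limit as the limit in norm.\<close>

theorem L2_complete:
  fixes F :: "nat \<Rightarrow> 'a::euclidean_space \<Rightarrow> 'b::euclidean_space"
  assumes F: "\<And>n. L2 (F n)"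
    and C: "\<And>e. e > 0 \<Longrightarrow> \<exists>N. \<forall>m\<ge>N. \<forall>n\<ge>N. n2 (\<lambda>x. F m x - F n x) < e"
  shows "\<exists>G. L2 G \<and> (\<lambda>n. n2 (\<lambda>x. F n x - G x)) \<longlonglongrightarrow> 0"
proof -
  have "\<forall>k. \<exists>N. \<forall>m\<ge>N. \<forall>n\<ge>N. n2 (\<lambda>x. F m x - F n x) < (1/4)^k" by (intro allI C) simp
  then obtain N where N: "\<And>k m n. m \<ge> N k \<Longrightarrow> n \<ge> N k \<Longrightarrow> n2 (\<lambda>x. F m x - F n x) < (1/4)^k" by metis
  \<comment> \<open>The sum lies above every \<open>N k\<close> and is nondecreasing in
    \<open>k\<close>; the summand \<open>k\<close> makes the indices unbounded.\<close>
  define s where "s k = (\<Sum>j\<le>k. N j) + k" for k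
  have sN: "s k \<ge> N k" for k unfolding s_def by (simp add: sum_nonneg trans_le_add1 member_le_sum)
  have sS: "s (Suc k) \<ge> s k" for k unfolding s_def by simp
  have sk: "s k \<ge> k" for k unfolding s_def by simp
  define d where "d k x = F (s (Suc k)) x - F (s k) x" for k x
  have d2: "L2 (d k)" for k unfolding d_def by (intro L2_diff F)
  have dn: "n2 (d k) \<le> (1/4)^k" for k
    unfolding d_def using N[of k "s (Suc k)" "s k"] sN[of k] sS[of k] by linarith
  note [measurable] = L2_measurable[OF F] L2_measurable[OF d2]
  \<comment> \<open>The squared increments are of order 4^-k, so a weight 2^k still leaves a
    convergent series; the weight is what later gives summability of the unsquared norms.\<close>
  have "(\<integral>\<^sup>+x. (\<Sum>k. ennreal (2^k * (norm (d k x))\<^sup>2)) \<partial>lborel) = (\<Sum>k. ennreal (2^k * n2 (d k)))"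
    by (subst nn_integral_suminf)
      (auto intro!: suminf_cong simp: ennreal_mult nn_integral_cmult n2_nn d2)
  also have "\<dots> \<le> (\<Sum>k. ennreal ((1/2)^k))"
  proof (intro suminf_le summableI ennreal_leI)
    fix k have "2^k * n2 (d k) \<le> 2^k * (1/4)^k" using dn[of k] by (intro mult_left_mono) auto
    also have "\<dots> = (1/2)^k" by (simp add: power_mult_distrib[symmetric])
    finally show "2^k * n2 (d k) \<le> (1/2)^k" .
  qed
  also have "\<dots> = ennreal (\<Sum>k. (1/2)^k)" by (intro suminf_ennreal2 summable_geometric) auto
  finally have "(\<integral>\<^sup>+x. (\<Sum>k. ennreal (2^k * (norm (d k x))\<^sup>2)) \<partial>lborel) \<noteq> \<infinity>"
    by (metis ennreal_neq_top infinity_ennreal_def neq_top_trans)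
  then have "AE x in lborel. (\<Sum>k. ennreal (2^k * (norm (d k x))\<^sup>2)) \<noteq> \<infinity>"
    by (intro nn_integral_PInf_AE) auto
  then have AEs: "AE x in lborel. convergent (\<lambda>k. F (s k) x)"
  proof eventually_elim
    fix x assume "(\<Sum>k. ennreal (2^k * (norm (d k x))\<^sup>2)) \<noteq> \<infinity>"
    then have "summable (\<lambda>k. 2^k * (norm (d k x))\<^sup>2)" by (intro summable_suminf_not_top) auto
    then have "summable (\<lambda>k. 2^k * (norm (d k x))\<^sup>2 + (1/2)^k)" by (intro summable_add summable_geometric) auto
    then have "summable (\<lambda>k. norm (d k x))"
    proof (rule summable_comparison_test')
      fix k
      \<comment> \<open>For \<open>a = 2^k * norm (d k x)\<close> the inequality a \<le> a^2 + 1,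
        divided by 2^k, bounds the norm of the increment by a summable term.\<close>
      have "0 \<le> (2^k * norm (d k x) - 1)\<^sup>2 + (2^k * norm (d k x))\<^sup>2" by simp
      then have "2 * 2^k * norm (d k x) \<le> 2 * (2^k * norm (d k x))\<^sup>2 + 1" by (simp add: power2_diff)
      then have "2^k * norm (d k x) \<le> (2^k * norm (d k x))\<^sup>2 + 1" by linarith
      also have "\<dots> = 2^k * (2^k * (norm (d k x))\<^sup>2 + (1/2)^k)"
        by (simp add: algebra_simps power2_eq_square power_one_over)
      finally show "norm (norm (d k x)) \<le> 2^k * (norm (d k x))\<^sup>2 + (1/2)^k" by simp
    qed
    then have "summable (\<lambda>k. d k x)" by (rule summable_norm_cancel)
    then have "convergent (\<lambda>n. \<Sum>k<n. d k x)" by (simp add: summable_iff_convergent)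
    moreover have "(\<Sum>k<n. d k x) = F (s n) x - F (s 0) x" for n
      unfolding d_def by (rule sum_lessThan_telescope)
    ultimately have "convergent (\<lambda>n. F (s n) x - F (s 0) x + F (s 0) x)"
      by (intro convergent_add convergent_const) simp
    then show "convergent (\<lambda>k. F (s k) x)" by simp
  qed
  \<comment> \<open>Where the subsequence diverges, \<open>lim\<close> has an unspecified value;
    this happens on a null set only, and measurability holds everywhere.\<close>
  define G where "G x = lim (\<lambda>k. F (s k) x)" for x
  have [measurable]: "G \<in> borel_measurable borel" unfolding G_def by (rule borel_measurable_lim_metric) auto
  \<comment> \<open>Fatou's lemma is applied along the subsequence while \<open>n\<close> is held
    fixed, so the bound covers the whole sequence.\<close>
  have bnd: "(\<integral>\<^sup>+x. ennreal ((norm (F n x - G x))\<^sup>2) \<partial>lborel) \<le> ennreal e"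
    if e: "e \<ge> 0" "\<And>k. k \<ge> K \<Longrightarrow> n2 (\<lambda>x. F n x - F (s k) x) \<le> e" for n e K
  proof -
    have "(\<integral>\<^sup>+x. ennreal ((norm (F n x - G x))\<^sup>2) \<partial>lborel)
       = (\<integral>\<^sup>+x. liminf (\<lambda>k. ennreal ((norm (F n x - F (s k) x))\<^sup>2)) \<partial>lborel)"
    proof (rule nn_integral_cong_AE)
      show "AE x in lborel. ennreal ((norm (F n x - G x))\<^sup>2) = liminf (\<lambda>k. ennreal ((norm (F n x - F (s k) x))\<^sup>2))"
        using AEs
      proof eventually_elim
        fix x assume "convergent (\<lambda>k. F (s k) x)"
        then have "(\<lambda>k. F (s k) x) \<longlonglongrightarrow> G x" unfolding G_def by (simp add: convergent_LIMSEQ_iff)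
        then have "(\<lambda>k. ennreal ((norm (F n x - F (s k) x))\<^sup>2)) \<longlonglongrightarrow> ennreal ((norm (F n x - G x))\<^sup>2)"
          by (intro tendsto_intros)
        then show "ennreal ((norm (F n x - G x))\<^sup>2) = liminf (\<lambda>k. ennreal ((norm (F n x - F (s k) x))\<^sup>2))"
          by (intro lim_imp_Liminf[symmetric]) auto
      qed
    qed
    also have "\<dots> \<le> liminf (\<lambda>k. \<integral>\<^sup>+x. ennreal ((norm (F n x - F (s k) x))\<^sup>2) \<partial>lborel)"
      by (rule nn_integral_liminf) auto
    also have "\<dots> = liminf (\<lambda>k. ennreal (n2 (\<lambda>x. F n x - F (s k) x)))"
      by (simp add: n2_nn L2_diff F)
    also have "\<dots> \<le> liminf (\<lambda>k. ennreal e)"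
      using e by (intro Liminf_mono eventually_sequentiallyI[of K] ennreal_leI) auto
    finally show ?thesis by (simp add: Liminf_const[OF sequentially_bot])
  qed
  have L: "L2 (\<lambda>x. F n x - G x)" "n2 (\<lambda>x. F n x - G x) \<le> (1/4)^k" if "n \<ge> N k" for n k
  proof -
    have "n2 (\<lambda>x. F n x - F (s j) x) \<le> (1/4)^k" if "j \<ge> N k" for j
      using N[of k n "s j"] sk[of j] that \<open>n \<ge> N k\<close> by fastforce
    from bnd[OF _ this] have *: "(\<integral>\<^sup>+x. ennreal ((norm (F n x - G x))\<^sup>2) \<partial>lborel) \<le> ennreal ((1/4)^k)" by simp
    show "L2 (\<lambda>x. F n x - G x)" by (rule L2_from_nn[OF _ *]) auto
    show "n2 (\<lambda>x. F n x - G x) \<le> (1/4)^k" by (rule L2_from_nn[OF _ *]) auto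
  qed
  have LG: "L2 G" using L2_diff[OF F[of "N 0"] L(1)[of 0 "N 0"]] by simp
  have "(\<lambda>n. n2 (\<lambda>x. F n x - G x)) \<longlonglongrightarrow> 0"
  proof (rule LIMSEQ_I)
    fix r :: real assume "0 < r"
    then obtain k where k: "(1/4::real)^k < r" using real_arch_pow_inv[of r "1/4"] by auto
    show "\<exists>no. \<forall>n\<ge>no. norm (n2 (\<lambda>x. F n x - G x) - 0) < r"
      using L(2)[of k] k by (intro exI[of _ "N k"]) (auto intro: order_le_less_trans)
  qed
  with LG show ?thesis by auto
qed

section \<open>Reflection and translation of integrals\<close>

lemma lborel_refl: "distr lborel borel (\<lambda>x. t - x) = (lborel :: 'a::euclidean_space measure)"
proof -
  show ?thesis using lborel_affine[of "-1" t, symmetric] by (simp add: density_1)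
qed

lemma integral_refl:
  fixes f :: "'a::euclidean_space \<Rightarrow> 'b::{banach,second_countable_topology}"
  assumes "f \<in> borel_measurable borel" shows "(\<integral>x. f (t - x) \<partial>lborel) = (\<integral>x. f x \<partial>lborel)"
  using integral_distr[of "\<lambda>x. t - x" lborel borel f] assms by (simp add: lborel_refl)

lemma integrable_refl:
  fixes f :: "'a::euclidean_space \<Rightarrow> 'b::{banach,second_countable_topology}"
  assumes "f \<in> borel_measurable borel" shows "integrable lborel (\<lambda>x. f (t - x)) \<longleftrightarrow> integrable lborel f"
  using integrable_distr_eq[of "\<lambda>x. t - x" lborel borel f] assms by (simp add: lborel_refl)

lemma integral_shift:
  fixes f :: "'a::euclidean_space \<Rightarrow> 'b::{banach,second_countable_topology}"
  assumes "f \<in> borel_measurable borel" shows "(\<integral>x. f (x + t) \<partial>lborel) = (\<integral>x. f x \<partial>lborel)"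
  using integral_distr[of "(+) t" lborel borel f] assms by (simp add: lborel_distr_plus add.commute)

lemma integrable_shift:
  fixes f :: "'a::euclidean_space \<Rightarrow> 'b::{banach,second_countable_topology}"
  assumes "f \<in> borel_measurable borel" shows "integrable lborel (\<lambda>x. f (x + t)) \<longleftrightarrow> integrable lborel f"
  using integrable_distr_eq[of "(+) t" lborel borel f] assms by (simp add: lborel_distr_plus add.commute)

lemma nn_integral_shift:
  assumes "f \<in> borel_measurable borel" shows "(\<integral>\<^sup>+x. f (x + t) \<partial>lborel) = (\<integral>\<^sup>+x. f x \<partial>lborel)"
  using nn_integral_distr[of "(+) t" lborel borel f] assms by (simp add: lborel_distr_plus add.commute)

lemma L2_shift: "L2 f \<Longrightarrow> L2 (\<lambda>x. f (x + t))"
  unfolding L2_def using integrable_shift[of "\<lambda>x. (norm (f x))\<^sup>2" t] by auto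

lemma n2_shift: "L2 f \<Longrightarrow> n2 (\<lambda>x. f (x + t)) = n2 f"
  unfolding n2_def using integral_shift[of "\<lambda>x. (norm (f x))\<^sup>2" t] by (auto dest: L2_measurable)

lemma L2_refl: "L2 f \<Longrightarrow> L2 (\<lambda>x. f (t - x))"
  unfolding L2_def using integrable_refl[of "\<lambda>x. (norm (f x))\<^sup>2" t] by auto

lemma n2_refl: "L2 f \<Longrightarrow> n2 (\<lambda>x. f (t - x)) = n2 f"
  unfolding n2_def using integral_refl[of "\<lambda>x. (norm (f x))\<^sup>2" t] by (auto dest: L2_measurable)

lemma integrable_continuous_compact:
  fixes f :: "'a::euclidean_space \<Rightarrow> real"
  assumes "continuous_on UNIV f" "compact K" "\<And>x. x \<notin> K \<Longrightarrow> f x = 0"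
  shows "integrable lborel f"
proof -
  have "integrable lborel (\<lambda>x. indicator K x *\<^sub>R f x)"
    by (intro borel_integrable_compact assms continuous_on_subset[OF assms(1)]) auto
  moreover have "(\<lambda>x. indicator K x *\<^sub>R f x) = f" using assms(3) by (auto simp: fun_eq_iff indicator_def)
  ultimately show ?thesis by simp
qed

lemma test_integrable:
  assumes "\<phi> \<in> test_functions S" "continuous_on UNIV f" shows "integrable lborel (\<lambda>x. f x * \<phi> x)"
proof -
  obtain K where "compact K" "\<And>x. x \<notin> K \<Longrightarrow> \<phi> x = 0" using assms(1) unfolding test_functions_iff by auto
  then show ?thesis
    by (intro integrable_continuous_compact[where K=K] continuous_intros assms test_continuous[OF assms(1)]) auto
qed

lemma test_L2: assumes "\<phi> \<in> test_functions S" shows "L2 \<phi>"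
  unfolding L2_def using test_integrable[OF assms test_continuous[OF assms]] test_continuous[OF assms]
  by (simp add: power2_eq_square borel_measurable_continuous_onI)

lemma test_grad_L2: assumes "\<phi> \<in> test_functions S" shows "L2 (grad \<phi>)"
proof -
  have "integrable lborel (\<lambda>x. (norm (grad \<phi> x))\<^sup>2)"
  proof -
    have "(norm (grad \<phi> x))\<^sup>2 = (\<Sum>i\<in>Basis. frechet_derivative \<phi> (at x) i * frechet_derivative \<phi> (at x) i)" for x
      unfolding power2_norm_eq_inner by (subst euclidean_inner) (simp add: grad_inner_Basis)
    moreover have "integrable lborel (\<lambda>x. \<Sum>i\<in>Basis. frechet_derivative \<phi> (at x) i * frechet_derivative \<phi> (at x) i)"
      by (intro Bochner_Integration.integrable_sum test_integrable[OF test_partial[OF assms]] test_continuous[OF test_partial[OF assms]])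
    ultimately show ?thesis by simp
  qed
  then show ?thesis unfolding L2_def
    using borel_measurable_continuous_onI[OF grad_continuous[OF test_smooth[OF assms]]] by simp
qed

text \<open>Jensen's inequality for a kernel of mass at most one, from Cauchy-Schwarz with
  \<open>k\<close> split into two square roots. A Bochner integral that does not exist has the value
  0, so integrability need not be assumed.\<close>

lemma ennreal_norm_integral_sq:
  fixes w :: "'a::euclidean_space \<Rightarrow> 'b::euclidean_space"
  assumes [measurable]: "k \<in> borel_measurable borel" "w \<in> borel_measurable borel"
    and k: "\<And>x. 0 \<le> k x" "(\<integral>\<^sup>+x. ennreal (k x) \<partial>lborel) \<le> 1"
  shows "ennreal ((norm (\<integral>h. k h *\<^sub>R w h \<partial>lborel))\<^sup>2) \<le> (\<integral>\<^sup>+h. ennreal (k h * (norm (w h))\<^sup>2) \<partial>lborel)"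
proof -
  have "ennreal (norm (\<integral>h. k h *\<^sub>R w h \<partial>lborel)) \<le> (\<integral>\<^sup>+h. ennreal (k h * norm (w h)) \<partial>lborel)"
  proof (cases "integrable lborel (\<lambda>h. k h *\<^sub>R w h)")
    case True
    then show ?thesis using integral_norm_bound_ennreal[OF True] k by simp
  qed (simp add: not_integrable_integral_eq)
  then have "(ennreal (norm (\<integral>h. k h *\<^sub>R w h \<partial>lborel)))\<^sup>2 \<le> (\<integral>\<^sup>+h. ennreal (k h * norm (w h)) \<partial>lborel)\<^sup>2"
    by (rule power_mono_ennreal)
  also have "(\<integral>\<^sup>+h. ennreal (k h * norm (w h)) \<partial>lborel)
      = (\<integral>\<^sup>+h. ennreal (sqrt (k h)) * ennreal (sqrt (k h) * norm (w h)) \<partial>lborel)"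
    by (rule nn_integral_cong) (use k in \<open>simp add: ennreal_mult[symmetric] mult.assoc[symmetric]\<close>)
  also have "\<dots>\<^sup>2 \<le> (\<integral>\<^sup>+h. (ennreal (sqrt (k h)))\<^sup>2 \<partial>lborel) * (\<integral>\<^sup>+h. (ennreal (sqrt (k h) * norm (w h)))\<^sup>2 \<partial>lborel)"
    by (rule Cauchy_Schwarz_nn_integral) auto
  also have "\<dots> = (\<integral>\<^sup>+h. ennreal (k h) \<partial>lborel) * (\<integral>\<^sup>+h. ennreal (k h * (norm (w h))\<^sup>2) \<partial>lborel)"
    using k by (simp add: ennreal_power power_mult_distrib)
  also have "\<dots> \<le> 1 * (\<integral>\<^sup>+h. ennreal (k h * (norm (w h))\<^sup>2) \<partial>lborel)"
    by (intro mult_right_mono k) auto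
  finally show ?thesis by (simp add: ennreal_power)
qed

section \<open>Weak gradients and mollification\<close>

text \<open>The gradient is carried as a second argument instead of being selected from the
  function, so limits can be taken for the pair.\<close>

definition wgr :: "('a::euclidean_space \<Rightarrow> real) \<Rightarrow> ('a \<Rightarrow> 'a) \<Rightarrow> bool" where
  "wgr u g \<longleftrightarrow> L2 u \<and> L2 g \<and>
     (\<forall>\<phi>\<in>test_functions UNIV. \<forall>i\<in>Basis.
        (\<integral>x. u x * frechet_derivative \<phi> (at x) i \<partial>lborel) = - (\<integral>x. (g x \<bullet> i) * \<phi> x \<partial>lborel))"

lemma emeasure_cball_finite [simp]: "emeasure lborel (cball (x::'a::euclidean_space) r) < top"
  using emeasure_compact_finite[OF compact_cball, of x r] by simp

lemma wgr_L2: "wgr u g \<Longrightarrow> L2 u" "wgr u g \<Longrightarrow> L2 g" by (auto simp: wgr_def)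

text \<open>Difference quotients integrate to zero by translation invariance, and dominated
  convergence passes this on to the derivative.\<close>

lemma test_integral_partial:
  assumes \<phi>: "\<phi> \<in> test_functions UNIV" and i: "i \<in> Basis"
  shows "(\<integral>x. frechet_derivative \<phi> (at x) i \<partial>lborel) = 0"
proof -
  obtain K where K: "compact K" "\<And>x. x \<notin> K \<Longrightarrow> \<phi> x = 0" using \<phi> unfolding test_functions_iff by auto
  obtain R where R: "\<And>x. x \<in> K \<Longrightarrow> norm x \<le> R" using compact_imp_bounded[OF K(1)] bounded_iff by blast
  obtain C where C: "C \<ge> 0" "\<And>x y. \<bar>\<phi> x - \<phi> y\<bar> \<le> C * norm (x - y)" using test_lipschitz[OF \<phi>] by auto
  have [measurable]: "\<phi> \<in> borel_measurable borel"
    by (rule borel_measurable_continuous_onI[OF test_continuous[OF \<phi>]])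
  have [measurable]: "(\<lambda>x. frechet_derivative \<phi> (at x) i) \<in> borel_measurable borel"
    by (rule borel_measurable_continuous_onI[OF test_continuous[OF test_partial[OF \<phi> i]]])
  have int: "integrable lborel \<phi>"
    using test_integrable[OF \<phi> continuous_on_const[of UNIV 1]] by simp
  define t where "t n = 1 / real (Suc n)" for n
  have t0: "t n > 0" "t n \<le> 1" for n by (auto simp: t_def)
  have tl: "t \<longlonglongrightarrow> 0" unfolding t_def by (rule LIMSEQ_Suc[OF lim_1_over_n])
  define q where "q n x = (\<phi> (x + t n *\<^sub>R i) - \<phi> x) / t n" for n x
  have "(\<lambda>n. \<integral>x. q n x \<partial>lborel) \<longlonglongrightarrow> (\<integral>x. frechet_derivative \<phi> (at x) i \<partial>lborel)"
  \<comment> \<open>Since the steps \<open>t n\<close> are at most 1, all difference quotients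
    vanish outside the ball of radius \<open>R + 1\<close>, and the Lipschitz constant
    \<open>C\<close> bounds them there.\<close>
  proof (rule integral_dominated_convergence[where w="\<lambda>x. C * indicator (cball 0 (R+1)) x"])
    show "integrable lborel (\<lambda>x::'a. C * indicator (cball 0 (R+1)) x :: real)"
      by (intro integrable_mult_right integrable_real_indicator) auto
    show "AE x in lborel. (\<lambda>n. q n x) \<longlonglongrightarrow> frechet_derivative \<phi> (at x) i"
    proof (rule AE_I2)
      fix x
      have "(\<phi> has_derivative frechet_derivative \<phi> (at x)) (at x)"
        by (rule smooth_has_derivative[OF test_smooth[OF \<phi>]])
      moreover have "((\<lambda>s. x + s *\<^sub>R i) has_derivative (\<lambda>s. s *\<^sub>R i)) (at 0)"
        by (auto intro!: derivative_eq_intros)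
      ultimately have "((\<lambda>s. \<phi> (x + s *\<^sub>R i)) has_derivative (\<lambda>s. frechet_derivative \<phi> (at x) (s *\<^sub>R i))) (at 0)"
        using diff_chain_at[of "\<lambda>s. x + s *\<^sub>R i" _ 0 \<phi>] by (simp add: o_def)
      moreover have "(\<lambda>s. frechet_derivative \<phi> (at x) (s *\<^sub>R i)) = (*) (frechet_derivative \<phi> (at x) i)"
        by (auto simp: fun_eq_iff linear_scale[OF linear_frechet_derivative[OF smooth_differentiable[OF test_smooth[OF \<phi>]]]])
      ultimately have "((\<lambda>s. \<phi> (x + s *\<^sub>R i)) has_real_derivative frechet_derivative \<phi> (at x) i) (at 0)"
        by (simp add: has_field_derivative_def)
      then have "((\<lambda>s. (\<phi> (x + s *\<^sub>R i) - \<phi> x) / s) \<longlongrightarrow> frechet_derivative \<phi> (at x) i) (at 0)"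
        by (simp add: DERIV_def)
      moreover have "filterlim t (at 0) sequentially"
        using tl t0 by (intro filterlim_atI) (auto intro!: always_eventually simp: less_imp_neq[symmetric])
      ultimately show "(\<lambda>n. q n x) \<longlonglongrightarrow> frechet_derivative \<phi> (at x) i"
        unfolding q_def by (rule filterlim_compose)
    qed
    show "AE x in lborel. norm (q n x) \<le> C * indicator (cball 0 (R+1)) x" for n
    proof (rule AE_I2)
      fix x
      show "norm (q n x) \<le> C * indicator (cball 0 (R+1)) x"
      proof (cases "norm x \<le> R + 1")
        case True
        have "\<bar>\<phi> (x + t n *\<^sub>R i) - \<phi> x\<bar> \<le> C * t n" using C(2)[of "x + t n *\<^sub>R i" x] t0[of n] i by simp
        then show ?thesis using True t0[of n] by (simp add: q_def divide_simps)
      next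
        case False
        have "norm x \<le> norm (x + t n *\<^sub>R i) + norm (t n *\<^sub>R i)" using norm_triangle_ineq4[of "x + t n *\<^sub>R i" "t n *\<^sub>R i"] by simp
        then have "\<not> norm (x + t n *\<^sub>R i) \<le> R" using False t0[of n] i by simp
        then have "\<phi> (x + t n *\<^sub>R i) = 0" "\<phi> x = 0" using K(2) R False by auto force
        then show ?thesis using False by (simp add: q_def)
      qed
    qed
  qed (unfold q_def, measurable)
  moreover have "(\<integral>x. q n x \<partial>lborel) = 0" for n
    unfolding q_def using int integral_shift[of \<phi> "t n *\<^sub>R i"] integrable_shift[of \<phi> "t n *\<^sub>R i"] by simp
  ultimately show ?thesis using LIMSEQ_unique by (simp add: LIMSEQ_const_iff)
qed

lemma test_parts:
  assumes \<phi>: "\<phi> \<in> test_functions UNIV" and f: "smooth_on UNIV f" and i: "i \<in> Basis"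
  shows "(\<integral>x. f x * frechet_derivative \<phi> (at x) i \<partial>lborel) = - (\<integral>x. frechet_derivative f (at x) i * \<phi> x \<partial>lborel)"
proof -
  have d: "frechet_derivative (\<lambda>x. f x * \<phi> x) (at x) i = f x * frechet_derivative \<phi> (at x) i + frechet_derivative f (at x) i * \<phi> x" for x
    by (rule frechet_derivative_eq) (intro has_derivative_mult smooth_has_derivative f test_smooth[OF \<phi>])
  have "integrable lborel (\<lambda>x. f x * frechet_derivative \<phi> (at x) i)"
    by (rule test_integrable[OF test_partial[OF \<phi> i] smooth_continuous[OF f]])
  moreover have "integrable lborel (\<lambda>x. frechet_derivative f (at x) i * \<phi> x)"
    by (rule test_integrable[OF \<phi> smooth_continuous[OF smooth_partial[OF f i]]])
  ultimately show ?thesis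
    using test_integral_partial[OF test_mult[OF \<phi> f] i] unfolding d by simp
qed

lemma wgr_test: "\<phi> \<in> test_functions UNIV \<Longrightarrow> wgr \<phi> (grad \<phi>)"
  unfolding wgr_def by (auto simp: grad_inner_Basis test_L2 test_grad_L2 test_parts test_smooth)

lemma wgr_diff: assumes "wgr u g" "wgr v h" shows "wgr (\<lambda>x. u x - v x) (\<lambda>x. g x - h x)"
  unfolding wgr_def
proof (intro conjI ballI)
  fix \<phi> :: "'a \<Rightarrow> real" and i :: 'a assume p: "\<phi> \<in> test_functions UNIV" "i \<in> Basis"
  note L = wgr_L2[OF assms(1)] wgr_L2[OF assms(2)] test_L2[OF p(1)] test_L2[OF test_partial[OF p]]
  note I = L2_mult_integrable[OF L(1) L(6)] L2_mult_integrable[OF L(3) L(6)]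
    L2_mult_integrable[OF L2_inner[OF L(2), of i] L(5)] L2_mult_integrable[OF L2_inner[OF L(4), of i] L(5)]
  show "(\<integral>x. (u x - v x) * frechet_derivative \<phi> (at x) i \<partial>lborel) = - (\<integral>x. ((g x - h x) \<bullet> i) * \<phi> x \<partial>lborel)"
    using assms p I by (simp add: wgr_def left_diff_distrib inner_diff_left)
qed (rule L2_diff[OF wgr_L2(1)[OF assms(1)] wgr_L2(1)[OF assms(2)]],
    rule L2_diff[OF wgr_L2(2)[OF assms(1)] wgr_L2(2)[OF assms(2)]])

lemma wgr_limit:
  assumes w: "\<And>n. wgr (U n) (G n)" and u: "L2 u" "(\<lambda>n. n2 (\<lambda>x. U n x - u x)) \<longlonglongrightarrow> 0"
    and g: "L2 g" "(\<lambda>n. n2 (\<lambda>x. G n x - g x)) \<longlonglongrightarrow> 0"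
  shows "wgr u g"
  unfolding wgr_def
proof (intro conjI ballI u g)
  fix \<phi> :: "'a \<Rightarrow> real" and i :: 'a assume p: "\<phi> \<in> test_functions UNIV" "i \<in> Basis"
  note L = test_L2[OF p(1)] test_L2[OF test_partial[OF p]]
  have "(\<lambda>n. \<integral>x. U n x \<bullet> frechet_derivative \<phi> (at x) i \<partial>lborel) \<longlonglongrightarrow> (\<integral>x. u x \<bullet> frechet_derivative \<phi> (at x) i \<partial>lborel)"
    by (rule L2_tendsto_inner[OF wgr_L2(1)[OF w] u L(2) L(2) L2_const[OF L(2)]])
  moreover have "(\<lambda>n. \<integral>x. G n x \<bullet> (\<phi> x *\<^sub>R i) \<partial>lborel) \<longlonglongrightarrow> (\<integral>x. g x \<bullet> (\<phi> x *\<^sub>R i) \<partial>lborel)"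
  proof -
    have L3: "L2 (\<lambda>x. \<phi> x *\<^sub>R i)"
      by (rule L2_bound[where f=\<phi> and c=1]) (use L(1) p(2) in \<open>auto dest: L2_measurable\<close>)
    show ?thesis by (rule L2_tendsto_inner[OF wgr_L2(2)[OF w] g L3 L3 L2_const[OF L3]])
  qed
  ultimately show "(\<integral>x. u x * frechet_derivative \<phi> (at x) i \<partial>lborel) = - (\<integral>x. (g x \<bullet> i) * \<phi> x \<partial>lborel)"
    using w p unfolding wgr_def
    by (auto simp: mult.commute intro!: LIMSEQ_unique dest: tendsto_minus)
qed

section \<open>Convolution with a test function\<close>

definition cv :: "('a::euclidean_space \<Rightarrow> real) \<Rightarrow> ('a \<Rightarrow> 'b::euclidean_space) \<Rightarrow> 'a \<Rightarrow> 'b" where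
  "cv k u x = (\<integral>y. k (x - y) *\<^sub>R u y \<partial>lborel)"

lemma cv_alt:
  assumes [measurable]: "k \<in> borel_measurable borel" "u \<in> borel_measurable borel"
  shows "cv k u x = (\<integral>h. k h *\<^sub>R u (x - h) \<partial>lborel)"
  unfolding cv_def using integral_refl[of "\<lambda>y. k (x - y) *\<^sub>R u y" x] by simp

lemma cv_integrable: "L2 k \<Longrightarrow> L2 u \<Longrightarrow> integrable lborel (\<lambda>y. k (x - y) *\<^sub>R u y)"
  by (intro L2_scaleR_integrable L2_refl)

lemma cv_bound:
  assumes "L2 k" "L2 u" shows "norm (cv k u x) \<le> sqrt (n2 k) * sqrt (n2 u)"
proof -
  have "norm (cv k u x) \<le> (\<integral>y. norm (k (x - y)) * norm (u y) \<partial>lborel)"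
    unfolding cv_def using integral_norm_bound[of lborel "\<lambda>y. k (x - y) *\<^sub>R u y"] by simp
  also have "\<dots> \<le> sqrt (n2 k) * sqrt (n2 u)"
    using L2_CS_norm[OF L2_refl[OF assms(1), of x] assms(2)] by (simp add: n2_refl assms)
  finally show ?thesis .
qed

lemma cv_measurable [measurable]:
  assumes [measurable]: "k \<in> borel_measurable borel" "u \<in> borel_measurable borel"
  shows "cv k u \<in> borel_measurable borel"
  unfolding cv_def[abs_def] by measurable

text \<open>The quadratic Taylor remainder is uniform in the base point, and it lives on a ball on
  which the square-integrable \<open>u\<close> is integrable. The error is thus at most
  \<open>C * M\<close> times the square of the increment.\<close>

lemma cv_has_derivative:
  assumes k: "k \<in> test_functions UNIV" and u: "L2 u"
  shows "(cv k u has_derivative (\<lambda>h. (\<integral>y. u y *\<^sub>R grad k (x - y) \<partial>lborel) \<bullet> h)) (at x)"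
proof -
  obtain K where K: "compact K" "\<And>x. x \<notin> K \<Longrightarrow> k x = 0" using k unfolding test_functions_iff by auto
  obtain R where R: "\<And>x. x \<in> K \<Longrightarrow> norm x \<le> R" using compact_imp_bounded[OF K(1)] bounded_iff by blast
  obtain C where C: "C \<ge> 0" "\<And>z h. \<bar>k (z + h) - k z - grad k z \<bullet> h\<bar> \<le> C * (norm h)\<^sup>2" using test_taylor[OF k] by auto
  have k0: "k z = 0" if "norm z > R" for z using K(2) R that by force
  have gk0: "grad k z = 0" if "norm z > R" for z
  proof -
    have "z \<in> - cball 0 R" using that by auto
    then have "frechet_derivative k (at z) i = 0" for i
      by (rule frechet_zero_open[rotated]) (auto intro!: k0)
    then show ?thesis by (simp add: grad_def)
  qed
  \<comment> \<open>Increments shorter than 1 keep the shifted and the unshifted kernel inside this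
    ball.\<close>
  let ?B = "\<lambda>y. indicator (cball x (R + 1)) y :: real"
  have B: "L2 ?B"
  proof -
    have "integrable lborel ?B" by (intro integrable_real_indicator) auto
    moreover have "(norm (?B y))\<^sup>2 = ?B y" for y by (simp add: indicator_def)
    ultimately show ?thesis by (simp add: L2_def borel_measurable_indicator)
  qed
  define M where "M = (\<integral>y. norm (u y) * norm (?B y) \<partial>lborel)"
  have iM: "integrable lborel (\<lambda>y. norm (u y) * norm (?B y))" by (rule L2_norm_mult_integrable[OF u B])
  have iD: "integrable lborel (\<lambda>y. u y *\<^sub>R grad k (x - y))"
    by (intro L2_scaleR_integrable u L2_refl[OF test_grad_L2[OF k]])
  note ik = cv_integrable[OF test_L2[OF k] u]
  show ?thesis
  proof (rule has_derivativeI_sandwich[where e=1 and H="\<lambda>y. C * norm (y - x) * M"])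
    show "bounded_linear (\<lambda>h. (\<integral>y. u y *\<^sub>R grad k (x - y) \<partial>lborel) \<bullet> h)" by (rule bounded_linear_inner_right)
    have "((\<lambda>y. C * norm (y - x) * M) \<longlongrightarrow> C * norm (x - x) * M) (at x)" by (intro tendsto_intros)
    then show "((\<lambda>y. C * norm (y - x) * M) \<longlongrightarrow> 0) (at x)" by simp
    fix z assume z: "z \<noteq> x" "dist z x < 1"
    define h where "h = z - x"
    have zh: "z = x + h" "norm h < 1" "h \<noteq> 0" using z by (auto simp: h_def dist_norm)
    have "cv k u z - cv k u x - (\<integral>y. u y *\<^sub>R grad k (x - y) \<partial>lborel) \<bullet> h
        = (\<integral>y. k (z - y) *\<^sub>R u y - k (x - y) *\<^sub>R u y - (u y *\<^sub>R grad k (x - y)) \<bullet> h \<partial>lborel)"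
      unfolding cv_def using ik iD by (simp add: integral_inner_left[symmetric] integrable_inner_left del: integral_inner_left inner_scaleR_left)
    also have "norm \<dots> \<le> (\<integral>y. C * (norm h)\<^sup>2 * (norm (u y) * norm (?B y)) \<partial>lborel)"
    proof (rule Bochner_Integration.integral_norm_bound_integral)
      show "integrable lborel (\<lambda>y. k (z - y) *\<^sub>R u y - k (x - y) *\<^sub>R u y - (u y *\<^sub>R grad k (x - y)) \<bullet> h)"
        by (intro Bochner_Integration.integrable_diff ik integrable_inner_left iD)
      fix y
      have e: "k (z - y) *\<^sub>R u y - k (x - y) *\<^sub>R u y - (u y *\<^sub>R grad k (x - y)) \<bullet> h
          = u y * (k ((x - y) + h) - k (x - y) - grad k (x - y) \<bullet> h)"
        by (simp add: zh algebra_simps)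
      show "norm (k (z - y) *\<^sub>R u y - k (x - y) *\<^sub>R u y - (u y *\<^sub>R grad k (x - y)) \<bullet> h)
          \<le> C * (norm h)\<^sup>2 * (norm (u y) * norm (?B y))"
      proof (cases "y \<in> cball x (R + 1)")
        case True
        then show ?thesis unfolding e using mult_left_mono[OF C(2)[of "x - y" h], of "\<bar>u y\<bar>"]
          by (simp add: abs_mult mult.commute mult.left_commute)
      next
        case False
        then have n: "norm (x - y) > R + 1" by (simp add: dist_norm)
        have "norm (x - y) \<le> norm (x - y + h) + norm h" using norm_triangle_ineq4[of "x - y + h" h] by simp
        then have "norm (x - y + h) > R" using n zh by simp
        then have "k (x - y + h) = 0" "k (x - y) = 0" "grad k (x - y) = 0" using k0 gk0 n by auto
        then show ?thesis unfolding e using False by simp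
      qed
    qed (use iM in simp)
    also have "\<dots> = C * (norm h)\<^sup>2 * M" unfolding M_def by simp
    finally show "norm (cv k u z - cv k u x - (\<integral>y. u y *\<^sub>R grad k (x - y) \<partial>lborel) \<bullet> (z - x)) / norm (z - x)
        \<le> C * norm (z - x) * M"
      using zh unfolding h_def[symmetric] by (simp add: power2_eq_square divide_simps mult_ac)
  qed auto
qed

lemma cv_grad:
  assumes k: "k \<in> test_functions UNIV" and u: "L2 u"
  shows "grad (cv k u) x = (\<integral>y. u y *\<^sub>R grad k (x - y) \<partial>lborel)"
  by (rule grad_eqI) (rule cv_has_derivative[OF assms])

lemma cv_partial:
  fixes u :: "'a::euclidean_space \<Rightarrow> real"
  assumes k: "k \<in> test_functions UNIV" and u: "L2 u" and i: "i \<in> Basis"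
  shows "frechet_derivative (cv k u) (at x) i = cv (\<lambda>z. frechet_derivative k (at z) i) u x"
proof -
  have "frechet_derivative (cv k u) (at x) i = (\<integral>y. u y *\<^sub>R grad k (x - y) \<partial>lborel) \<bullet> i"
    using grad_inner_Basis[OF i, of "cv k u" x] cv_grad[OF k u, of x] by simp
  also have "\<dots> = (\<integral>y. (u y *\<^sub>R grad k (x - y)) \<bullet> i \<partial>lborel)"
    by (rule integral_inner_left[symmetric]) (intro L2_scaleR_integrable u L2_refl[OF test_grad_L2[OF k]])
  also have "\<dots> = cv (\<lambda>z. frechet_derivative k (at z) i) u x"
    unfolding cv_def by (simp add: grad_inner_Basis[OF i] mult.commute)
  finally show ?thesis .
qed

text \<open>Every partial derivative is again a convolution of \<open>u\<close> with a test
  function, so the induction on the order generalises over the kernel.\<close>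

lemma cv_smooth:
  assumes "k \<in> test_functions UNIV" "L2 u" shows "smooth_on UNIV (cv k u)"
proof -
  have "Ck_on n UNIV (cv k u)" if "k \<in> test_functions UNIV" for n k
    using that
  proof (induction n arbitrary: k)
    case 0
    have "continuous (at x) (cv k u)" for x
      using has_derivative_continuous[OF cv_has_derivative[OF 0 assms(2)]] .
    then show ?case by (simp add: continuous_on_eq_continuous_at)
  next
    case (Suc n)
    have "(\<lambda>x. frechet_derivative (cv k u) (at x) i) = cv (\<lambda>z. frechet_derivative k (at z) i) u"
      if "i \<in> Basis" for i using cv_partial[OF Suc.prems assms(2) that] by auto
    then show ?case
      using Suc.IH[OF test_partial[OF Suc.prems]] differentiableI[OF cv_has_derivative[OF Suc.prems assms(2)]] by simp
  qed
  with assms show ?thesis by (simp add: smooth_on_def)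
qed

text \<open>For fixed \<open>x\<close> the reflected kernel is a test function of the integration
  variable, so the weak gradient absorbs the derivative.\<close>

lemma cv_grad_wgr:
  assumes k: "k \<in> test_functions UNIV" and w: "wgr u g"
  shows "grad (cv k u) x = cv k g x"
proof (rule euclidean_eqI)
  fix i :: 'a assume i: "i \<in> Basis"
  define \<psi> where "\<psi> y = k ((-1) *\<^sub>R y + x)" for y
  have \<psi>: "\<psi> \<in> test_functions UNIV" unfolding \<psi>_def by (rule test_affine[OF k]) simp
  have d: "frechet_derivative \<psi> (at y) i = - frechet_derivative k (at (x - y)) i" for y
  proof -
    have "(k has_derivative frechet_derivative k (at ((-1) *\<^sub>R y + x))) (at ((-1) *\<^sub>R y + x))"
      by (rule smooth_has_derivative[OF test_smooth[OF k]])
    moreover have "((\<lambda>y. (-1) *\<^sub>R y + x) has_derivative (\<lambda>h. (-1) *\<^sub>R h)) (at y)"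
      by (auto intro!: derivative_eq_intros)
    ultimately have "(\<psi> has_derivative (\<lambda>h. frechet_derivative k (at ((-1) *\<^sub>R y + x)) ((-1) *\<^sub>R h))) (at y)"
      using diff_chain_at[of "\<lambda>y. (-1) *\<^sub>R y + x" _ y k] by (simp add: o_def \<psi>_def[abs_def])
    then show ?thesis
      by (simp only: frechet_derivative_eq linear_scale[OF linear_frechet_derivative[OF smooth_differentiable[OF test_smooth[OF k]]]])
        (simp add: algebra_simps)
  qed
  have "grad (cv k u) x \<bullet> i = (\<integral>y. frechet_derivative k (at (x - y)) i * u y \<partial>lborel)"
    using cv_partial[OF k wgr_L2(1)[OF w] i] by (simp add: grad_inner_Basis[OF i] cv_def)
  also have "\<dots> = - (\<integral>y. u y * frechet_derivative \<psi> (at y) i \<partial>lborel)" by (simp add: d mult.commute)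
  also have "\<dots> = (\<integral>y. (g y \<bullet> i) * \<psi> y \<partial>lborel)" using w \<psi> i by (simp add: wgr_def)
  also have "\<dots> = (\<integral>y. (k (x - y) *\<^sub>R g y) \<bullet> i \<partial>lborel)" by (simp add: \<psi>_def mult.commute add.commute[of "- _"])
  also have "\<dots> = cv k g x \<bullet> i"
    unfolding cv_def by (rule integral_inner_left) (rule cv_integrable[OF test_L2[OF k] wgr_L2(2)[OF w]])
  finally show "grad (cv k u) x \<bullet> i = cv k g x \<bullet> i" .
qed

text \<open>As a function of the shift, the pairing of the translated \<open>u\<close> with \<phi>
  is the convolution of \<open>u\<close> with the reflected \<phi>. It is smooth with gradient
  bounded by Cauchy-Schwarz, and the mean value inequality gives the Lipschitz estimate.\<close>

lemma wgr_translate_weak: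
  assumes w: "wgr u g" and \<phi>: "\<phi> \<in> test_functions UNIV"
  shows "\<bar>\<integral>x. (u (x + h) - u x) * \<phi> x \<partial>lborel\<bar> \<le> norm h * sqrt (n2 g) * sqrt (n2 \<phi>)"
proof -
  note L = wgr_L2[OF w] test_L2[OF \<phi>]
  define \<psi> where "\<psi> z = \<phi> ((-1) *\<^sub>R z + 0)" for z
  have \<psi>: "\<psi> \<in> test_functions UNIV" unfolding \<psi>_def by (rule test_affine[OF \<phi>]) simp
  have \<psi>': "\<psi> z = \<phi> (0 - z)" for z by (simp add: \<psi>_def)
  have n\<psi>: "n2 \<psi> = n2 \<phi>" unfolding \<psi>' using n2_refl[OF L(3), of 0] by simp
  have c: "cv \<psi> u s = (\<integral>x. u (x + s) * \<phi> x \<partial>lborel)" for s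
  proof -
    note [measurable] = L2_measurable[OF L(1)] L2_measurable[OF L(3)]
    have "(\<lambda>y. \<phi> (y - s) * u y) \<in> borel_measurable borel" by measurable
    from integral_shift[OF this, of s] show ?thesis unfolding cv_def by (simp add: \<psi>' mult.commute)
  qed
  have "norm (cv \<psi> u h - cv \<psi> u 0) \<le> (sqrt (n2 \<phi>) * sqrt (n2 g)) * norm (h - 0)"
  proof (rule differentiable_bound[of UNIV "cv \<psi> u" "\<lambda>x h. cv \<psi> g x \<bullet> h"])
    show "(cv \<psi> u has_derivative (\<lambda>h. cv \<psi> g x \<bullet> h)) (at x)" for x
      using smooth_has_grad[OF cv_smooth[OF \<psi> L(1)], of x] cv_grad_wgr[OF \<psi> w, of x] by simp
    show "onorm (\<lambda>h. cv \<psi> g x \<bullet> h) \<le> sqrt (n2 \<phi>) * sqrt (n2 g)" for x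
      using cv_bound[OF test_L2[OF \<psi>] L(2), of x] n\<psi>
      by (intro onorm_bound) (auto intro!: order_trans[OF Cauchy_Schwarz_ineq2] mult_right_mono)
  qed auto
  moreover have "(\<integral>x. (u (x + h) - u x) * \<phi> x \<partial>lborel) = cv \<psi> u h - cv \<psi> u 0"
    using L2_mult_integrable[OF L2_shift[OF L(1), of h] L(3)] L2_mult_integrable[OF L(1,3)]
    by (simp add: c left_diff_distrib)
  ultimately show ?thesis by (simp add: mult_ac)
qed

section \<open>Density of test functions\<close>

lemma cball_measurable [measurable]: "cball (x::'a::euclidean_space) r \<in> sets borel"
  by (rule borel_closed) simp

text \<open>A finite sum \<open>S\<close> of bumps is at least some \<open>m > 0\<close> on
  \<open>K\<close>, and \<open>n * S / (1 + n * S)\<close> stays below 1 while approaching 1 on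
  \<open>K\<close>. The value 1 itself is not attained, and the approximations below only use values
  close to it.\<close>

lemma smooth_urysohn:
  fixes K :: "'a::euclidean_space set"
  assumes K: "compact K" and U: "open U" "K \<subseteq> U" and e: "0 < e"
  shows "\<exists>\<phi>\<in>test_functions U. (\<forall>x. 0 \<le> \<phi> x \<and> \<phi> x \<le> 1) \<and> (\<forall>x\<in>K. 1 - e \<le> \<phi> x)"
proof -
  have "\<forall>x\<in>K. \<exists>r>0. cball x r \<subseteq> U" using U by (meson open_contains_cball subsetD)
  then obtain r where r: "\<And>x. x \<in> K \<Longrightarrow> 0 < r x" "\<And>x. x \<in> K \<Longrightarrow> cball x (r x) \<subseteq> U" by metis
  have cov: "K \<subseteq> (\<Union>x\<in>K. ball x (r x))" using r(1) by auto
  obtain F where F: "F \<subseteq> K" "finite F" "K \<subseteq> (\<Union>x\<in>F. ball x (r x))"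
    by (rule compactE_image[OF K _ cov]) auto
  define S where "S x = (\<Sum>c\<in>F. bump 0 c (r c) x)" for x
  have S: "S \<in> test_functions U" unfolding S_def by (intro test_sum test_bump r) (use F(1) in blast)+
  have S0: "0 \<le> S x" for x unfolding S_def by (intro sum_nonneg bump_nonneg)
  have Spos: "0 < S x" if "x \<in> K" for x
  proof -
    obtain c where c: "c \<in> F" "x \<in> ball c (r c)" using F(3) \<open>x \<in> K\<close> by auto
    have "0 < bump 0 c (r c) x" using c F r by (intro bump_pos) auto
    also have "\<dots> \<le> S x" unfolding S_def by (intro member_le_sum F c bump_nonneg)
    finally show ?thesis .
  qed
  have "\<exists>m>0. \<forall>x\<in>K. m \<le> S x"
  proof (cases "K = {}")
    case False
    obtain x where "x \<in> K" "\<forall>y\<in>K. S x \<le> S y"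
      using continuous_attains_inf[OF K False, of S] continuous_on_subset[OF test_continuous[OF S]] by auto
    then show ?thesis using Spos by auto
  qed (auto intro: exI[of _ 1])
  then obtain m where m: "m > 0" "\<And>x. x \<in> K \<Longrightarrow> m \<le> S x" by auto
  \<comment> \<open>On \<open>K\<close> this makes \<open>n * S x\<close> at least
    \<open>1 / e\<close>, whence the quotient is at least \<open>1 - e\<close>.\<close>
  define n where "n = 1 / (m * e)"
  have n: "n > 0" using m e by (simp add: n_def)
  define \<phi> where "\<phi> x = (n * (1 + n * S x) powr (-1)) * S x" for x
  have p: "0 < 1 + n * S x" for x using n S0[of x] by (simp add: add_pos_nonneg)
  have eq: "\<phi> x = n * S x / (1 + n * S x)" for x
    using p[of x] by (simp add: \<phi>_def powr_minus_divide)
  have "\<phi> \<in> test_functions U" unfolding \<phi>_def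
    by (intro test_mult S smooth_cmult smooth_powr smooth_add smooth_const test_smooth[OF S] p)
  moreover have "0 \<le> \<phi> x \<and> \<phi> x \<le> 1" for x unfolding eq using p[of x] n S0[of x] by (simp add: divide_simps)
  moreover have "1 - e \<le> \<phi> x" if "x \<in> K" for x
  proof -
    have "n * m \<le> n * S x" using m(2)[OF that] n by (intro mult_left_mono) auto
    then have "1 / e \<le> n * S x" using m e by (simp add: n_def)
    then have "1 \<le> e * (n * S x)" using e by (simp add: divide_simps mult.commute)
    then have "1 \<le> e * (1 + n * S x)" using e by (simp add: distrib_left)
    then have "(1 - e) * (1 + n * S x) \<le> n * S x" by (simp add: algebra_simps)
    then show ?thesis unfolding eq using p[of x] by (simp add: pos_le_divide_eq)
  qed
  ultimately show ?thesis by blast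
qed

definition tdense :: "('a::euclidean_space \<Rightarrow> real) \<Rightarrow> bool" where
  "tdense f \<longleftrightarrow> (\<forall>e>0. \<exists>\<phi>\<in>test_functions UNIV. n2 (\<lambda>x. f x - \<phi> x) < e)"

lemma tdense_add:
  assumes "L2 f" "L2 g" "tdense f" "tdense g" shows "tdense (\<lambda>x. f x + g x)"
  unfolding tdense_def
proof (intro allI impI)
  fix e :: real assume "0 < e"
  then obtain \<phi> \<psi> where p: "\<phi> \<in> test_functions UNIV" "n2 (\<lambda>x. f x - \<phi> x) < e/4"
    "\<psi> \<in> test_functions UNIV" "n2 (\<lambda>x. g x - \<psi> x) < e/4"
    using assms unfolding tdense_def by (meson divide_pos_pos zero_less_numeral)
  have "n2 (\<lambda>x. (f x - \<phi> x) + (g x - \<psi> x)) \<le> 2 * n2 (\<lambda>x. f x - \<phi> x) + 2 * n2 (\<lambda>x. g x - \<psi> x)"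
    by (intro n2_add_le L2_diff assms test_L2[OF p(1)] test_L2[OF p(3)])
  moreover have "(\<lambda>x. f x + g x - (\<phi> x + \<psi> x)) = (\<lambda>x. (f x - \<phi> x) + (g x - \<psi> x))" by auto
  ultimately show "\<exists>\<eta>\<in>test_functions UNIV. n2 (\<lambda>x. f x + g x - \<eta> x) < e"
    using p test_add[OF p(1,3)] by (intro bexI[of _ "\<lambda>x. \<phi> x + \<psi> x"]) auto
qed

lemma tdense_cmult:
  assumes "tdense f" shows "tdense (\<lambda>x. c * f x)"
  unfolding tdense_def
proof (intro allI impI)
  fix e :: real assume e: "0 < e"
  have "0 < e / (c\<^sup>2 + 1)" using e by (intro divide_pos_pos add_nonneg_pos) auto
  then obtain \<phi> where p: "\<phi> \<in> test_functions UNIV" "n2 (\<lambda>x. f x - \<phi> x) < e / (c\<^sup>2 + 1)"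
    using assms unfolding tdense_def by meson
  have "(\<lambda>x. c * f x - c * \<phi> x) = (\<lambda>x. c * (f x - \<phi> x))" by (simp add: right_diff_distrib)
  then have "n2 (\<lambda>x. c * f x - c * \<phi> x) = c\<^sup>2 * n2 (\<lambda>x. f x - \<phi> x)" by (simp only: n2_cmult)
  also have "\<dots> \<le> (c\<^sup>2 + 1) * n2 (\<lambda>x. f x - \<phi> x)" by (intro mult_right_mono) auto
  also have "\<dots> < e" using p(2) by (simp add: pos_less_divide_eq add_nonneg_pos mult.commute)
  finally show "\<exists>\<eta>\<in>test_functions UNIV. n2 (\<lambda>x. c * f x - \<eta> x) < e"
    using test_cmult[OF p(1), of c] by (intro bexI[of _ "\<lambda>x. c * \<phi> x"]) auto
qed

lemma tdense_limit:
  assumes f: "L2 f" and d: "\<And>n. tdense (F n)" "\<And>n. L2 (F n)" and l: "(\<lambda>n. n2 (\<lambda>x. F n x - f x)) \<longlonglongrightarrow> 0"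
  shows "tdense f"
  unfolding tdense_def
proof (intro allI impI)
  fix e :: real assume e: "0 < e"
  then have "\<forall>\<^sub>F n in sequentially. n2 (\<lambda>x. F n x - f x) < e/4" using l by (intro order_tendstoD(2)) auto
  then obtain n where n: "n2 (\<lambda>x. F n x - f x) < e/4" by (meson eventually_sequentially order_refl)
  obtain \<phi> where p: "\<phi> \<in> test_functions UNIV" "n2 (\<lambda>x. F n x - \<phi> x) < e/4"
    using d(1)[of n] e unfolding tdense_def by (meson divide_pos_pos zero_less_numeral)
  have "n2 (\<lambda>x. f x - \<phi> x) \<le> 2 * n2 (\<lambda>x. f x - F n x) + 2 * n2 (\<lambda>x. F n x - \<phi> x)"
    by (intro n2_tri f d test_L2[OF p(1)])
  then show "\<exists>\<eta>\<in>test_functions UNIV. n2 (\<lambda>x. f x - \<eta> x) < e"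
    using n p by (intro bexI[of _ \<phi>]) (auto simp: n2_minus_commute[of f])
qed

lemma L2_indicator:
  assumes "A \<in> sets borel" "emeasure lborel A < \<infinity>" shows "L2 (indicator A :: _ \<Rightarrow> real)"
proof -
  have "integrable lborel (indicator A :: _ \<Rightarrow> real)" using assms by (intro integrable_real_indicator) auto
  moreover have "(norm (indicator A y :: real))\<^sup>2 = indicator A y" for y by (simp add: indicator_def)
  ultimately show ?thesis using assms by (simp add: L2_def borel_measurable_indicator)
qed

text \<open>Regularity of the measure encloses \<open>A\<close> between a compact and an open set; a
  smooth cutoff between them is wrong only on the two small differences and, slightly, on the
  compact set.\<close>

lemma tdense_indicator:
  fixes A :: "'a::euclidean_space set"
  assumes A: "A \<in> sets borel" "A \<subseteq> cball 0 R" shows "tdense (indicator A)"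
  unfolding tdense_def
proof (intro allI impI)
  fix e0 :: real assume e0: "0 < e0"
  define e where "e = e0 / 2"
  have e: "0 < e" "e < e0" using e0 by (auto simp: e_def)
  have Al: "A \<in> sets lebesgue" using A by auto
  obtain T where T: "closed T" "T \<subseteq> A" "A - T \<in> lmeasurable" "emeasure lebesgue (A - T) < ennreal (e/4)"
    using sets_lebesgue_inner_closed[OF Al, of "e/4"] e by auto
  obtain U where U: "open U" "A \<subseteq> U" "U - A \<in> lmeasurable" "emeasure lebesgue (U - A) < ennreal (e/4)"
    using sets_lebesgue_outer_open[OF Al, of "e/4"] e by auto
  have cT: "compact T"
    using T(1,2) A(2) by (meson bounded_cball bounded_subset compact_eq_bounded_closed order_trans)
  define M where "M = measure lborel (cball (0::'a) R) + 1"
  have M: "M > 0" unfolding M_def by (simp add: add_nonneg_pos)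
  \<comment> \<open>Each of the two differences costs at most \<open>e / 4\<close>; the defect
    \<open>d\<close> on the ball costs at most \<open>d^2 * M = e / 2\<close>.\<close>
  define d where "d = sqrt (e / (2 * M))"
  have d: "d > 0" "d\<^sup>2 = e / (2 * M)" using e M by (auto simp: d_def)
  obtain \<phi> where p: "\<phi> \<in> test_functions U" "\<And>x. 0 \<le> \<phi> x" "\<And>x. \<phi> x \<le> 1" "\<And>x. x \<in> T \<Longrightarrow> 1 - d \<le> \<phi> x"
    using smooth_urysohn[OF cT U(1) _ d(1)] T(2) U(2) by (metis order_trans)
  note [measurable] = L2_measurable[OF test_L2[OF p(1)]] A(1) borel_closed[OF T(1)] borel_open[OF U(1)]
  have em: "emeasure lborel (A - T) < ennreal (e/4)" "emeasure lborel (U - A) < ennreal (e/4)"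
    using T(4) U(4) by simp_all
  have "(\<integral>\<^sup>+x. ennreal ((norm (indicator A x - \<phi> x))\<^sup>2) \<partial>lborel)
     \<le> (\<integral>\<^sup>+x. indicator (A - T) x + indicator (U - A) x + ennreal (d\<^sup>2) * indicator (cball 0 R) x \<partial>lborel)"
  proof (rule nn_integral_mono)
    fix x
    have sq: "(norm (indicator A x - \<phi> x))\<^sup>2 \<le> 1" using p(2,3)[of x] by (simp add: indicator_def power_le_one abs_square_le_1)
    consider "x \<in> T" | "x \<in> A - T" | "x \<in> U - A" | "x \<notin> U" using U(2) T(2) by blast
    then show "ennreal ((norm (indicator A x - \<phi> x))\<^sup>2)
       \<le> indicator (A - T) x + indicator (U - A) x + ennreal (d\<^sup>2) * indicator (cball 0 R) x"
    proof cases
      case 1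
      then have "x \<in> A" "x \<in> cball 0 R" using T(2) A(2) by auto
      have "(1 - \<phi> x)\<^sup>2 \<le> d\<^sup>2" using p(3)[of x] p(4)[OF 1] by (intro power_mono) auto
      then show ?thesis using \<open>x \<in> A\<close> \<open>x \<in> cball 0 R\<close> 1 by (simp add: ennreal_leI)
    next
      case 2
      have "ennreal ((norm (indicator A x - \<phi> x))\<^sup>2) \<le> 1" using sq by (metis ennreal_1 ennreal_leI)
      also have "1 \<le> indicator (A - T) x + indicator (U - A) x + ennreal (d\<^sup>2) * indicator (cball 0 R) x"
        using 2 by (simp add: add_increasing2 add.assoc)
      finally show ?thesis .
    next
      case 3
      have "ennreal ((norm (indicator A x - \<phi> x))\<^sup>2) \<le> 1" using sq by (metis ennreal_1 ennreal_leI)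
      also have "1 \<le> indicator (A - T) x + indicator (U - A) x + ennreal (d\<^sup>2) * indicator (cball 0 R) x"
        using 3 by (simp add: add_increasing2 add.assoc)
      finally show ?thesis .
    next
      case 4
      then have "\<phi> x = 0" "x \<notin> A" using test_outside[OF p(1)] U(2) by auto
      then show ?thesis by simp
    qed
  qed
  also have "\<dots> = emeasure lborel (A - T) + emeasure lborel (U - A) + ennreal (d\<^sup>2) * emeasure lborel (cball (0::'a) R)"
  proof -
    have "A - T \<in> sets lborel" "U - A \<in> sets lborel" using A T U by auto
    then show ?thesis by (subst nn_integral_add, simp, simp)+ (simp add: nn_integral_cmult)
  qed
  also have "\<dots> \<le> ennreal (e/4) + ennreal (e/4) + ennreal (d\<^sup>2) * ennreal M"
  proof (intro add_mono mult_left_mono)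
    show "emeasure lborel (cball (0::'a) R) \<le> ennreal M"
      unfolding M_def by (subst emeasure_eq_ennreal_measure) (auto intro: ennreal_leI simp: less_imp_neq[OF emeasure_cball_finite])
  qed (use em in \<open>auto intro: less_imp_le\<close>)
  also have "\<dots> = ennreal (e/4 + e/4 + d\<^sup>2 * M)" using e M by (simp add: ennreal_mult[symmetric] ennreal_plus[symmetric] del: ennreal_plus)
  also have "e/4 + e/4 + d\<^sup>2 * M = e" unfolding d(2) using M by simp
  finally have "n2 (\<lambda>x. indicator A x - \<phi> x) \<le> e" using e by (intro L2_from_nn) auto
  then show "\<exists>\<eta>\<in>test_functions UNIV. n2 (\<lambda>x. indicator A x - \<eta> x) < e0"
    using test_UNIV[OF p(1)] e by (intro bexI[of _ \<phi>]) auto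
qed


lemma L2_tdense:
  fixes f :: "'a::euclidean_space \<Rightarrow> real"
  assumes f: "L2 f" shows "tdense f"
proof -
  note [measurable] = L2_measurable[OF f]
  obtain F where F: "\<And>i. simple_function borel (F i)" "\<And>x. (\<lambda>i. F i x) \<longlonglongrightarrow> f x" "\<And>i x. norm (F i x) \<le> 2 * norm (f x)"
    using borel_measurable_implies_sequence_metric[OF L2_measurable[OF f], of 0] by (auto simp: dist_norm)
  note [measurable] = borel_measurable_simple_function[OF F(1)]
  \<comment> \<open>The cutoff gives all level sets finite measure, including the one of the value
    0.\<close>
  define G where "G i x = indicator (cball 0 (real i)) x * F i x" for i :: nat and x
  have [measurable]: "G i \<in> borel_measurable borel" for i unfolding G_def[abs_def]
    by (intro borel_measurable_times borel_measurable_indicator borel_measurable_simple_function F) auto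
  have Gf: "norm (G i x) \<le> 2 * norm (f x)" for i x
    using F(3)[of i x] by (auto simp: G_def indicator_def)
  have LG: "L2 (G i)" for i by (rule L2_bound[OF _ f Gf]) measurable
  have "tdense (G i) " for i
  proof -
    have fin: "finite (range (F i))" using F(1)[of i] by (simp add: simple_function_def)
    have tds: "L2 (\<lambda>x. \<Sum>c\<in>I. g c x) \<and> tdense (\<lambda>x. \<Sum>c\<in>I. g c x)"
      if "finite I" "\<And>c. c \<in> I \<Longrightarrow> L2 (g c) \<and> tdense (g c)" for I :: "real set" and g :: "real \<Rightarrow> 'a \<Rightarrow> real"
      using that
    proof (induction I)
      case empty
      have "L2 (\<lambda>x::'a. 0::real)" by (simp add: L2_def)
      moreover have "tdense (\<lambda>x::'a. 0::real)" unfolding tdense_def using test_zero by (auto simp: n2_def intro!: bexI[of _ "\<lambda>x. 0"])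
      ultimately show ?case by simp
    next
      case (insert c I) then show ?case by (auto intro!: L2_add tdense_add)
    qed
    let ?A = "\<lambda>c. F i -` {c} \<inter> cball 0 (real i)"
    have A: "?A c \<in> sets borel" for c
      using measurable_sets[OF borel_measurable_simple_function[OF F(1)[of i]], of "{c}"] by auto
    have "L2 (\<lambda>x. c * indicator (?A c) x) \<and> tdense (\<lambda>x. c * indicator (?A c) x)" for c
    proof
      have "emeasure lborel (?A c) \<le> emeasure lborel (cball (0::'a) (real i))" by (intro emeasure_mono) auto
      then have "emeasure lborel (?A c) < \<infinity>" by (simp add: order_le_less_trans)
      then show "L2 (\<lambda>x. c * indicator (?A c) x)" by (intro L2_cmult L2_indicator A)
      show "tdense (\<lambda>x. c * indicator (?A c) x)"
        by (intro tdense_cmult tdense_indicator[where R="real i"] A) auto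
    qed
    with tds[OF fin, of "\<lambda>c x. c * indicator (?A c) x"]
    have "tdense (\<lambda>x. \<Sum>c\<in>range (F i). c * indicator (?A c) x)" by blast
    moreover have "(\<Sum>c\<in>range (F i). c * indicator (?A c) x) = G i x" for x
    proof -
      have "(\<Sum>c\<in>range (F i). c * indicator (?A c) x) = (\<Sum>c\<in>{F i x}. c * indicator (?A c) x)"
        by (rule sum.mono_neutral_right[OF fin]) (auto simp: indicator_def)
      then show ?thesis by (simp add: G_def indicator_def)
    qed
    ultimately show ?thesis by simp
  qed
  moreover have "(\<lambda>n. n2 (\<lambda>x. G n x - f x)) \<longlonglongrightarrow> 0"
  proof -
    have "(\<lambda>n. \<integral>x. (norm (G n x - f x))\<^sup>2 \<partial>lborel) \<longlonglongrightarrow> integral\<^sup>L lborel (\<lambda>x::'a. 0::real)"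
    proof (rule integral_dominated_convergence[where w="\<lambda>x. 9 * (norm (f x))\<^sup>2"])
      show "integrable lborel (\<lambda>x. 9 * (norm (f x))\<^sup>2)" using L2_integrable[OF f] by simp
      show "AE x in lborel. (\<lambda>n. (norm (G n x - f x))\<^sup>2) \<longlonglongrightarrow> 0"
      proof (rule AE_I2)
        fix x
        have "\<forall>\<^sub>F n in sequentially. F n x = G n x"
          using eventually_ge_at_top[of "nat \<lceil>norm x\<rceil>"]
        proof eventually_elim
          fix n assume "nat \<lceil>norm x\<rceil> \<le> n"
          then have "norm x \<le> real n" by linarith
          then show "F n x = G n x" by (simp add: G_def)
        qed
        then have "(\<lambda>n. G n x) \<longlonglongrightarrow> f x" by (rule Lim_transform_eventually[OF F(2)])
        then have "(\<lambda>n. (norm (G n x - f x))\<^sup>2) \<longlonglongrightarrow> (norm (f x - f x))\<^sup>2" by (intro tendsto_intros)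
        then show "(\<lambda>n. (norm (G n x - f x))\<^sup>2) \<longlonglongrightarrow> 0" by simp
      qed
      show "AE x in lborel. norm ((norm (G n x - f x))\<^sup>2) \<le> 9 * (norm (f x))\<^sup>2" for n
      proof (rule AE_I2)
        fix x
        have "norm (G n x - f x) \<le> 3 * norm (f x)" using Gf[of n x] norm_triangle_ineq4[of "G n x" "f x"] by linarith
        then have "(norm (G n x - f x))\<^sup>2 \<le> (3 * norm (f x))\<^sup>2" by (intro power_mono) auto
        then show "norm ((norm (G n x - f x))\<^sup>2) \<le> 9 * (norm (f x))\<^sup>2" by (simp add: power_mult_distrib)
      qed
    qed measurable
    then show ?thesis by (simp add: n2_def)
  qed
  ultimately show ?thesis by (intro tdense_limit[OF f _ LG])
qed

lemma L2_test_sequence: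
  assumes "L2 f" shows "\<exists>\<Phi>. (\<forall>n. \<Phi> n \<in> test_functions UNIV) \<and> (\<lambda>n. n2 (\<lambda>x. \<Phi> n x - f x)) \<longlonglongrightarrow> 0"
proof -
  have "\<forall>n. \<exists>\<phi>\<in>test_functions UNIV. n2 (\<lambda>x. f x - \<phi> x) < inverse (real (Suc n))"
    using L2_tdense[OF assms] unfolding tdense_def by simp
  then obtain \<Phi> where P: "\<And>n. \<Phi> n \<in> test_functions UNIV" "\<And>n. n2 (\<lambda>x. f x - \<Phi> n x) < inverse (real (Suc n))"
    by metis
  have "(\<lambda>n. n2 (\<lambda>x. \<Phi> n x - f x)) \<longlonglongrightarrow> 0"
    using P(2) by (intro Lim_null_comparison[OF always_eventually LIMSEQ_inverse_real_of_nat])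
      (auto simp: n2_minus_commute[of "\<Phi> _"] intro: less_imp_le)
  with P show ?thesis by blast
qed

text \<open>In the dual estimate the test function may tend to the increment of \<open>u\<close>
  itself; one factor of its norm then cancels.\<close>

theorem wgr_translate:
  assumes w: "wgr u g" shows "n2 (\<lambda>x. u (x + h) - u x) \<le> (norm h)\<^sup>2 * n2 g"
proof -
  let ?w = "\<lambda>x. u (x + h) - u x"
  have L: "L2 ?w" by (intro L2_diff L2_shift wgr_L2[OF w])
  obtain \<Phi> where P: "\<And>n. \<Phi> n \<in> test_functions UNIV" "(\<lambda>n. n2 (\<lambda>x. \<Phi> n x - ?w x)) \<longlonglongrightarrow> 0"
    using L2_test_sequence[OF L] by auto
  have a: "(\<lambda>n. \<integral>x. ?w x \<bullet> \<Phi> n x \<partial>lborel) \<longlonglongrightarrow> (\<integral>x. ?w x \<bullet> ?w x \<partial>lborel)"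
    by (rule L2_tendsto_inner[OF L L L2_const[OF L] test_L2[OF P(1)] L P(2)])
  have b: "(\<lambda>n. n2 (\<Phi> n)) \<longlonglongrightarrow> n2 ?w" by (rule L2_tendsto_n2[OF test_L2[OF P(1)] L P(2)])
  have "(\<lambda>n. norm h * sqrt (n2 g) * sqrt (n2 (\<Phi> n))) \<longlonglongrightarrow> norm h * sqrt (n2 g) * sqrt (n2 ?w)"
    by (intro tendsto_intros b)
  moreover have "(\<integral>x. ?w x \<bullet> \<Phi> n x \<partial>lborel) \<le> norm h * sqrt (n2 g) * sqrt (n2 (\<Phi> n))" for n
    using wgr_translate_weak[OF w P(1), of h n] by simp
  ultimately have "n2 ?w \<le> norm h * sqrt (n2 g) * sqrt (n2 ?w)"
    unfolding n2_eq_inner[of ?w] using a by (intro LIMSEQ_le) auto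
  then have "sqrt (n2 ?w) * sqrt (n2 ?w) \<le> (norm h * sqrt (n2 g)) * sqrt (n2 ?w)" by simp
  then have "sqrt (n2 ?w) \<le> norm h * sqrt (n2 g)"
  proof (cases "sqrt (n2 ?w) = 0")
    case False
    then have "0 < sqrt (n2 ?w)" by (simp add: less_le)
    with \<open>sqrt (n2 ?w) * sqrt (n2 ?w) \<le> _\<close> show ?thesis by (rule mult_right_le_imp_le)
  qed (auto intro: mult_nonneg_nonneg)
  then have "(sqrt (n2 ?w))\<^sup>2 \<le> (norm h * sqrt (n2 g))\<^sup>2" by (intro power_mono) auto
  then show ?thesis by (simp add: power_mult_distrib)
qed

lemma cv_L2:
  fixes u :: "'a::euclidean_space \<Rightarrow> 'b::euclidean_space"
  assumes k: "L2 k" "\<And>x. 0 \<le> k x" "(\<integral>\<^sup>+x. ennreal (k x) \<partial>lborel) \<le> 1" and u: "L2 u"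
  shows "L2 (cv k u)" "n2 (cv k u) \<le> n2 u"
proof -
  note [measurable] = L2_measurable[OF u] L2_measurable[OF k(1)]
  have "(\<integral>\<^sup>+x. ennreal ((norm (cv k u x))\<^sup>2) \<partial>lborel)
      \<le> (\<integral>\<^sup>+x. (\<integral>\<^sup>+h. ennreal (k h * (norm (u (x - h)))\<^sup>2) \<partial>lborel) \<partial>lborel)"
    using k by (intro nn_integral_mono) (simp add: cv_alt ennreal_norm_integral_sq)
  also have "\<dots> = (\<integral>\<^sup>+h. (\<integral>\<^sup>+x. ennreal (k h * (norm (u (x - h)))\<^sup>2) \<partial>lborel) \<partial>lborel)"
    by (rule lborel_pair.Fubini') measurable
  also have "\<dots> = (\<integral>\<^sup>+h. ennreal (k h) * ennreal (n2 u) \<partial>lborel)"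
  proof (rule nn_integral_cong)
    fix h
    have "(\<integral>\<^sup>+x. ennreal (k h * (norm (u (x - h)))\<^sup>2) \<partial>lborel) = ennreal (k h) * (\<integral>\<^sup>+x. ennreal ((norm (u (x + (- h))))\<^sup>2) \<partial>lborel)"
      by (subst nn_integral_cmult[symmetric]) (auto simp: ennreal_mult' k)
    also have "\<dots> = ennreal (k h) * ennreal (n2 u)"
      by (subst nn_integral_shift) (auto simp: n2_nn u)
    finally show "(\<integral>\<^sup>+x. ennreal (k h * (norm (u (x - h)))\<^sup>2) \<partial>lborel) = ennreal (k h) * ennreal (n2 u)" .
  qed
  also have "\<dots> = (\<integral>\<^sup>+h. ennreal (k h) \<partial>lborel) * ennreal (n2 u)" by (rule nn_integral_multc) measurable
  also have "\<dots> \<le> 1 * ennreal (n2 u)" by (intro mult_right_mono k) auto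
  finally have *: "(\<integral>\<^sup>+x. ennreal ((norm (cv k u x))\<^sup>2) \<partial>lborel) \<le> ennreal (n2 u)" by simp
  show "L2 (cv k u)" by (rule L2_from_nn[OF _ *]) auto
  show "n2 (cv k u) \<le> n2 u" by (rule L2_from_nn[OF _ *]) auto
qed

text \<open>The error is the \<open>k\<close>-average of the translation errors
  \<open>u (x - h) - u x\<close>. Jensen's inequality and Fubini reduce it to the largest
  translation error over the support of \<open>k\<close>.\<close>

lemma cv_approx:
  fixes u :: "'a::euclidean_space \<Rightarrow> 'b::euclidean_space"
  assumes k: "L2 k" "\<And>x. 0 \<le> k x" "(\<integral>\<^sup>+x. ennreal (k x) \<partial>lborel) = 1" and u: "L2 u"
    and B: "\<And>h. k h \<noteq> 0 \<Longrightarrow> n2 (\<lambda>x. u (x - h) - u x) \<le> B" "0 \<le> B"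
  shows "n2 (\<lambda>x. cv k u x - u x) \<le> B"
proof -
  note [measurable] = L2_measurable[OF u] L2_measurable[OF k(1)]
  have ik: "integrable lborel k" using k by (intro integrableI_nonneg) auto
  have "ennreal (\<integral>x. k x \<partial>lborel) = 1" using nn_integral_eq_integral[OF ik] k by simp
  then have k1: "(\<integral>x. k x \<partial>lborel) = 1" by simp
  have "cv k u x - u x = (\<integral>h. k h *\<^sub>R (u (x - h) - u x) \<partial>lborel)" for x
  proof -
    have "integrable lborel (\<lambda>h. k h *\<^sub>R u (x - h))" by (intro L2_scaleR_integrable k L2_refl u)
    then show ?thesis using ik k1 by (simp add: cv_alt scaleR_diff_right)
  qed
  then have "(\<integral>\<^sup>+x. ennreal ((norm (cv k u x - u x))\<^sup>2) \<partial>lborel)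
      \<le> (\<integral>\<^sup>+x. (\<integral>\<^sup>+h. ennreal (k h * (norm (u (x - h) - u x))\<^sup>2) \<partial>lborel) \<partial>lborel)"
    using k by (intro nn_integral_mono) (simp add: ennreal_norm_integral_sq)
  also have "\<dots> = (\<integral>\<^sup>+h. (\<integral>\<^sup>+x. ennreal (k h * (norm (u (x - h) - u x))\<^sup>2) \<partial>lborel) \<partial>lborel)"
    by (rule lborel_pair.Fubini') measurable
  also have "\<dots> \<le> (\<integral>\<^sup>+h. ennreal (k h) * ennreal B \<partial>lborel)"
  proof (rule nn_integral_mono)
    fix h
    have "(\<integral>\<^sup>+x. ennreal (k h * (norm (u (x - h) - u x))\<^sup>2) \<partial>lborel) = ennreal (k h) * (\<integral>\<^sup>+x. ennreal ((norm (u (x - h) - u x))\<^sup>2) \<partial>lborel)"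
      by (subst nn_integral_cmult[symmetric]) (auto simp: ennreal_mult' k)
    also have "(\<integral>\<^sup>+x. ennreal ((norm (u (x - h) - u x))\<^sup>2) \<partial>lborel) = ennreal (n2 (\<lambda>x. u (x - h) - u x))"
      using n2_nn[OF L2_diff[OF L2_shift[OF u, of "-h"] u]] by simp
    also have "ennreal (k h) * ennreal (n2 (\<lambda>x. u (x - h) - u x)) \<le> ennreal (k h) * ennreal B"
      using B(1)[of h] by (cases "k h = 0") (auto intro!: mult_left_mono ennreal_leI)
    finally show "(\<integral>\<^sup>+x. ennreal (k h * (norm (u (x - h) - u x))\<^sup>2) \<partial>lborel) \<le> ennreal (k h) * ennreal B" .
  qed
  also have "\<dots> = (\<integral>\<^sup>+h. ennreal (k h) \<partial>lborel) * ennreal B" by (rule nn_integral_multc) measurable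
  finally have *: "(\<integral>\<^sup>+x. ennreal ((norm (cv k u x - u x))\<^sup>2) \<partial>lborel) \<le> ennreal B" using k by simp
  show ?thesis by (rule L2_from_nn[OF _ * B(2)]) auto
qed

definition kc :: "'a::euclidean_space itself \<Rightarrow> real" where
  "kc _ = (\<integral>x. bump (Suc 0) (0::'a) 1 x \<partial>lborel)"

text \<open>The mollifier is built from the derivative of the profile. With this choice its change
  in \<open>r\<close> becomes a Laplacian of the bump built from the profile itself, see
  \<open>laplace_bump\<close>.\<close>

definition kern :: "real \<Rightarrow> 'a::euclidean_space \<Rightarrow> real" where
  "kern r x = bump (Suc 0) 0 r x / (kc TYPE('a) * r ^ DIM('a))"

lemma kc_pos: "0 < kc TYPE('a::euclidean_space)"
proof -
  let ?b = "bump (Suc 0) (0::'a) 1"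
  have t: "?b \<in> test_functions UNIV" by (rule test_bump) auto
  have i: "integrable lborel ?b" using test_integrable[OF t continuous_on_const[of UNIV 1]] by simp
  have "kc TYPE('a) \<noteq> 0"
  proof
    assume "kc TYPE('a) = 0"
    then have "AE x in lborel. ?b x = 0"
      unfolding kc_def using i by (subst (asm) integral_nonneg_eq_0_iff_AE) (auto intro: bump_nonneg)
    then have "AE x in lborel. x \<notin> ball (0::'a) 1"
      by eventually_elim (metis bump_pos(2) less_irrefl zero_less_one)
    moreover have "ball (0::'a) 1 = {x. norm x < 1}" by auto
    ultimately have "emeasure lborel (ball (0::'a) 1) = 0" by (subst (asm) AE_iff_measurable[OF _ refl]) auto
    then have "ball (0::'a) 1 \<in> null_sets lborel" by (intro null_setsI) auto
    then show False using open_not_negligible[of "ball (0::'a) 1"] by (simp add: negligible_iff_null_sets null_sets_completionI)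
  qed
  moreover have "0 \<le> kc TYPE('a)" unfolding kc_def by (intro Bochner_Integration.integral_nonneg bump_nonneg)
  ultimately show ?thesis by simp
qed

lemma kern_nonneg: "0 < r \<Longrightarrow> 0 \<le> kern r (x::'a::euclidean_space)"
  unfolding kern_def using kc_pos[where 'a='a] by (intro divide_nonneg_pos bump_nonneg) auto

lemma test_kern: "0 < r \<Longrightarrow> (kern r :: 'a::euclidean_space \<Rightarrow> real) \<in> test_functions UNIV"
  using test_cmult[OF test_bump[of r "0::'a" UNIV "Suc 0"], of "1 / (kc TYPE('a) * r ^ DIM('a))"]
  unfolding kern_def[abs_def] by simp

lemma kern_outside: "0 < r \<Longrightarrow> r \<le> norm x \<Longrightarrow> kern r x = 0"
  unfolding kern_def using bump_outside[of r x 0 "Suc 0"] by simp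

lemma kern_nn_integral:
  assumes r: "0 < r" shows "(\<integral>\<^sup>+x. ennreal (kern r (x::'a::euclidean_space)) \<partial>lborel) = 1"
proof -
  have [measurable]: "(kern r :: 'a \<Rightarrow> real) \<in> borel_measurable borel"
    by (rule L2_measurable[OF test_L2[OF test_kern[OF r]]])
  have t: "bump (Suc 0) (0::'a) 1 \<in> test_functions UNIV" by (rule test_bump) auto
  have i: "integrable lborel (bump (Suc 0) (0::'a) 1)" using test_integrable[OF t continuous_on_const[of UNIV 1]] by simp
  have [measurable]: "bump (Suc 0) (0::'a) 1 \<in> borel_measurable borel" by (rule L2_measurable[OF test_L2[OF t]])
  have "(\<integral>\<^sup>+x. ennreal (kern r (x::'a)) \<partial>lborel)
     = (\<integral>\<^sup>+x. ennreal (kern r (x::'a)) \<partial>density (distr lborel borel (\<lambda>x. 0 + r *\<^sub>R x)) (\<lambda>_. ennreal (\<bar>r\<bar> ^ DIM('a))))"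
    by (subst lborel_affine[of r "0::'a"]) (use r in simp_all)
  also have "\<dots> = (\<integral>\<^sup>+x. ennreal (\<bar>r\<bar> ^ DIM('a)) * ennreal (kern r (r *\<^sub>R x :: 'a)) \<partial>lborel)"
    by (simp add: nn_integral_density nn_integral_distr)
  also have "\<dots> = (\<integral>\<^sup>+x. ennreal (bump (Suc 0) (0::'a) 1 x / kc TYPE('a)) \<partial>lborel)"
  proof (rule nn_integral_cong)
    fix x :: 'a
    have "bump (Suc 0) 0 r (r *\<^sub>R x) = bump (Suc 0) 0 1 x"
      using r by (simp add: bump_def power_mult_distrib)
    then have "r ^ DIM('a) * kern r (r *\<^sub>R x) = bump (Suc 0) 0 1 x / kc TYPE('a)" using r by (simp add: kern_def)
    then show "ennreal (\<bar>r\<bar> ^ DIM('a)) * ennreal (kern r (r *\<^sub>R x)) = ennreal (bump (Suc 0) (0::'a) 1 x / kc TYPE('a))"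
      using r by (simp add: ennreal_mult'[symmetric])
  qed
  also have "\<dots> = ennreal (\<integral>x. bump (Suc 0) (0::'a) 1 x / kc TYPE('a) \<partial>lborel)"
    using i kc_pos[where 'a='a] by (intro nn_integral_eq_integral) (auto intro!: divide_nonneg_pos bump_nonneg)
  also have "(\<integral>x. bump (Suc 0) (0::'a) 1 x / kc TYPE('a) \<partial>lborel) = kc TYPE('a) / kc TYPE('a)"
    by (simp add: kc_def)
  also have "\<dots> = 1" using kc_pos[where 'a='a] by simp
  finally show ?thesis by simp
qed

lemma kern_approx:
  assumes w: "wgr u g" and r: "0 < r"
  shows "n2 (\<lambda>x. cv (kern r) u x - u x) \<le> r\<^sup>2 * n2 g"
proof (rule cv_approx)
  fix h :: 'a assume "kern r h \<noteq> 0"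
  then have "norm h \<le> r" using kern_outside[OF r, of h] by force
  then have "(norm (-h))\<^sup>2 * n2 g \<le> r\<^sup>2 * n2 g" by (intro mult_right_mono power_mono) auto
  with wgr_translate[OF w, of "-h"] show "n2 (\<lambda>x. u (x - h) - u x) \<le> r\<^sup>2 * n2 g" by simp
qed (use r w in \<open>auto simp: kern_nonneg kern_nn_integral test_L2[OF test_kern] wgr_L2\<close>)

lemma kern_cv_L2:
  assumes "0 < r" "L2 u" shows "L2 (cv (kern r) u)" "n2 (cv (kern r) u) \<le> n2 u"
  using assms by (auto intro!: cv_L2 test_L2[OF test_kern] simp: kern_nonneg kern_nn_integral)

lemma cv_diff:
  assumes "L2 k" "L2 u" "L2 v" shows "cv k (\<lambda>x. u x - v x) x = cv k u x - cv k v x"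
  unfolding cv_def scaleR_diff_right using cv_integrable[OF assms(1,2)] cv_integrable[OF assms(1,3)] by simp

lemma kern_tendsto_real:
  assumes u: "L2 u" and r: "\<And>n::nat. 0 < r n" "r \<longlonglongrightarrow> 0"
  shows "(\<lambda>n. n2 (\<lambda>x. cv (kern (r n)) u x - u x :: real)) \<longlonglongrightarrow> 0"
proof (rule LIMSEQ_I)
  fix e :: real assume e: "0 < e"
  \<comment> \<open>Three errors of size \<open>e / 12\<close> enter with the factors 2, 4 and 4,
    which leaves the total below \<open>e\<close>.\<close>
  obtain \<phi> where p: "\<phi> \<in> test_functions UNIV" "n2 (\<lambda>x. u x - \<phi> x) < e/12"
    using L2_tdense[OF u] e unfolding tdense_def by (meson divide_pos_pos zero_less_numeral)
  have "(\<lambda>n. (r n)\<^sup>2 * n2 (grad \<phi>)) \<longlonglongrightarrow> 0\<^sup>2 * n2 (grad \<phi>)" by (intro tendsto_intros r)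
  then have "\<forall>\<^sub>F n in sequentially. (r n)\<^sup>2 * n2 (grad \<phi>) < e/12" using e by (intro order_tendstoD(2)) auto
  then obtain N where N: "\<And>n. n \<ge> N \<Longrightarrow> (r n)\<^sup>2 * n2 (grad \<phi>) < e/12" by (auto simp: eventually_sequentially)
  have "n2 (\<lambda>x. cv (kern (r n)) u x - u x) < e" if n: "n \<ge> N" for n
  proof -
    let ?k = "kern (r n)"
    note L\<phi> = test_L2[OF p(1)] and Lk = test_L2[OF test_kern[OF r(1)[of n]]]
    note Lc = kern_cv_L2[OF r(1)[of n]]
    have 1: "n2 (\<lambda>x. cv ?k u x - cv ?k \<phi> x) \<le> e/12"
    proof -
      have "(\<lambda>x. cv ?k u x - cv ?k \<phi> x) = cv ?k (\<lambda>x. u x - \<phi> x)" by (rule ext) (rule cv_diff[OF Lk u L\<phi>, symmetric])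
      then show ?thesis using Lc(2)[OF L2_diff[OF u L\<phi>]] p(2) by simp
    qed
    have 2: "n2 (\<lambda>x. cv ?k \<phi> x - \<phi> x) \<le> e/12"
      using kern_approx[OF wgr_test[OF p(1)] r(1)[of n]] N[OF n] by linarith
    have 3: "n2 (\<lambda>x. \<phi> x - u x) \<le> e/12" using p(2) by (simp add: n2_minus_commute[of \<phi>])
    have 4: "n2 (\<lambda>x. cv ?k \<phi> x - u x) \<le> 2 * n2 (\<lambda>x. cv ?k \<phi> x - \<phi> x) + 2 * n2 (\<lambda>x. \<phi> x - u x)"
      by (intro n2_tri Lc L\<phi> u)
    have "n2 (\<lambda>x. cv ?k u x - u x) \<le> 2 * n2 (\<lambda>x. cv ?k u x - cv ?k \<phi> x) + 2 * n2 (\<lambda>x. cv ?k \<phi> x - u x)"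
      by (intro n2_tri Lc L\<phi> u)
    then show ?thesis using 1 2 3 4 e by linarith
  qed
  then show "\<exists>N. \<forall>n\<ge>N. norm (n2 (\<lambda>x. cv (kern (r n)) u x - u x) - 0) < e" by (intro exI[of _ N]) auto
qed

lemma n2_components:
  assumes "L2 f" shows "n2 f = (\<Sum>i\<in>Basis. n2 (\<lambda>x. f x \<bullet> i))"
proof -
  have "(norm (f x))\<^sup>2 = (\<Sum>i\<in>Basis. (norm (f x \<bullet> i))\<^sup>2)" for x
    unfolding power2_norm_eq_inner by (subst euclidean_inner) (simp add: power2_eq_square)
  then show ?thesis unfolding n2_def using L2_integrable[OF L2_inner[OF assms]] by simp
qed

lemma kern_tendsto:
  fixes u :: "'a::euclidean_space \<Rightarrow> 'b::euclidean_space"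
  assumes u: "L2 u" and r: "\<And>n::nat. 0 < r n" "r \<longlonglongrightarrow> 0"
  shows "(\<lambda>n. n2 (\<lambda>x. cv (kern (r n)) u x - u x)) \<longlonglongrightarrow> 0"
proof -
  have c: "(cv (kern (r n)) u x - u x) \<bullet> i = cv (kern (r n)) (\<lambda>y. u y \<bullet> i) x - u x \<bullet> i" for n x and i :: 'b
  proof -
    have "integrable lborel (\<lambda>y. kern (r n) (x - y) *\<^sub>R u y)" by (rule cv_integrable[OF test_L2[OF test_kern[OF r(1)]] u])
    from integral_inner_left[OF this, of i] show ?thesis by (simp add: cv_def inner_diff_left)
  qed
  have "n2 (\<lambda>x. cv (kern (r n)) u x - u x) = (\<Sum>i\<in>Basis. n2 (\<lambda>x. cv (kern (r n)) (\<lambda>y. u y \<bullet> i) x - u x \<bullet> i))" for n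
    using n2_components[OF L2_diff[OF kern_cv_L2(1)[OF r(1)[of n] u] u]] by (simp only: c)
  moreover have "(\<lambda>n. \<Sum>i\<in>Basis. n2 (\<lambda>x. cv (kern (r n)) (\<lambda>y. u y \<bullet> i) x - u x \<bullet> i)) \<longlonglongrightarrow> (\<Sum>i\<in>(Basis::'b set). 0)"
    by (intro tendsto_sum kern_tendsto_real L2_inner u r)
  ultimately show ?thesis by simp
qed

text \<open>The mean value inequality bounds all difference quotients by the same \<open>G\<close>
  that bounds the derivative, so dominated convergence applies along every sequence of
  increments.\<close>

lemma deriv_under_integral:
  fixes F :: "real \<Rightarrow> 'a::euclidean_space \<Rightarrow> real"
  assumes r0: "a < r0" "r0 < b"
    and D: "\<And>r y. a < r \<Longrightarrow> r < b \<Longrightarrow> ((\<lambda>r. F r y) has_real_derivative F' r y) (at r)"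
    and B: "\<And>r y. a < r \<Longrightarrow> r < b \<Longrightarrow> \<bar>F' r y\<bar> \<le> G y"
    and G: "integrable lborel G"
    and I: "\<And>r. a < r \<Longrightarrow> r < b \<Longrightarrow> integrable lborel (F r)"
    and m: "F' r0 \<in> borel_measurable borel"
  shows "((\<lambda>r. \<integral>y. F r y \<partial>lborel) has_real_derivative (\<integral>y. F' r0 y \<partial>lborel)) (at r0)"
  unfolding DERIV_def tendsto_at_iff_sequentially
proof (intro allI impI)
  fix X :: "nat \<Rightarrow> real" assume X: "\<forall>i. X i \<in> UNIV - {0}" "X \<longlonglongrightarrow> 0"
  have "0 < min (r0 - a) (b - r0)" using r0 by auto
  from LIMSEQ_D[OF X(2) this] obtain N where "\<forall>n\<ge>N. norm (X n - 0) < min (r0 - a) (b - r0)" ..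
  then have N: "\<bar>X n\<bar> < min (r0 - a) (b - r0)" if "n \<ge> N" for n using that by simp
  define Y where "Y n = X (n + N)" for n
  have Y: "Y \<longlonglongrightarrow> 0" unfolding Y_def by (rule LIMSEQ_ignore_initial_segment[OF X(2)])
  have Y0: "Y n \<noteq> 0" for n using X(1) by (simp add: Y_def)
  have Yb: "a < r0 + Y n" "r0 + Y n < b" for n using N[of "n + N"] by (auto simp: Y_def)
  have "(\<lambda>n. \<integral>y. (F (r0 + Y n) y - F r0 y) / Y n \<partial>lborel) \<longlonglongrightarrow> (\<integral>y. F' r0 y \<partial>lborel)"
  proof (rule integral_dominated_convergence[where w=G])
    show "F' r0 \<in> borel_measurable lborel" using m by simp
    show "(\<lambda>y. (F (r0 + Y n) y - F r0 y) / Y n) \<in> borel_measurable lborel" for n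
      using borel_measurable_integrable[OF I[OF Yb, of n]] borel_measurable_integrable[OF I[OF r0]] by measurable
    show "AE y in lborel. (\<lambda>n. (F (r0 + Y n) y - F r0 y) / Y n) \<longlonglongrightarrow> F' r0 y"
    proof (rule AE_I2)
      fix y
      have "((\<lambda>h. (F (r0 + h) y - F r0 y) / h) \<longlongrightarrow> F' r0 y) (at 0)" using D[OF r0, of y] by (simp add: DERIV_def)
      moreover have "filterlim Y (at 0) sequentially" using Y Y0 by (intro filterlim_atI) auto
      ultimately show "(\<lambda>n. (F (r0 + Y n) y - F r0 y) / Y n) \<longlonglongrightarrow> F' r0 y" by (rule filterlim_compose)
    qed
    show "AE y in lborel. norm ((F (r0 + Y n) y - F r0 y) / Y n) \<le> G y" for n
    proof (rule AE_I2)
      fix y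
      have "norm (F (r0 + Y n) y - F r0 y) \<le> G y * norm ((r0 + Y n) - r0)"
      proof (rule field_differentiable_bound[of "{a<..<b}" "\<lambda>r. F r y" "\<lambda>r. F' r y"])
        show "((\<lambda>r. F r y) has_field_derivative F' r y) (at r within {a<..<b})" if "r \<in> {a<..<b}" for r
          using D[of r y] that by (auto intro: has_field_derivative_at_within)
      qed (use B Yb r0 in auto)
      then show "norm ((F (r0 + Y n) y - F r0 y) / Y n) \<le> G y" using Y0[of n] by (simp add: divide_simps)
    qed
  qed (rule G)
  moreover have "(\<integral>y. (F (r0 + Y n) y - F r0 y) / Y n \<partial>lborel)
      = ((\<integral>y. F (r0 + Y n) y \<partial>lborel) - (\<integral>y. F r0 y \<partial>lborel)) / Y n" for n
    using I[OF Yb, of n] I[OF r0] by simp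
  ultimately have "(\<lambda>n. ((\<lambda>h. ((\<integral>y. F (r0 + h) y \<partial>lborel) - (\<integral>y. F r0 y \<partial>lborel)) / h) \<circ> X) (n + N)) \<longlonglongrightarrow> (\<integral>y. F' r0 y \<partial>lborel)"
    unfolding o_def Y_def by (simp only:)
  then show "((\<lambda>h. ((\<integral>y. F (r0 + h) y \<partial>lborel) - (\<integral>y. F r0 y \<partial>lborel)) / h) \<circ> X) \<longlonglongrightarrow> (\<integral>y. F' r0 y \<partial>lborel)"
    by (rule LIMSEQ_offset)
qed

section \<open>The mean value formula and the Sobolev inequality\<close>

text \<open>The derivative of \<open>kern r z\<close> with respect to \<open>r\<close>; up to a
  factor it is also the Laplacian of \<open>bump 0\<close> of radius \<open>r\<close>.\<close>

definition kd :: "real \<Rightarrow> 'a::euclidean_space \<Rightarrow> real" where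
  "kd r z = (2 * (norm z)\<^sup>2 * flatd (Suc (Suc 0)) (1 - (norm z)\<^sup>2 / r\<^sup>2) / r ^ 3
      - real DIM('a) * flatd (Suc 0) (1 - (norm z)\<^sup>2 / r\<^sup>2) / r) / (kc TYPE('a) * r ^ DIM('a))"

lemma kern_deriv:
  fixes z :: "'a::euclidean_space"
  assumes r: "0 < r" shows "((\<lambda>r. kern r z) has_real_derivative kd r z) (at r)"
proof -
  let ?c = "kc TYPE('a)" and ?N = "DIM('a)"
  have c: "?c > 0" by (rule kc_pos)
  define s where "s = (norm z)\<^sup>2"
  have q: "((\<lambda>r. 1 - s / r\<^sup>2) has_real_derivative 2 * s / r ^ 3) (at r)"
    using r by (auto intro!: derivative_eq_intros simp: field_simps eval_nat_numeral)
  have "((\<lambda>r. flatd (Suc 0) (1 - s / r\<^sup>2)) has_real_derivative flatd (Suc (Suc 0)) (1 - s / r\<^sup>2) * (2 * s / r ^ 3)) (at r)"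
    using DERIV_chain2[OF flatd_has_derivative[of "Suc 0"] q] by simp
  moreover have "((\<lambda>r. 1 / (?c * r ^ ?N)) has_real_derivative - (real ?N / (?c * r ^ ?N * r))) (at r)"
  proof -
    have "((\<lambda>r. 1 / (?c * r ^ ?N)) has_real_derivative - (?c * (real ?N * r ^ (?N - 1))) / (?c * r ^ ?N)\<^sup>2) (at r)"
      using r c by (auto intro!: derivative_eq_intros simp: power2_eq_square)
    moreover have "r ^ ?N = r ^ (?N - 1) * r" by (metis DIM_positive power_minus_mult)
    ultimately show ?thesis using r c by (simp add: power2_eq_square divide_simps mult_ac)
  qed
  ultimately have "((\<lambda>r. flatd (Suc 0) (1 - s / r\<^sup>2) * (1 / (?c * r ^ ?N))) has_real_derivative
     flatd (Suc 0) (1 - s / r\<^sup>2) * (- (real ?N / (?c * r ^ ?N * r))) + flatd (Suc (Suc 0)) (1 - s / r\<^sup>2) * (2 * s / r ^ 3) * (1 / (?c * r ^ ?N))) (at r)"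
    by (rule DERIV_mult')
  moreover have "flatd (Suc 0) (1 - s / r\<^sup>2) * (- (real ?N / (?c * r ^ ?N * r))) + flatd (Suc (Suc 0)) (1 - s / r\<^sup>2) * (2 * s / r ^ 3) * (1 / (?c * r ^ ?N)) = kd r z"
    unfolding kd_def s_def[symmetric] using r c by (simp add: diff_divide_distrib mult.commute)
  moreover have "(\<lambda>r. kern r z) = (\<lambda>r. flatd (Suc 0) (1 - s / r\<^sup>2) * (1 / (?c * r ^ ?N)))"
    by (simp add: kern_def bump_def s_def)
  ultimately show ?thesis by simp
qed

lemma bump_has_derivative:
  "(bump j x r has_derivative (\<lambda>h. ((flatd (Suc j) (1 - (norm (y - x))\<^sup>2 / r\<^sup>2) * (- 2 / r\<^sup>2)) *\<^sub>R (y - x)) \<bullet> h)) (at y)"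
proof -
  have q: "((\<lambda>y. 1 - (norm (y - x))\<^sup>2 / r\<^sup>2) has_derivative (\<lambda>h. - (2 * ((y - x) \<bullet> h)) / r\<^sup>2)) (at y)"
    unfolding power2_norm_eq_inner divide_inverse
    by (auto intro!: derivative_eq_intros simp: inner_commute algebra_simps)
  have "(flatd j has_derivative (*) (flatd (Suc j) (1 - (norm (y - x))\<^sup>2 / r\<^sup>2))) (at (1 - (norm (y - x))\<^sup>2 / r\<^sup>2))"
    using flatd_has_derivative by (simp add: has_field_derivative_def)
  from diff_chain_at[OF q this] show ?thesis
    by (simp add: o_def bump_def[abs_def] mult_ac)
qed

lemma grad_bump:
  "grad (bump j x r) y = (flatd (Suc j) (1 - (norm (y - x))\<^sup>2 / r\<^sup>2) * (- 2 / r\<^sup>2)) *\<^sub>R (y - x)"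
  by (rule grad_eqI) (rule bump_has_derivative)

lemma frechet_bump:
  "frechet_derivative (bump j x r) (at y) i = - 2 / r\<^sup>2 * (bump (Suc j) x r y * ((y - x) \<bullet> i))"
  unfolding frechet_derivative_eq[OF bump_has_derivative] bump_def by simp

lemma frechet_bump2:
  assumes "i \<in> Basis"
  shows "frechet_derivative (\<lambda>y. frechet_derivative (bump j x r) (at y) i) (at y) i
    = 4 / r ^ 4 * (((y - x) \<bullet> i)\<^sup>2 * bump (Suc (Suc j)) x r y) - 2 / r\<^sup>2 * bump (Suc j) x r y"
proof -
  have D: "((\<lambda>y. c * (bump (Suc j) x r y * ((y - x) \<bullet> i))) has_derivative
     (\<lambda>h. c * (bump (Suc j) x r y * (h \<bullet> i) + (frechet_derivative (bump (Suc j) x r) (at y) h) * ((y - x) \<bullet> i)))) (at y)" for c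
    by (auto intro!: derivative_eq_intros smooth_has_derivative[OF smooth_bump])
  have alg: "- 2 / r\<^sup>2 * (B1 * 1 + (- 2 / r\<^sup>2 * (B2 * a)) * a) = 4 / r ^ 4 * (a\<^sup>2 * B2) - 2 / r\<^sup>2 * B1"
    for a B1 B2 :: real
    by (simp add: algebra_simps power2_eq_square power4_eq_xxxx)
  show ?thesis
    unfolding frechet_bump frechet_derivative_eq[OF D] inner_same_Basis[OF assms] by (rule alg)
qed

text \<open>For a profile F and N = \<open>DIM('a)\<close> the Laplacian of F(1 - |z|^2/r^2) is (4
  |z|^2/r^4) F'' - (2 N/r^2) F'. The derivative in r of r^-N F'(1 - |z|^2/r^2) is r^-N ((2
  |z|^2/r^3) F'' - (N/r) F'). They differ only by the factor r^(1-N)/2, and one integration by parts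
  moves a derivative onto \<open>u\<close>.\<close>

lemma laplace_bump:
  fixes x :: "'a::euclidean_space"
  assumes w: "wgr u g" and r: "0 < r"
  shows "(\<integral>y. u y * kd r (x - y) \<partial>lborel)
    = - (1 / (2 * kc TYPE('a) * r ^ (DIM('a) - 1))) * (\<integral>y. g y \<bullet> grad (bump 0 x r) y \<partial>lborel)"
proof -
  let ?c = "kc TYPE('a)" and ?N = "DIM('a)"
  let ?\<eta> = "bump 0 x r"
  have t: "?\<eta> \<in> test_functions UNIV" using r by (intro test_bump) auto
  have c: "?c > 0" by (rule kc_pos)
  have rN: "r ^ ?N = r ^ (?N - 1) * r" by (metis DIM_positive power_minus_mult)
  have kd: "kd r (x - y) = 1 / (2 * ?c * r ^ (?N - 1)) * (\<Sum>i\<in>Basis. frechet_derivative (\<lambda>y. frechet_derivative ?\<eta> (at y) i) (at y) i)" for y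
  proof -
    have "(\<Sum>i\<in>Basis. ((y - x) \<bullet> i)\<^sup>2) = (norm (x - y))\<^sup>2"
      unfolding norm_minus_commute[of x] power2_norm_eq_inner by (subst euclidean_inner) (simp add: power2_eq_square)
    then have sq: "(\<Sum>i\<in>Basis. 4 / r ^ 4 * (((y - x) \<bullet> i)\<^sup>2 * bump (Suc (Suc 0)) x r y))
        = 4 / r ^ 4 * ((norm (x - y))\<^sup>2 * bump (Suc (Suc 0)) x r y)"
      by (simp only: sum_distrib_left[symmetric] sum_distrib_right[symmetric])
    have "(\<Sum>i\<in>Basis. frechet_derivative (\<lambda>y. frechet_derivative ?\<eta> (at y) i) (at y) i)
       = (\<Sum>i\<in>Basis. 4 / r ^ 4 * (((y - x) \<bullet> i)\<^sup>2 * bump (Suc (Suc 0)) x r y) - 2 / r\<^sup>2 * bump (Suc 0) x r y)"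
      by (intro sum.cong refl frechet_bump2)
    also have "\<dots> = 4 / r ^ 4 * ((norm (x - y))\<^sup>2 * bump (Suc (Suc 0)) x r y) - 2 / r\<^sup>2 * bump (Suc 0) x r y * ?N"
      unfolding sum_subtractf sq by simp
    finally have eqS: "(\<Sum>i\<in>Basis. frechet_derivative (\<lambda>y. frechet_derivative ?\<eta> (at y) i) (at y) i)
       = 4 / r ^ 4 * ((norm (x - y))\<^sup>2 * bump (Suc (Suc 0)) x r y) - 2 / r\<^sup>2 * bump (Suc 0) x r y * ?N" .
    have alg: "(2 * s * B2 / r ^ 3 - ?N * B1 / r) / (?c * (p * r)) = 1 / (2 * ?c * p) * (4 / r ^ 4 * (s * B2) - 2 / r\<^sup>2 * B1 * ?N)"
      if "p > 0" for s B1 B2 p :: real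
      using r c that by (simp add: divide_simps) (simp add: algebra_simps eval_nat_numeral)
    show ?thesis unfolding eqS kd_def bump_def norm_minus_commute[of y x] rN
      by (rule alg) (use r in simp)
  qed
  have L: "L2 (\<lambda>y. frechet_derivative (\<lambda>y. frechet_derivative ?\<eta> (at y) i) (at y) i)" if "i \<in> Basis" for i
    by (rule test_L2[OF test_partial[OF test_partial[OF t that] that]])
  have L1: "L2 (\<lambda>y. frechet_derivative ?\<eta> (at y) i)" if "i \<in> Basis" for i
    by (rule test_L2[OF test_partial[OF t that]])
  have "(\<integral>y. u y * kd r (x - y) \<partial>lborel)
     = (\<integral>y. 1 / (2 * ?c * r ^ (?N - 1)) * (\<Sum>i\<in>Basis. u y * frechet_derivative (\<lambda>y. frechet_derivative ?\<eta> (at y) i) (at y) i) \<partial>lborel)"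
    unfolding kd by (simp add: sum_distrib_left mult_ac)
  also have "\<dots> = 1 / (2 * ?c * r ^ (?N - 1)) * (\<Sum>i\<in>Basis. \<integral>y. u y * frechet_derivative (\<lambda>y. frechet_derivative ?\<eta> (at y) i) (at y) i \<partial>lborel)"
    by (subst integral_mult_right_zero, subst Bochner_Integration.integral_sum)
      (auto intro!: L2_mult_integrable wgr_L2[OF w] L)
  also have "(\<Sum>i\<in>Basis. \<integral>y. u y * frechet_derivative (\<lambda>y. frechet_derivative ?\<eta> (at y) i) (at y) i \<partial>lborel)
     = (\<Sum>i\<in>Basis. - (\<integral>y. (g y \<bullet> i) * frechet_derivative ?\<eta> (at y) i \<partial>lborel))"
    using w test_partial[OF t] by (intro sum.cong) (auto simp: wgr_def)
  also have "\<dots> = - (\<integral>y. (\<Sum>i\<in>Basis. (g y \<bullet> i) * frechet_derivative ?\<eta> (at y) i) \<partial>lborel)"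
    by (subst Bochner_Integration.integral_sum)
      (auto intro!: L2_mult_integrable L2_inner wgr_L2[OF w] L1 simp: sum_negf)
  also have "(\<lambda>y. \<Sum>i\<in>Basis. (g y \<bullet> i) * frechet_derivative ?\<eta> (at y) i) = (\<lambda>y. g y \<bullet> grad ?\<eta> y)"
    by (rule ext) (subst (2) euclidean_inner, simp add: grad_inner_Basis)
  finally show ?thesis by simp
qed

lemma kd_bound:
  "\<exists>M\<ge>0. \<forall>r z. 0 < r \<longrightarrow> \<bar>kd r (z::'a::euclidean_space)\<bar> \<le> M / r ^ (DIM('a) + 1) * indicator (cball 0 r) z"
proof -
  let ?c = "kc TYPE('a)" and ?N = "DIM('a)"
  have c: "?c > 0" by (rule kc_pos)
  obtain C1 where C1: "C1 \<ge> 0" "\<And>t. t \<le> 1 \<Longrightarrow> \<bar>flatd (Suc 0) t\<bar> \<le> C1" using flatd_bounded[of "Suc 0"] by auto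
  obtain C2 where C2: "C2 \<ge> 0" "\<And>t. t \<le> 1 \<Longrightarrow> \<bar>flatd (Suc (Suc 0)) t\<bar> \<le> C2" using flatd_bounded[of "Suc (Suc 0)"] by auto
  have "\<bar>kd r z\<bar> \<le> ((2 * C2 + ?N * C1) / ?c) / r ^ (?N + 1) * indicator (cball 0 r) z" if r: "0 < r" for r and z :: 'a
  proof (cases "norm z \<le> r")
    case False
    then have "r\<^sup>2 \<le> (norm z)\<^sup>2" using r by (intro power_mono) auto
    then have "1 - (norm z)\<^sup>2 / r\<^sup>2 \<le> 0" using r by (simp add: divide_simps)
    then show ?thesis using False by (simp add: kd_def)
  next
    case True
    let ?q = "1 - (norm z)\<^sup>2 / r\<^sup>2"
    have q: "?q \<le> 1" by simp
    have 0: "(norm z)\<^sup>2 * \<bar>flatd (Suc (Suc 0)) ?q\<bar> \<le> r\<^sup>2 * C2"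
      using True by (intro mult_mono power_mono C2 q) auto
    have 1: "\<bar>2 * (norm z)\<^sup>2 * flatd (Suc (Suc 0)) ?q / r ^ 3\<bar> \<le> 2 * C2 / r"
    proof -
      have "\<bar>2 * (norm z)\<^sup>2 * flatd (Suc (Suc 0)) ?q / r ^ 3\<bar> = 2 * ((norm z)\<^sup>2 * \<bar>flatd (Suc (Suc 0)) ?q\<bar>) / r ^ 3"
        using r by (simp add: abs_mult)
      also have "\<dots> \<le> 2 * (r\<^sup>2 * C2) / r ^ 3" using 0 r by (intro divide_right_mono) auto
      also have "\<dots> = 2 * C2 / r" using r by (simp add: power2_eq_square power3_eq_cube)
      finally show ?thesis .
    qed
    have 2: "\<bar>real ?N * flatd (Suc 0) ?q / r\<bar> \<le> ?N * C1 / r"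
      using r C1(2)[OF q] by (simp add: abs_mult divide_simps mult_left_mono)
    have "\<bar>kd r z\<bar> = \<bar>2 * (norm z)\<^sup>2 * flatd (Suc (Suc 0)) ?q / r ^ 3 - real ?N * flatd (Suc 0) ?q / r\<bar> / (?c * r ^ ?N)"
      unfolding kd_def using r c by (simp add: abs_divide abs_mult)
    also have "\<dots> \<le> (2 * C2 / r + ?N * C1 / r) / (?c * r ^ ?N)"
      using 1 2 r c by (intro divide_right_mono order_trans[OF abs_triangle_ineq4] add_mono) auto
    also have "\<dots> = ((2 * C2 + ?N * C1) / ?c) / r ^ (?N + 1)" by (simp add: add_divide_distrib mult_ac)
    finally show ?thesis using True by simp
  qed
  moreover have "0 \<le> (2 * C2 + ?N * C1) / ?c" using C1 C2 c by simp
  ultimately show ?thesis by blast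
qed

text \<open>The derivative in \<open>r\<close> of a mean of \<open>u\<close> over a ball is a radial multiple of the distributional
  Laplacian of \<open>u\<close> tested against \<open>bump 0 x r\<close>: this is the mean value formula, and it drives both the
  Sobolev inequality and the positivity of the ground state.\<close>

lemma cv_kern_deriv:
  fixes x :: "'a::euclidean_space"
  assumes w: "wgr u g" and r0: "0 < r0"
  shows "((\<lambda>r. cv (kern r) u x) has_real_derivative
     - (1 / (2 * kc TYPE('a) * r0 ^ (DIM('a) - 1))) * (\<integral>y. g y \<bullet> grad (bump 0 x r0) y \<partial>lborel)) (at r0)"
proof -
  let ?N = "DIM('a)"
  obtain M where M: "M \<ge> 0" "\<And>r z. 0 < r \<Longrightarrow> \<bar>kd r (z::'a)\<bar> \<le> M / r ^ (?N + 1) * indicator (cball 0 r) z"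
    using kd_bound by blast
  define B where "B = M / (r0/2) ^ (?N + 1)"
  have B0: "0 \<le> B" unfolding B_def using M(1) r0 by simp
  have u: "L2 u" by (rule wgr_L2[OF w])
  note [measurable] = L2_measurable[OF u]
  have "((\<lambda>r. \<integral>y. kern r (x - y) *\<^sub>R u y \<partial>lborel) has_real_derivative (\<integral>y. u y * kd r0 (x - y) \<partial>lborel)) (at r0)"
  \<comment> \<open>For radii between \<open>r0/2\<close> and \<open>2*r0\<close> the bound
    \<open>B\<close> is taken at the smallest and the support at the largest radius, so one function
    dominates them all.\<close>
  proof (rule deriv_under_integral[where a="r0/2" and b="2*r0" and G="\<lambda>y. norm (u y) * norm (B * indicator (cball x (2*r0)) y)"])
    show "((\<lambda>r. kern r (x - y) *\<^sub>R u y) has_real_derivative u y * kd r (x - y)) (at r)" if "r0/2 < r" for r y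
      using kern_deriv[of r "x - y"] that r0 by (auto intro!: derivative_eq_intros)
    show "\<bar>u y * kd r (x - y)\<bar> \<le> norm (u y) * norm (B * indicator (cball x (2*r0)) y)" if r: "r0/2 < r" "r < 2 * r0" for r y
    proof -
      have rp: "r > 0" using r r0 by linarith
      have "\<bar>kd r (x - y)\<bar> \<le> M / r ^ (?N + 1) * indicator (cball 0 r) (x - y)" by (rule M(2)[OF rp])
      also have "\<dots> \<le> B * indicator (cball x (2*r0)) y"
      proof (rule mult_mono)
        show "M / r ^ (?N + 1) \<le> B" unfolding B_def using M(1) r r0 rp
          by (intro divide_left_mono power_mono mult_pos_pos zero_less_power) auto
        show "indicator (cball 0 r) (x - y) \<le> (indicator (cball x (2*r0)) y :: real)"
          using r by (auto simp: indicator_def dist_norm norm_minus_commute[of x y])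
      qed (use B0 in auto)
      finally show ?thesis using B0 by (simp add: abs_mult mult_left_mono)
    qed
    show "integrable lborel (\<lambda>y. norm (u y) * norm (B * indicator (cball x (2*r0)) y))"
      by (intro L2_norm_mult_integrable u L2_cmult L2_indicator) auto
    show "integrable lborel (\<lambda>y. kern r (x - y) *\<^sub>R u y)" if "r0/2 < r" for r
      using that r0 by (intro cv_integrable test_L2[OF test_kern] u) linarith
    show "(\<lambda>y. u y * kd r0 (x - y)) \<in> borel_measurable borel"
      unfolding kd_def
      by (intro borel_measurable_times borel_measurable_divide borel_measurable_diff L2_measurable[OF u]
        borel_measurable_const measurable_compose[OF _ borel_measurable_continuous_onI[OF flatd_continuous]]) measurable
  qed (use r0 in auto)
  then show ?thesis unfolding laplace_bump[OF w r0] cv_def[symmetric] by simp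
qed

text \<open>The gradient has size at most a constant over \<open>r\<close> and lives on a ball whose
  volume is a multiple of \<open>r ^ DIM('a)\<close>. This power determines the exponent in the
  supremum bound below.\<close>

lemma n2_grad_bump:
  "\<exists>C\<ge>0. \<forall>(x::'a::euclidean_space) r. 0 < r \<longrightarrow> n2 (grad (bump 0 x r)) \<le> C * r ^ DIM('a) / r\<^sup>2"
proof -
  obtain C1 where C1: "C1 \<ge> 0" "\<And>t. t \<le> 1 \<Longrightarrow> \<bar>flatd (Suc 0) t\<bar> \<le> C1" using flatd_bounded[of "Suc 0"] by auto
  let ?V = "unit_ball_vol (DIM('a))"
  have "n2 (grad (bump 0 x r)) \<le> (4 * C1\<^sup>2 * ?V) * r ^ DIM('a) / r\<^sup>2" if r: "0 < r" for x :: 'a and r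
  proof -
    have B: "L2 (\<lambda>y. (2 * C1 / r) * indicator (cball x r) y :: real)" by (intro L2_cmult L2_indicator) auto
    have "norm (grad (bump 0 x r) y) \<le> norm ((2 * C1 / r) * indicator (cball x r) y :: real)" for y
    proof (cases "y \<in> cball x r")
      case True
      have "norm (grad (bump 0 x r) y) = \<bar>flatd (Suc 0) (1 - (norm (y - x))\<^sup>2 / r\<^sup>2)\<bar> * (2 / r\<^sup>2) * norm (y - x)"
        by (simp add: grad_bump abs_mult)
      also have "\<dots> \<le> C1 * (2 / r\<^sup>2) * r"
        using True C1 r by (intro mult_mono) (auto simp: dist_norm norm_minus_commute)
      also have "\<dots> = 2 * C1 / r" using r by (simp add: power2_eq_square)
      finally show ?thesis using True C1 r by simp
    next
      case False
      then have "r\<^sup>2 \<le> (norm (y - x))\<^sup>2" using r by (intro power_mono) (auto simp: dist_norm norm_minus_commute)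
      then have "1 - (norm (y - x))\<^sup>2 / r\<^sup>2 \<le> 0" using r by (simp add: divide_simps)
      then show ?thesis by (simp add: grad_bump)
    qed
    then have "n2 (grad (bump 0 x r)) \<le> n2 (\<lambda>y. (2 * C1 / r) * indicator (cball x r) y :: real)"
      by (intro n2_mono B AE_I2)
    also have "\<dots> = (2 * C1 / r)\<^sup>2 * measure lborel (cball x r)"
    proof -
      have "(\<lambda>y. (indicator (cball x r) y :: real)\<^sup>2) = indicator (cball x r)" by (auto simp: indicator_def)
      then show ?thesis unfolding n2_cmult by (simp add: n2_real)
    qed
    also have "measure lborel (cball x r) = ?V * r ^ DIM('a)" using content_cball[of r x] r by simp
    finally show ?thesis by (simp add: power_divide power_mult_distrib)
  qed
  moreover have "0 \<le> 4 * C1\<^sup>2 * ?V" by simp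
  ultimately show ?thesis by blast
qed

text \<open>The squared norm is at most the supremum times the mass, which is 1. The resulting decay
  forces the means to vanish as the radius grows.\<close>

lemma n2_kern:
  "\<exists>C\<ge>0. \<forall>r>0. n2 (kern r :: 'a::euclidean_space \<Rightarrow> real) \<le> C / r ^ DIM('a)"
proof -
  obtain C1 where C1: "C1 \<ge> 0" "\<And>t. t \<le> 1 \<Longrightarrow> \<bar>flatd (Suc 0) t\<bar> \<le> C1" using flatd_bounded[of "Suc 0"] by auto
  let ?c = "kc TYPE('a)"
  have c: "?c > 0" by (rule kc_pos)
  have "n2 (kern r :: 'a \<Rightarrow> real) \<le> (C1 / ?c) / r ^ DIM('a)" if r: "0 < r" for r
  proof -
    let ?k = "kern r :: 'a \<Rightarrow> real"
    let ?B = "(C1 / ?c) / r ^ DIM('a)"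
    have b: "?k z \<le> ?B" for z
      using C1(2)[of "1 - (norm z)\<^sup>2 / r\<^sup>2"] r c by (simp add: kern_def bump_def divide_simps)
    have ik: "integrable lborel ?k" using test_integrable[OF test_kern[OF r] continuous_on_const[of UNIV 1]] by simp
    have "ennreal (\<integral>z. ?k z \<partial>lborel) = 1"
      using nn_integral_eq_integral[OF ik AE_I2[OF kern_nonneg[OF r]]] kern_nn_integral[OF r, where 'a='a] by simp
    then have "(\<integral>z. ?k z \<partial>lborel) = 1" by simp
    moreover have "(?k z)\<^sup>2 \<le> ?B * ?k z" for z
      using mult_right_mono[OF b kern_nonneg[OF r]] by (simp add: power2_eq_square)
    then have "n2 ?k \<le> (\<integral>z. ?B * ?k z \<partial>lborel)"
      unfolding n2_real using ik L2_integrable[OF test_L2[OF test_kern[OF r]]]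
      by (intro integral_mono) auto
    ultimately show ?thesis by simp
  qed
  moreover have "0 \<le> C1 / ?c" using C1 c by simp
  ultimately show ?thesis by blast
qed

lemma wgr_cmult: assumes "wgr u g" shows "wgr (\<lambda>x. c * u x) (\<lambda>x. c *\<^sub>R g x)"
  using assms unfolding wgr_def by (auto simp: L2_cmult L2_scale mult.assoc)

text \<open>Cauchy-Schwarz in the mean value formula gives \<open>\<bar>A' r\<bar> \<le> C * sqrt (n2 g) * r powr (- DIM('a) / 2)\<close> for
  \<open>A r = cv (kern r) u x\<close>; integrate from \<open>r\<close> to infinity, where \<open>A\<close> vanishes.\<close>

lemma kern_sup_bound:
  assumes N: "DIM('a::euclidean_space) \<ge> 3"
  shows "\<exists>C>0. \<forall>(u::'a \<Rightarrow> real) g r x. wgr u g \<longrightarrow> 0 < r \<longrightarrow>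
    \<bar>cv (kern r) u x\<bar> \<le> C * sqrt (n2 g) * r powr (1 - real DIM('a) / 2)"
proof -
  let ?N = "DIM('a)" and ?c = "kc TYPE('a)"
  \<comment> \<open>Positive because the dimension is at least 3: the derivative of the mean, of
    order \<open>s powr (- e - 1)\<close>, is then integrable at infinity.\<close>
  define e where "e = real ?N / 2 - 1"
  have e: "e > 0" using N by (simp add: e_def)
  have c: "?c > 0" by (rule kc_pos)
  obtain G where G: "G \<ge> 0" "\<And>(x::'a) r. 0 < r \<Longrightarrow> n2 (grad (bump 0 x r)) \<le> G * r ^ ?N / r\<^sup>2"
    using n2_grad_bump[where 'a='a] by blast
  obtain K where K: "K \<ge> 0" "\<And>r. 0 < r \<Longrightarrow> n2 (kern r :: 'a \<Rightarrow> real) \<le> K / r ^ ?N"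
    using n2_kern[where 'a='a] by blast
  define C where "C = (sqrt G + 1) / (2 * ?c * e)"
  have C: "C > 0" unfolding C_def using G c e by (intro divide_pos_pos add_nonneg_pos) auto
  have main: "cv (kern r) u x \<le> C * sqrt (n2 g) * r powr (- e)"
    if w: "wgr u g" and r: "0 < r" for u :: "'a \<Rightarrow> real" and g r x
  proof -
    define D where "D = sqrt (n2 g)"
    have D: "D \<ge> 0" by (simp add: D_def)
    let ?A = "\<lambda>r. cv (kern r) u x"
    define A' where "A' s = - (1 / (2 * ?c * s ^ (?N - 1))) * (\<integral>y. g y \<bullet> grad (bump 0 x s) y \<partial>lborel)" for s
    have A': "(?A has_real_derivative A' s) (at s)" if "s > 0" for s
      unfolding A'_def by (rule cv_kern_deriv[OF w that])
    have A'b: "\<bar>A' s\<bar> \<le> C * D * e * s powr (- e - 1)" if s: "s > 0" for s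
    proof -
      have t: "bump 0 x s \<in> test_functions UNIV" using s by (intro test_bump) auto
      have "\<bar>\<integral>y. g y \<bullet> grad (bump 0 x s) y \<partial>lborel\<bar> \<le> D * sqrt (n2 (grad (bump 0 x s)))"
        unfolding D_def by (rule L2_CS[OF wgr_L2(2)[OF w] test_grad_L2[OF t]])
      also have "\<dots> \<le> D * sqrt (G * s ^ ?N / s\<^sup>2)"
        using D G(2)[OF s] by (intro mult_left_mono) auto
      also have "sqrt (G * s ^ ?N / s\<^sup>2) = sqrt G * s powr e"
      proof -
        have "s ^ ?N / s\<^sup>2 = s powr (2 * e)"
          using s by (simp add: e_def powr_diff powr_realpow)
        also have "\<dots> = (s powr e)\<^sup>2" using s by (simp add: powr_powr mult.commute flip: powr_realpow)
        finally have "G * s ^ ?N / s\<^sup>2 = G * (s powr e)\<^sup>2" by (simp flip: times_divide_eq_right)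
        then show ?thesis by (simp add: real_sqrt_mult)
      qed
      finally have i: "\<bar>\<integral>y. g y \<bullet> grad (bump 0 x s) y \<partial>lborel\<bar> \<le> D * (sqrt G * s powr e)" .
      have pw: "s ^ (?N - 1) = s powr (2 * e + 1)"
        using s N by (simp add: e_def of_nat_diff flip: powr_realpow)
      have "\<bar>A' s\<bar> = 1 / (2 * ?c * s ^ (?N - 1)) * \<bar>\<integral>y. g y \<bullet> grad (bump 0 x s) y \<partial>lborel\<bar>"
        unfolding A'_def using s c by (simp add: abs_mult abs_divide)
      also have "\<dots> \<le> 1 / (2 * ?c * s ^ (?N - 1)) * (D * ((sqrt G + 1) * s powr e))"
        using s c D i by (intro mult_left_mono order_trans[OF i] mult_right_mono) auto
      also have "\<dots> = C * D * e * (s powr e / s powr (2 * e + 1))"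
        unfolding pw C_def using e c by (simp add: divide_simps)
      also have "s powr e / s powr (2 * e + 1) = s powr (- e - 1)" by (simp flip: powr_diff)
      finally show ?thesis .
    qed
    \<comment> \<open>An antiderivative, up to sign, of the bound on the derivative; hence
      \<open>?A - h\<close> is nondecreasing.\<close>
    define h where "h s = C * D * s powr (- e)" for s
    have h: "(h has_real_derivative - (C * D * e * s powr (- e - 1))) (at s)" if "s > 0" for s
      unfolding h_def using that by (auto intro!: derivative_eq_intros simp: has_real_derivative_powr)
    have mono: "?A r - h r \<le> ?A R - h R" if R: "r \<le> R" for R
    proof (rule DERIV_nonneg_imp_nondecreasing[OF R])
      fix s assume "r \<le> s" "s \<le> R"
      then have s: "s > 0" using r by simp
      show "\<exists>y. ((\<lambda>s. ?A s - h s) has_real_derivative y) (at s) \<and> 0 \<le> y"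
        using A'b[OF s] by (intro exI[of _ "A' s - (- (C * D * e * s powr (- e - 1)))"] conjI DERIV_diff A' h s) auto
    qed
    \<comment> \<open>\<open>h R\<close> is nonnegative and drops out, and \<open>?A R\<close> is
      bounded through the decaying norm of the kernel; only the term with \<open>R\<close> is left
      to vanish.\<close>
    have "?A r \<le> h r + sqrt (K / R ^ ?N) * sqrt (n2 u)" if R: "r \<le> R" for R
    proof -
      have R0: "R > 0" using r R by simp
      have "\<bar>?A R\<bar> \<le> sqrt (n2 (kern R :: 'a \<Rightarrow> real)) * sqrt (n2 u)"
        using cv_bound[OF test_L2[OF test_kern[OF R0]] wgr_L2(1)[OF w], of x] by simp
      also have "\<dots> \<le> sqrt (K / R ^ ?N) * sqrt (n2 u)" using K(2)[OF R0] by (intro mult_right_mono) auto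
      moreover have "0 \<le> h R" unfolding h_def using C D by simp
      ultimately show ?thesis using mono[OF R] by linarith
    qed
    then have "\<forall>\<^sub>F R in at_top. ?A r \<le> h r + sqrt (K / R ^ ?N) * sqrt (n2 u)"
      unfolding eventually_at_top_linorder by blast
    moreover have "((\<lambda>R::real. h r + sqrt (K / R ^ ?N) * sqrt (n2 u)) \<longlongrightarrow> h r + sqrt 0 * sqrt (n2 u)) at_top"
    proof (intro tendsto_intros)
      have "filterlim (\<lambda>R::real. R ^ ?N) at_top at_top" using N by (intro filterlim_pow_at_top filterlim_ident) simp
      then show "((\<lambda>R::real. K / R ^ ?N) \<longlongrightarrow> 0) at_top"
        by (intro tendsto_divide_0[OF tendsto_const] filterlim_at_top_imp_at_infinity)
    qed
    ultimately have "?A r \<le> h r + sqrt 0 * sqrt (n2 u)"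
      by (intro tendsto_lowerbound[where F=at_top]) auto
    then show ?thesis by (simp add: h_def D_def)
  qed
  have "\<bar>cv (kern r) u x\<bar> \<le> C * sqrt (n2 g) * r powr (1 - real ?N / 2)"
    if w: "wgr u g" and r: "0 < r" for u :: "'a \<Rightarrow> real" and g r x
  proof -
    have w': "wgr (\<lambda>x. - u x) (\<lambda>x. - g x)" using wgr_cmult[OF w, of "-1"] by simp
    have "cv (kern r) (\<lambda>x. - u x) x = - cv (kern r) u x" by (simp add: cv_def)
    moreover have "n2 (\<lambda>x. - g x) = n2 g" by (simp add: n2_def)
    ultimately show ?thesis using main[OF w r, of x] main[OF w' r, of x] by (simp add: e_def)
  qed
  then show ?thesis using C by blast
qed

text \<open>Choose \<open>r\<close> such that the mean of \<open>u\<close> at scale \<open>r\<close> is at most \<open>t / 2\<close> everywhere. Then \<open>\<bar>u\<bar> > t\<close> forces the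
  mean to differ from \<open>u\<close> by \<open>t / 2\<close>, and the square of that difference has integral at most \<open>r\<^sup>2\<close>.\<close>

lemma weak_sobolev:
  assumes N: "DIM('a::euclidean_space) \<ge> 3"
  defines "P \<equiv> 2 * real DIM('a) / (real DIM('a) - 2)"
  shows "\<exists>C\<ge>0. \<forall>(u::'a \<Rightarrow> real) g t. wgr u g \<longrightarrow> n2 g \<le> 1 \<longrightarrow> 0 < t \<longrightarrow>
    emeasure lborel {x. t < \<bar>u x\<bar>} \<le> ennreal (C * t powr (- P))"
proof -
  let ?N = "real DIM('a)"
  obtain C0 where C0: "C0 > 0" "\<And>(u::'a \<Rightarrow> real) g r x. wgr u g \<Longrightarrow> 0 < r \<Longrightarrow>
    \<bar>cv (kern r) u x\<bar> \<le> C0 * sqrt (n2 g) * r powr (1 - ?N / 2)"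
    using kern_sup_bound[OF N] by blast
  define e where "e = ?N / 2 - 1"
  have e: "e > 0" using N by (simp add: e_def)
  \<comment> \<open>The critical exponent in terms of \<open>e\<close>: Chebyshev's inequality
    supplies the power 2 of \<open>t\<close> and the choice of the radius supplies the power
    \<open>2 / e\<close>.\<close>
  have P: "P = 2 + 2 / e" using N unfolding P_def e_def by (simp add: field_simps)
  define C where "C = 4 * (2 * C0) powr (2 / e)"
  have "emeasure lborel {x. t < \<bar>u x\<bar>} \<le> ennreal (C * t powr (- P))"
    if w: "wgr u g" and g: "n2 g \<le> 1" and t: "0 < t" for u :: "'a \<Rightarrow> real" and g t
  proof -
    \<comment> \<open>Solves \<open>C0 * r powr (- e) = t / 2\<close>, so that all means at this
      radius are at most \<open>t / 2\<close>.\<close>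
    define r where "r = (2 * C0 / t) powr (1 / e)"
    have r: "r > 0" using C0 t by (simp add: r_def)
    have re: "r powr (- e) = t / (2 * C0)"
      using C0 t e by (simp add: r_def powr_powr powr_minus_divide)
    note [measurable] = L2_measurable[OF wgr_L2(1)[OF w]] L2_measurable[OF test_L2[OF test_kern[OF r]]]
    let ?v = "\<lambda>x. cv (kern r) u x - u x"
    have L: "L2 ?v" by (intro L2_diff kern_cv_L2 r wgr_L2[OF w])
    have b: "\<bar>cv (kern r) u x\<bar> \<le> t / 2" for x
    proof -
      have "\<bar>cv (kern r) u x\<bar> \<le> C0 * sqrt (n2 g) * r powr (- e)" using C0(2)[OF w r, of x] by (simp add: e_def)
      also have "\<dots> \<le> C0 * 1 * r powr (- e)" using C0 g by (intro mult_right_mono mult_left_mono) auto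
      also have "\<dots> = t / 2" using C0 by (simp add: re)
      finally show ?thesis .
    qed
    have sub: "t\<^sup>2 / 4 \<le> (norm (?v x))\<^sup>2" if "t < \<bar>u x\<bar>" for x
    proof -
      have "t / 2 \<le> norm (?v x)" using b[of x] that by (simp add: abs_if split: if_splits)
      then have "(t / 2)\<^sup>2 \<le> (norm (?v x))\<^sup>2" using t by (intro power_mono) auto
      then show ?thesis by (simp add: power_divide)
    qed
    have "ennreal (t\<^sup>2 / 4) * emeasure lborel {x. t < \<bar>u x\<bar>} = (\<integral>\<^sup>+x. ennreal (t\<^sup>2 / 4) * indicator {x. t < \<bar>u x\<bar>} x \<partial>lborel)"
      by (subst nn_integral_cmult_indicator) auto
    also have "\<dots> \<le> (\<integral>\<^sup>+x. ennreal ((norm (?v x))\<^sup>2) \<partial>lborel)"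
      using sub by (intro nn_integral_mono) (auto simp: indicator_def intro!: ennreal_leI)
    also have "\<dots> = ennreal (n2 ?v)" by (rule n2_nn[OF L])
    also have "\<dots> \<le> ennreal (r\<^sup>2)"
    proof (rule ennreal_leI)
      have "n2 ?v \<le> r\<^sup>2 * n2 g" by (rule kern_approx[OF w r])
      also have "\<dots> \<le> r\<^sup>2 * 1" using g by (intro mult_left_mono) auto
      finally show "n2 ?v \<le> r\<^sup>2" by simp
    qed
    finally have *: "ennreal (t\<^sup>2 / 4) * emeasure lborel {x. t < \<bar>u x\<bar>} \<le> ennreal (r\<^sup>2)" .
    have "emeasure lborel {x. t < \<bar>u x\<bar>} = ennreal (4 / t\<^sup>2) * (ennreal (t\<^sup>2 / 4) * emeasure lborel {x. t < \<bar>u x\<bar>})"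
      using t by (simp add: mult.assoc[symmetric] ennreal_mult[symmetric])
    also have "\<dots> \<le> ennreal (4 / t\<^sup>2) * ennreal (r\<^sup>2)" by (intro mult_left_mono *) auto
    also have "\<dots> = ennreal (C * t powr (- P))"
    proof -
      have "r\<^sup>2 = (2 * C0 / t) powr (2 / e)"
      proof -
        have "r\<^sup>2 = r powr 2" using r by simp
        also have "\<dots> = (2 * C0 / t) powr (2 / e)" unfolding r_def by (simp only: powr_powr) simp
        finally show ?thesis .
      qed
      also have "\<dots> = (2 * C0) powr (2 / e) * t powr (- (2 / e))"
        using C0 t by (simp add: powr_divide powr_minus_divide)
      finally have "4 / t\<^sup>2 * r\<^sup>2 = C * (t powr (- (2 / e)) / t powr 2)"
        using t by (simp add: C_def)
      also have "t powr (- (2 / e)) / t powr 2 = t powr (- P)" unfolding powr_diff[symmetric] P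
        by (rule arg_cong[where f="\<lambda>z. t powr z"]) simp
      finally show ?thesis by (simp add: ennreal_mult[symmetric])
    qed
    finally show ?thesis .
  qed
  moreover have "C \<ge> 0" by (simp add: C_def)
  ultimately show ?thesis by blast
qed

text \<open>Values up to 1 are controlled by the square; a larger value lies in one shell between
  2^j and 2^(j+1) and is counted by the corresponding term. This is a discrete layer-cake formula,
  ready for bounds on superlevel sets.\<close>

lemma dyadic_bound:
  assumes q: "2 \<le> q" shows "ennreal (\<bar>s\<bar> powr q) \<le> ennreal (s\<^sup>2) + (\<Sum>j. ennreal ((2 ^ Suc j) powr q) * indicator {x. 2 ^ j < \<bar>x\<bar>} (s::real))"
proof (cases "\<bar>s\<bar> \<le> 1")
  case True
  have "\<bar>s\<bar> powr q \<le> s\<^sup>2"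
  proof (cases "s = 0")
    case False
    then have "\<bar>s\<bar> powr q \<le> \<bar>s\<bar> powr 2" using True q by (intro powr_mono') auto
    then show ?thesis using False by simp
  qed simp
  then have "ennreal (\<bar>s\<bar> powr q) \<le> ennreal (s\<^sup>2)" by (rule ennreal_leI)
  then show ?thesis by (rule order_trans) simp
next
  case False
  define n where "n = (LEAST n. \<bar>s\<bar> \<le> 2 ^ n)"
  have ex: "\<exists>n. \<bar>s\<bar> \<le> 2 ^ n" using real_arch_pow[of 2 "\<bar>s\<bar>"] by (auto intro: less_imp_le)
  have n: "\<bar>s\<bar> \<le> 2 ^ n" unfolding n_def by (rule LeastI_ex[OF ex])
  have "n \<noteq> 0" using n False by (cases n) auto
  then obtain j where j: "n = Suc j" by (cases n) auto
  have "\<not> \<bar>s\<bar> \<le> 2 ^ j" using not_less_Least[of j "\<lambda>n. \<bar>s\<bar> \<le> 2 ^ n"] j by (simp add: n_def)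
  then have js: "2 ^ j < \<bar>s\<bar>" by simp
  have "ennreal (\<bar>s\<bar> powr q) \<le> ennreal ((2 ^ Suc j) powr q)"
    using n j q by (intro ennreal_leI powr_mono2) auto
  also have "\<dots> = ennreal ((2 ^ Suc j) powr q) * indicator {x. 2 ^ j < \<bar>x\<bar>} s" using js by simp
  also have "\<dots> \<le> (\<Sum>j. ennreal ((2 ^ Suc j) powr q) * indicator {x. 2 ^ j < \<bar>x\<bar>} s)"
  proof -
    have "f j \<le> suminf f" for f :: "nat \<Rightarrow> ennreal" using sum_le_suminf[of f "{j}"] by simp
    then show ?thesis .
  qed
  finally show ?thesis by (rule order_trans) simp
qed

text \<open>The weak estimate at the critical exponent makes the dyadic sum geometric as soon as
  \<open>q\<close> is strictly smaller, while the square integral handles small values.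
  Subcriticality thus suffices without the sharp endpoint inequality.\<close>

theorem sobolev:
  assumes N: "DIM('a::euclidean_space) \<ge> 3"
    and q: "2 \<le> q" "q < 2 * real DIM('a) / (real DIM('a) - 2)"
  shows "\<exists>C>0. \<forall>(u::'a \<Rightarrow> real) g D. wgr u g \<longrightarrow> 0 < D \<longrightarrow> n2 u \<le> D \<longrightarrow> n2 g \<le> D \<longrightarrow>
    integrable lborel (\<lambda>x. \<bar>u x\<bar> powr q) \<and> (\<integral>x. \<bar>u x\<bar> powr q \<partial>lborel) \<le> C * D powr (q / 2)"
proof -
  define P where "P = 2 * real DIM('a) / (real DIM('a) - 2)"
  obtain C0 where C0: "C0 \<ge> 0" "\<And>(u::'a \<Rightarrow> real) g t. wgr u g \<Longrightarrow> n2 g \<le> 1 \<Longrightarrow> 0 < t \<Longrightarrow>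
    emeasure lborel {x. t < \<bar>u x\<bar>} \<le> ennreal (C0 * t powr (- P))"
    using weak_sobolev[OF N] unfolding P_def by blast
  \<comment> \<open>The ratio of the geometric series: 2^q from the height of a dyadic level and
    2^-P from the measure of its superlevel set.\<close>
  define \<theta> where "\<theta> = 2 powr (q - P)"
  have th: "0 < \<theta>" "\<theta> < 1" using q(2) by (auto simp: \<theta>_def P_def powr_less_one)
  define C where "C = 1 + 2 powr q * C0 / (1 - \<theta>)"
  have C: "C > 0" unfolding C_def using C0 th by (intro add_pos_nonneg) auto
  have unit: "(\<integral>\<^sup>+x. ennreal (\<bar>u x\<bar> powr q) \<partial>lborel) \<le> ennreal C"
    if w: "wgr u g" and u: "n2 u \<le> 1" and g: "n2 g \<le> 1" for u :: "'a \<Rightarrow> real" and g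
  proof -
    note [measurable] = L2_measurable[OF wgr_L2(1)[OF w]]
    have "(\<integral>\<^sup>+x. ennreal (\<bar>u x\<bar> powr q) \<partial>lborel)
      \<le> (\<integral>\<^sup>+x. ennreal ((u x)\<^sup>2) + (\<Sum>j. ennreal ((2 ^ Suc j) powr q) * indicator {x. 2 ^ j < \<bar>u x\<bar>} x) \<partial>lborel)"
      using dyadic_bound[OF q(1)] by (intro nn_integral_mono) (auto simp: indicator_def)
    also have "\<dots> = (\<integral>\<^sup>+x. ennreal ((u x)\<^sup>2) \<partial>lborel)
       + (\<integral>\<^sup>+x. (\<Sum>j. ennreal ((2 ^ Suc j) powr q) * indicator {x. 2 ^ j < \<bar>u x\<bar>} x) \<partial>lborel)"
      by (rule nn_integral_add) measurable
    also have "(\<integral>\<^sup>+x. (\<Sum>j. ennreal ((2 ^ Suc j) powr q) * indicator {x. 2 ^ j < \<bar>u x\<bar>} x) \<partial>lborel)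
       = (\<Sum>j. ennreal ((2 ^ Suc j) powr q) * emeasure lborel {x. 2 ^ j < \<bar>u x\<bar>})"
      by (subst nn_integral_suminf) (auto simp: nn_integral_cmult_indicator)
    also have "\<dots> \<le> (\<Sum>j. ennreal (2 powr q * C0 * \<theta> ^ j))"
    proof (intro suminf_le summableI)
      fix j
      have "ennreal ((2 ^ Suc j) powr q) * emeasure lborel {x. 2 ^ j < \<bar>u x\<bar>}
        \<le> ennreal ((2 ^ Suc j) powr q) * ennreal (C0 * (2 ^ j) powr (- P))"
        by (intro mult_left_mono C0(2)[OF w g]) auto
      also have "\<dots> = ennreal ((2 ^ Suc j) powr q * (C0 * (2 ^ j) powr (- P)))" by (simp add: ennreal_mult'[symmetric] C0)
      also have "(2 ^ Suc j) powr q * (C0 * (2 ^ j) powr (- P)) = 2 powr q * C0 * \<theta> ^ j"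
      proof -
        have "((2::real) ^ Suc j) powr q = 2 powr q * 2 powr (j * q)"
          by (simp add: powr_mult powr_powr flip: powr_realpow)
        moreover have "((2::real) ^ j) powr (- P) = 2 powr (j * (- P))" by (simp add: powr_powr flip: powr_realpow)
        moreover have "\<theta> ^ j = 2 powr (j * q) * 2 powr (j * (- P))"
          by (simp add: \<theta>_def powr_powr algebra_simps flip: powr_realpow powr_add)
        ultimately show ?thesis by simp
      qed
      finally show "ennreal ((2 ^ Suc j) powr q) * emeasure lborel {x. 2 ^ j < \<bar>u x\<bar>} \<le> ennreal (2 powr q * C0 * \<theta> ^ j)" .
    qed
    also have "\<dots> = ennreal (\<Sum>j. 2 powr q * C0 * \<theta> ^ j)"
      using th C0 by (intro suminf_ennreal2 summable_mult summable_geometric) auto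
    also have "(\<Sum>j. 2 powr q * C0 * \<theta> ^ j) = 2 powr q * C0 / (1 - \<theta>)"
      using th by (subst suminf_mult) (auto simp: suminf_geometric)
    also have "(\<integral>\<^sup>+x. ennreal ((u x)\<^sup>2) \<partial>lborel) = ennreal (n2 u)" using n2_nn[OF wgr_L2(1)[OF w]] by simp
    also have "ennreal (n2 u) + ennreal (2 powr q * C0 / (1 - \<theta>)) \<le> ennreal 1 + ennreal (2 powr q * C0 / (1 - \<theta>))"
      using u by (intro add_mono ennreal_leI) auto
    also have "\<dots> = ennreal C" unfolding C_def using C0 th by (subst ennreal_plus) auto
    finally show ?thesis by (simp add: add_left_mono)
  qed
  have "integrable lborel (\<lambda>x. \<bar>u x\<bar> powr q) \<and> (\<integral>x. \<bar>u x\<bar> powr q \<partial>lborel) \<le> C * D powr (q / 2)"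
    if w: "wgr u g" and D: "0 < D" and u: "n2 u \<le> D" and g: "n2 g \<le> D" for u :: "'a \<Rightarrow> real" and g D
  proof -
    note [measurable] = L2_measurable[OF wgr_L2(1)[OF w]]
    \<comment> \<open>Normalises function and gradient at once, because \<open>D\<close> bounds both
      squared norms; homogeneity restores the power \<open>q / 2\<close>.\<close>
    let ?s = "1 / sqrt D"
    have w': "wgr (\<lambda>x. ?s * u x) (\<lambda>x. ?s *\<^sub>R g x)" by (rule wgr_cmult[OF w])
    have "n2 (\<lambda>x. ?s * u x) \<le> 1" "n2 (\<lambda>x. ?s *\<^sub>R g x) \<le> 1"
      unfolding n2_cmult n2_scale using D u g by (simp_all add: power_divide)
    from unit[OF w' this] have "(\<integral>\<^sup>+x. ennreal (\<bar>?s * u x\<bar> powr q) \<partial>lborel) \<le> ennreal C" .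
    moreover have "ennreal (\<bar>?s * u x\<bar> powr q) = ennreal (D powr (- q / 2)) * ennreal (\<bar>u x\<bar> powr q)" for x
    proof -
      have "\<bar>?s * u x\<bar> powr q = ?s powr q * \<bar>u x\<bar> powr q" using D by (simp add: abs_mult powr_mult powr_divide)
      also have "?s powr q = D powr (- q / 2)" using D by (simp add: powr_half_sqrt[symmetric] powr_divide powr_powr powr_minus_divide)
      finally show ?thesis by (simp add: ennreal_mult)
    qed
    ultimately have b: "ennreal (D powr (- q / 2)) * (\<integral>\<^sup>+x. ennreal (\<bar>u x\<bar> powr q) \<partial>lborel) \<le> ennreal C"
      by (simp add: nn_integral_cmult)
    have "(\<integral>\<^sup>+x. ennreal (\<bar>u x\<bar> powr q) \<partial>lborel) = ennreal (D powr (q / 2)) * (ennreal (D powr (- q / 2)) * (\<integral>\<^sup>+x. ennreal (\<bar>u x\<bar> powr q) \<partial>lborel))"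
      using D by (simp add: mult.assoc[symmetric] ennreal_mult[symmetric] flip: powr_add)
    also have "\<dots> \<le> ennreal (D powr (q / 2)) * ennreal C" by (intro mult_left_mono b) auto
    also have "\<dots> = ennreal (C * D powr (q / 2))" using C by (simp add: ennreal_mult[symmetric] mult.commute)
    finally have f: "(\<integral>\<^sup>+x. ennreal (\<bar>u x\<bar> powr q) \<partial>lborel) \<le> ennreal (C * D powr (q / 2))" .
    then have "(\<integral>\<^sup>+x. ennreal (\<bar>u x\<bar> powr q) \<partial>lborel) < \<infinity>" by (simp add: order_le_less_trans)
    then have i: "integrable lborel (\<lambda>x. \<bar>u x\<bar> powr q)" by (intro integrableI_nonneg) auto
    have "ennreal (\<integral>x. \<bar>u x\<bar> powr q \<partial>lborel) \<le> ennreal (C * D powr (q / 2))"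
      using f nn_integral_eq_integral[OF i] by simp
    then show ?thesis using i C by (simp add: ennreal_le_iff)
  qed
  then show ?thesis using C by blast
qed

section \<open>Compactness\<close>

text \<open>At each scale the mollified sequence is bounded and equicontinuous, so Arzela-Ascoli applies to it;
  the mollification error is uniformly small.\<close>

lemma rellich:
  fixes w :: "nat \<Rightarrow> 'a::euclidean_space \<Rightarrow> real"
  assumes w: "\<And>n. wgr (w n) (g n)" and C: "\<And>n. n2 (w n) \<le> C" "\<And>n. n2 (g n) \<le> C"
    and R: "\<And>n x. x \<notin> cball 0 R \<Longrightarrow> w n x = 0"
  shows "\<exists>s::nat \<Rightarrow> nat. strict_mono s \<and> (\<forall>e>0. \<exists>N. \<forall>m\<ge>N. \<forall>n\<ge>N. n2 (\<lambda>x. w (s m) x - w (s n) x) < e)"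
proof -
  define P where "P j s \<longleftrightarrow> (\<exists>N. \<forall>m\<ge>N. \<forall>n\<ge>N. n2 (\<lambda>x. w (s m) x - w (s n) x) < 1 / real (Suc j))" for j and s :: "nat \<Rightarrow> nat"
  have C0: "0 \<le> C" using C(1)[of 0] n2_nonneg order_trans by blast
  let ?S = "cball (0::'a) R"
  have step: "\<exists>r'. strict_mono r' \<and> P j (s \<circ> r')" for j and s :: "nat \<Rightarrow> nat"
  proof -
    define d where "d = 1 / real (Suc j)"
    have d: "d > 0" by (simp add: d_def)
    \<comment> \<open>Differences of two members have gradient norm squared at most
      \<open>4 * C\<close>; with the factor 2 of the splitting below, the mollification error costs
      at most \<open>d / 4\<close>.\<close>
    define r where "r = sqrt (d / (32 * (C + 1)))"
    have r: "r > 0" "r\<^sup>2 * (8 * C) \<le> d / 4"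
    proof -
      show "r > 0" using d C0 by (simp add: r_def)
      have r2: "r\<^sup>2 = d / (32 * (C + 1))" using d C0 by (simp add: r_def)
      have "r\<^sup>2 * (8 * C) \<le> r\<^sup>2 * (8 * (C + 1))" using C0 by (intro mult_left_mono) auto
      also have "\<dots> = d / 4" unfolding r2 using C0 by (simp add: divide_simps)
      finally show "r\<^sup>2 * (8 * C) \<le> d / 4" .
    qed
    define V where "V = measure lborel ?S + 1"
    have V: "V > 0" by (simp add: V_def add_nonneg_pos)
    \<comment> \<open>The uniform error of two mollified members is at most \<open>2 * e\<close> on
      a ball of measure below \<open>V\<close>; after splitting it costs
      \<open>8 * e^2 * V = d / 4\<close>.\<close>
    define e where "e = sqrt (d / (32 * V))"
    have e: "e > 0" "8 * e\<^sup>2 * V = d / 4" using d V by (auto simp: e_def)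
    let ?k = "kern r :: 'a \<Rightarrow> real"
    have k: "?k \<in> test_functions UNIV" by (rule test_kern[OF r(1)])
    define L where "L = sqrt (n2 ?k) * sqrt C + 1"
    have L: "L > 0" using C0 by (simp add: L_def add_nonneg_pos)
    define F where "F n = cv ?k (w (s n))" for n
    have b1: "norm (F n x) \<le> L" for n x
    proof -
      have "norm (F n x) \<le> sqrt (n2 ?k) * sqrt (n2 (w (s n)))" unfolding F_def by (rule cv_bound[OF test_L2[OF k] wgr_L2(1)[OF w]])
      also have "\<dots> \<le> sqrt (n2 ?k) * sqrt C" by (intro mult_left_mono real_sqrt_le_mono C) auto
      finally show ?thesis by (simp add: L_def)
    qed
    have b2: "norm (F n x - F n y) \<le> L * norm (x - y)" for n x y
    proof (rule differentiable_bound[of UNIV "F n" "\<lambda>x h. cv ?k (g (s n)) x \<bullet> h"])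
      show "(F n has_derivative (\<lambda>h. cv ?k (g (s n)) x \<bullet> h)) (at x)" for x
        unfolding F_def using smooth_has_grad[OF cv_smooth[OF k wgr_L2(1)[OF w]], of "s n" x] cv_grad_wgr[OF k w, of "s n" x] by simp
      show "onorm (\<lambda>h. cv ?k (g (s n)) x \<bullet> h) \<le> L" for x
      proof (rule onorm_bound)
        show "norm (cv ?k (g (s n)) x \<bullet> h) \<le> L * norm h" for h
        proof -
          have "norm (cv ?k (g (s n)) x) \<le> sqrt (n2 ?k) * sqrt (n2 (g (s n)))" by (rule cv_bound[OF test_L2[OF k] wgr_L2(2)[OF w]])
          also have "\<dots> \<le> sqrt (n2 ?k) * sqrt C" by (intro mult_left_mono real_sqrt_le_mono C) auto
          finally have "norm (cv ?k (g (s n)) x) \<le> L" by (simp add: L_def)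
          then have "norm (cv ?k (g (s n)) x) * norm h \<le> L * norm h" by (rule mult_right_mono) simp
          then show ?thesis using Cauchy_Schwarz_ineq2[of "cv ?k (g (s n)) x" h] by simp
        qed
      qed (use L in simp)
    qed auto
    obtain G k' where k': "strict_mono (k' :: nat \<Rightarrow> nat)"
      and unif: "\<And>e. 0 < e \<Longrightarrow> \<exists>N. \<forall>n x. n \<ge> N \<and> x \<in> ?S \<longrightarrow> norm (F (k' n) x - G x) < e"
    proof (rule Arzela_Ascoli[of ?S F L])
      show "norm (F n x) \<le> L" for n x by (rule b1)
      fix x e assume "x \<in> ?S" "0 < (e::real)"
      show "\<exists>d>0. \<forall>n y. y \<in> ?S \<and> norm (x - y) < d \<longrightarrow> norm (F n x - F n y) < e"
      proof (intro exI[of _ "e / L"] conjI allI impI)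
        fix n y assume "y \<in> ?S \<and> norm (x - y) < e / L"
        then have "L * norm (x - y) < e" using L by (simp add: pos_less_divide_eq mult.commute)
        then show "norm (F n x - F n y) < e" using b2[of n x y] by linarith
      qed (use L \<open>0 < e\<close> in simp)
    qed auto
    obtain N where N: "\<And>n x. n \<ge> N \<Longrightarrow> x \<in> ?S \<Longrightarrow> norm (F (k' n) x - G x) < e" using unif[OF e(1)] by blast
    have "n2 (\<lambda>x. w (s (k' m)) x - w (s (k' n)) x) < d" if mn: "m \<ge> N" "n \<ge> N" for m n
    proof -
      let ?v = "\<lambda>x. w (s (k' m)) x - w (s (k' n)) x" and ?h = "\<lambda>x. g (s (k' m)) x - g (s (k' n)) x"
      have wv: "wgr ?v ?h" by (rule wgr_diff[OF w w])
      have h: "n2 ?h \<le> 4 * C"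
        using n2_diff_le[OF wgr_L2(2)[OF w] wgr_L2(2)[OF w], of "s (k' m)" "s (k' n)"] C(2)[of "s (k' m)"] C(2)[of "s (k' n)"] by linarith
      have cvv: "cv ?k ?v x = F (k' m) x - F (k' n) x" for x
        unfolding F_def by (rule cv_diff[OF test_L2[OF k] wgr_L2(1)[OF w] wgr_L2(1)[OF w]])
      let ?a = "\<lambda>x. cv ?k ?v x - ?v x"
      have La: "L2 ?a" by (intro L2_diff kern_cv_L2 r wgr_L2[OF w])
      have na: "n2 ?a \<le> r\<^sup>2 * (4 * C)"
        using kern_approx[OF wv r(1)] mult_left_mono[OF h, of "r\<^sup>2"] by simp
      have Lb: "L2 (\<lambda>x. (2 * e) * indicator ?S x :: real)" by (intro L2_cmult L2_indicator) auto
      \<comment> \<open>Uniform convergence is only known on the ball, but outside it the members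
        themselves vanish.\<close>
      have pw: "norm (?v x) \<le> norm (norm (?a x) + (2 * e) * indicator ?S x)" for x
      proof (cases "x \<in> ?S")
        case True
        have "norm (cv ?k ?v x) \<le> 2 * e"
          unfolding cvv using N[OF mn(1) True] N[OF mn(2) True] norm_triangle_ineq4[of "F (k' m) x - G x" "F (k' n) x - G x"] by simp
        moreover have "norm (?v x) \<le> norm (cv ?k ?v x) + norm (?a x)" using norm_triangle_ineq4[of "cv ?k ?v x" "?a x"] by simp
        ultimately show ?thesis using True e by simp
      qed (use R in simp)
      have "n2 ?v \<le> n2 (\<lambda>x. norm (?a x) + (2 * e) * indicator ?S x)"
        using pw by (intro n2_mono L2_add L2_norm La Lb AE_I2)
      also have "\<dots> \<le> 2 * n2 (\<lambda>x. norm (?a x)) + 2 * n2 (\<lambda>x. (2 * e) * indicator ?S x :: real)"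
        by (intro n2_add_le L2_norm La Lb)
      also have "n2 (\<lambda>x. norm (?a x)) = n2 ?a" by (simp add: n2_def)
      also have "n2 (\<lambda>x. (2 * e) * indicator ?S x :: real) = (2 * e)\<^sup>2 * measure lborel ?S"
      proof -
        have "(\<lambda>y. (indicator ?S y :: real)\<^sup>2) = indicator ?S" by (auto simp: indicator_def)
        then show ?thesis unfolding n2_cmult by (simp add: n2_real)
      qed
      also have "\<dots> \<le> (2 * e)\<^sup>2 * V" by (intro mult_left_mono) (auto simp: V_def)
      finally have "n2 ?v \<le> 2 * n2 ?a + 2 * ((2 * e)\<^sup>2 * V)" by simp
      also have "\<dots> \<le> r\<^sup>2 * (8 * C) + 8 * e\<^sup>2 * V" using na by (simp add: power_mult_distrib mult_ac)
      also have "\<dots> < d" using r(2) e(2) d by linarith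
      finally show ?thesis .
    qed
    then have "P j (s \<circ> k')" unfolding P_def d_def o_def by blast
    with k' show ?thesis by blast
  qed
  interpret subseqs P by unfold_locales (rule step)
  \<comment> \<open>A subsequence index is at least the index itself, so the threshold
    \<open>N\<close> remains valid.\<close>
  have closed: "P j (s \<circ> r)" if sr: "strict_mono r" and Ps: "P j s" for j and s r :: "nat \<Rightarrow> nat"
  proof -
    obtain N where N: "\<And>m n. m \<ge> N \<Longrightarrow> n \<ge> N \<Longrightarrow> n2 (\<lambda>x. w (s m) x - w (s n) x) < 1 / real (Suc j)"
      using Ps unfolding P_def by blast
    have "N \<le> r n" if "N \<le> n" for n using seq_suble[OF sr, of n] that by simp
    then show ?thesis unfolding P_def o_def by (intro exI[of _ N] allI impI N)
  qed
  have "\<exists>N. \<forall>m\<ge>N. \<forall>n\<ge>N. n2 (\<lambda>x. w (diagseq m) x - w (diagseq n) x) < e" if e: "e > 0" for e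
  proof -
    obtain j where j: "1 / real (Suc j) < e" using e nat_approx_posE by blast
    \<comment> \<open>The property for \<open>j\<close> is only guaranteed for the tail of the
      diagonal sequence that starts at \<open>Suc j\<close>; the shift is undone below.\<close>
    have "P j (diagseq \<circ> ((+) (Suc j)))" by (rule diagseq_holds) (rule closed)
    then obtain N where N: "\<And>m n. m \<ge> N \<Longrightarrow> n \<ge> N \<Longrightarrow> n2 (\<lambda>x. w (diagseq (Suc j + m)) x - w (diagseq (Suc j + n)) x) < 1 / real (Suc j)"
      unfolding P_def o_def by blast
    have "n2 (\<lambda>x. w (diagseq m) x - w (diagseq n) x) < e" if "m \<ge> N + Suc j" "n \<ge> N + Suc j" for m n
      using N[of "m - Suc j" "n - Suc j"] that j by force
    then show ?thesis by blast
  qed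
  then show ?thesis using subseq_diagseq by blast
qed

section \<open>The first eigenvalue\<close>

definition wint :: "('a::euclidean_space \<Rightarrow> real) \<Rightarrow> ('a \<Rightarrow> real) \<Rightarrow> ('a \<Rightarrow> real) \<Rightarrow> real" where
  "wint w u v = (\<integral>x. w x * u x * v x \<partial>lborel)"

definition bdd_weight :: "('a::euclidean_space \<Rightarrow> real) \<Rightarrow> bool" where
  "bdd_weight w \<longleftrightarrow> w \<in> borel_measurable borel \<and> (\<exists>C. \<forall>x. \<bar>w x\<bar> \<le> C)"

lemma bdd_weight_L2: assumes "bdd_weight w" "L2 u" shows "L2 (\<lambda>x. w x * u x)"
  using assms L2_bmult[OF assms(2), of w] by (auto simp: bdd_weight_def)

lemma wint_integrable: "bdd_weight w \<Longrightarrow> L2 u \<Longrightarrow> L2 v \<Longrightarrow> integrable lborel (\<lambda>x. w x * u x * v x)"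
  using L2_mult_integrable[OF bdd_weight_L2] by blast

lemma wint_commute: "wint w u v = wint w v u"
  unfolding wint_def by (simp add: mult_ac)

lemma wint_add:
  assumes "bdd_weight w" "L2 u" "L2 u'" "L2 v"
  shows "wint w (\<lambda>x. u x + u' x) v = wint w u v + wint w u' v"
  using wint_integrable[OF assms(1,2,4)] wint_integrable[OF assms(1,3,4)]
  unfolding wint_def by (simp add: algebra_simps)

lemma wint_cmult: "wint w (\<lambda>x. c * u x) v = c * wint w u v"
  unfolding wint_def by (simp add: mult.assoc mult.left_commute)

lemma wint_tendsto:
  assumes w: "bdd_weight w"
    and F: "\<And>n. L2 (F n)" "L2 f" "(\<lambda>n. n2 (\<lambda>x. F n x - f x)) \<longlonglongrightarrow> 0"
    and G: "\<And>n. L2 (G n)" "L2 g" "(\<lambda>n. n2 (\<lambda>x. G n x - g x)) \<longlonglongrightarrow> 0"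
  shows "(\<lambda>n. wint w (F n) (G n)) \<longlonglongrightarrow> wint w f g"
proof -
  obtain C where C: "\<And>x. \<bar>w x\<bar> \<le> C" and m: "w \<in> borel_measurable borel" using w by (auto simp: bdd_weight_def)
  have "(\<lambda>n. n2 (\<lambda>x. w x * F n x - w x * f x)) \<longlonglongrightarrow> 0"
  proof (rule Lim_null_comparison[OF always_eventually])
    have "n2 (\<lambda>x. w x *\<^sub>R (F n x - f x)) \<le> C\<^sup>2 * n2 (\<lambda>x. F n x - f x)" for n
      by (intro n2_bmult L2_diff F m C)
    then show "\<forall>n. norm (n2 (\<lambda>x. w x * F n x - w x * f x)) \<le> C\<^sup>2 * n2 (\<lambda>x. F n x - f x)"
      by (simp add: right_diff_distrib)
    show "(\<lambda>n. C\<^sup>2 * n2 (\<lambda>x. F n x - f x)) \<longlonglongrightarrow> 0" using tendsto_mult_left[OF F(3), of "C\<^sup>2"] by simp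
  qed
  from L2_tendsto_inner[OF bdd_weight_L2[OF w F(1)] bdd_weight_L2[OF w F(2)] this G]
  show ?thesis by (simp add: wint_def)
qed

definition En :: "('a::euclidean_space \<Rightarrow> real) \<Rightarrow> ('a \<Rightarrow> real) \<Rightarrow> ('a \<Rightarrow> 'a) \<Rightarrow> ('a \<Rightarrow> real) \<Rightarrow> ('a \<Rightarrow> 'a) \<Rightarrow> real" where
  "En w u g v h = (\<integral>x. g x \<bullet> h x \<partial>lborel) + wint w u v"

lemma En_commute: "En w u g v h = En w v h u g"
  unfolding En_def by (simp add: wint_commute[of w u] inner_commute)

lemma En_self: "En w u g u g = n2 g + wint w u u"
  unfolding En_def n2_eq_inner ..

lemma En_add:
  assumes "bdd_weight w" "L2 u" "L2 g" "L2 v" "L2 h" "L2 z" "L2 k"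
  shows "En w (\<lambda>x. u x + c * v x) (\<lambda>x. g x + c *\<^sub>R h x) z k = En w u g z k + c * En w v h z k"
proof -
  have "(\<integral>x. (g x + c *\<^sub>R h x) \<bullet> k x \<partial>lborel) = (\<integral>x. g x \<bullet> k x \<partial>lborel) + c * (\<integral>x. h x \<bullet> k x \<partial>lborel)"
    using L2_inner_integrable[OF assms(3,7)] L2_inner_integrable[OF assms(5,7)] by (simp add: inner_add_left)
  then show ?thesis unfolding En_def
    using wint_add[OF assms(1,2) L2_cmult[OF assms(4), of c] assms(6)] by (simp add: wint_cmult algebra_simps)
qed

lemma En_square:
  assumes "bdd_weight w" "L2 u" "L2 g" "L2 v" "L2 h"
  shows "En w (\<lambda>x. u x + c * v x) (\<lambda>x. g x + c *\<^sub>R h x) (\<lambda>x. u x + c * v x) (\<lambda>x. g x + c *\<^sub>R h x)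
     = En w u g u g + 2 * c * En w u g v h + c\<^sup>2 * En w v h v h"
proof -
  have L: "L2 (\<lambda>x. u x + c * v x)" "L2 (\<lambda>x. g x + c *\<^sub>R h x)" by (intro L2_add L2_cmult L2_scale assms)+
  show ?thesis
    unfolding En_add[OF assms L] En_commute[of w u g "\<lambda>x. u x + c * v x"] En_commute[of w v h "\<lambda>x. u x + c * v x"]
      En_add[OF assms assms(2,3)] En_add[OF assms assms(4,5)]
    by (simp add: En_commute[of w v h u g] algebra_simps power2_eq_square)
qed

lemma En_tendsto:
  assumes w: "bdd_weight w"
    and F: "\<And>n. L2 (F n)" "L2 f" "(\<lambda>n. n2 (\<lambda>x. F n x - f x)) \<longlonglongrightarrow> 0"
    and F': "\<And>n. L2 (F' n)" "L2 f'" "(\<lambda>n. n2 (\<lambda>x. F' n x - f' x)) \<longlonglongrightarrow> 0"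
    and G: "\<And>n. L2 (G n)" "L2 g" "(\<lambda>n. n2 (\<lambda>x. G n x - g x)) \<longlonglongrightarrow> 0"
    and G': "\<And>n. L2 (G' n)" "L2 g'" "(\<lambda>n. n2 (\<lambda>x. G' n x - g' x)) \<longlonglongrightarrow> 0"
  shows "(\<lambda>n. En w (F n) (F' n) (G n) (G' n)) \<longlonglongrightarrow> En w f f' g g'"
  unfolding En_def by (intro tendsto_add L2_tendsto_inner wint_tendsto assms)

text \<open>The closure of the test functions of \<Omega> for pairs of function and gradient. The
  members are functions on the whole space, so extension by zero is built in up to null
  sets.\<close>

definition H0 :: "'a::euclidean_space set \<Rightarrow> ('a \<Rightarrow> real) \<Rightarrow> ('a \<Rightarrow> 'a) \<Rightarrow> bool" where
  "H0 \<Omega> u g \<longleftrightarrow> L2 u \<and> L2 g \<and> (\<exists>\<Phi>. (\<forall>n::nat. \<Phi> n \<in> test_functions \<Omega>) \<and>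
      (\<lambda>n. n2 (\<lambda>x. \<Phi> n x - u x)) \<longlonglongrightarrow> 0 \<and> (\<lambda>n. n2 (\<lambda>x. grad (\<Phi> n) x - g x)) \<longlonglongrightarrow> 0)"

lemma H0_L2: "H0 \<Omega> u g \<Longrightarrow> L2 u" "H0 \<Omega> u g \<Longrightarrow> L2 g" by (auto simp: H0_def)

lemma H0_test: "\<phi> \<in> test_functions \<Omega> \<Longrightarrow> H0 \<Omega> \<phi> (grad \<phi>)"
  unfolding H0_def using test_L2 test_grad_L2 by (auto simp: n2_def intro!: exI[of _ "\<lambda>_. \<phi>"])

lemma H0_wgr: assumes "H0 \<Omega> u g" shows "wgr u g"
proof -
  obtain \<Phi> where P: "\<And>n::nat. \<Phi> n \<in> test_functions \<Omega>" "(\<lambda>n. n2 (\<lambda>x. \<Phi> n x - u x)) \<longlonglongrightarrow> 0" "(\<lambda>n. n2 (\<lambda>x. grad (\<Phi> n) x - g x)) \<longlonglongrightarrow> 0"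
    using assms unfolding H0_def by blast
  show ?thesis by (rule wgr_limit[OF wgr_test[OF test_UNIV[OF P(1)]] H0_L2(1)[OF assms] P(2) H0_L2(2)[OF assms] P(3)])
qed

lemma L2_limit_outside:
  assumes "L2 u" "\<And>n::nat. L2 (F n)" "(\<lambda>n. n2 (\<lambda>x. F n x - u x)) \<longlonglongrightarrow> 0" "\<And>n x. x \<notin> S \<Longrightarrow> F n x = 0" "S \<in> sets borel"
  shows "AE x in lborel. x \<notin> S \<longrightarrow> u x = 0"
proof -
  let ?v = "\<lambda>x. indicator (- S) x *\<^sub>R u x"
  have Lv: "L2 ?v" by (rule L2_bmult[where c=1]) (use assms in \<open>auto simp: indicator_def\<close>)
  have "n2 ?v \<le> n2 (\<lambda>x. F n x - u x)" for n
    using assms(4)[of _ n] by (intro n2_mono L2_diff assms AE_I2) (auto simp: indicator_def)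
  then have "n2 ?v \<le> 0" using assms(3) by (intro LIMSEQ_le_const) auto
  from n2_zero_AE[OF Lv this] show ?thesis by eventually_elim (auto simp: indicator_def)
qed

lemma H0_outside: assumes "H0 \<Omega> u g" "open \<Omega>"
  shows "AE x in lborel. x \<notin> \<Omega> \<longrightarrow> u x = 0" "AE x in lborel. x \<notin> \<Omega> \<longrightarrow> g x = 0"
proof -
  obtain \<Phi> where P: "\<And>n::nat. \<Phi> n \<in> test_functions \<Omega>" "(\<lambda>n. n2 (\<lambda>x. \<Phi> n x - u x)) \<longlonglongrightarrow> 0" "(\<lambda>n. n2 (\<lambda>x. grad (\<Phi> n) x - g x)) \<longlonglongrightarrow> 0"
    using assms unfolding H0_def by blast
  show "AE x in lborel. x \<notin> \<Omega> \<longrightarrow> u x = 0"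
    by (rule L2_limit_outside[OF H0_L2(1)[OF assms(1)] test_L2[OF P(1)] P(2) test_outside[OF P(1)] borel_open[OF assms(2)]])
  show "AE x in lborel. x \<notin> \<Omega> \<longrightarrow> g x = 0"
    by (rule L2_limit_outside[OF H0_L2(2)[OF assms(1)] test_grad_L2[OF P(1)] P(3) test_grad_outside[OF P(1)] borel_open[OF assms(2)]])
qed

text \<open>In the application \<open>W\<close> is the potential cut off to \<Omega>. The bound
  \<open>K\<close> on it makes the weighted forms continuous in \<open>L2\<close>, although the
  potential may be unbounded on the whole space.\<close>

locale dirichlet =
  fixes \<Omega> :: "'a::euclidean_space set" and W m :: "'a \<Rightarrow> real" and K c R :: real
  assumes open_dom: "open \<Omega>" and nonempty: "\<Omega> \<noteq> {}" and sub: "\<Omega> \<subseteq> cball 0 R"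
    and Wm: "W \<in> borel_measurable borel" and W0: "\<And>x. 0 \<le> W x" and WK: "\<And>x. W x \<le> K"
    and Wc: "\<And>x. x \<in> \<Omega> \<Longrightarrow> c \<le> W x" and c: "0 < c"
    and mm: "m \<in> borel_measurable borel" and m0: "\<And>x. 0 \<le> m x" and mK: "\<And>x. m x \<le> K"
    and mpos: "\<And>x. x \<in> \<Omega> \<Longrightarrow> 0 < m x" and mout: "\<And>x. x \<notin> \<Omega> \<Longrightarrow> m x = 0"
begin

lemma K0: "0 < K" using nonempty Wc WK c by (metis all_not_in_conv order_less_le_trans)

lemma bwW: "bdd_weight W" unfolding bdd_weight_def using Wm W0 WK by (intro conjI exI[of _ K]) auto
lemma bwm: "bdd_weight m" unfolding bdd_weight_def using mm m0 mK by (intro conjI exI[of _ K]) auto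

lemma wint_m_nonneg: "0 \<le> wint m u u"
  unfolding wint_def by (intro Bochner_Integration.integral_nonneg) (simp add: m0 mult.assoc)

lemma wint_W_nonneg: "0 \<le> wint W u u"
  unfolding wint_def by (intro Bochner_Integration.integral_nonneg) (simp add: W0 mult.assoc)

lemma wint_m_le: assumes "L2 u" shows "wint m u u \<le> K * n2 u"
proof -
  have "wint m u u \<le> (\<integral>x. K * (norm (u x))\<^sup>2 \<partial>lborel)"
    unfolding wint_def using mK K0 L2_integrable[OF assms] wint_integrable[OF bwm assms assms]
    by (intro integral_mono) (auto simp: power2_eq_square mult.assoc intro!: mult_right_mono)
  then show ?thesis by (simp add: n2_def)
qed

lemma wint_W_ge:
  assumes "L2 u" "AE x in lborel. x \<notin> \<Omega> \<longrightarrow> u x = 0" shows "c * n2 u \<le> wint W u u"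
proof -
  have "(\<integral>x. c * (norm (u x))\<^sup>2 \<partial>lborel) \<le> wint W u u"
    unfolding wint_def
  proof (rule integral_mono_AE)
    show "integrable lborel (\<lambda>x. c * (norm (u x))\<^sup>2)" using L2_integrable[OF assms(1)] by simp
    show "integrable lborel (\<lambda>x. W x * u x * u x)" by (rule wint_integrable[OF bwW assms(1,1)])
    show "AE x in lborel. c * (norm (u x))\<^sup>2 \<le> W x * u x * u x"
      using assms(2)
    proof eventually_elim
      fix x assume "x \<notin> \<Omega> \<longrightarrow> u x = 0"
      then show "c * (norm (u x))\<^sup>2 \<le> W x * u x * u x"
        using Wc[of x] by (cases "x \<in> \<Omega>") (auto simp: power2_eq_square mult.assoc intro!: mult_right_mono)
    qed
  qed
  then show ?thesis by (simp add: n2_def)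
qed

lemma wint_m_pos:
  assumes u: "L2 u" "AE x in lborel. x \<notin> \<Omega> \<longrightarrow> u x = 0" "\<not> (AE x in lborel. u x = 0)"
  shows "0 < wint m u u"
proof (rule ccontr)
  assume "\<not> 0 < wint m u u"
  then have "wint m u u = 0" using wint_m_nonneg[of u] by simp
  then have "AE x in lborel. m x * u x * u x = 0"
    unfolding wint_def using wint_integrable[OF bwm u(1,1)]
    by (subst (asm) integral_nonneg_eq_0_iff_AE) (auto simp: m0 mult.assoc)
  with u(2) have "AE x in lborel. u x = 0"
    by eventually_elim (use mpos in fastforce)
  with u(3) show False ..
qed

definition E :: "('a \<Rightarrow> real) \<Rightarrow> ('a \<Rightarrow> 'a) \<Rightarrow> real" where "E u g = En W u g u g"

lemma E_eq: "E u g = n2 g + wint W u u" by (simp add: E_def En_self)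

lemma test_AE_zero: assumes "\<phi> \<in> test_functions \<Omega>" "AE x in lborel. \<phi> x = 0" shows "\<phi> = (\<lambda>x. 0)"
proof (rule ext, rule ccontr)
  fix x assume "\<phi> x \<noteq> 0"
  let ?U = "{x. \<phi> x \<noteq> 0}"
  have U: "open ?U" using open_Collect_neq[OF test_continuous[OF assms(1)] continuous_on_const] by simp
  have "emeasure lborel ?U = 0" using assms(2) U by (subst (asm) AE_iff_measurable[OF _ refl]) auto
  then have "?U \<in> null_sets lborel" using U by (intro null_setsI) auto
  then have "negligible ?U" by (simp add: negligible_iff_null_sets null_sets_completionI)
  then show False using open_not_negligible[OF U] \<open>\<phi> x \<noteq> 0\<close> by blast
qed

text \<open>The infimum ranges over test functions only; density carries the resulting inequality to
  all of \<open>H0\<close> in \<open>Q_nonneg\<close>.\<close>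

definition lam :: real where
  "lam = Inf ((\<lambda>\<phi>. E \<phi> (grad \<phi>) / wint m \<phi> \<phi>) ` {\<phi> \<in> test_functions \<Omega>. \<phi> \<noteq> (\<lambda>x. 0)})"

lemma test_wint_pos: assumes "\<phi> \<in> test_functions \<Omega>" "\<phi> \<noteq> (\<lambda>x. 0)" shows "0 < wint m \<phi> \<phi>"
  using assms test_AE_zero[OF assms(1)] test_outside[OF assms(1)]
  by (intro wint_m_pos test_L2[OF assms(1)]) auto

text \<open>The weighted mass is at most \<open>K\<close> times and the potential energy at least
  \<open>c\<close> times the squared norm. Hence the infimum is positive.\<close>

lemma test_ratio: assumes "\<phi> \<in> test_functions \<Omega>" "\<phi> \<noteq> (\<lambda>x. 0)"
  shows "c / K \<le> E \<phi> (grad \<phi>) / wint m \<phi> \<phi>"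
proof -
  have p: "0 < wint m \<phi> \<phi>" by (rule test_wint_pos[OF assms])
  have "c / K * wint m \<phi> \<phi> \<le> c / K * (K * n2 \<phi>)"
    using wint_m_le[OF test_L2[OF assms(1)]] c K0 by (intro mult_left_mono) auto
  also have "\<dots> = c * n2 \<phi>" using K0 by simp
  also have "\<dots> \<le> wint W \<phi> \<phi>" using test_outside[OF assms(1)] by (intro wint_W_ge test_L2[OF assms(1)]) auto
  also have "\<dots> \<le> E \<phi> (grad \<phi>)" unfolding E_eq by simp
  finally show ?thesis using p by (simp add: pos_le_divide_eq)
qed

lemma ex_test: "\<exists>\<phi>\<in>test_functions \<Omega>. \<phi> \<noteq> (\<lambda>x. 0)"
proof -
  obtain x r where r: "r > 0" "cball x r \<subseteq> \<Omega>" using open_dom nonempty open_contains_cball by blast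
  have "bump 0 x r \<in> test_functions \<Omega>" by (rule test_bump[OF r])
  moreover have "bump 0 x r x \<noteq> 0" using bump_pos(1)[of r x x] r by simp
  ultimately show ?thesis by (intro bexI[of _ "bump 0 x r"]) auto
qed

lemma lam_ge: "c / K \<le> lam" unfolding lam_def
  using ex_test test_ratio by (intro cInf_greatest) auto

lemma lam_pos: "0 < lam" using lam_ge c K0 by (meson divide_pos_pos less_le_trans)

text \<open>Subtracting the weighted mass turns minimality into nonnegativity of the quadratic form
  with potential \<open>q\<close>, and a minimiser into a zero of that form.\<close>

definition q where "q x = W x - lam * m x"

lemma bwq: "bdd_weight q"
proof -
  have "\<bar>q x\<bar> \<le> K + lam * K" for x
  proof -
    have "\<bar>q x\<bar> \<le> \<bar>W x\<bar> + \<bar>lam * m x\<bar>" unfolding q_def by (rule abs_triangle_ineq4)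
    also have "\<dots> \<le> K + lam * K" using W0[of x] WK[of x] m0[of x] mK[of x] lam_pos
      by (intro add_mono) (auto simp: abs_mult intro!: mult_left_mono)
    finally show ?thesis .
  qed
  then show ?thesis unfolding bdd_weight_def q_def[abs_def] using Wm mm by (intro conjI) auto
qed

lemma wint_q: assumes "L2 u" "L2 v" shows "wint q u v = wint W u v - lam * wint m u v"
  unfolding wint_def q_def using wint_integrable[OF bwW assms] wint_integrable[OF bwm assms]
  by (simp add: left_diff_distrib mult.assoc)

lemma En_q: assumes "L2 u" "L2 v" shows "En q u g v h = En W u g v h - lam * wint m u v"
  unfolding En_def by (simp add: wint_q assms)

definition Q :: "('a \<Rightarrow> real) \<Rightarrow> ('a \<Rightarrow> 'a) \<Rightarrow> real" where "Q u g = En q u g u g"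

lemma Q_eq: "L2 u \<Longrightarrow> Q u g = E u g - lam * wint m u u"
  by (simp add: Q_def E_def En_q)

lemma Q_test_nonneg: assumes "\<phi> \<in> test_functions \<Omega>" shows "0 \<le> Q \<phi> (grad \<phi>)"
proof (cases "\<phi> = (\<lambda>x. 0)")
  case True
  have "wint m \<phi> \<phi> = 0" using True by (simp add: wint_def)
  moreover have "0 \<le> E \<phi> (grad \<phi>)" unfolding E_eq using wint_W_nonneg by (simp add: add_nonneg_nonneg)
  ultimately show ?thesis by (simp add: Q_eq test_L2[OF assms])
next
  case False
  have "lam \<le> E \<phi> (grad \<phi>) / wint m \<phi> \<phi>"
    unfolding lam_def using assms False test_ratio by (intro cInf_lower) (auto intro!: bdd_belowI[of _ "c / K"])
  then have "lam * wint m \<phi> \<phi> \<le> E \<phi> (grad \<phi>)" using test_wint_pos[OF assms False] by (simp add: pos_le_divide_eq)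
  then show ?thesis by (simp add: Q_eq test_L2[OF assms])
qed

lemma Q_nonneg: assumes "H0 \<Omega> u g" shows "0 \<le> Q u g"
proof -
  obtain \<Phi> where P: "\<And>n::nat. \<Phi> n \<in> test_functions \<Omega>" "(\<lambda>n. n2 (\<lambda>x. \<Phi> n x - u x)) \<longlonglongrightarrow> 0" "(\<lambda>n. n2 (\<lambda>x. grad (\<Phi> n) x - g x)) \<longlonglongrightarrow> 0"
    using assms unfolding H0_def by blast
  have "(\<lambda>n. Q (\<Phi> n) (grad (\<Phi> n))) \<longlonglongrightarrow> Q u g" unfolding Q_def
    by (intro En_tendsto bwq test_L2[OF P(1)] test_grad_L2[OF P(1)] P(2,3) H0_L2[OF assms])
  then show ?thesis using Q_test_nonneg[OF P(1)] by (intro LIMSEQ_le_const) auto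
qed

text \<open>\<open>sqrt (v\<^sup>2 + d\<^sup>2) - d\<close> is a smooth substitute for \<open>\<bar>v\<bar>\<close> with the same support as \<open>v\<close>.\<close>

lemma abs_approx:
  assumes v: "v \<in> test_functions \<Omega>" and e: "0 < e"
  shows "\<exists>w\<in>test_functions \<Omega>. (\<forall>x. 0 \<le> w x) \<and> wint m w w \<le> wint m v v \<and> wint m v v - e \<le> wint m w w \<and>
     E w (grad w) \<le> E v (grad v)"
proof -
  note Lv = test_L2[OF v]
  have i1: "integrable lborel (\<lambda>x. m x * \<bar>v x\<bar>)"
  proof -
    obtain K' where K': "compact K'" "\<And>x. x \<notin> K' \<Longrightarrow> v x = 0" using v unfolding test_functions_iff by auto
    have "integrable lborel (\<lambda>x. \<bar>v x\<bar>)"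
      using integrable_continuous_compact[OF continuous_on_rabs[OF test_continuous[OF v]] K'(1)] K'(2) by simp
    then have "integrable lborel (\<lambda>x. K * \<bar>v x\<bar>)" by simp
    then show ?thesis
      by (rule Bochner_Integration.integrable_bound)
        (use mm m0 mK K0 L2_measurable[OF Lv] in \<open>auto simp: abs_mult intro!: mult_right_mono\<close>)
  qed
  define I where "I = (\<integral>x. m x * \<bar>v x\<bar> \<partial>lborel)"
  have I: "0 \<le> I" unfolding I_def by (intro Bochner_Integration.integral_nonneg) (simp add: m0)
  \<comment> \<open>Smoothing the absolute value loses at most \<open>2 * d * I\<close> of the
    weighted mass, which this choice keeps below \<open>e\<close>.\<close>
  define d where "d = e / (2 * (I + 1))"
  have d: "0 < d" "2 * d * I \<le> e" using e I by (auto simp: d_def divide_simps)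
  \<comment> \<open>Written as a power for \<open>smooth_powr\<close>; the base is positive since
    \<open>d > 0\<close>, and \<open>G 0 = 0\<close> preserves compact support.\<close>
  define G where "G t = (t\<^sup>2 + d\<^sup>2) powr (1/2) - d" for t :: real
  have p: "0 < t\<^sup>2 + d\<^sup>2" for t using d by (simp add: add_nonneg_pos)
  have Gs: "G t = sqrt (t\<^sup>2 + d\<^sup>2) - d" for t by (simp add: G_def powr_half_sqrt)
  have G0: "0 \<le> G t" for t unfolding Gs using real_sqrt_le_mono[of "d\<^sup>2" "t\<^sup>2 + d\<^sup>2"] d by simp
  have G1: "G t \<le> \<bar>t\<bar>" for t
    unfolding Gs using sqrt_sum_squares_le_sum_abs[of t d] d by simp
  have G2: "\<bar>t\<bar> - d \<le> G t" for t
    unfolding Gs using real_sqrt_le_mono[of "t\<^sup>2" "t\<^sup>2 + d\<^sup>2"] by simp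
  have DG: "(G has_real_derivative t / sqrt (t\<^sup>2 + d\<^sup>2)) (at t)" for t
    unfolding Gs[abs_def] using p[of t] by (auto intro!: derivative_eq_intros simp: divide_simps)
  have DG1: "\<bar>t / sqrt (t\<^sup>2 + d\<^sup>2)\<bar> \<le> 1" for t
  proof -
    have "\<bar>t\<bar> \<le> sqrt (t\<^sup>2 + d\<^sup>2)" by (rule real_le_rsqrt) simp
    then show ?thesis using p[of t] by (simp add: divide_simps)
  qed
  define w where "w x = G (v x)" for x
  have sw: "smooth_on UNIV w" unfolding w_def G_def power2_eq_square
    by (intro smooth_diff smooth_powr smooth_add smooth_mult smooth_const test_smooth[OF v])
      (metis p power2_eq_square)
  have w: "w \<in> test_functions \<Omega>"
    using v sw d unfolding test_functions_iff by (auto simp: w_def Gs)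
  have gw: "grad w x = (v x / sqrt ((v x)\<^sup>2 + d\<^sup>2)) *\<^sub>R grad v x" for x
    unfolding w_def by (rule grad_comp[OF test_smooth[OF v] DG])
  note Lw = test_L2[OF w]
  have sq1: "(w x)\<^sup>2 \<le> (v x)\<^sup>2" for x
    using G0[of "v x"] G1[of "v x"] power_mono[of "w x" "\<bar>v x\<bar>" 2] by (simp add: w_def)
  have sq2: "(v x)\<^sup>2 - 2 * d * \<bar>v x\<bar> \<le> (w x)\<^sup>2" for x
  proof (cases "\<bar>v x\<bar> \<le> d")
    case True
    then have "\<bar>v x\<bar> * \<bar>v x\<bar> \<le> d * \<bar>v x\<bar>" by (intro mult_right_mono) auto
    moreover have "0 \<le> d * \<bar>v x\<bar>" using d by simp
    ultimately have "(v x)\<^sup>2 - 2 * d * \<bar>v x\<bar> \<le> 0" by (simp add: power2_eq_square)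
    then show ?thesis using zero_le_power2[of "w x"] by linarith
  next
    case False
    then have "(\<bar>v x\<bar> - d)\<^sup>2 \<le> (w x)\<^sup>2" using G2[of "v x"] by (intro power_mono) (auto simp: w_def)
    then have "\<bar>v x\<bar>\<^sup>2 + d\<^sup>2 - 2 * \<bar>v x\<bar> * d \<le> (w x)\<^sup>2" by (simp only: power2_diff)
    then have "(v x)\<^sup>2 + d\<^sup>2 - 2 * d * \<bar>v x\<bar> \<le> (w x)\<^sup>2" by (simp add: mult_ac)
    then show ?thesis using zero_le_power2[of d] by linarith
  qed
  have a: "wint m w w \<le> wint m v v"
    unfolding wint_def using wint_integrable[OF bwm Lw Lw] wint_integrable[OF bwm Lv Lv] sq1 m0
    by (intro integral_mono) (auto simp: mult.assoc power2_eq_square intro!: mult_left_mono)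
  have b: "wint W w w \<le> wint W v v"
    unfolding wint_def using wint_integrable[OF bwW Lw Lw] wint_integrable[OF bwW Lv Lv] sq1 W0
    by (intro integral_mono) (auto simp: mult.assoc power2_eq_square intro!: mult_left_mono)
  have cc: "n2 (grad w) \<le> n2 (grad v)"
  proof (rule n2_mono[OF test_grad_L2[OF v]], rule AE_I2)
    fix x
    show "norm (grad w x) \<le> norm (grad v x)"
      unfolding gw using mult_right_mono[OF DG1[of "v x"], of "norm (grad v x)"] by simp
  qed
  have "wint m v v - 2 * d * I = (\<integral>x. m x * v x * v x - 2 * d * (m x * \<bar>v x\<bar>) \<partial>lborel)"
    unfolding wint_def I_def using i1 wint_integrable[OF bwm Lv Lv] by simp
  also have "\<dots> \<le> wint m w w"
    unfolding wint_def
  proof (rule integral_mono)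
    show "integrable lborel (\<lambda>x. m x * v x * v x - 2 * d * (m x * \<bar>v x\<bar>))"
      using i1 wint_integrable[OF bwm Lv Lv] by simp
    show "integrable lborel (\<lambda>x. m x * w x * w x)" by (rule wint_integrable[OF bwm Lw Lw])
    fix x show "m x * v x * v x - 2 * d * (m x * \<bar>v x\<bar>) \<le> m x * w x * w x"
      using mult_left_mono[OF sq2[of x] m0[of x]] by (simp add: power2_eq_square algebra_simps)
  qed
  finally have "wint m v v - e \<le> wint m w w" using d by linarith
  then show ?thesis using w G0 a b cc unfolding E_eq by (intro bexI[of _ w]) (auto simp: w_def)
qed

text \<open>A near-minimiser is normalised and then replaced by its smooth absolute value. The
  energy does not grow, but the mass can drop below 1, so the normalisation is only asymptotic and
  the form \<open>Q\<close> is what tends to zero.\<close>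

lemma minimizing_sequence:
  "\<exists>w. (\<forall>n. w n \<in> test_functions \<Omega>) \<and> (\<forall>n x. 0 \<le> w n x) \<and> (\<forall>n. wint m (w n) (w n) \<le> 1) \<and>
     (\<lambda>n::nat. wint m (w n) (w n)) \<longlonglongrightarrow> 1 \<and> (\<lambda>n. Q (w n) (grad (w n))) \<longlonglongrightarrow> 0"
proof -
  let ?S = "{\<phi> \<in> test_functions \<Omega>. \<phi> \<noteq> (\<lambda>x. 0)}"
  have "\<exists>w\<in>test_functions \<Omega>. (\<forall>x. 0 \<le> w x) \<and> wint m w w \<le> 1 \<and> 1 - e \<le> wint m w w \<and> Q w (grad w) \<le> (1 + lam) * e"
    if e: "0 < e" for e
  proof -
    have "lam < lam + e" using e by simp
    then obtain \<phi> where p: "\<phi> \<in> test_functions \<Omega>" "\<phi> \<noteq> (\<lambda>x. 0)" "E \<phi> (grad \<phi>) / wint m \<phi> \<phi> < lam + e"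
      using cInf_lessD[of "(\<lambda>\<phi>. E \<phi> (grad \<phi>) / wint m \<phi> \<phi>) ` ?S" "lam + e"] ex_test unfolding lam_def[symmetric] by blast
    have pp: "0 < wint m \<phi> \<phi>" by (rule test_wint_pos[OF p(1,2)])
    define t where "t = 1 / sqrt (wint m \<phi> \<phi>)"
    have t2: "t\<^sup>2 = 1 / wint m \<phi> \<phi>" using pp by (simp add: t_def power_divide)
    define v where "v x = t * \<phi> x" for x
    have v: "v \<in> test_functions \<Omega>" unfolding v_def by (rule test_cmult[OF p(1)])
    have gv: "grad v = (\<lambda>x. t *\<^sub>R grad \<phi> x)" unfolding v_def by (rule ext) (rule grad_cmult[OF test_smooth[OF p(1)]])
    have wv: "wint w v v = t\<^sup>2 * wint w \<phi> \<phi>" for w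
      unfolding v_def wint_cmult by (subst wint_commute) (simp add: wint_cmult power2_eq_square)
    have mv: "wint m v v = 1" unfolding wv t2 using pp by simp
    have "E v (grad v) = t\<^sup>2 * E \<phi> (grad \<phi>)" unfolding E_eq gv n2_scale wv by (simp add: distrib_left)
    also have "\<dots> < lam + e" using p(3) by (simp add: t2)
    finally have Ev: "E v (grad v) < lam + e" .
    obtain w where w: "w \<in> test_functions \<Omega>" "\<forall>x. 0 \<le> w x" "wint m w w \<le> wint m v v" "wint m v v - e \<le> wint m w w"
      "E w (grad w) \<le> E v (grad v)" using abs_approx[OF v e] by blast
    have "Q w (grad w) = E w (grad w) - lam * wint m w w" by (rule Q_eq[OF test_L2[OF w(1)]])
    also have "\<dots> \<le> (lam + e) - lam * (1 - e)"
      using w(4,5) Ev lam_pos unfolding mv by (intro diff_mono mult_left_mono) auto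
    also have "\<dots> = (1 + lam) * e" by (simp add: algebra_simps)
    finally have "Q w (grad w) \<le> (1 + lam) * e" .
    then show ?thesis using w unfolding mv by auto
  qed
  then have "\<forall>n. \<exists>w\<in>test_functions \<Omega>. (\<forall>x. 0 \<le> w x) \<and> wint m w w \<le> 1 \<and> 1 - inverse (real (Suc n)) \<le> wint m w w
      \<and> Q w (grad w) \<le> (1 + lam) * inverse (real (Suc n))" by simp
  then obtain w where w: "\<And>n. w n \<in> test_functions \<Omega>" "\<And>n x. 0 \<le> w n x" "\<And>n. wint m (w n) (w n) \<le> 1"
    "\<And>n. 1 - inverse (real (Suc n)) \<le> wint m (w n) (w n)" "\<And>n. Q (w n) (grad (w n)) \<le> (1 + lam) * inverse (real (Suc n))"
    by metis
  have "(\<lambda>n. 1 - inverse (real (Suc n))) \<longlonglongrightarrow> 1 - 0" by (intro tendsto_intros LIMSEQ_inverse_real_of_nat)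
  then have "(\<lambda>n. wint m (w n) (w n)) \<longlonglongrightarrow> 1"
    using w by (intro tendsto_sandwich[of "\<lambda>n. 1 - inverse (real (Suc n))" "\<lambda>n. wint m (w n) (w n)" sequentially "\<lambda>_. 1" 1]) auto
  moreover have "(\<lambda>n. (1 + lam) * inverse (real (Suc n))) \<longlonglongrightarrow> (1 + lam) * 0" by (intro tendsto_intros LIMSEQ_inverse_real_of_nat)
  then have "(\<lambda>n. Q (w n) (grad (w n))) \<longlonglongrightarrow> 0"
    using w Q_test_nonneg by (intro tendsto_sandwich[of "\<lambda>_. 0" "\<lambda>n. Q (w n) (grad (w n))" sequentially "\<lambda>n. (1 + lam) * inverse (real (Suc n))" 0]) auto
  ultimately show ?thesis using w by blast
qed

text \<open>The parallelogram identity for the nonnegative form \<open>Q\<close> gives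
  \<open>Q (a - b) \<le> 2 * Q a + 2 * Q b\<close>. Together with strong convergence of the
  functions it makes the gradients a Cauchy sequence, so the limit is strong in both components and
  no weak compactness enters.\<close>

theorem eigenfunction:
  "\<exists>u g. H0 \<Omega> u g \<and> wint m u u = 1 \<and> (AE x in lborel. 0 \<le> u x) \<and>
     (\<exists>w. (\<forall>n. w n \<in> test_functions \<Omega>) \<and> (\<forall>n x. 0 \<le> w n x) \<and>
        (\<lambda>n::nat. n2 (\<lambda>x. w n x - u x)) \<longlonglongrightarrow> 0 \<and> (\<lambda>n. n2 (\<lambda>x. grad (w n) x - g x)) \<longlonglongrightarrow> 0) \<and>
     (\<forall>v h. H0 \<Omega> v h \<longrightarrow> En q u g v h = 0)"
proof -
  obtain w where w: "\<And>n::nat. w n \<in> test_functions \<Omega>" "\<And>n x. 0 \<le> w n x" "\<And>n. wint m (w n) (w n) \<le> 1"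
     "(\<lambda>n. wint m (w n) (w n)) \<longlonglongrightarrow> 1" "(\<lambda>n. Q (w n) (grad (w n))) \<longlonglongrightarrow> 0"
    using minimizing_sequence by blast
  note Lw = test_L2[OF w(1)] and Lg = test_grad_L2[OF w(1)]
  obtain B where B: "\<And>n. Q (w n) (grad (w n)) \<le> B"
    using convergent_imp_Bseq[OF convergentI[OF w(5)]] unfolding Bseq_def by (metis abs_le_D1 real_norm_def)
  have Eb: "E (w n) (grad (w n)) \<le> B + lam" for n
  proof -
    have "lam * wint m (w n) (w n) \<le> lam * 1" using w(3)[of n] lam_pos by (intro mult_left_mono) auto
    then show ?thesis using B[of n] Q_eq[OF Lw, of n "grad (w n)"] by linarith
  qed
  have b1: "n2 (grad (w n)) \<le> B + lam" for n using Eb[of n] wint_W_nonneg[of "w n"] unfolding E_eq by linarith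
  have b2: "n2 (w n) \<le> (B + lam) / c" for n
  proof -
    have "c * n2 (w n) \<le> wint W (w n) (w n)" using test_outside[OF w(1)] by (intro wint_W_ge Lw) auto
    also have "\<dots> \<le> B + lam" using Eb[of n] n2_nonneg[of "grad (w n)"] unfolding E_eq by linarith
    finally show ?thesis using c by (simp add: pos_le_divide_eq mult.commute)
  qed
  define D where "D = max (B + lam) ((B + lam) / c)"
  have D: "n2 (w n) \<le> D" "n2 (grad (w n)) \<le> D" for n
    using b1[of n] b2[of n] unfolding D_def by simp_all
  have out: "w n x = 0" if "x \<notin> cball 0 R" for n x
    using that sub by (intro test_outside[OF w(1)]) blast
  from rellich[OF wgr_test[OF test_UNIV[OF w(1)]] D out] obtain s :: "nat \<Rightarrow> nat"
    where s': "strict_mono s \<and> (\<forall>e>0. \<exists>N. \<forall>a\<ge>N. \<forall>b\<ge>N. n2 (\<lambda>x. w (s a) x - w (s b) x) < e)" ..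
  have s: "strict_mono s" "\<And>e. e > 0 \<Longrightarrow> \<exists>N. \<forall>a\<ge>N. \<forall>b\<ge>N. n2 (\<lambda>x. w (s a) x - w (s b) x) < e"
    by (rule conjunct1[OF s'], rule conjunct2[OF s', rule_format])
  let ?Q = "\<lambda>n. Q (w (s n)) (grad (w (s n)))"
  have Qs: "?Q \<longlonglongrightarrow> 0" using LIMSEQ_subseq_LIMSEQ[OF w(5) s(1)] by (simp add: o_def)
  have ms: "(\<lambda>n. wint m (w (s n)) (w (s n))) \<longlonglongrightarrow> 1" using LIMSEQ_subseq_LIMSEQ[OF w(4) s(1)] by (simp add: o_def)
  \<comment> \<open>\<open>Q\<close> of the sum is nonnegative and is dropped from the parallelogram
    identity; the subtracted mass of the difference is at most \<open>lam * K\<close> times its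
    squared norm.\<close>
  have gd: "n2 (\<lambda>x. grad (w a) x - grad (w b) x) \<le> 2 * Q (w a) (grad (w a)) + 2 * Q (w b) (grad (w b)) + lam * K * n2 (\<lambda>x. w a x - w b x)" for a b
  proof -
    let ?d = "\<lambda>x. w a x + (-1) * w b x" and ?gd = "\<lambda>x. grad (w a) x + (-1) *\<^sub>R grad (w b) x"
    let ?p = "\<lambda>x. w a x + 1 * w b x" and ?gp = "\<lambda>x. grad (w a) x + 1 *\<^sub>R grad (w b) x"
    have "?p \<in> test_functions \<Omega>" using test_add[OF w(1)[of a] w(1)[of b]] by simp
    moreover have "grad ?p = ?gp" using grad_add[OF test_smooth[OF w(1)[of a]] test_smooth[OF w(1)[of b]]] by (auto simp: fun_eq_iff)
    ultimately have "0 \<le> En q ?p ?gp ?p ?gp" using Q_test_nonneg[of ?p] unfolding Q_def by simp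
    then have "En q ?d ?gd ?d ?gd \<le> 2 * Q (w a) (grad (w a)) + 2 * Q (w b) (grad (w b))"
      unfolding En_square[OF bwq Lw Lg Lw Lg] Q_def by simp
    moreover have Ld: "L2 ?d" by (intro L2_add L2_cmult Lw)
    ultimately have "n2 ?gd + wint W ?d ?d - lam * wint m ?d ?d \<le> 2 * Q (w a) (grad (w a)) + 2 * Q (w b) (grad (w b))"
      using En_q[OF Ld Ld, of ?gd ?gd] En_self[of W ?d ?gd] by simp
    moreover have "lam * wint m ?d ?d \<le> lam * (K * n2 ?d)" using wint_m_le[OF Ld] lam_pos by (intro mult_left_mono) auto
    ultimately have "n2 ?gd \<le> 2 * Q (w a) (grad (w a)) + 2 * Q (w b) (grad (w b)) + lam * K * n2 ?d"
      using wint_W_nonneg[of ?d] by simp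
    then show ?thesis by simp
  qed
  have "\<exists>u. L2 u \<and> (\<lambda>n. n2 (\<lambda>x. w (s n) x - u x)) \<longlonglongrightarrow> 0" by (intro L2_complete Lw s(2))
  then obtain u where u: "L2 u" "(\<lambda>n. n2 (\<lambda>x. w (s n) x - u x)) \<longlonglongrightarrow> 0" by (elim exE conjE)
  have gC: "\<exists>N. \<forall>a\<ge>N. \<forall>b\<ge>N. n2 (\<lambda>x. grad (w (s a)) x - grad (w (s b)) x) < e" if e: "e > 0" for e
  proof -
    have "e / (4 * (lam * K)) > 0" using e lam_pos K0 by simp
    then obtain N1 where N1: "\<And>a b. a \<ge> N1 \<Longrightarrow> b \<ge> N1 \<Longrightarrow> n2 (\<lambda>x. w (s a) x - w (s b) x) < e / (4 * (lam * K))"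
      using s(2) by blast
    have "\<forall>\<^sub>F n in sequentially. ?Q n < e / 8" using Qs e by (intro order_tendstoD(2)) auto
    then obtain N2 where N2: "\<And>n. n \<ge> N2 \<Longrightarrow> ?Q n < e / 8" unfolding eventually_sequentially by blast
    have "n2 (\<lambda>x. grad (w (s a)) x - grad (w (s b)) x) < e" if ab: "a \<ge> max N1 N2" "b \<ge> max N1 N2" for a b
    proof -
      have "lam * K * n2 (\<lambda>x. w (s a) x - w (s b) x) \<le> lam * K * (e / (4 * (lam * K)))"
        using N1[of a b] ab lam_pos K0 by (intro mult_left_mono) auto
      also have "\<dots> = e / 4" using lam_pos K0 by simp
      finally show ?thesis using gd[of "s a" "s b"] N2[of a] N2[of b] ab e by simp
    qed
    then show ?thesis by blast
  qed
  have "\<exists>g. L2 g \<and> (\<lambda>n. n2 (\<lambda>x. grad (w (s n)) x - g x)) \<longlonglongrightarrow> 0" by (intro L2_complete Lg gC)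
  then obtain g where g: "L2 g" "(\<lambda>n. n2 (\<lambda>x. grad (w (s n)) x - g x)) \<longlonglongrightarrow> 0" by (elim exE conjE)
  have H: "H0 \<Omega> u g" unfolding H0_def by (intro conjI exI[of _ "\<lambda>n. w (s n)"] allI u g w)
  have "(\<lambda>n. wint m (w (s n)) (w (s n))) \<longlonglongrightarrow> wint m u u" by (intro wint_tendsto bwm Lw u)
  then have mu: "wint m u u = 1" using ms LIMSEQ_unique by blast
  have "?Q \<longlonglongrightarrow> Q u g" unfolding Q_def by (intro En_tendsto bwq Lw Lg u g)
  then have Qu: "Q u g = 0" using Qs LIMSEQ_unique by blast
  have pos: "AE x in lborel. 0 \<le> u x"
  proof -
    let ?v = "\<lambda>x. min 0 (u x)"
    have Lv: "L2 ?v" by (rule L2_bound[where c=1 and f=u]) (use u(1) in \<open>auto dest: L2_measurable\<close>)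
    \<comment> \<open>Where \<open>u\<close> is negative, its distance to the nonnegative member of
      the sequence is at least its absolute value.\<close>
    have "n2 ?v \<le> n2 (\<lambda>x. w (s n) x - u x)" for n
    proof (intro n2_mono L2_diff Lw u AE_I2)
      fix x show "norm (?v x) \<le> norm (w (s n) x - u x)" using w(2)[of "s n" x] by (simp add: min_def)
    qed
    then have "n2 ?v \<le> 0" using u(2) by (intro LIMSEQ_le_const) auto
    from n2_zero_AE[OF Lv this] show ?thesis by eventually_elim (auto simp: min_def split: if_splits)
  qed
  have eq: "En q u g v h = 0" if vh: "H0 \<Omega> v h" for v h
  proof (rule ccontr)
    assume n: "En q u g v h \<noteq> 0"
    let ?b = "En q u g v h"
    \<comment> \<open>Limit of \<open>Q \<ge> 0\<close> along the perturbed sequence. The constant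
      term is \<open>Q u g = 0\<close>, so a nonzero linear coefficient would make the polynomial
      negative for a suitable \<open>t\<close>.\<close>
    have H': "0 \<le> 2 * t * ?b + t\<^sup>2 * Q v h" for t
    proof -
      obtain \<Phi> where P: "\<And>n::nat. \<Phi> n \<in> test_functions \<Omega>" "(\<lambda>n. n2 (\<lambda>x. \<Phi> n x - v x)) \<longlonglongrightarrow> 0" "(\<lambda>n. n2 (\<lambda>x. grad (\<Phi> n) x - h x)) \<longlonglongrightarrow> 0"
        using vh unfolding H0_def by blast
      note LP = test_L2[OF P(1)] test_grad_L2[OF P(1)] and Lv = H0_L2[OF vh]
      have "(\<lambda>n. Q (w (s n)) (grad (w (s n))) + 2 * t * En q (w (s n)) (grad (w (s n))) (\<Phi> n) (grad (\<Phi> n)) + t\<^sup>2 * Q (\<Phi> n) (grad (\<Phi> n)))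
         \<longlonglongrightarrow> Q u g + 2 * t * ?b + t\<^sup>2 * Q v h"
        unfolding Q_def by (intro tendsto_intros En_tendsto bwq Lw Lg u g P(2,3) LP Lv)
      moreover have "0 \<le> Q (w (s n)) (grad (w (s n))) + 2 * t * En q (w (s n)) (grad (w (s n))) (\<Phi> n) (grad (\<Phi> n)) + t\<^sup>2 * Q (\<Phi> n) (grad (\<Phi> n))" for n
      proof -
        let ?p = "\<lambda>x. w (s n) x + t * \<Phi> n x" and ?gp = "\<lambda>x. grad (w (s n)) x + t *\<^sub>R grad (\<Phi> n) x"
        have "?p \<in> test_functions \<Omega>" by (intro test_add test_cmult w P)
        moreover have "grad ?p = ?gp"
          using grad_add[OF test_smooth[OF w(1)] smooth_cmult[OF test_smooth[OF P(1)]]] grad_cmult[OF test_smooth[OF P(1)]] by (auto simp: fun_eq_iff)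
        ultimately have "0 \<le> En q ?p ?gp ?p ?gp" using Q_test_nonneg[of ?p] unfolding Q_def by simp
        then show ?thesis unfolding En_square[OF bwq Lw Lg LP] Q_def .
      qed
      ultimately have "0 \<le> Q u g + 2 * t * ?b + t\<^sup>2 * Q v h" by (intro LIMSEQ_le_const) auto
      then show ?thesis using Qu by simp
    qed
    \<comment> \<open>The summand 1 keeps the denominator of the chosen \<open>t\<close> positive
      even if the quadratic coefficient is zero.\<close>
    define k where "k = Q v h + 1"
    have k: "k > 0" unfolding k_def using Q_nonneg[OF vh] by simp
    have "0 \<le> 2 * (- ?b / k) * ?b + (- ?b / k)\<^sup>2 * Q v h" by (rule H')
    also have "\<dots> \<le> 2 * (- ?b / k) * ?b + (- ?b / k)\<^sup>2 * k" by (intro add_left_mono mult_left_mono) (auto simp: k_def)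
    also have "\<dots> = - (?b\<^sup>2 / k)" using k by (simp add: power2_eq_square divide_simps)
    also have "\<dots> < 0" using k n by simp
    finally show False by simp
  qed
  show ?thesis
    by (intro exI[of _ u] exI[of _ g] conjI H mu pos exI[of _ "\<lambda>n. w (s n)"] allI impI w u g eq)
qed

end

section \<open>Subsolution property and positivity of the ground state\<close>

lemma AE_tendsto_of_n2_summable:
  fixes F :: "nat \<Rightarrow> 'a::euclidean_space \<Rightarrow> 'b::euclidean_space"
  assumes F: "\<And>n. L2 (F n)" and b: "\<And>n. n2 (F n) \<le> b n" "summable b"
  shows "AE x in lborel. (\<lambda>n. F n x) \<longlonglongrightarrow> 0"
proof -
  note [measurable] = L2_measurable[OF F]
  have b0: "0 \<le> b n" for n using b(1)[of n] n2_nonneg order_trans by blast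
  have "(\<integral>\<^sup>+x. (\<Sum>n. ennreal ((norm (F n x))\<^sup>2)) \<partial>lborel) = (\<Sum>n. ennreal (n2 (F n)))"
    by (subst nn_integral_suminf) (auto simp: n2_nn F)
  also have "\<dots> \<le> (\<Sum>n. ennreal (b n))" by (intro suminf_le summableI ennreal_leI b)
  also have "\<dots> = ennreal (\<Sum>n. b n)" by (intro suminf_ennreal2 b b0)
  finally have "(\<integral>\<^sup>+x. (\<Sum>n. ennreal ((norm (F n x))\<^sup>2)) \<partial>lborel) \<noteq> \<infinity>"
    by (metis ennreal_neq_top infinity_ennreal_def neq_top_trans)
  then have "AE x in lborel. (\<Sum>n. ennreal ((norm (F n x))\<^sup>2)) \<noteq> \<infinity>"
    by (intro nn_integral_PInf_AE) auto
  then show ?thesis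
  proof eventually_elim
    fix x assume "(\<Sum>n. ennreal ((norm (F n x))\<^sup>2)) \<noteq> \<infinity>"
    then have "summable (\<lambda>n. (norm (F n x))\<^sup>2)" by (intro summable_suminf_not_top) auto
    then have "(\<lambda>n. (norm (F n x))\<^sup>2) \<longlonglongrightarrow> 0" by (rule summable_LIMSEQ_zero)
    then have "(\<lambda>n. sqrt ((norm (F n x))\<^sup>2)) \<longlonglongrightarrow> sqrt 0" by (rule tendsto_real_sqrt)
    then show "(\<lambda>n. F n x) \<longlonglongrightarrow> 0" by (simp add: tendsto_norm_zero_iff)
  qed
qed

text \<open>By Lindelof's theorem countably many of the balls cover \<Omega>, so the exceptional
  null sets can be united.\<close>

lemma AE_open_local:
  fixes \<Omega> :: "'a::euclidean_space set"
  assumes "\<And>x. x \<in> \<Omega> \<Longrightarrow> \<exists>r>0. AE y in lborel. y \<in> ball x r \<longrightarrow> P y"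
  shows "AE y in lborel. y \<in> \<Omega> \<longrightarrow> P y"
proof -
  obtain r where r: "\<And>x. x \<in> \<Omega> \<Longrightarrow> 0 < r x" "\<And>x. x \<in> \<Omega> \<Longrightarrow> AE y in lborel. y \<in> ball x (r x) \<longrightarrow> P y"
    using assms by metis
  obtain F' where F': "F' \<subseteq> (\<lambda>x. ball x (r x)) ` \<Omega>" "countable F'" "\<Union>F' = \<Union>((\<lambda>x. ball x (r x)) ` \<Omega>)"
    using Lindelof[of "(\<lambda>x. ball x (r x)) ` \<Omega>"] by (metis (no_types, lifting) imageE open_ball)
  have "AE y in lborel. \<forall>B\<in>F'. y \<in> B \<longrightarrow> P y"
    using F'(1) r(2) by (subst AE_ball_countable[OF F'(2)]) blast
  then show ?thesis
  proof eventually_elim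
    fix y assume a: "\<forall>B\<in>F'. y \<in> B \<longrightarrow> P y"
    show "y \<in> \<Omega> \<longrightarrow> P y"
    proof
      assume "y \<in> \<Omega>"
      then have "y \<in> \<Union>F'" unfolding F'(3) using r(1)[of y] by (intro UnionI[of "ball y (r y)"]) auto
      with a show "P y" by blast
    qed
  qed
qed

lemma AE_ball_nonempty:
  assumes "AE y in lborel. y \<in> ball (x::'a::euclidean_space) r \<longrightarrow> P y" "0 < r"
  shows "\<exists>y\<in>ball x r. P y"
proof (rule ccontr)
  assume "\<not> ?thesis"
  with assms(1) have "AE y in lborel. y \<notin> ball x r" by auto
  then have "emeasure lborel (ball x r) = 0" by (subst (asm) AE_iff_measurable[of "ball x r"]) auto
  then have "ball x r \<in> null_sets lborel" by (intro null_setsI) auto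
  then have "negligible (ball x r)" by (simp add: negligible_iff_null_sets null_sets_completionI)
  then show False using open_not_negligible[of "ball x r"] assms(2) by (metis centre_in_ball empty_iff open_ball)
qed

text \<open>A smooth substitute for the positive part.\<close>

definition softpos :: "real \<Rightarrow> real \<Rightarrow> real" where "softpos d y = y * flatd 0 ((1/d) * y)"

text \<open>For y > 0 the function is y exp(-d/y), with derivative (1 + d/y) exp(-d/y), and 1 + s
  \<le> exp s bounds the latter by 1. Composition therefore increases neither the function nor its
  gradient.\<close>

lemma softpos:
  assumes d: "0 < d"
  shows "y \<le> 0 \<Longrightarrow> softpos d y = 0" "\<bar>softpos d y\<bar> \<le> \<bar>y\<bar>" "0 \<le> softpos d y" "y - d \<le> softpos d y"
    "\<exists>D. (softpos d has_real_derivative D) (at y) \<and> \<bar>D\<bar> \<le> 1"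
proof -
  have pos: "softpos d y = y * exp (- (d / y))" if "y > 0" for y
    using that d by (simp add: softpos_def flatd_0)
  show z: "softpos d y = 0" if "y \<le> 0" for y
  proof -
    have "(1/d) * y \<le> 0" using that d by (intro mult_nonneg_nonpos) auto
    then show ?thesis by (simp only: softpos_def flatd_nonpos mult_zero_right)
  qed
  show "\<bar>softpos d y\<bar> \<le> \<bar>y\<bar>" using d pos[of y] z[of y]
    by (cases "y > 0") (auto simp: abs_mult)
  show "0 \<le> softpos d y" using pos[of y] z[of y] by (cases "y > 0") auto
  show "y - d \<le> softpos d y"
  proof (cases "y > 0")
    case True
    have "1 + - (d / y) \<le> exp (- (d / y))" by (rule exp_ge_add_one_self)
    then have "y * (1 + - (d / y)) \<le> y * exp (- (d / y))" using True by (intro mult_left_mono) auto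
    then show ?thesis using True pos[OF True] by (simp add: algebra_simps)
  qed (use d z in auto)
  let ?s = "(1/d) * y"
  have "(softpos d has_real_derivative flatd 0 ?s + y * (flatd (Suc 0) ?s * (1/d))) (at y)"
  proof -
    have "((*) (1/d) has_real_derivative 1/d) (at y)" using DERIV_cmult_Id[of "1/d" y] by simp
    from DERIV_mult'[OF DERIV_ident DERIV_chain2[OF flatd_has_derivative[of 0] this]]
    show ?thesis unfolding softpos_def[abs_def] by (simp add: add.commute)
  qed
  moreover have "\<bar>flatd 0 ?s + y * (flatd (Suc 0) ?s * (1/d))\<bar> \<le> 1"
  proof (cases "y > 0")
    case True
    then have s: "?s > 0" using d by simp
    have "flatd 0 ?s + y * (flatd (Suc 0) ?s * (1/d)) = (1 + d / y) * exp (- (d / y))"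
      unfolding flatd_0[OF s] flatd_1[OF s] using True d by (simp add: divide_simps power2_eq_square) (simp add: algebra_simps)
    moreover have "(1 + d / y) * exp (- (d / y)) \<le> exp (d / y) * exp (- (d / y))"
      by (intro mult_right_mono exp_ge_add_one_self) auto
    moreover have "exp (d / y) * exp (- (d / y)) = 1" by (simp flip: exp_add)
    moreover have "0 \<le> (1 + d / y) * exp (- (d / y))" using True d by simp
    ultimately show ?thesis by simp
  next
    case False
    then have "?s \<le> 0" using d by (intro mult_nonneg_nonpos) auto
    then show ?thesis by simp
  qed
  ultimately show "\<exists>D. (softpos d has_real_derivative D) (at y) \<and> \<bar>D\<bar> \<le> 1" by blast
qed

lemma smooth_softpos: "smooth_on UNIV f \<Longrightarrow> smooth_on UNIV (\<lambda>x. softpos d (f x))"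
  unfolding softpos_def by (intro smooth_mult smooth_flatd smooth_cmult)

context dirichlet
begin

text \<open>The competitor \<open>softpos d (\<phi> - t v)\<close> is supported where \<open>\<phi> > 0\<close>, hence is a test function in \<open>\<Omega>\<close> although
  \<open>v\<close> need not vanish outside \<open>\<Omega>\<close>. For \<open>\<phi>\<close> tending to the ground state and then \<open>t\<close> to \<open>0\<close> this shows
  that the ground state, extended by zero, is a subsolution on the whole space.\<close>

lemma subsolution_smooth:
  assumes \<phi>: "\<phi> \<in> test_functions \<Omega>" "\<And>x. 0 \<le> \<phi> x"
    and v: "smooth_on UNIV v" "L2 v" "L2 (grad v)" "\<And>x. 0 \<le> v x" and t: "0 < t"
  shows "0 \<le> Q \<phi> (grad \<phi>) - 2 * t * En q \<phi> (grad \<phi>) v (grad v) + t\<^sup>2 * E v (grad v)"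
proof -
  note L\<phi> = test_L2[OF \<phi>(1)] test_grad_L2[OF \<phi>(1)]
  let ?y = "\<lambda>x. \<phi> x + (-t) * v x" and ?gy = "\<lambda>x. grad \<phi> x + (-t) *\<^sub>R grad v x"
  have sy: "smooth_on UNIV ?y" by (intro smooth_add smooth_cmult test_smooth[OF \<phi>(1)] v)
  have gy: "grad ?y = ?gy"
    by (rule ext) (simp only: grad_add[OF test_smooth[OF \<phi>(1)] smooth_cmult[OF v(1)]] grad_cmult[OF v(1)])
  have Ly: "L2 ?y" "L2 ?gy" by (intro L2_add L2_cmult L2_scale L\<phi> v)+
  have i1: "integrable lborel (\<lambda>x. m x * \<phi> x)"
  proof -
    have "integrable lborel \<phi>" using test_integrable[OF \<phi>(1) continuous_on_const[of UNIV 1]] by simp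
    then have "integrable lborel (\<lambda>x. K * \<phi> x)" by simp
    then show ?thesis
      by (rule Bochner_Integration.integrable_bound)
        (use mm m0 mK K0 L2_measurable[OF L\<phi>(1)] \<phi>(2) in \<open>auto simp: abs_mult intro!: mult_right_mono\<close>)
  qed
  define I where "I = (\<integral>x. m x * \<phi> x \<partial>lborel)"
  \<comment> \<open>Minimality of \<open>lam\<close> applied to the truncated competitor; its defect
    against the exact positive part is linear in \<open>d\<close> and disappears in the
    limit.\<close>
  have "lam * (wint m \<phi> \<phi> - 2 * t * wint m \<phi> v - 2 * d * I) \<le> E ?y ?gy" if d: "0 < d" for d
  proof -
    define F where "F x = softpos d (?y x)" for x
    have out: "F x = 0" if "\<phi> x = 0" for x
      unfolding F_def using that t v(4)[of x] by (intro softpos(1)[OF d]) simp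
    have F: "F \<in> test_functions \<Omega>"
      using \<phi>(1) out smooth_softpos[OF sy, of d] unfolding test_functions_iff F_def[abs_def] by blast
    note LF = test_L2[OF F] test_grad_L2[OF F]
    have "n2 (grad F) \<le> n2 ?gy"
    proof (rule n2_mono[OF Ly(2)], rule AE_I2)
      fix x
      obtain D where D: "(softpos d has_real_derivative D) (at (?y x))" "\<bar>D\<bar> \<le> 1" using softpos(5)[OF d] by blast
      have "grad F x = D *\<^sub>R ?gy x" unfolding F_def using grad_comp[OF sy D(1)] unfolding gy .
      then show "norm (grad F x) \<le> norm (?gy x)" using mult_right_mono[OF D(2), of "norm (?gy x)"] by simp
    qed
    moreover have "wint W F F \<le> wint W ?y ?y"
      unfolding wint_def
    proof (rule integral_mono[OF wint_integrable[OF bwW LF(1,1)] wint_integrable[OF bwW Ly(1,1)]])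
      fix x
      have "(F x)\<^sup>2 \<le> (?y x)\<^sup>2" using softpos(2)[OF d, of "?y x"] unfolding F_def abs_le_square_iff .
      then show "W x * F x * F x \<le> W x * ?y x * ?y x"
        using mult_left_mono[OF _ W0[of x], of "(F x)\<^sup>2" "(?y x)\<^sup>2"] by (simp only: power2_eq_square mult.assoc)
    qed
    ultimately have "E F (grad F) \<le> E ?y ?gy" unfolding E_eq by simp
    moreover have "lam * wint m F F \<le> E F (grad F)" using Q_test_nonneg[OF F] by (simp add: Q_eq LF)
    moreover have "wint m \<phi> \<phi> - 2 * t * wint m \<phi> v - 2 * d * I \<le> wint m F F"
    proof -
      have "wint m \<phi> \<phi> - 2 * t * wint m \<phi> v - 2 * d * I
        = (\<integral>x. m x * \<phi> x * \<phi> x - 2 * t * (m x * \<phi> x * v x) - 2 * d * (m x * \<phi> x) \<partial>lborel)"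
        unfolding wint_def I_def using i1 wint_integrable[OF bwm L\<phi>(1,1)] wint_integrable[OF bwm L\<phi>(1) v(2)] by simp
      also have "\<dots> \<le> wint m F F" unfolding wint_def
      proof (rule integral_mono)
        show "integrable lborel (\<lambda>x. m x * \<phi> x * \<phi> x - 2 * t * (m x * \<phi> x * v x) - 2 * d * (m x * \<phi> x))"
          using i1 wint_integrable[OF bwm L\<phi>(1,1)] wint_integrable[OF bwm L\<phi>(1) v(2)] by simp
        show "integrable lborel (\<lambda>x. m x * F x * F x)" by (rule wint_integrable[OF bwm LF(1,1)])
        fix x
        have tv: "0 \<le> t * v x" using t v(4)[of x] by simp
        \<comment> \<open>For \<open>?y x \<le> d\<close> the left side is nonpositive. Otherwise
          the competitor is at least \<open>?y x - d\<close>, and expanding the square leaves a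
          discarded square; this loses a multiple of \<open>t^2\<close>, so the last term of the
          lemma has \<open>E v\<close> in place of \<open>Q v\<close>.\<close>
        have "(\<phi> x)\<^sup>2 - 2 * t * (\<phi> x * v x) - 2 * d * \<phi> x \<le> (F x)\<^sup>2"
        proof (cases "?y x \<le> d")
          case True
          then have "\<phi> x * (\<phi> x - t * v x) \<le> \<phi> x * d" using \<phi>(2)[of x] by (intro mult_left_mono) auto
          moreover have "0 \<le> \<phi> x * d" "0 \<le> \<phi> x * (t * v x)" using \<phi>(2)[of x] d tv by auto
          moreover have "(\<phi> x)\<^sup>2 - 2 * t * (\<phi> x * v x) - 2 * d * \<phi> x
             = \<phi> x * (\<phi> x - t * v x) - \<phi> x * (t * v x) - 2 * (\<phi> x * d)" by (simp add: power2_eq_square algebra_simps)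
          ultimately have "(\<phi> x)\<^sup>2 - 2 * t * (\<phi> x * v x) - 2 * d * \<phi> x \<le> 0" by linarith
          then show ?thesis using zero_le_power2[of "F x"] by linarith
        next
          case False
          then have "(?y x - d)\<^sup>2 \<le> (F x)\<^sup>2" using softpos(4)[OF d, of "?y x"] unfolding F_def by (intro power_mono) auto
          moreover have "(?y x - d)\<^sup>2 = (\<phi> x)\<^sup>2 - 2 * t * (\<phi> x * v x) - 2 * d * \<phi> x + (t * v x + d)\<^sup>2"
            by (simp add: power2_eq_square algebra_simps)
          moreover have "0 \<le> (t * v x + d)\<^sup>2" by simp
          ultimately show ?thesis by linarith
        qed
        from mult_left_mono[OF this m0[of x]]
        show "m x * \<phi> x * \<phi> x - 2 * t * (m x * \<phi> x * v x) - 2 * d * (m x * \<phi> x) \<le> m x * F x * F x"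
          by (simp add: power2_eq_square algebra_simps)
      qed
      finally show ?thesis .
    qed
    then have "lam * (wint m \<phi> \<phi> - 2 * t * wint m \<phi> v - 2 * d * I) \<le> lam * wint m F F"
      using lam_pos by (intro mult_left_mono) auto
    ultimately show ?thesis by linarith
  qed
  then have "\<And>n. lam * (wint m \<phi> \<phi> - 2 * t * wint m \<phi> v - 2 * inverse (real (Suc n)) * I) \<le> E ?y ?gy" by simp
  moreover have "(\<lambda>n. lam * (wint m \<phi> \<phi> - 2 * t * wint m \<phi> v - 2 * inverse (real (Suc n)) * I))
     \<longlonglongrightarrow> lam * (wint m \<phi> \<phi> - 2 * t * wint m \<phi> v - 2 * 0 * I)"
    by (intro tendsto_intros LIMSEQ_inverse_real_of_nat)
  ultimately have "lam * (wint m \<phi> \<phi> - 2 * t * wint m \<phi> v - 2 * 0 * I) \<le> E ?y ?gy"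
    by (intro LIMSEQ_le_const2) auto
  moreover have "E ?y ?gy = E \<phi> (grad \<phi>) - 2 * t * En W \<phi> (grad \<phi>) v (grad v) + t\<^sup>2 * E v (grad v)"
    unfolding E_def En_square[OF bwW L\<phi> v(2,3)] by simp
  ultimately show ?thesis
    by (simp add: Q_eq L\<phi> En_q[OF L\<phi>(1) v(2)] algebra_simps)
qed

text \<open>Approximability by nonnegative test functions is recorded because the subsolution property needs it.\<close>

definition is_ground :: "('a \<Rightarrow> real) \<Rightarrow> ('a \<Rightarrow> 'a) \<Rightarrow> bool" where
  "is_ground u g \<longleftrightarrow> H0 \<Omega> u g \<and> wint m u u = 1 \<and> (AE x in lborel. 0 \<le> u x) \<and>
     (\<exists>w. (\<forall>n. w n \<in> test_functions \<Omega>) \<and> (\<forall>n x. 0 \<le> w n x) \<and>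
        (\<lambda>n::nat. n2 (\<lambda>x. w n x - u x)) \<longlonglongrightarrow> 0 \<and> (\<lambda>n. n2 (\<lambda>x. grad (w n) x - g x)) \<longlonglongrightarrow> 0) \<and>
     (\<forall>v h. H0 \<Omega> v h \<longrightarrow> En q u g v h = 0)"

lemma ex_ground: "\<exists>u g. is_ground u g"
  unfolding is_ground_def by (rule eigenfunction)

lemma ground_subsolution_smooth:
  assumes G: "is_ground u g" and v: "smooth_on UNIV v" "L2 v" "L2 (grad v)" "\<And>x. 0 \<le> v x"
  shows "En q u g v (grad v) \<le> 0"
proof -
  obtain w where w: "\<And>n::nat. w n \<in> test_functions \<Omega>" "\<And>n x. 0 \<le> w n x"
     "(\<lambda>n. n2 (\<lambda>x. w n x - u x)) \<longlonglongrightarrow> 0" "(\<lambda>n. n2 (\<lambda>x. grad (w n) x - g x)) \<longlonglongrightarrow> 0"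
    using G unfolding is_ground_def by blast
  have H: "H0 \<Omega> u g" and Q0: "Q u g = 0" using G unfolding is_ground_def Q_def by auto
  note Lu = H0_L2[OF H] and Lw = test_L2[OF w(1)] and Lg = test_grad_L2[OF w(1)]
  \<comment> \<open>Since \<open>Q u g = 0\<close>, the inequality starts with its first-order term;
    after division by \<open>t\<close> only a multiple of \<open>t\<close> is left on the
    right.\<close>
  have t: "2 * En q u g v (grad v) \<le> t * E v (grad v)" if t: "0 < t" for t
  proof -
    have "(\<lambda>n. Q (w n) (grad (w n)) - 2 * t * En q (w n) (grad (w n)) v (grad v) + t\<^sup>2 * E v (grad v))
      \<longlonglongrightarrow> Q u g - 2 * t * En q u g v (grad v) + t\<^sup>2 * E v (grad v)"
      unfolding Q_def by (intro tendsto_intros En_tendsto bwq Lw Lg Lu w v L2_const)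
    moreover have "0 \<le> Q (w n) (grad (w n)) - 2 * t * En q (w n) (grad (w n)) v (grad v) + t\<^sup>2 * E v (grad v)" for n
      by (rule subsolution_smooth[OF w(1,2) v t])
    ultimately have "0 \<le> Q u g - 2 * t * En q u g v (grad v) + t\<^sup>2 * E v (grad v)" by (intro LIMSEQ_le_const) auto
    then have "t * (2 * En q u g v (grad v)) \<le> t * (t * E v (grad v))" using Q0 by (simp add: power2_eq_square algebra_simps)
    then show ?thesis using t by simp
  qed
  have "(\<lambda>n. inverse (real (Suc n)) * E v (grad v)) \<longlonglongrightarrow> 0 * E v (grad v)"
    by (intro tendsto_intros LIMSEQ_inverse_real_of_nat)
  then have "2 * En q u g v (grad v) \<le> 0 * E v (grad v)" using t by (intro LIMSEQ_le_const) auto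
  then show ?thesis by simp
qed

text \<open>Mollification preserves nonnegativity and commutes with the gradient. Smoothness was
  only required to make the truncated competitor a test function.\<close>

theorem ground_subsolution:
  assumes G: "is_ground u g" and v: "wgr v h" "AE x in lborel. 0 \<le> v x"
  shows "En q u g v h \<le> 0"
proof -
  have H: "H0 \<Omega> u g" using G unfolding is_ground_def by auto
  note Lu = H0_L2[OF H] and Lv = wgr_L2[OF v(1)]
  define r where "r n = inverse (real (Suc n))" for n
  have r: "0 < r n" "r \<longlonglongrightarrow> 0" for n unfolding r_def using LIMSEQ_inverse_real_of_nat by auto
  let ?v = "\<lambda>n. cv (kern (r n)) v"
  note k = test_kern[OF r(1)]
  have gv: "grad (?v n) = cv (kern (r n)) h" for n using cv_grad_wgr[OF k v(1)] by auto
  have "En q u g (?v n) (cv (kern (r n)) h) \<le> 0" for n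
  proof -
    have "0 \<le> ?v n x" for x unfolding cv_def
    proof (rule integral_nonneg_AE)
      show "AE y in lborel. 0 \<le> kern (r n) (x - y) *\<^sub>R v y"
        using v(2) by eventually_elim (simp add: kern_nonneg r)
    qed
    then have "En q u g (?v n) (grad (?v n)) \<le> 0"
      by (intro ground_subsolution_smooth[OF G] cv_smooth k Lv) (auto simp: gv intro!: kern_cv_L2 r Lv)
    then show ?thesis by (simp add: gv)
  qed
  moreover have "(\<lambda>n. En q u g (?v n) (cv (kern (r n)) h)) \<longlonglongrightarrow> En q u g v h"
    by (intro En_tendsto bwq Lu Lv L2_const kern_cv_L2 kern_tendsto r)
  ultimately show ?thesis by (intro LIMSEQ_le_const2) auto
qed

text \<open>By the equation, the means \<open>A r\<close> of \<open>u\<close> at \<open>x\<close> satisfy \<open>A' r \<le> (K * r / 2) * A r\<close>, so \<open>A r * exp (- K * r\<^sup>2 / 4)\<close>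
  is decreasing in \<open>r\<close>. Since \<open>A r\<close> tends to \<open>u x\<close>, all these means vanish when \<open>u x = 0\<close>.\<close>

lemma ground_zero_ball:
  assumes G: "is_ground u g"
  shows "AE x in lborel. u x = 0 \<longrightarrow> (\<forall>\<rho>>0. cball x \<rho> \<subseteq> \<Omega> \<longrightarrow> (AE y in lborel. y \<in> ball x \<rho> \<longrightarrow> u y = 0))"
proof -
  have H: "H0 \<Omega> u g" and u0: "AE x in lborel. 0 \<le> u x" and eq: "\<And>v h. H0 \<Omega> v h \<Longrightarrow> En q u g v h = 0"
    using G unfolding is_ground_def by auto
  note w = H0_wgr[OF H] and Lu = H0_L2[OF H]
  \<comment> \<open>Geometric radii make the squared mollification errors summable, which upgrades
    convergence in norm to convergence almost everywhere along this sequence.\<close>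
  define r where "r n = (1/2::real) ^ n" for n :: nat
  have r: "0 < r n" for n by (simp add: r_def)
  have r0: "r \<longlonglongrightarrow> 0" unfolding r_def[abs_def] by (rule LIMSEQ_power_zero) simp
  have "AE x in lborel. (\<lambda>n. cv (kern (r n)) u x - u x) \<longlonglongrightarrow> 0"
  proof (rule AE_tendsto_of_n2_summable[where b="\<lambda>n. (1/4)^n * n2 g"])
    show "L2 (\<lambda>x. cv (kern (r n)) u x - u x)" for n by (intro L2_diff kern_cv_L2 r Lu)
    have "(r n)\<^sup>2 = (1/4)^n" for n unfolding r_def by (simp add: power2_eq_square power_mult_distrib[symmetric])
    then show "n2 (\<lambda>x. cv (kern (r n)) u x - u x) \<le> (1/4)^n * n2 g" for n
      using kern_approx[OF w r[of n]] by simp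
    show "summable (\<lambda>n. (1/4::real)^n * n2 g)" by (intro summable_mult2 summable_geometric) simp
  qed
  then show ?thesis
  proof eventually_elim
    fix x assume lim: "(\<lambda>n. cv (kern (r n)) u x - u x) \<longlonglongrightarrow> 0"
    show "u x = 0 \<longrightarrow> (\<forall>\<rho>>0. cball x \<rho> \<subseteq> \<Omega> \<longrightarrow> (AE y in lborel. y \<in> ball x \<rho> \<longrightarrow> u y = 0))"
    proof (intro impI allI)
      fix \<rho> :: real assume ux: "u x = 0" and \<rho>: "0 < \<rho>" and sub: "cball x \<rho> \<subseteq> \<Omega>"
      let ?N = "DIM('a)" and ?c = "kc TYPE('a)"
      have kc: "?c > 0" by (rule kc_pos)
      let ?A = "\<lambda>s. cv (kern s) u x"
      define A' where "A' s = - (1 / (2 * ?c * s ^ (?N - 1))) * (\<integral>y. g y \<bullet> grad (bump 0 x s) y \<partial>lborel)" for s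
      have A': "(?A has_real_derivative A' s) (at s)" if "s > 0" for s
        unfolding A'_def by (rule cv_kern_deriv[OF w that])
      have A0: "0 \<le> ?A s" if "s > 0" for s unfolding cv_def
      proof (rule integral_nonneg_AE)
        show "AE y in lborel. 0 \<le> kern s (x - y) *\<^sub>R u y"
          using u0 by eventually_elim (simp add: kern_nonneg that)
      qed
      have A'b: "A' s \<le> (K * s / 2) * ?A s" if s: "0 < s" "s \<le> \<rho>" for s
      proof -
        have sN: "s ^ ?N = s ^ (?N - 1) * s" by (metis DIM_positive power_minus_mult)
        have t: "bump 0 x s \<in> test_functions \<Omega>" using s sub by (intro test_bump) (auto intro: order_trans)
        have t1: "bump (Suc 0) x s \<in> test_functions \<Omega>" using s sub by (intro test_bump) (auto intro: order_trans)
        \<comment> \<open>The bump is a test function inside \<Omega>, so the eigenvalue equation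
          evaluates the flux integral in the mean value formula.\<close>
        have "0 = En q u g (bump 0 x s) (grad (bump 0 x s))" using eq[OF H0_test[OF t]] by simp
        then have "- (\<integral>y. g y \<bullet> grad (bump 0 x s) y \<partial>lborel) = wint q u (bump 0 x s)" unfolding En_def by simp
        also have "\<dots> \<le> (\<integral>y. K * (u y * bump (Suc 0) x s y) \<partial>lborel)"
          unfolding wint_def
        proof (rule integral_mono_AE)
          show "integrable lborel (\<lambda>y. q y * u y * bump 0 x s y)" by (rule wint_integrable[OF bwq Lu(1) test_L2[OF t]])
          show "integrable lborel (\<lambda>y. K * (u y * bump (Suc 0) x s y))" using L2_mult_integrable[OF Lu(1) test_L2[OF t1]] by simp
          show "AE y in lborel. q y * u y * bump 0 x s y \<le> K * (u y * bump (Suc 0) x s y)"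
            using u0
          proof eventually_elim
            fix y assume uy: "0 \<le> u y"
            have "q y \<le> K" using WK[of y] m0[of y] lam_pos unfolding q_def by (smt (verit) mult_nonneg_nonneg)
            then have "q y * (u y * bump 0 x s y) \<le> K * (u y * bump 0 x s y)"
              using uy bump_nonneg(1)[of x s y] by (intro mult_right_mono) auto
            \<comment> \<open>Passing to the first derivative of the profile turns the right side
              into a multiple of the mean itself and closes the differential inequality.\<close>
            also have "\<dots> \<le> K * (u y * bump (Suc 0) x s y)"
              using uy K0 bump_0_le_1[of x s y] by (intro mult_left_mono) auto
            finally show "q y * u y * bump 0 x s y \<le> K * (u y * bump (Suc 0) x s y)" by (simp add: mult.assoc)
          qed
        qed
        also have "\<dots> = K * (?c * s ^ ?N * ?A s)"
        proof -
          have "u y * bump (Suc 0) x s y = ?c * s ^ ?N * (kern s (x - y) *\<^sub>R u y)" for y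
            using s kc by (simp add: kern_def bump_def norm_minus_commute)
          then have "(\<integral>y. K * (u y * bump (Suc 0) x s y) \<partial>lborel) = (\<integral>y. K * (?c * s ^ ?N * (kern s (x - y) *\<^sub>R u y)) \<partial>lborel)"
            by (simp only:)
          then show ?thesis by (simp add: cv_def)
        qed
        finally have *: "- (\<integral>y. g y \<bullet> grad (bump 0 x s) y \<partial>lborel) \<le> K * (?c * s ^ ?N * ?A s)" .
        have "A' s = (1 / (2 * ?c * s ^ (?N - 1))) * (- (\<integral>y. g y \<bullet> grad (bump 0 x s) y \<partial>lborel))" unfolding A'_def by simp
        also have "\<dots> \<le> (1 / (2 * ?c * s ^ (?N - 1))) * (K * (?c * s ^ ?N * ?A s))"
          using s kc by (intro mult_left_mono *) auto
        also have "\<dots> = (K * s / 2) * ?A s" unfolding sN using s kc by simp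
        finally show ?thesis .
      qed
      let ?f = "\<lambda>s. ?A s * exp (- (K * s\<^sup>2 / 4))"
      have mono: "?f \<rho> \<le> ?f s" if s: "0 < s" "s \<le> \<rho>" for s
      proof (rule DERIV_nonpos_imp_nonincreasing[OF s(2)])
        fix z assume "s \<le> z" "z \<le> \<rho>"
        then have z: "0 < z" "z \<le> \<rho>" using s by auto
        have "((\<lambda>s. exp (- (K * s\<^sup>2 / 4))) has_real_derivative exp (- (K * z\<^sup>2 / 4)) * (- (K * z / 2))) (at z)"
          by (auto intro!: derivative_eq_intros)
        from DERIV_mult[OF A'[OF z(1)] this]
        have "(?f has_real_derivative (A' z - (K * z / 2) * ?A z) * exp (- (K * z\<^sup>2 / 4))) (at z)"
          by (simp add: algebra_simps)
        moreover have "(A' z - (K * z / 2) * ?A z) * exp (- (K * z\<^sup>2 / 4)) \<le> 0"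
          using A'b[OF z] by (intro mult_nonpos_nonneg) auto
        ultimately show "\<exists>y. (?f has_real_derivative y) (at z) \<and> y \<le> 0" by blast
      qed
      have "\<forall>\<^sub>F n in sequentially. r n < \<rho>" using r0 \<rho> by (intro order_tendstoD(2)) auto
      then have ev: "\<forall>\<^sub>F n in sequentially. ?f \<rho> \<le> ?A (r n)"
      proof eventually_elim
        fix n assume "r n < \<rho>"
        then have "?f \<rho> \<le> ?f (r n)" using r[of n] by (intro mono) auto
        also have "\<dots> \<le> ?A (r n) * 1" using A0[OF r[of n]] K0 by (intro mult_left_mono) auto
        finally show "?f \<rho> \<le> ?A (r n)" by simp
      qed
      moreover have "(\<lambda>n. ?A (r n)) \<longlonglongrightarrow> 0" using lim ux by simp
      ultimately have "?f \<rho> \<le> 0" by (intro tendsto_lowerbound[of "\<lambda>n. ?A (r n)" 0 sequentially]) auto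
      then have "?A \<rho> \<le> 0" by (simp add: mult_le_0_iff)
      then have "?A \<rho> = 0" using A0[OF \<rho>] by simp
      moreover have "AE y in lborel. 0 \<le> kern \<rho> (x - y) * u y"
        using u0 by eventually_elim (simp add: kern_nonneg \<rho>)
      moreover have "integrable lborel (\<lambda>y. kern \<rho> (x - y) * u y)"
        using cv_integrable[OF test_L2[OF test_kern[OF \<rho>]] Lu(1), of x] by simp
      ultimately have "AE y in lborel. kern \<rho> (x - y) * u y = 0"
        unfolding cv_def by (subst (asm) (1) real_scaleR_def, subst (asm) integral_nonneg_eq_0_iff_AE) auto
      then show "AE y in lborel. y \<in> ball x \<rho> \<longrightarrow> u y = 0"
      proof eventually_elim
        fix y assume a: "kern \<rho> (x - y) * u y = 0"
        show "y \<in> ball x \<rho> \<longrightarrow> u y = 0"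
        proof
          assume y: "y \<in> ball x \<rho>"
          have "kern \<rho> (x - y) = bump (Suc 0) x \<rho> y / (?c * \<rho> ^ ?N)" by (simp add: kern_def bump_def norm_minus_commute)
          also have "\<dots> > 0" using bump_pos(2)[OF \<rho> y] kc \<rho> by simp
          finally show "u y = 0" using a by simp
        qed
      qed
    qed
  qed
qed

text \<open>The points near which \<open>u\<close> vanishes and those near which it is positive,
  both almost everywhere, form two disjoint open sets covering \<Omega>. Connectedness leaves one of
  them, and the normalisation excludes vanishing.\<close>

theorem ground_positive:
  assumes G: "is_ground u g" and con: "connected \<Omega>"
  shows "AE x in lborel. x \<in> \<Omega> \<longrightarrow> 0 < u x"
proof -
  have H: "H0 \<Omega> u g" and m1: "wint m u u = 1" and u0: "AE x in lborel. 0 \<le> u x" using G unfolding is_ground_def by auto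
  let ?loc = "\<lambda>P x. \<exists>r>0. AE y in lborel. y \<in> ball x r \<longrightarrow> P y"
  define Z where "Z = {x \<in> \<Omega>. ?loc (\<lambda>y. u y = 0) x}"
  define P where "P = {x \<in> \<Omega>. ?loc (\<lambda>y. 0 < u y) x}"
  have op: "open {x \<in> \<Omega>. ?loc S x}" for S
    unfolding open_contains_ball
  proof (intro ballI)
    fix x assume "x \<in> {x \<in> \<Omega>. ?loc S x}"
    then obtain r where r: "x \<in> \<Omega>" "r > 0" "AE y in lborel. y \<in> ball x r \<longrightarrow> S y" by auto
    obtain d where d: "d > 0" "ball x d \<subseteq> \<Omega>" using open_dom r(1) open_contains_ball by blast
    have "z \<in> {x \<in> \<Omega>. ?loc S x}" if z: "z \<in> ball x (min d (r/2))" for z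
    proof -
      have zr: "ball z (r/2) \<subseteq> ball x r"
      proof
        fix y assume "y \<in> ball z (r/2)"
        then show "y \<in> ball x r" using z dist_triangle[of x y z] by auto
      qed
      have "AE y in lborel. y \<in> ball z (r/2) \<longrightarrow> S y" using r(3) by eventually_elim (use zr in blast)
      moreover have "z \<in> \<Omega>" using z d by auto
      ultimately show ?thesis using r(2) by (intro CollectI conjI exI[of _ "r/2"]) auto
    qed
    then have "ball x (min d (r/2)) \<subseteq> {x \<in> \<Omega>. ?loc S x}" by blast
    moreover have "0 < min d (r/2)" using d r by simp
    ultimately show "\<exists>e>0. ball x e \<subseteq> {x \<in> \<Omega>. ?loc S x}" by (intro exI conjI)
  qed
  have oZ: "open Z" and oP: "open P" unfolding Z_def P_def by (rule op)+
  have disj: "Z \<inter> P = {}"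
  proof (rule ccontr)
    assume "Z \<inter> P \<noteq> {}"
    then obtain x r1 r2 where r: "r1 > 0" "AE y in lborel. y \<in> ball x r1 \<longrightarrow> u y = 0"
      "r2 > 0" "AE y in lborel. y \<in> ball x r2 \<longrightarrow> 0 < u y" unfolding Z_def P_def by blast
    have "AE y in lborel. y \<in> ball x (min r1 r2) \<longrightarrow> False"
      using r(2,4) by eventually_elim auto
    then show False using AE_ball_nonempty[of x "min r1 r2" "\<lambda>_. False"] r by auto
  qed
  have cover: "x \<in> Z \<union> P" if x: "x \<in> \<Omega>" for x
  proof -
    obtain e where e: "e > 0" "cball x e \<subseteq> \<Omega>" using open_dom x open_contains_cball by blast
    \<comment> \<open>For \<open>y\<close> in \<open>ball x d\<close> the ball of radius
      \<open>2 * d\<close> around \<open>y\<close> stays inside \<open>cball x e\<close> and still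
      contains \<open>ball x d\<close>.\<close>
    define d where "d = e / 3"
    have d: "d > 0" "3 * d = e" using e by (auto simp: d_def)
    show ?thesis
    \<comment> \<open>The lemma \<open>ground_zero_ball\<close> holds at almost every point only, so
      the case split asks for a zero at which its conclusion is available.\<close>
    proof (cases "\<exists>y\<in>ball x d. u y = 0 \<and> (\<forall>\<rho>>0. cball y \<rho> \<subseteq> \<Omega> \<longrightarrow> (AE z in lborel. z \<in> ball y \<rho> \<longrightarrow> u z = 0))")
      case True
      then obtain y where y: "y \<in> ball x d" "\<And>\<rho>. \<rho> > 0 \<Longrightarrow> cball y \<rho> \<subseteq> \<Omega> \<Longrightarrow> AE z in lborel. z \<in> ball y \<rho> \<longrightarrow> u z = 0"
        by blast
      have "cball y (2 * d) \<subseteq> cball x e"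
      proof
        fix z assume "z \<in> cball y (2 * d)"
        then show "z \<in> cball x e" using y(1) d dist_triangle[of x z y] by auto
      qed
      then have AEy: "AE z in lborel. z \<in> ball y (2 * d) \<longrightarrow> u z = 0" using d e by (intro y(2)) auto
      have bb: "z \<in> ball y (2 * d)" if "z \<in> ball x d" for z
        using that y(1) dist_triangle[of y z x] by (auto simp: dist_commute)
      have "AE z in lborel. z \<in> ball x d \<longrightarrow> u z = 0" using AEy by eventually_elim (use bb in blast)
      with d(1) have "?loc (\<lambda>y. u y = 0) x" by (intro exI conjI)
      then show ?thesis using x by (simp add: Z_def)
    next
      case False
      have "AE y in lborel. y \<in> ball x d \<longrightarrow> 0 < u y"
        using ground_zero_ball[OF G] u0
      proof eventually_elim
        fix y assume z: "u y = 0 \<longrightarrow> (\<forall>\<rho>>0. cball y \<rho> \<subseteq> \<Omega> \<longrightarrow> (AE z in lborel. z \<in> ball y \<rho> \<longrightarrow> u z = 0))" "0 \<le> u y"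
        have "u y \<noteq> 0" if "y \<in> ball x d"
        proof
          assume uy: "u y = 0"
          have "u y = 0 \<and> (\<forall>\<rho>>0. cball y \<rho> \<subseteq> \<Omega> \<longrightarrow> (AE z in lborel. z \<in> ball y \<rho> \<longrightarrow> u z = 0))" by (rule conjI[OF uy mp[OF z(1) uy]])
          with that have "\<exists>y\<in>ball x d. u y = 0 \<and> (\<forall>\<rho>>0. cball y \<rho> \<subseteq> \<Omega> \<longrightarrow> (AE z in lborel. z \<in> ball y \<rho> \<longrightarrow> u z = 0))" by (rule bexI[rotated])
          with False show False by (rule notE)
        qed
        with z(2) show "y \<in> ball x d \<longrightarrow> 0 < u y" by (simp add: less_le)
      qed
      with d(1) have "?loc (\<lambda>y. 0 < u y) x" by (intro exI conjI)
      then show ?thesis using x by (simp add: P_def)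
    qed
  qed
  have "Z \<subseteq> \<Omega>" "P \<subseteq> \<Omega>" by (auto simp: Z_def P_def)
  then have ZP: "Z \<inter> \<Omega> = Z" "P \<inter> \<Omega> = P" by auto
  have d1: "Z \<inter> P \<inter> \<Omega> = {}" using disj by simp
  have d2: "\<Omega> \<subseteq> Z \<union> P" using cover by (rule subsetI)
  from connectedD[OF con oZ oP d1 d2] have "Z = {} \<or> P = {}" unfolding ZP .
  then consider "Z = {}" | "P = {}" by (rule disjE)
  then show ?thesis
  proof cases
    case 1
    then have "?loc (\<lambda>y. 0 < u y) x" if "x \<in> \<Omega>" for x using cover[OF that] by (simp add: P_def)
    then show ?thesis by (rule AE_open_local)
  next
    case 2
    then have "?loc (\<lambda>y. u y = 0) x" if "x \<in> \<Omega>" for x using cover[OF that] by (simp add: Z_def)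
    then have "AE y in lborel. y \<in> \<Omega> \<longrightarrow> u y = 0" by (rule AE_open_local)
    then have "AE y in lborel. m y * u y * u y = 0" by eventually_elim (use mout in auto)
    then have "wint m u u = 0" unfolding wint_def by (rule integral_eq_zero_AE)
    then show ?thesis using m1 by simp
  qed
qed

end

section \<open>Sobolev spaces on open sets\<close>

lemma AE_leb_on: "open S \<Longrightarrow> (AE x in lebesgue_on S. P x) \<longleftrightarrow> (AE x in lborel. x \<in> S \<longrightarrow> P x)"
  by (subst AE_restrict_space_iff) (auto simp: AE_completion_iff)

lemma borel_measurable_lebesgue_AE:
  fixes F F' :: "'a::euclidean_space \<Rightarrow> 'b::euclidean_space"
  assumes F': "F' \<in> borel_measurable borel" and ae: "AE x in lborel. F x = F' x"
  shows "F \<in> borel_measurable lebesgue"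
proof (rule measurableI)
  fix B :: "'b set" assume B: "B \<in> sets borel"
  obtain N where N0: "\<And>x. x \<in> space lborel - N \<Longrightarrow> F x = F' x" and N1: "N \<in> null_sets lborel"
    using AE_E3[OF ae] by blast
  then have N: "N \<in> null_sets lborel" "{x. F x \<noteq> F' x} \<subseteq> N" by auto
  have "F' -` B \<in> sets borel" using measurable_sets[OF F' B] by simp
  then have 1: "F' -` B - N \<in> sets lebesgue" using N(1) by (intro sets.Diff) auto
  have "F -` B \<inter> N \<in> null_sets lebesgue"
    using null_sets_completion_subset[of "F -` B \<inter> N" N lborel] N(1) by (simp add: null_sets_completionI)
  then have 2: "F -` B \<inter> N \<in> sets lebesgue" by auto
  have eq: "(F' -` B - N) \<union> (F -` B \<inter> N) = F -` B" using N(2) by auto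
  show "F -` B \<inter> space lebesgue \<in> sets lebesgue" using sets.Un[OF 1 2] unfolding eq by simp
qed simp

text \<open>The bridge between the spaces of the theorem and the Borel setting: a function on
  \<open>S\<close> is matched by a Borel function that vanishes almost everywhere outside
  \<open>S\<close>.\<close>

lemma
  fixes F F' :: "'a::euclidean_space \<Rightarrow> 'b::euclidean_space"
  assumes S: "open S" and F': "F' \<in> borel_measurable borel"
    and ae: "AE x in lborel. x \<in> S \<longrightarrow> F x = F' x" and z: "AE x in lborel. x \<notin> S \<longrightarrow> F' x = 0"
  shows integral_leb_on: "(\<integral>x. F x \<partial>lebesgue_on S) = (\<integral>x. F' x \<partial>lborel)"
    and integrable_leb_on: "integrable (lebesgue_on S) F \<longleftrightarrow> integrable lborel F'"
    and measurable_leb_on: "F \<in> borel_measurable (lebesgue_on S)"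
proof -
  let ?G = "\<lambda>x. indicator S x *\<^sub>R F x"
  have ae': "AE x in lborel. ?G x = F' x" using ae z by eventually_elim (auto simp: indicator_def)
  have mG: "?G \<in> borel_measurable lebesgue" by (rule borel_measurable_lebesgue_AE[OF F' ae'])
  have mF': "F' \<in> borel_measurable lebesgue" using F' by (simp add: measurable_completion)
  have Sl: "S \<inter> space lebesgue \<in> sets lebesgue" using S by auto
  have "(\<integral>x. F x \<partial>lebesgue_on S) = (\<integral>x. ?G x \<partial>lebesgue)" by (rule integral_restrict_space[OF Sl])
  also have "\<dots> = (\<integral>x. F' x \<partial>lebesgue)" using ae' mG mF' by (intro integral_cong_AE) (auto simp: AE_completion_iff)
  also have "\<dots> = (\<integral>x. F' x \<partial>lborel)" using F' by (intro integral_completion) simp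
  finally show "(\<integral>x. F x \<partial>lebesgue_on S) = (\<integral>x. F' x \<partial>lborel)" .
  have "integrable (lebesgue_on S) F \<longleftrightarrow> integrable lebesgue ?G" by (rule integrable_restrict_space[OF Sl])
  also have "\<dots> \<longleftrightarrow> integrable lebesgue F'" using ae' mG mF' by (intro integrable_cong_AE) (auto simp: AE_completion_iff)
  also have "\<dots> \<longleftrightarrow> integrable lborel F'" using F' by (intro integrable_completion) simp
  finally show "integrable (lebesgue_on S) F \<longleftrightarrow> integrable lborel F'" .
  show "F \<in> borel_measurable (lebesgue_on S)" using mG borel_measurable_restrict_space_iff[OF Sl, of F] by simp
qed

lemma
  fixes F F' :: "'a::euclidean_space \<Rightarrow> 'b::euclidean_space"
  assumes F': "F' \<in> borel_measurable borel" and ae: "AE x in lborel. F x = F' x"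
  shows integral_leb: "(\<integral>x. F x \<partial>lebesgue) = (\<integral>x. F' x \<partial>lborel)"
    and integrable_leb: "integrable lebesgue F \<longleftrightarrow> integrable lborel F'"
  using integral_leb_on[OF open_UNIV F', of F] integrable_leb_on[OF open_UNIV F', of F] ae
  by (auto simp: lebesgue_on_UNIV_eq)

lemma borel_representative:
  fixes f :: "'a::euclidean_space \<Rightarrow> 'b::euclidean_space"
  assumes S: "open S" and f: "f \<in> borel_measurable (lebesgue_on S)"
  shows "\<exists>f'. f' \<in> borel_measurable borel \<and> (AE x in lborel. x \<in> S \<longrightarrow> f x = f' x) \<and> (\<forall>x. x \<notin> S \<longrightarrow> f' x = 0)"
proof -
  have m: "(\<lambda>x. indicator S x *\<^sub>R f x) \<in> borel_measurable lebesgue"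
    using f S by (subst (asm) borel_measurable_restrict_space_iff) auto
  have "\<exists>h\<in>borel_measurable lborel. AE x in lborel. (indicator S x *\<^sub>R f x) \<bullet> i = h x" for i
    by (rule completion_ex_borel_measurable_real) (rule borel_measurable_inner[OF m borel_measurable_const])
  then have "\<forall>i. \<exists>h. h \<in> borel_measurable lborel \<and> (AE x in lborel. (indicator S x *\<^sub>R f x) \<bullet> i = h x)"
    unfolding Bex_def by (rule allI)
  from choice[OF this] obtain h
    where h0: "\<forall>i. h i \<in> borel_measurable lborel \<and> (AE x in lborel. (indicator S x *\<^sub>R f x) \<bullet> i = h i x)" ..
  have h: "h i \<in> borel_measurable borel" "AE x in lborel. (indicator S x *\<^sub>R f x) \<bullet> i = h i x" for i
    using spec[OF h0, of i] by simp_all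
  have [measurable]: "S \<in> sets borel" using S by simp
  note [measurable] = h(1)
  define f' where "f' x = indicator S x *\<^sub>R (\<Sum>i\<in>Basis. h i x *\<^sub>R i)" for x
  have "f' \<in> borel_measurable borel" unfolding f'_def by measurable
  moreover have "AE x in lborel. \<forall>i\<in>Basis. (indicator S x *\<^sub>R f x) \<bullet> i = h i x" by (intro AE_finite_allI h) simp
  then have "AE x in lborel. x \<in> S \<longrightarrow> f x = f' x"
  proof eventually_elim
    fix x assume a: "\<forall>i\<in>Basis. (indicator S x *\<^sub>R f x) \<bullet> i = h i x"
    show "x \<in> S \<longrightarrow> f x = f' x"
    proof
      assume "x \<in> S"
      then have "f x = (\<Sum>i\<in>Basis. h i x *\<^sub>R i)" using a by (subst euclidean_representation[of "f x", symmetric]) simp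
      then show "f x = f' x" using \<open>x \<in> S\<close> by (simp add: f'_def)
    qed
  qed
  ultimately show ?thesis by (auto simp: f'_def)
qed

text \<open>The set where \<open>d > 0\<close> within a compact set is filled up to \<open>e\<close>
  by a closed subset. A positive function with zero integral forces that subset to be null. The
  one-sided form is applied to \<open>d\<close> and to its negative.\<close>

lemma zero_on_compact_imp_AE_zero:
  fixes d :: "'a::euclidean_space \<Rightarrow> real"
  assumes S: "open S" and i: "\<And>K. compact K \<Longrightarrow> K \<subseteq> S \<Longrightarrow> set_integrable lebesgue K d"
    and z: "\<And>K. compact K \<Longrightarrow> K \<subseteq> S \<Longrightarrow> (\<integral>x. indicator K x * d x \<partial>lebesgue) = 0"
  shows "AE x in lebesgue. x \<in> S \<longrightarrow> d x \<le> 0"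
proof -
  have comp: "AE x in lebesgue. x \<in> C \<longrightarrow> d x \<le> 0" if C: "compact C" "C \<subseteq> S" for C
  proof -
    have m: "(\<lambda>x. indicator C x * d x) \<in> borel_measurable lebesgue"
      using i[OF C] unfolding set_integrable_def by (simp add: borel_measurable_integrable)
    define A where "A = {x. 0 < indicator C x * d x}"
    have AC: "A \<subseteq> C" by (auto simp: A_def indicator_def)
    have A: "A \<in> sets lebesgue"
      using borel_measurable_less[OF borel_measurable_const[of 0 lebesgue] m] by (simp add: A_def)
    have "emeasure lebesgue A \<le> ennreal e" if e: "e > 0" for e
    proof -
      obtain T where T: "closed T" "T \<subseteq> A" "emeasure lebesgue (A - T) < ennreal e"
        using sets_lebesgue_inner_closed[OF A e] by metis
      have "C \<inter> T = T" using T(2) AC by auto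
      then have cT: "compact T" using compact_Int_closed[OF C(1) T(1)] by simp
      have TS: "T \<subseteq> S" using T(2) AC C(2) by blast
      have Tl: "T \<in> sets lebesgue" using borel_closed[OF T(1)] by simp
      have "integrable lebesgue (\<lambda>x. indicator T x * d x)" using i[OF cT TS] by (simp add: set_integrable_def)
      moreover have Tpos: "0 < d x" if "x \<in> T" for x
      proof -
        have "0 < indicator C x * d x" using that T(2) unfolding A_def by blast
        then show ?thesis by (cases "x \<in> C") auto
      qed
      then have "0 \<le> indicator T x * d x" for x by (cases "x \<in> T") (auto intro: less_imp_le)
      ultimately have "AE x in lebesgue. indicator T x * d x = 0"
        using z[OF cT TS] by (subst (asm) integral_nonneg_eq_0_iff_AE) auto
      then have "AE x in lebesgue. x \<notin> T"
        by eventually_elim (use Tpos in force)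
      then have "T \<in> null_sets lebesgue" using Tl by (subst AE_iff_null_sets) auto
      from emeasure_Diff_null_set[OF this A] T(3) show ?thesis by (metis less_imp_le)
    qed
    then have "emeasure lebesgue A \<le> 0 + ennreal e" if "e > 0" for e using that by simp
    then have "emeasure lebesgue A \<le> 0" by (rule ennreal_le_epsilon)
    then have "A \<in> null_sets lebesgue" using A by (intro null_setsI) simp_all
    from AE_not_in[OF this] show ?thesis
    proof eventually_elim
      fix x assume "x \<notin> A"
      then have "\<not> 0 < indicator C x * d x" by (simp add: A_def)
      then show "x \<in> C \<longrightarrow> d x \<le> 0" by auto
    qed
  qed
  have "\<exists>r>0. AE y in lborel. y \<in> ball x r \<longrightarrow> d y \<le> 0" if "x \<in> S" for x
  proof -
    obtain e where e: "e > 0" "cball x e \<subseteq> S" using S \<open>x \<in> S\<close> unfolding open_contains_cball by blast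
    have "AE y in lborel. y \<in> cball x e \<longrightarrow> d y \<le> 0" using comp[OF compact_cball e(2)] by (simp add: AE_completion_iff)
    then have "AE y in lborel. y \<in> ball x e \<longrightarrow> d y \<le> 0" by eventually_elim auto
    with e(1) show ?thesis by blast
  qed
  then have "AE y in lborel. y \<in> S \<longrightarrow> d y \<le> 0" by (rule AE_open_local)
  then show ?thesis by (simp add: AE_completion_iff)
qed

text \<open>Smooth cutoffs supported in shrinking neighbourhoods of \<open>K\<close> converge
  pointwise to its indicator, because their values on \<open>K\<close> tend to 1.\<close>

lemma test_integral_zero_imp_compact:
  fixes d :: "'a::euclidean_space \<Rightarrow> real"
  assumes S: "open S" and i: "\<And>K. compact K \<Longrightarrow> K \<subseteq> S \<Longrightarrow> set_integrable lebesgue K d"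
    and z: "\<And>\<phi>. \<phi> \<in> test_functions S \<Longrightarrow> (\<integral>x. d x * \<phi> x \<partial>lebesgue_on S) = 0"
    and K: "compact K" "K \<subseteq> S"
  shows "(\<integral>x. indicator K x * d x \<partial>lebesgue) = 0"
proof -
  obtain e where e: "e > 0" "(\<Union>x\<in>K. ball x e) \<subseteq> S"
    using compact_subset_open_imp_ball_epsilon_subset[OF K(1) S K(2)] by metis
  \<comment> \<open>One compact neighbourhood inside \<open>S\<close> contains all the shrinking
    ones; \<open>d\<close> is integrable on it and dominates.\<close>
  define K' where "K' = {x + y | x y. x \<in> K \<and> y \<in> cball 0 (e/2)}"
  have cK': "compact K'" unfolding K'_def by (intro compact_sums K compact_cball)
  have K'S: "K' \<subseteq> S"
  proof
    fix z assume "z \<in> K'"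
    then obtain x y where "z = x + y" "x \<in> K" "norm y \<le> e/2" by (auto simp: K'_def)
    then have "z \<in> ball x e" using e(1) by (simp add: dist_norm)
    then show "z \<in> S" using e(2) \<open>x \<in> K\<close> by blast
  qed
  define U where "U n = (\<Union>x\<in>K. ball x (e / (2 * real (Suc n))))" for n :: nat
  have oU: "open (U n)" for n by (auto simp: U_def)
  have KU: "K \<subseteq> U n" for n using e(1) by (force simp: U_def)
  have UK': "U n \<subseteq> K'" for n
  proof
    fix z assume "z \<in> U n"
    then obtain x where x: "x \<in> K" "dist x z < e / (2 * real (Suc n))" by (auto simp: U_def)
    have "e / (2 * real (Suc n)) \<le> e / 2" using e(1) by (simp add: divide_simps)
    then have "dist x z \<le> e / 2" using x(2) by linarith
    then have "z - x \<in> cball 0 (e/2)" by (simp add: dist_norm norm_minus_commute)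
    moreover have "z = x + (z - x)" by simp
    ultimately show "z \<in> K'" unfolding K'_def using x(1) by blast
  qed
  have "\<forall>n. \<exists>\<phi>\<in>test_functions (U n). (\<forall>x. 0 \<le> \<phi> x \<and> \<phi> x \<le> 1) \<and> (\<forall>x\<in>K. 1 - inverse (real (Suc n)) \<le> \<phi> x)"
    by (intro allI smooth_urysohn K oU KU) simp
  then obtain \<phi> where p: "\<And>n. \<phi> n \<in> test_functions (U n)" "\<And>n x. 0 \<le> \<phi> n x" "\<And>n x. \<phi> n x \<le> 1"
    "\<And>n x. x \<in> K \<Longrightarrow> 1 - inverse (real (Suc n)) \<le> \<phi> n x" by metis
  have out: "\<phi> n x = 0" if "x \<notin> U n" for n x by (rule test_outside[OF p(1) that])
  have iK': "integrable lebesgue (\<lambda>x. indicator K' x * d x)" using i[OF cK' K'S] by (simp add: set_integrable_def)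
  have e2: "indicator K' x * d x * \<phi> n x = d x * \<phi> n x" for n x
    using out[of x n] UK'[of n] by (auto simp: indicator_def)
  have pm: "\<phi> n \<in> borel_measurable lebesgue" for n
    using L2_measurable[OF test_L2[OF p(1)]] by (simp add: measurable_completion)
  have "(\<lambda>n. \<integral>x. indicator K' x * d x * \<phi> n x \<partial>lebesgue) \<longlonglongrightarrow> (\<integral>x. indicator K x * d x \<partial>lebesgue)"
  proof (rule integral_dominated_convergence[where w="\<lambda>x. \<bar>indicator K' x * d x\<bar>"])
    show "integrable lebesgue (\<lambda>x. \<bar>indicator K' x * d x\<bar>)" using iK' by (rule integrable_abs)
    show "(\<lambda>x. indicator K x * d x) \<in> borel_measurable lebesgue"
      using i[OF K] by (simp add: set_integrable_def borel_measurable_integrable)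
    show "(\<lambda>x. indicator K' x * d x * \<phi> n x) \<in> borel_measurable lebesgue" for n
      by (intro borel_measurable_times borel_measurable_integrable[OF iK'] pm)
    show "AE x in lebesgue. norm (indicator K' x * d x * \<phi> n x) \<le> \<bar>indicator K' x * d x\<bar>" for n
    proof (rule AE_I2)
      fix x
      have "\<bar>\<phi> n x\<bar> \<le> 1" using p(2,3)[of n x] by simp
      then have "\<bar>indicator K' x * d x\<bar> * \<bar>\<phi> n x\<bar> \<le> \<bar>indicator K' x * d x\<bar> * 1" by (intro mult_left_mono) auto
      then show "norm (indicator K' x * d x * \<phi> n x) \<le> \<bar>indicator K' x * d x\<bar>" by (simp add: abs_mult)
    qed
    show "AE x in lebesgue. (\<lambda>n. indicator K' x * d x * \<phi> n x) \<longlonglongrightarrow> indicator K x * d x"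
    proof (rule AE_I2)
      fix x
      have "(\<lambda>n. \<phi> n x) \<longlonglongrightarrow> indicator K x"
      proof (cases "x \<in> K")
        case True
        have "(\<lambda>n. 1 - inverse (real (Suc n))) \<longlonglongrightarrow> 1 - 0" by (intro tendsto_intros LIMSEQ_inverse_real_of_nat)
        then have "(\<lambda>n. \<phi> n x) \<longlonglongrightarrow> 1"
          using p(3,4) True by (intro tendsto_sandwich[of "\<lambda>n. 1 - inverse (real (Suc n))" "\<lambda>n. \<phi> n x" sequentially "\<lambda>_. 1" 1]) auto
        then show ?thesis using True by simp
      next
        case False
        have "open (- K)" using K(1) by (simp add: compact_imp_closed open_Compl)
        then obtain \<delta> where \<delta>: "\<delta> > 0" "ball x \<delta> \<subseteq> - K" using False open_contains_ball by (metis ComplI)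
        obtain N where N: "e / (2 * real (Suc N)) < \<delta>"
        proof -
          obtain N where "inverse (real (Suc N)) < 2 * \<delta> / e" using reals_Archimedean[of "2 * \<delta> / e"] \<delta>(1) e(1) by auto
          then have "e / (2 * real (Suc N)) < \<delta>" using e(1) by (simp add: field_simps)
          then show ?thesis by (rule that)
        qed
        have "\<phi> n x = 0" if n: "n \<ge> N" for n
        proof (rule out)
          have "e / (2 * real (Suc n)) \<le> e / (2 * real (Suc N))" using n e(1) by (intro divide_left_mono) auto
          then have "e / (2 * real (Suc n)) < \<delta>" using N by simp
          then show "x \<notin> U n" using \<delta>(2) by (force simp: U_def dist_commute)
        qed
        then have "\<forall>\<^sub>F n in sequentially. \<phi> n x = 0" unfolding eventually_sequentially by blast
        then show ?thesis using False by (simp add: tendsto_eventually)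
      qed
      then have "(\<lambda>n. indicator K' x * d x * \<phi> n x) \<longlonglongrightarrow> indicator K' x * d x * indicator K x" by (intro tendsto_intros)
      moreover have "indicator K' x * d x * indicator K x = indicator K x * d x"
        using KU[of 0] UK'[of 0] by (auto simp: indicator_def)
      ultimately show "(\<lambda>n. indicator K' x * d x * \<phi> n x) \<longlonglongrightarrow> indicator K x * d x" by simp
    qed
  qed
  moreover have "(\<integral>x. indicator K' x * d x * \<phi> n x \<partial>lebesgue) = 0" for n
  proof -
    have "U n \<subseteq> S" using UK' K'S by blast
    then have t: "\<phi> n \<in> test_functions S" using p(1) test_mono by blast
    have "0 = (\<integral>x. d x * \<phi> n x \<partial>lebesgue_on S)" using z[OF t] by simp
    also have "\<dots> = (\<integral>x. indicator S x *\<^sub>R (d x * \<phi> n x) \<partial>lebesgue)" using S by (intro integral_restrict_space) auto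
    also have "(\<lambda>x. indicator S x *\<^sub>R (d x * \<phi> n x)) = (\<lambda>x. indicator K' x * d x * \<phi> n x)"
      unfolding e2 using test_outside[OF t] by (auto simp: fun_eq_iff indicator_def)
    finally show ?thesis by simp
  qed
  ultimately show ?thesis by (simp add: LIMSEQ_const_iff)
qed

lemma fundamental_lemma:
  fixes d :: "'a::euclidean_space \<Rightarrow> real"
  assumes S: "open S" and i: "\<And>K. compact K \<Longrightarrow> K \<subseteq> S \<Longrightarrow> set_integrable lebesgue K d"
    and z: "\<And>\<phi>. \<phi> \<in> test_functions S \<Longrightarrow> (\<integral>x. d x * \<phi> x \<partial>lebesgue_on S) = 0"
  shows "AE x in lebesgue_on S. d x = 0"
proof -
  have zc: "(\<integral>x. indicator K x * d x \<partial>lebesgue) = 0" if "compact K" "K \<subseteq> S" for K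
    by (rule test_integral_zero_imp_compact[OF S]) (use i z that in auto)
  have "AE x in lebesgue. x \<in> S \<longrightarrow> d x \<le> 0" by (rule zero_on_compact_imp_AE_zero[OF S i zc])
  moreover have "AE x in lebesgue. x \<in> S \<longrightarrow> - d x \<le> 0"
  proof (rule zero_on_compact_imp_AE_zero[OF S])
    fix K assume K: "compact K" "K \<subseteq> S"
    show "set_integrable lebesgue K (\<lambda>x. - d x)" using i[OF K] by (simp add: set_integrable_def)
    show "(\<integral>x. indicator K x * - d x \<partial>lebesgue) = 0" using zc[OF K] by simp
  qed
  ultimately have "AE x in lebesgue. x \<in> S \<longrightarrow> d x = 0" by eventually_elim auto
  then show ?thesis using S by (simp add: AE_leb_on AE_completion_iff)
qed

lemma local_test_integrable:
  fixes f :: "'a::euclidean_space \<Rightarrow> real"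
  assumes S: "open S" and f: "locally_integrable S f" and \<phi>: "\<phi> \<in> test_functions S"
  shows "integrable (lebesgue_on S) (\<lambda>x. f x * \<phi> x)"
proof -
  obtain K where K: "compact K" "K \<subseteq> S" "\<And>x. x \<notin> K \<Longrightarrow> \<phi> x = 0" using \<phi> unfolding test_functions_iff by auto
  obtain C where C: "\<And>x. \<bar>\<phi> x\<bar> \<le> C" using test_bounded[OF \<phi>] by auto
  have i: "integrable lebesgue (\<lambda>x. indicator K x * f x)"
    using f K(1,2) by (simp add: locally_integrable_def set_integrable_def)
  have m: "\<phi> \<in> borel_measurable lebesgue" using L2_measurable[OF test_L2[OF \<phi>]] by (simp add: measurable_completion)
  have "integrable lebesgue (\<lambda>x. \<phi> x * (indicator K x * f x))"
  proof (rule Bochner_Integration.integrable_bound)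
    show "integrable lebesgue (\<lambda>x. C * \<bar>indicator K x * f x\<bar>)" using i by (intro integrable_mult_right integrable_abs) simp
    show "(\<lambda>x. \<phi> x * (indicator K x * f x)) \<in> borel_measurable lebesgue" by (intro borel_measurable_times m borel_measurable_integrable[OF i])
    show "AE x in lebesgue. norm (\<phi> x * (indicator K x * f x)) \<le> norm (C * \<bar>indicator K x * f x\<bar>)"
      using C by (intro AE_I2) (auto simp: abs_mult intro!: mult_right_mono order_trans[OF C abs_ge_self])
  qed
  moreover have "(\<lambda>x. \<phi> x * (indicator K x * f x)) = (\<lambda>x. indicator S x *\<^sub>R (f x * \<phi> x))"
    using K(2,3) by (auto simp: fun_eq_iff indicator_def)
  ultimately show ?thesis using S by (subst integrable_restrict_space) auto
qed

lemma locally_integrable_inner: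
  fixes g :: "'a::euclidean_space \<Rightarrow> 'b::euclidean_space"
  assumes "locally_integrable S g" shows "locally_integrable S (\<lambda>x. g x \<bullet> i)"
  unfolding locally_integrable_def set_integrable_def
proof (intro allI impI)
  fix K assume "compact K \<and> K \<subseteq> S"
  then have "integrable lebesgue (\<lambda>x. (indicator K x *\<^sub>R g x) \<bullet> i)"
    using assms by (intro integrable_inner_left) (auto simp: locally_integrable_def set_integrable_def)
  then show "integrable lebesgue (\<lambda>x. indicator K x *\<^sub>R (g x \<bullet> i))" by simp
qed

text \<open>Makes the representative selected by \<open>weak_grad\<close> immaterial under
  integrals.\<close>

lemma weak_grad_unique:
  assumes S: "open S" and g: "has_weak_grad S u g" "has_weak_grad S u h"
  shows "AE x in lebesgue_on S. g x = h x"
proof -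
  have "AE x in lebesgue_on S. g x \<bullet> i - h x \<bullet> i = 0" if i: "i \<in> Basis" for i
  proof (rule fundamental_lemma[OF S])
    have l: "locally_integrable S (\<lambda>x. g x \<bullet> i)" "locally_integrable S (\<lambda>x. h x \<bullet> i)"
      using g by (auto simp: has_weak_grad_def intro!: locally_integrable_inner)
    show "set_integrable lebesgue K (\<lambda>x. g x \<bullet> i - h x \<bullet> i)" if "compact K" "K \<subseteq> S" for K
      using l that by (intro set_integral_diff) (auto simp: locally_integrable_def)
    fix \<phi> assume p: "\<phi> \<in> test_functions S"
    have "(\<integral>x. (g x \<bullet> i) * \<phi> x \<partial>lebesgue_on S) = (\<integral>x. (h x \<bullet> i) * \<phi> x \<partial>lebesgue_on S)"
      using g p i by (simp add: has_weak_grad_def)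
    then show "(\<integral>x. (g x \<bullet> i - h x \<bullet> i) * \<phi> x \<partial>lebesgue_on S) = 0"
      using local_test_integrable[OF S l(1) p] local_test_integrable[OF S l(2) p] by (simp add: left_diff_distrib)
  qed
  then have "AE x in lebesgue_on S. \<forall>i\<in>Basis. g x \<bullet> i - h x \<bullet> i = 0" by (intro AE_finite_allI) auto
  then show ?thesis by eventually_elim (auto intro: euclidean_eqI)
qed

lemma weak_grad_eq:
  assumes S: "open S" and g: "has_weak_grad S u g" shows "AE x in lebesgue_on S. weak_grad S u x = g x"
  by (rule weak_grad_unique[OF S _ g]) (unfold weak_grad_def, rule someI[of _ g], rule g)

text \<open>Function and gradient vanish outside \<open>S\<close> everywhere, so integrals over
  \<open>S\<close> become integrals over the space. Testing is restricted to \<open>S\<close>: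
  across the boundary, \<open>g\<close> need not be the weak gradient of \<open>u\<close>.\<close>

definition wgr_on :: "'a::euclidean_space set \<Rightarrow> ('a \<Rightarrow> real) \<Rightarrow> ('a \<Rightarrow> 'a) \<Rightarrow> bool" where
  "wgr_on S u g \<longleftrightarrow> L2 u \<and> L2 g \<and> (\<forall>x. x \<notin> S \<longrightarrow> u x = 0 \<and> g x = 0) \<and>
     (\<forall>\<phi>\<in>test_functions S. \<forall>i\<in>Basis.
        (\<integral>x. u x * frechet_derivative \<phi> (at x) i \<partial>lborel) = - (\<integral>x. (g x \<bullet> i) * \<phi> x \<partial>lborel))"

lemma L2_locally_integrable:
  fixes u' :: "'a::euclidean_space \<Rightarrow> 'b::euclidean_space"
  assumes S: "open S" and u': "L2 u'" and ae: "AE x in lborel. x \<in> S \<longrightarrow> u x = u' x"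
  shows "locally_integrable S u"
  unfolding locally_integrable_def set_integrable_def
proof (intro allI impI)
  fix K assume K: "compact K \<and> K \<subseteq> S"
  then have [measurable]: "K \<in> sets borel" by (auto simp: compact_imp_closed)
  note [measurable] = L2_measurable[OF u']
  have "AE x in lborel. indicator K x *\<^sub>R u x = indicator K x *\<^sub>R u' x"
    using ae by eventually_elim (use K in \<open>auto simp: indicator_def\<close>)
  moreover have "integrable lborel (\<lambda>x. indicator K x *\<^sub>R u' x)"
  proof -
    have "emeasure lborel K < \<infinity>" using K emeasure_compact_finite by blast
    then have "L2 (indicator K :: 'a \<Rightarrow> real)" by (intro L2_indicator) auto
    from L2_scaleR_integrable[OF this u'] show ?thesis .
  qed
  ultimately show "integrable lebesgue (\<lambda>x. indicator K x *\<^sub>R u x)"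
    by (subst integrable_leb[of "\<lambda>x. indicator K x *\<^sub>R u' x"]) auto
qed

lemma in_Lp2_iff:
  fixes u' :: "'a::euclidean_space \<Rightarrow> 'b::euclidean_space"
  assumes S: "open S" and u': "u' \<in> borel_measurable borel" "\<forall>x. x \<notin> S \<longrightarrow> u' x = 0" and ae: "AE x in lborel. x \<in> S \<longrightarrow> u x = u' x"
  shows "in_Lp 2 S u \<longleftrightarrow> L2 u'"
proof -
  have p: "norm y powr 2 = (norm y)\<^sup>2" for y :: 'b by (cases "y = 0") auto
  have "u \<in> borel_measurable (lebesgue_on S)" by (rule measurable_leb_on[OF S u'(1) ae]) (use u'(2) in auto)
  moreover have "integrable (lebesgue_on S) (\<lambda>x. norm (u x) powr 2) \<longleftrightarrow> integrable lborel (\<lambda>x. (norm (u' x))\<^sup>2)"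
    unfolding p using u' ae by (intro integrable_leb_on[OF S]) auto
  ultimately show ?thesis using u'(1) by (simp add: in_Lp_def L2_def)
qed

lemma has_weak_grad_of_wgr_on:
  assumes S: "open S" and w: "wgr_on S u' g'"
    and ae: "AE x in lborel. x \<in> S \<longrightarrow> u x = u' x" "AE x in lborel. x \<in> S \<longrightarrow> g x = g' x"
  shows "has_weak_grad S u g"
  unfolding has_weak_grad_def
proof (intro conjI ballI)
  have L: "L2 u'" "L2 g'" using w by (auto simp: wgr_on_def)
  note [measurable] = L2_measurable[OF L(1)] L2_measurable[OF L(2)]
  show "locally_integrable S u" "locally_integrable S g" by (rule L2_locally_integrable[OF S L(1) ae(1)], rule L2_locally_integrable[OF S L(2) ae(2)])
  fix \<phi> :: "'a \<Rightarrow> real" and i :: 'a assume p: "\<phi> \<in> test_functions S" "i \<in> Basis"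
  note [measurable] = L2_measurable[OF test_L2[OF p(1)]] L2_measurable[OF test_L2[OF test_partial[OF p]]]
  have "(\<integral>x. u x * frechet_derivative \<phi> (at x) i \<partial>lebesgue_on S) = (\<integral>x. u' x * frechet_derivative \<phi> (at x) i \<partial>lborel)"
    using ae(1) w by (intro integral_leb_on[OF S]) (auto simp: wgr_on_def)
  also have "\<dots> = - (\<integral>x. (g' x \<bullet> i) * \<phi> x \<partial>lborel)" using w p by (simp add: wgr_on_def)
  also have "(\<integral>x. (g' x \<bullet> i) * \<phi> x \<partial>lborel) = (\<integral>x. (g x \<bullet> i) * \<phi> x \<partial>lebesgue_on S)"
    using ae(2) w by (intro integral_leb_on[OF S, symmetric]) (auto simp: wgr_on_def)
  finally show "(\<integral>x. u x * frechet_derivative \<phi> (at x) i \<partial>lebesgue_on S) = - (\<integral>x. (g x \<bullet> i) * \<phi> x \<partial>lebesgue_on S)" .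
qed

lemma H1_of_wgr_on:
  assumes S: "open S" and w: "wgr_on S u' g'" and ae: "AE x in lborel. x \<in> S \<longrightarrow> u x = u' x"
  shows "u \<in> H1 S" "AE x in lborel. x \<in> S \<longrightarrow> weak_grad S u x = g' x"
proof -
  have L: "L2 u'" "L2 g'" "\<forall>x. x \<notin> S \<longrightarrow> u' x = 0" "\<forall>x. x \<notin> S \<longrightarrow> g' x = 0" using w by (auto simp: wgr_on_def)
  have h: "has_weak_grad S u g'" by (rule has_weak_grad_of_wgr_on[OF S w ae]) simp
  have "in_Lp 2 S u" using in_Lp2_iff[OF S L2_measurable[OF L(1)] L(3) ae] L by simp
  moreover have "in_Lp 2 S g'" using in_Lp2_iff[OF S L2_measurable[OF L(2)] L(4), of g'] L by simp
  ultimately show "u \<in> H1 S" using h by (auto simp: H1_def)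
  show "AE x in lborel. x \<in> S \<longrightarrow> weak_grad S u x = g' x" using weak_grad_eq[OF S h] S by (simp add: AE_leb_on)
qed

lemma wgr_on_of_H1:
  assumes S: "open S" and u: "u \<in> H1 S"
  shows "\<exists>u' g'. wgr_on S u' g' \<and> (AE x in lborel. x \<in> S \<longrightarrow> u x = u' x)
     \<and> (AE x in lborel. x \<in> S \<longrightarrow> weak_grad S u x = g' x)"
proof -
  obtain g where g: "has_weak_grad S u g" "in_Lp 2 S g" and u2: "in_Lp 2 S u" using u by (auto simp: H1_def)
  obtain u' where u': "u' \<in> borel_measurable borel" "AE x in lborel. x \<in> S \<longrightarrow> u x = u' x" "\<forall>x. x \<notin> S \<longrightarrow> u' x = 0"
    using borel_representative[OF S, of u] u2 by (auto simp: in_Lp_def)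
  obtain g' where g': "g' \<in> borel_measurable borel" "AE x in lborel. x \<in> S \<longrightarrow> g x = g' x" "\<forall>x. x \<notin> S \<longrightarrow> g' x = 0"
    using borel_representative[OF S, of g] g(2) by (auto simp: in_Lp_def)
  have L: "L2 u'" "L2 g'" using in_Lp2_iff[OF S u'(1,3,2)] in_Lp2_iff[OF S g'(1,3,2)] u2 g(2) by auto
  note [measurable] = u'(1) g'(1)
  have "(\<integral>x. u' x * frechet_derivative \<phi> (at x) i \<partial>lborel) = - (\<integral>x. (g' x \<bullet> i) * \<phi> x \<partial>lborel)"
    if p: "\<phi> \<in> test_functions S" "i \<in> Basis" for \<phi> i
  proof -
    note [measurable] = L2_measurable[OF test_L2[OF p(1)]] L2_measurable[OF test_L2[OF test_partial[OF p]]]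
    have "(\<integral>x. u' x * frechet_derivative \<phi> (at x) i \<partial>lborel) = (\<integral>x. u x * frechet_derivative \<phi> (at x) i \<partial>lebesgue_on S)"
      using u' by (intro integral_leb_on[OF S, symmetric]) auto
    also have "\<dots> = - (\<integral>x. (g x \<bullet> i) * \<phi> x \<partial>lebesgue_on S)" using g(1) p by (simp add: has_weak_grad_def)
    also have "(\<integral>x. (g x \<bullet> i) * \<phi> x \<partial>lebesgue_on S) = (\<integral>x. (g' x \<bullet> i) * \<phi> x \<partial>lborel)"
      using g' by (intro integral_leb_on[OF S]) auto
    finally show ?thesis .
  qed
  then have w: "wgr_on S u' g'" using L u'(3) g'(3) by (simp add: wgr_on_def)
  have "AE x in lborel. x \<in> S \<longrightarrow> weak_grad S u x = g' x"
    using weak_grad_eq[OF S g(1)] g'(2) S unfolding AE_leb_on[OF S] by auto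
  then show ?thesis using w u'(2) by blast
qed

lemma wgr_on_UNIV: "wgr_on UNIV u g \<longleftrightarrow> wgr u g"
  by (simp add: wgr_on_def wgr_def)

lemma wgr_on_test: "\<phi> \<in> test_functions S \<Longrightarrow> wgr_on S \<phi> (grad \<phi>)"
  using wgr_test[OF test_UNIV] by (auto simp: wgr_on_def wgr_def test_outside test_grad_outside test_UNIV)

lemma wgr_on_diff:
  assumes "wgr_on S u g" "wgr_on S v h" shows "wgr_on S (\<lambda>x. u x - v x) (\<lambda>x. g x - h x)"
  unfolding wgr_on_def
proof (intro conjI ballI)
  have L': "L2 u" "L2 g" "L2 v" "L2 h" using assms by (auto simp: wgr_on_def)
  show "L2 (\<lambda>x. u x - v x)" "L2 (\<lambda>x. g x - h x)" by (intro L2_diff L')+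
  fix \<phi> :: "'a \<Rightarrow> real" and i :: 'a assume p: "\<phi> \<in> test_functions S" "i \<in> Basis"
  note L = L' test_L2[OF p(1)] test_L2[OF test_partial[OF p]]
  note I = L2_mult_integrable[OF L(1) L(6)] L2_mult_integrable[OF L(3) L(6)]
    L2_mult_integrable[OF L2_inner[OF L(2), of i] L(5)] L2_mult_integrable[OF L2_inner[OF L(4), of i] L(5)]
  show "(\<integral>x. (u x - v x) * frechet_derivative \<phi> (at x) i \<partial>lborel) = - (\<integral>x. ((g x - h x) \<bullet> i) * \<phi> x \<partial>lborel)"
    using assms p I by (simp add: wgr_on_def left_diff_distrib inner_diff_left)
qed (use assms in \<open>auto simp: wgr_on_def\<close>)

lemma H1_norm_wgr_on:
  assumes S: "open S" and w: "wgr_on S u' g'" and ae: "AE x in lborel. x \<in> S \<longrightarrow> u x = u' x"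
  shows "(H1_norm S u)\<^sup>2 = n2 g' + n2 u'"
proof -
  have L: "L2 u'" "L2 g'" and z: "\<And>x. x \<notin> S \<Longrightarrow> u' x = 0" "\<And>x. x \<notin> S \<Longrightarrow> g' x = 0" using w by (auto simp: wgr_on_def)
  note [measurable] = L2_measurable[OF L(1)] L2_measurable[OF L(2)]
  have "(\<integral>x. (norm (weak_grad S u x))\<^sup>2 + (u x)\<^sup>2 \<partial>lebesgue_on S) = (\<integral>x. (norm (g' x))\<^sup>2 + (norm (u' x))\<^sup>2 \<partial>lborel)"
  proof (rule integral_leb_on[OF S])
    show "AE x in lborel. x \<in> S \<longrightarrow> (norm (weak_grad S u x))\<^sup>2 + (u x)\<^sup>2 = (norm (g' x))\<^sup>2 + (norm (u' x))\<^sup>2"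
      using ae H1_of_wgr_on(2)[OF S w ae] by eventually_elim auto
  qed (use z in auto)
  also have "\<dots> = n2 g' + n2 u'" unfolding n2_def
    by (rule Bochner_Integration.integral_add) (intro L2_integrable L)+
  finally show ?thesis by (simp add: H1_norm_def)
qed

lemma H10_of_H0:
  assumes S: "open S" and H: "H0 S u g" and ae: "AE x in lborel. x \<in> S \<longrightarrow> v x = u x"
  shows "v \<in> H10 S" "AE x in lborel. x \<in> S \<longrightarrow> weak_grad S v x = g x"
proof -
  obtain \<Phi> where P: "\<And>n::nat. \<Phi> n \<in> test_functions S" "(\<lambda>n. n2 (\<lambda>x. \<Phi> n x - u x)) \<longlonglongrightarrow> 0" "(\<lambda>n. n2 (\<lambda>x. grad (\<Phi> n) x - g x)) \<longlonglongrightarrow> 0"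
    using H unfolding H0_def by blast
  have [measurable]: "S \<in> sets borel" using S by simp
  note L = H0_L2[OF H]
  note [measurable] = L2_measurable[OF L(1)] L2_measurable[OF L(2)]
  \<comment> \<open>Members of \<open>H0\<close> vanish outside \<open>S\<close> only almost
    everywhere, whereas \<open>wgr_on\<close> demands it at every point.\<close>
  let ?u = "\<lambda>x. indicator S x * u x" and ?g = "\<lambda>x. indicator S x *\<^sub>R g x"
  have aeu: "AE x in lborel. u x = ?u x" using H0_outside(1)[OF H S] by eventually_elim (auto simp: indicator_def)
  have aeg: "AE x in lborel. g x = ?g x" using H0_outside(2)[OF H S] by eventually_elim (auto simp: indicator_def)
  have Lu: "L2 ?u" by (rule L2_cong_AE[OF L(1) _ aeu]) measurable
  have Lg: "L2 ?g" by (rule L2_cong_AE[OF L(2) _ aeg]) measurable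
  have w: "wgr_on S ?u ?g"
    unfolding wgr_on_def
  proof (intro conjI ballI Lu Lg)
    fix \<phi> :: "'a \<Rightarrow> real" and i :: 'a assume p: "\<phi> \<in> test_functions S" "i \<in> Basis"
    note [measurable] = L2_measurable[OF test_L2[OF p(1)]] L2_measurable[OF test_L2[OF test_partial[OF p]]]
    have "(\<integral>x. ?u x * frechet_derivative \<phi> (at x) i \<partial>lborel) = (\<integral>x. u x * frechet_derivative \<phi> (at x) i \<partial>lborel)"
      using aeu by (intro integral_cong_AE) auto
    also have "\<dots> = - (\<integral>x. (g x \<bullet> i) * \<phi> x \<partial>lborel)" using H0_wgr[OF H] test_UNIV[OF p(1)] p(2) by (simp add: wgr_def)
    also have "(\<integral>x. (g x \<bullet> i) * \<phi> x \<partial>lborel) = (\<integral>x. (?g x \<bullet> i) * \<phi> x \<partial>lborel)"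
    proof (rule integral_cong_AE)
      show "AE x in lborel. (g x \<bullet> i) * \<phi> x = (?g x \<bullet> i) * \<phi> x" using aeg by eventually_elim metis
    qed auto
    finally show "(\<integral>x. ?u x * frechet_derivative \<phi> (at x) i \<partial>lborel) = - (\<integral>x. (?g x \<bullet> i) * \<phi> x \<partial>lborel)" .
  qed auto
  have ae': "AE x in lborel. x \<in> S \<longrightarrow> v x = ?u x" using ae by eventually_elim auto
  note H1 = H1_of_wgr_on[OF S w ae']
  show "AE x in lborel. x \<in> S \<longrightarrow> weak_grad S v x = g x" using H1(2) by eventually_elim auto
  have nrm: "(H1_norm S (\<lambda>x. v x - \<Phi> n x))\<^sup>2 = n2 (\<lambda>x. grad (\<Phi> n) x - g x) + n2 (\<lambda>x. \<Phi> n x - u x)" for n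
  proof -
    have "(H1_norm S (\<lambda>x. v x - \<Phi> n x))\<^sup>2 = n2 (\<lambda>x. ?g x - grad (\<Phi> n) x) + n2 (\<lambda>x. ?u x - \<Phi> n x)"
      by (rule H1_norm_wgr_on[OF S wgr_on_diff[OF w wgr_on_test[OF P(1)]]]) (use ae' in \<open>auto elim!: eventually_mono\<close>)
    also have "n2 (\<lambda>x. ?g x - grad (\<Phi> n) x) = n2 (\<lambda>x. g x - grad (\<Phi> n) x)"
      using aeg L2_measurable[OF test_grad_L2[OF P(1)[of n]]] by (intro n2_cong_AE) (auto elim!: eventually_mono)
    also have "n2 (\<lambda>x. ?u x - \<Phi> n x) = n2 (\<lambda>x. u x - \<Phi> n x)"
      using aeu L2_measurable[OF test_L2[OF P(1)[of n]]] by (intro n2_cong_AE) (auto elim!: eventually_mono)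
    finally show ?thesis by (simp only: n2_minus_commute[of g] n2_minus_commute[of u])
  qed
  have "\<exists>\<phi>\<in>test_functions S. H1_norm S (\<lambda>x. v x - \<phi> x) < e" if e: "e > 0" for e
  proof -
    have "(\<lambda>n. n2 (\<lambda>x. grad (\<Phi> n) x - g x) + n2 (\<lambda>x. \<Phi> n x - u x)) \<longlonglongrightarrow> 0 + 0" by (intro tendsto_add P)
    then have "\<forall>\<^sub>F n in sequentially. n2 (\<lambda>x. grad (\<Phi> n) x - g x) + n2 (\<lambda>x. \<Phi> n x - u x) < e\<^sup>2"
      using e by (intro order_tendstoD(2)) auto
    then obtain n where "n2 (\<lambda>x. grad (\<Phi> n) x - g x) + n2 (\<lambda>x. \<Phi> n x - u x) < e\<^sup>2" by (meson eventually_sequentially order_refl)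
    then have "(H1_norm S (\<lambda>x. v x - \<Phi> n x))\<^sup>2 < e\<^sup>2" unfolding nrm .
    then have "H1_norm S (\<lambda>x. v x - \<Phi> n x) < e" using e by (intro power2_less_imp_less[of _ e]) auto
    then show ?thesis using P(1) by blast
  qed
  then show "v \<in> H10 S" using H1(1) by (simp add: H10_def)
qed

lemma H0_of_H10:
  assumes S: "open S" and u: "u \<in> H10 S"
  shows "\<exists>u' g'. H0 S u' g' \<and> (AE x in lborel. x \<in> S \<longrightarrow> u x = u' x) \<and> (AE x in lborel. x \<in> S \<longrightarrow> weak_grad S u x = g' x)"
proof -
  have "u \<in> H1 S" using u by (simp add: H10_def)
  from wgr_on_of_H1[OF S this] obtain u' g' where w: "wgr_on S u' g'" and ae: "AE x in lborel. x \<in> S \<longrightarrow> u x = u' x"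
    and aeg: "AE x in lborel. x \<in> S \<longrightarrow> weak_grad S u x = g' x" by blast
  have "\<forall>n. \<exists>\<phi>\<in>test_functions S. H1_norm S (\<lambda>x. u x - \<phi> x) < inverse (real (Suc n))"
    using u by (simp add: H10_def)
  then obtain \<Phi> where P: "\<And>n. \<Phi> n \<in> test_functions S" "\<And>n. H1_norm S (\<lambda>x. u x - \<Phi> n x) < inverse (real (Suc n))" by metis
  have nrm: "(H1_norm S (\<lambda>x. u x - \<Phi> n x))\<^sup>2 = n2 (\<lambda>x. g' x - grad (\<Phi> n) x) + n2 (\<lambda>x. u' x - \<Phi> n x)" for n
    by (rule H1_norm_wgr_on[OF S wgr_on_diff[OF w wgr_on_test[OF P(1)]]]) (use ae in \<open>auto elim!: eventually_mono\<close>)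
  have b: "n2 (\<lambda>x. \<Phi> n x - u' x) \<le> (inverse (real (Suc n)))\<^sup>2" "n2 (\<lambda>x. grad (\<Phi> n) x - g' x) \<le> (inverse (real (Suc n)))\<^sup>2" for n
  proof -
    have "0 \<le> H1_norm S (\<lambda>x. u x - \<Phi> n x)" unfolding H1_norm_def by (intro real_sqrt_ge_zero Bochner_Integration.integral_nonneg) auto
    then have "(H1_norm S (\<lambda>x. u x - \<Phi> n x))\<^sup>2 \<le> (inverse (real (Suc n)))\<^sup>2" using P(2)[of n] by (intro power_mono) auto
    then have *: "n2 (\<lambda>x. g' x - grad (\<Phi> n) x) + n2 (\<lambda>x. u' x - \<Phi> n x) \<le> (inverse (real (Suc n)))\<^sup>2" unfolding nrm .
    show "n2 (\<lambda>x. \<Phi> n x - u' x) \<le> (inverse (real (Suc n)))\<^sup>2"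
      using * n2_nonneg[of "\<lambda>x. g' x - grad (\<Phi> n) x"] by (simp only: n2_minus_commute[of "\<Phi> n"])
    show "n2 (\<lambda>x. grad (\<Phi> n) x - g' x) \<le> (inverse (real (Suc n)))\<^sup>2"
      using * n2_nonneg[of "\<lambda>x. u' x - \<Phi> n x"] by (simp only: n2_minus_commute[of "grad (\<Phi> n)"])
  qed
  have l: "(\<lambda>n. (inverse (real (Suc n)))\<^sup>2) \<longlonglongrightarrow> 0" using tendsto_power[OF LIMSEQ_inverse_real_of_nat, of 2] by simp
  have "(\<lambda>n. n2 (\<lambda>x. \<Phi> n x - u' x)) \<longlonglongrightarrow> 0" "(\<lambda>n. n2 (\<lambda>x. grad (\<Phi> n) x - g' x)) \<longlonglongrightarrow> 0"
    by (rule Lim_null_comparison[OF always_eventually l], use b in simp)+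
  moreover have "L2 u'" "L2 g'" using w by (auto simp: wgr_on_def)
  ultimately have "H0 S u' g'" using P(1) unfolding H0_def by (intro conjI exI[of _ \<Phi>]) auto
  with ae aeg show ?thesis by blast
qed

section \<open>The strict inequality between the two constants\<close>

text \<open>Dividing by the common mean \<open>w\<close> and taking logarithms turns equality into
  equality in \<open>ln s \<le> s - 1\<close> at both \<open>x / w\<close> and \<open>y / w\<close>,
  hence both are 1.\<close>

lemma amgm_equality:
  fixes x y :: real
  assumes ab: "0 < \<alpha>" "0 < \<beta>" "\<beta> + \<alpha> = 1" and xy: "0 < x" "0 < y"
    and eq: "x powr \<beta> * y powr \<alpha> = \<beta> * x + \<alpha> * y"
  shows "x = y"
proof -
  define w where "w = \<beta> * x + \<alpha> * y"
  have w: "w > 0" unfolding w_def using ab xy by (intro add_pos_pos mult_pos_pos)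
  have "ln w = \<beta> * ln x + \<alpha> * ln y"
    unfolding w_def eq[symmetric] using xy by (simp add: ln_mult ln_powr)
  moreover have "\<beta> * (ln x - ln w) + \<alpha> * (ln y - ln w) = (\<beta> * ln x + \<alpha> * ln y) - (\<beta> + \<alpha>) * ln w"
    by (simp add: algebra_simps)
  ultimately have "\<beta> * (ln x - ln w) + \<alpha> * (ln y - ln w) = 0" using ab(3) by simp
  then have s0: "\<beta> * ln (x / w) + \<alpha> * ln (y / w) = 0" using xy w by (simp add: ln_div)
  have "\<beta> * (x / w - 1) + \<alpha> * (y / w - 1) = (\<beta> * x + \<alpha> * y) / w - (\<beta> + \<alpha>)" by (simp add: algebra_simps add_divide_distrib)
  also have "\<dots> = 0" using w ab(3) by (simp add: w_def)
  finally have s1: "\<beta> * (x / w - 1) + \<alpha> * (y / w - 1) = 0" .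
  have i: "ln (x / w) \<le> x / w - 1" "ln (y / w) \<le> y / w - 1" using xy w by (auto intro: ln_le_minus_one)
  have "\<beta> * (x / w - 1 - ln (x / w)) + \<alpha> * (y / w - 1 - ln (y / w)) = 0" using s0 s1 by (simp add: algebra_simps)
  moreover have "0 \<le> \<beta> * (x / w - 1 - ln (x / w))" "0 \<le> \<alpha> * (y / w - 1 - ln (y / w))" using i ab by auto
  ultimately have "\<beta> * (x / w - 1 - ln (x / w)) = 0" "\<alpha> * (y / w - 1 - ln (y / w)) = 0" by linarith+
  then have l: "ln (x / w) = x / w - 1" "ln (y / w) = y / w - 1" using ab by auto
  have "x / w = 1" by (rule ln_eq_minus_one[OF divide_pos_pos[OF xy(1) w] l(1)])
  moreover have "y / w = 1" by (rule ln_eq_minus_one[OF divide_pos_pos[OF xy(2) w] l(2)])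
  ultimately show ?thesis using w by simp
qed

text \<open>Young's inequality bounds the right side below by a constant times t, since the weights
  make the powers of t combine to the first. The hypothesis on \<open>lam\<close> says precisely
  that this constant exceeds \<open>l\<close>.\<close>

lemma singular_superlinear:
  fixes l lam t \<gamma> p :: real
  assumes g: "0 < \<gamma>" "1 < p" and l: "0 < l" and t: "0 < t"
    and lam: "lam > l powr ((p + \<gamma>) / (p - 1)) * ((\<gamma> + 1) / (p - 1)) powr ((\<gamma> + 1) / (p - 1))
                  * ((p - 1) / (p + \<gamma>)) powr ((p + \<gamma>) / (p - 1))"
  shows "l * t < lam * t powr (- \<gamma>) + t powr p"
proof -
  \<comment> \<open>The weights solve \<open>\<alpha> + \<beta> = 1\<close> and
    \<open>- \<gamma> * \<alpha> + p * \<beta> = 1\<close>.\<close>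
  define \<alpha> where "\<alpha> = (p - 1) / (p + \<gamma>)"
  define \<beta> where "\<beta> = (\<gamma> + 1) / (p + \<gamma>)"
  have ab: "0 < \<alpha>" "0 < \<beta>" "\<alpha> + \<beta> = 1" using g by (auto simp: \<alpha>_def \<beta>_def add_divide_distrib[symmetric])
  have r: "(p + \<gamma>) / (p - 1) = 1 / \<alpha>" "(\<gamma> + 1) / (p - 1) = \<beta> / \<alpha>" using g by (auto simp: \<alpha>_def \<beta>_def)
  have one: "1 / \<alpha> = 1 + \<beta> / \<alpha>" using ab by (simp add: field_simps)
  have E: "l powr (1 / \<alpha>) * (\<beta> / \<alpha>) powr (\<beta> / \<alpha>) * \<alpha> powr (1 / \<alpha>)
      = \<alpha> * (l powr (1 / \<alpha>) * \<beta> powr (\<beta> / \<alpha>))"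
    using ab unfolding one by (simp add: powr_divide powr_add)
  have lam': "\<alpha> * (l powr (1 / \<alpha>) * \<beta> powr (\<beta> / \<alpha>)) < lam"
    using lam unfolding r \<alpha>_def[symmetric] E .
  have lam0: "0 < lam" using lam' ab l by (intro le_less_trans[OF _ lam']) auto
  have "(l powr (1 / \<alpha>) * \<beta> powr (\<beta> / \<alpha>)) < lam / \<alpha>" using lam' ab by (simp add: field_simps)
  then have "(l powr (1 / \<alpha>) * \<beta> powr (\<beta> / \<alpha>)) powr \<alpha> < (lam / \<alpha>) powr \<alpha>"
    using ab l by (intro powr_less_mono2) auto
  moreover have "(l powr (1 / \<alpha>) * \<beta> powr (\<beta> / \<alpha>)) powr \<alpha> = l * \<beta> powr \<beta>"
    using ab l by (simp add: powr_mult powr_powr)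
  ultimately have k: "l < (lam / \<alpha>) powr \<alpha> / \<beta> powr \<beta>" using ab by (simp add: field_simps)
  have "(lam * t powr (- \<gamma>) / \<alpha>) powr \<alpha> * (t powr p / \<beta>) powr \<beta> \<le> \<alpha> * (lam * t powr (- \<gamma>) / \<alpha>) + \<beta> * (t powr p / \<beta>)"
    using ab lam0 t by (intro Youngs_inequality_0) auto
  also have "\<dots> = lam * t powr (- \<gamma>) + t powr p" using ab by simp
  finally have y: "(lam * t powr (- \<gamma>) / \<alpha>) powr \<alpha> * (t powr p / \<beta>) powr \<beta> \<le> lam * t powr (- \<gamma>) + t powr p" .
  have "- \<gamma> * \<alpha> + p * \<beta> = (- \<gamma> * (p - 1) + p * (\<gamma> + 1)) / (p + \<gamma>)"
    unfolding \<alpha>_def \<beta>_def add_divide_distrib[of "- \<gamma> * (p - 1)"] by simp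
  also have "- \<gamma> * (p - 1) + p * (\<gamma> + 1) = p + \<gamma>" by (simp add: algebra_simps)
  finally have e: "- \<gamma> * \<alpha> + p * \<beta> = 1" using g by simp
  have "(lam * t powr (- \<gamma>) / \<alpha>) powr \<alpha> * (t powr p / \<beta>) powr \<beta>
      = (lam / \<alpha>) powr \<alpha> / \<beta> powr \<beta> * (t powr (- \<gamma> * \<alpha>) * t powr (p * \<beta>))"
    using ab lam0 t by (simp add: powr_mult powr_divide powr_powr)
  also have "t powr (- \<gamma> * \<alpha>) * t powr (p * \<beta>) = t" unfolding powr_add[symmetric] e using t by simp
  finally have "(lam / \<alpha>) powr \<alpha> / \<beta> powr \<beta> * t \<le> lam * t powr (- \<gamma>) + t powr p" using y by simp
  moreover have "l * t < (lam / \<alpha>) powr \<alpha> / \<beta> powr \<beta> * t" using k t by (intro mult_strict_right_mono)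
  ultimately show ?thesis by linarith
qed

lemma wgr_cong_AE:
  assumes w: "wgr u g" and u': "u' \<in> borel_measurable borel" and ae: "AE x in lborel. u x = u' x"
  shows "wgr u' g"
  unfolding wgr_def
proof (intro conjI ballI)
  show "L2 u'" by (rule L2_cong_AE[OF wgr_L2(1)[OF w] u' ae])
  show "L2 g" by (rule wgr_L2(2)[OF w])
  fix \<phi> :: "'a \<Rightarrow> real" and i :: 'a assume p: "\<phi> \<in> test_functions UNIV" "i \<in> Basis"
  note [measurable] = L2_measurable[OF test_L2[OF test_partial[OF p]]] u' L2_measurable[OF wgr_L2(1)[OF w]]
  have "(\<integral>x. u' x * frechet_derivative \<phi> (at x) i \<partial>lborel) = (\<integral>x. u x * frechet_derivative \<phi> (at x) i \<partial>lborel)"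
    using ae by (intro integral_cong_AE) auto
  then show "(\<integral>x. u' x * frechet_derivative \<phi> (at x) i \<partial>lborel) = - (\<integral>x. (g x \<bullet> i) * \<phi> x \<partial>lborel)"
    using w p by (simp add: wgr_def)
qed

text \<open>For a function with values in \<open>{0, \<kappa>}\<close> the squared translation distance is subadditive in the
  translation, so a quadratic bound forces it to vanish.\<close>

lemma two_valued_zero:
  fixes u :: "'a::euclidean_space \<Rightarrow> real"
  assumes w: "wgr u g" and two: "AE x in lborel. u x = 0 \<or> u x = \<kappa>"
    and out: "AE x in lborel. x \<notin> cball 0 R \<longrightarrow> u x = 0"
  shows "AE x in lborel. u x = 0"
proof -
  note [measurable] = L2_measurable[OF wgr_L2(1)[OF w]]
  \<comment> \<open>A representative that takes only the two values, and vanishes off the ball, at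
    every point; pointwise case distinctions and the disjointness of translates then hold without
    exceptional sets.\<close>
  define v where "v x = (if x \<in> cball 0 R \<and> u x \<noteq> 0 then \<kappa> else 0)" for x
  have vm: "v \<in> borel_measurable borel" unfolding v_def by measurable
  have ae: "AE x in lborel. u x = v x" using two out by eventually_elim (auto simp: v_def)
  have wv: "wgr v g" by (rule wgr_cong_AE[OF w vm ae])
  note L = wgr_L2(1)[OF wv]
  have v2: "v x = 0 \<or> v x = \<kappa>" for x by (simp add: v_def)
  define G where "G h = n2 (\<lambda>x. v (x + h) - v x)" for h
  have Gq: "G h \<le> (norm h)\<^sup>2 * n2 g" for h unfolding G_def by (rule wgr_translate[OF wv])
  \<comment> \<open>If the outer two of three values differ, the middle one agrees with exactly one
    of them, so the squared differences satisfy the triangle inequality.\<close>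
  have add: "G (h + k) \<le> G h + G k" for h k
  proof -
    have L1: "L2 (\<lambda>x. v (x + k + h) - v (x + k))" using L2_shift[OF L2_diff[OF L2_shift[OF L, of h] L], of k] .
    have L2': "L2 (\<lambda>x. v (x + k) - v x)" by (intro L2_diff L2_shift L)
    have "G (h + k) \<le> (\<integral>x. (norm (v (x + k + h) - v (x + k)))\<^sup>2 + (norm (v (x + k) - v x))\<^sup>2 \<partial>lborel)"
      unfolding G_def n2_def
    proof (rule integral_mono)
      show "integrable lborel (\<lambda>x. (norm (v (x + (h + k)) - v x))\<^sup>2)" by (intro L2_integrable L2_diff L2_shift L)
      show "integrable lborel (\<lambda>x. (norm (v (x + k + h) - v (x + k)))\<^sup>2 + (norm (v (x + k) - v x))\<^sup>2)"
        by (intro Bochner_Integration.integrable_add L2_integrable L1 L2')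
      fix x
      have e: "x + (h + k) = x + k + h" by (simp add: ac_simps)
      show "(norm (v (x + (h + k)) - v x))\<^sup>2 \<le> (norm (v (x + k + h) - v (x + k)))\<^sup>2 + (norm (v (x + k) - v x))\<^sup>2"
        unfolding e using v2[of x] v2[of "x + k"] v2[of "x + k + h"] by auto
    qed
    also have "\<dots> = n2 (\<lambda>x. v (x + k + h) - v (x + k)) + n2 (\<lambda>x. v (x + k) - v x)"
      unfolding n2_def by (intro Bochner_Integration.integral_add L2_integrable L1 L2')
    also have "n2 (\<lambda>x. v (x + k + h) - v (x + k)) = G h"
      unfolding G_def using n2_shift[OF L2_diff[OF L2_shift[OF L, of h] L], of k] .
    finally show ?thesis by (simp add: G_def)
  qed
  have mult: "G (real n *\<^sub>R h) \<le> real n * G h" for n h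
  proof (induction n)
    case 0 show ?case by (simp add: G_def n2_def)
  next
    case (Suc n)
    have "G (h + real n *\<^sub>R h) \<le> G h + G (real n *\<^sub>R h)" by (rule add)
    then show ?case using Suc by (simp add: algebra_simps)
  qed
  obtain i :: 'a where i: "i \<in> Basis" using nonempty_Basis by blast
  \<comment> \<open>Longer than the diameter of the ball, so the translate and the original have
    disjoint supports; the absolute value covers a negative \<open>R\<close>.\<close>
  define H where "H = (2 * \<bar>R\<bar> + 1) *\<^sub>R i"
  have nH: "norm H = 2 * \<bar>R\<bar> + 1" using i by (simp add: H_def)
  \<comment> \<open>Splitting the shift into n equal steps gives n times a bound of order
    1/n^2.\<close>
  have b: "G H \<le> (norm H)\<^sup>2 * n2 g * inverse (real (Suc n))" for n
  proof -
    have "G H = G (real (Suc n) *\<^sub>R (inverse (real (Suc n)) *\<^sub>R H))" by simp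
    also have "\<dots> \<le> real (Suc n) * G (inverse (real (Suc n)) *\<^sub>R H)" by (rule mult)
    also have "\<dots> \<le> real (Suc n) * ((norm (inverse (real (Suc n)) *\<^sub>R H))\<^sup>2 * n2 g)"
      by (intro mult_left_mono Gq) simp
    also have "\<dots> = (norm H)\<^sup>2 * n2 g * inverse (real (Suc n))"
      by (simp add: power_mult_distrib power2_eq_square)
    finally show ?thesis .
  qed
  have "(\<lambda>n. (norm H)\<^sup>2 * n2 g * inverse (real (Suc n))) \<longlonglongrightarrow> (norm H)\<^sup>2 * n2 g * 0"
    by (intro tendsto_intros LIMSEQ_inverse_real_of_nat)
  then have "G H \<le> 0" using b by (intro LIMSEQ_le_const) auto
  moreover have "G H = 2 * n2 v"
  proof -
    have "v (x + H) * v x = 0" for x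
    proof (rule ccontr)
      assume "v (x + H) * v x \<noteq> 0"
      then have "norm x \<le> R" "norm (x + H) \<le> R" by (auto simp: v_def split: if_splits)
      then have "norm H \<le> 2 * R" using norm_triangle_ineq4[of "x + H" x] by simp
      then show False using nH by simp
    qed
    then have "(\<lambda>x. v (x + H) \<bullet> v x) = (\<lambda>x. 0)" by auto
    then show ?thesis unfolding G_def n2_diff[OF L2_shift[OF L] L] by (simp only: n2_shift[OF L]) simp
  qed
  ultimately have "n2 v \<le> 0" by simp
  from n2_zero_AE[OF L this] ae show ?thesis by eventually_elim simp
qed

context dirichlet
begin

lemma ground_nonzero: assumes "is_ground u g" shows "\<not> (AE x in lborel. x \<in> \<Omega> \<longrightarrow> u x = 0)"
proof
  assume "AE x in lborel. x \<in> \<Omega> \<longrightarrow> u x = 0"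
  then have "AE y in lborel. m y * u y * u y = 0" by eventually_elim (use mout in auto)
  then have "wint m u u = 0" unfolding wint_def by (rule integral_eq_zero_AE)
  then show False using assms by (simp add: is_ground_def)
qed

lemma int_m_powr_pos:
  assumes G: "is_ground u g" and i: "integrable lborel (\<lambda>x. m x * \<bar>u x\<bar> powr s)"
  shows "0 < (\<integral>x. m x * \<bar>u x\<bar> powr s \<partial>lborel)"
proof (rule ccontr)
  assume n: "\<not> ?thesis"
  have "0 \<le> (\<integral>x. m x * \<bar>u x\<bar> powr s \<partial>lborel)" by (intro Bochner_Integration.integral_nonneg) (simp add: m0)
  then have "(\<integral>x. m x * \<bar>u x\<bar> powr s \<partial>lborel) = 0" using n by simp
  then have "AE x in lborel. m x * \<bar>u x\<bar> powr s = 0"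
    using i by (subst (asm) integral_nonneg_eq_0_iff_AE) (auto simp: m0)
  then have "AE x in lborel. x \<in> \<Omega> \<longrightarrow> u x = 0"
    by eventually_elim (use mpos in fastforce)
  then show False using ground_nonzero[OF G] by simp
qed

text \<open>On the bounded set carrying \<open>m\<close>, t^s \<le> 1 + t^2 suffices. The exponent
  \<open>p + 1\<close> exceeds 2 and is left to \<open>sobolev\<close>.\<close>

lemma int_m_powr_low:
  assumes u: "L2 u" and s: "0 \<le> s" "s \<le> 2"
  shows "integrable lborel (\<lambda>x. m x * \<bar>u x\<bar> powr s)"
proof (rule Bochner_Integration.integrable_bound)
  show "integrable lborel (\<lambda>x. K * (indicator (cball 0 R) x + (norm (u x))\<^sup>2))"
    by (intro integrable_mult_right Bochner_Integration.integrable_add L2_integrable u integrable_real_indicator) auto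
  show "(\<lambda>x. m x * \<bar>u x\<bar> powr s) \<in> borel_measurable lborel" using mm L2_measurable[OF u] by measurable
  show "AE x in lborel. norm (m x * \<bar>u x\<bar> powr s) \<le> norm (K * (indicator (cball 0 R) x + (norm (u x))\<^sup>2))"
  proof (rule AE_I2)
    fix x
    show "norm (m x * \<bar>u x\<bar> powr s) \<le> norm (K * (indicator (cball 0 R) x + (norm (u x))\<^sup>2))"
    proof (cases "x \<in> \<Omega>")
      case True
      have "\<bar>u x\<bar> powr s \<le> 1 + (u x)\<^sup>2"
      proof (cases "\<bar>u x\<bar> \<le> 1")
        case True
        then have "\<bar>u x\<bar> powr s \<le> 1" using s by (simp add: powr_le1)
        then show ?thesis by (simp add: add_increasing2)
      next
        case False
        then have "\<bar>u x\<bar> powr s \<le> \<bar>u x\<bar> powr 2" using s by (intro powr_mono) auto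
        also have "\<dots> = (u x)\<^sup>2" using False by simp
        finally show ?thesis by simp
      qed
      then have "m x * \<bar>u x\<bar> powr s \<le> K * (1 + (u x)\<^sup>2)" using m0[of x] mK[of x] K0 by (intro mult_mono) auto
      moreover have "0 \<le> m x * \<bar>u x\<bar> powr s" using m0[of x] by simp
      moreover have "x \<in> cball 0 R" using True sub by blast
      ultimately show ?thesis by simp
    qed (simp add: mout)
  qed
qed

text \<open>The normalisation \<open>wint m u u = 1\<close> is split by Hoelder between the exponents \<open>p + 1\<close> and \<open>1 - \<gamma>\<close>. Equality
  would make \<open>u\<close> take only one nonzero value almost everywhere.\<close>

lemma ground_holder_strict:
  assumes G: "is_ground u g" and \<gamma>: "0 < \<gamma>" "\<gamma> < 1" and p: "1 < p"
    and i: "integrable lborel (\<lambda>x. m x * \<bar>u x\<bar> powr (p + 1))"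
  shows "1 < (\<integral>x. m x * \<bar>u x\<bar> powr (p + 1) \<partial>lborel) powr ((1 + \<gamma>) / (p - 1)) * (\<integral>x. m x * \<bar>u x\<bar> powr (1 - \<gamma>) \<partial>lborel)"
proof -
  have H: "H0 \<Omega> u g" and m1: "wint m u u = 1" and u0: "AE x in lborel. 0 \<le> u x" using G unfolding is_ground_def by auto
  note Lu = H0_L2[OF H]
  define P where "P = (\<integral>x. m x * \<bar>u x\<bar> powr (p + 1) \<partial>lborel)"
  define S where "S = (\<integral>x. m x * \<bar>u x\<bar> powr (1 - \<gamma>) \<partial>lborel)"
  have j: "integrable lborel (\<lambda>x. m x * \<bar>u x\<bar> powr (1 - \<gamma>))" using \<gamma> by (intro int_m_powr_low Lu) auto
  have P: "0 < P" unfolding P_def by (rule int_m_powr_pos[OF G i])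
  have S: "0 < S" unfolding S_def by (rule int_m_powr_pos[OF G j])
  \<comment> \<open>The weights that interpolate 2 between the exponents \<open>p + 1\<close> and
    \<open>1 - \<gamma>\<close>.\<close>
  define \<alpha> where "\<alpha> = (p - 1) / (p + \<gamma>)"
  define \<beta> where "\<beta> = (1 + \<gamma>) / (p + \<gamma>)"
  have ab: "0 < \<alpha>" "0 < \<beta>" "\<beta> + \<alpha> = 1" using \<gamma> p by (auto simp: \<alpha>_def \<beta>_def add_divide_distrib[symmetric])
  have e2: "(p + 1) * \<beta> + (1 - \<gamma>) * \<alpha> = 2"
    unfolding \<alpha>_def \<beta>_def using \<gamma> p by (simp add: divide_simps) (simp add: algebra_simps)
  define c0 where "c0 = P powr \<beta> * S powr \<alpha>"
  have c0: "0 < c0" using P S by (simp add: c0_def)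
  have id: "t\<^sup>2 = c0 * ((t powr (p + 1) / P) powr \<beta> * (t powr (1 - \<gamma>) / S) powr \<alpha>)" if t: "0 < t" for t
  proof -
    have "(t powr (p + 1) / P) powr \<beta> * (t powr (1 - \<gamma>) / S) powr \<alpha> = t powr ((p + 1) * \<beta>) * t powr ((1 - \<gamma>) * \<alpha>) / c0"
      unfolding c0_def using t P S by (simp add: powr_divide powr_powr)
    also have "t powr ((p + 1) * \<beta>) * t powr ((1 - \<gamma>) * \<alpha>) = t powr 2" unfolding powr_add[symmetric] e2 ..
    finally show ?thesis using c0 t by simp
  qed
  \<comment> \<open>Young's inequality with both factors normalised by their integrals; the weighted
    integral of the majorant is then exactly \<open>c0\<close>.\<close>
  define h where "h t = c0 * (\<beta> * (t powr (p + 1) / P) + \<alpha> * (t powr (1 - \<gamma>) / S))" for t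
  have le: "t\<^sup>2 \<le> h t" if t: "0 \<le> t" for t
  proof (cases "t = 0")
    case False
    then have t: "0 < t" using t by simp
    show ?thesis unfolding id[OF t] h_def using ab c0 t P S by (intro mult_left_mono Youngs_inequality_0) auto
  qed (simp add: h_def)
  have hi: "(\<integral>x. m x * h \<bar>u x\<bar> \<partial>lborel) = c0" and hint: "integrable lborel (\<lambda>x. m x * h \<bar>u x\<bar>)"
  proof -
    have eq: "m x * h \<bar>u x\<bar> = (c0 * \<beta> / P) * (m x * \<bar>u x\<bar> powr (p + 1)) + (c0 * \<alpha> / S) * (m x * \<bar>u x\<bar> powr (1 - \<gamma>))" for x
      by (simp add: h_def algebra_simps)
    show "integrable lborel (\<lambda>x. m x * h \<bar>u x\<bar>)" unfolding eq using i j by simp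
    have "(\<integral>x. m x * h \<bar>u x\<bar> \<partial>lborel) = (c0 * \<beta> / P) * P + (c0 * \<alpha> / S) * S"
      unfolding eq using i j by (simp add: P_def[symmetric] S_def[symmetric])
    also have "\<dots> = c0 * (\<beta> + \<alpha>)" using P S by (simp add: distrib_left)
    finally show "(\<integral>x. m x * h \<bar>u x\<bar> \<partial>lborel) = c0" using ab by simp
  qed
  \<comment> \<open>The integral of the nonnegative difference between majorant and square is
    \<open>c0 - 1\<close>. If it is not positive, the difference vanishes and Young's inequality is
    an equality wherever \<open>u\<close> is nonzero.\<close>
  have "1 < c0"
  proof (rule ccontr)
    assume n: "\<not> 1 < c0"
    have iw: "integrable lborel (\<lambda>x. m x * u x * u x)" by (rule wint_integrable[OF bwm Lu(1) Lu(1)])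
    have nn: "0 \<le> m x * h \<bar>u x\<bar> - m x * u x * u x" for x
      using mult_left_mono[OF le[of "\<bar>u x\<bar>"] m0[of x]] by (simp add: power2_eq_square mult.assoc)
    have "(\<integral>x. m x * h \<bar>u x\<bar> - m x * u x * u x \<partial>lborel) = c0 - 1"
      using hint iw hi m1 by (simp add: wint_def)
    moreover have "0 \<le> (\<integral>x. m x * h \<bar>u x\<bar> - m x * u x * u x \<partial>lborel)" using nn by (intro Bochner_Integration.integral_nonneg) auto
    ultimately have "(\<integral>x. m x * h \<bar>u x\<bar> - m x * u x * u x \<partial>lborel) = 0" using n by simp
    then have "AE x in lborel. m x * h \<bar>u x\<bar> - m x * u x * u x = 0"
      using hint iw nn by (subst (asm) integral_nonneg_eq_0_iff_AE) auto
    then have two: "AE x in lborel. u x = 0 \<or> u x = (P / S) powr (1 / (p + \<gamma>))"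
      using u0 H0_outside(1)[OF H open_dom]
    proof eventually_elim
      fix x assume e: "m x * h \<bar>u x\<bar> - m x * u x * u x = 0" and x0: "0 \<le> u x" and o: "x \<notin> \<Omega> \<longrightarrow> u x = 0"
      show "u x = 0 \<or> u x = (P / S) powr (1 / (p + \<gamma>))"
      proof (cases "u x = 0")
        case False
        then have t: "0 < u x" and x: "x \<in> \<Omega>" using x0 o by auto
        have "m x * h (u x) = m x * (u x)\<^sup>2" using e t by (simp add: power2_eq_square mult.assoc)
        then have "h (u x) = (u x)\<^sup>2" using mpos[OF x] by simp
        then have "c0 * (\<beta> * (u x powr (p + 1) / P) + \<alpha> * (u x powr (1 - \<gamma>) / S))
           = c0 * ((u x powr (p + 1) / P) powr \<beta> * (u x powr (1 - \<gamma>) / S) powr \<alpha>)"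
          unfolding h_def id[OF t] .
        note eq = sym[OF iffD1[OF mult_left_cancel[OF less_imp_neq[OF c0, symmetric]] this]]
        have px: "0 < u x powr (p + 1) / P" "0 < u x powr (1 - \<gamma>) / S" using t P S by simp_all
        have "u x powr (p + 1) / P = u x powr (1 - \<gamma>) / S" by (rule amgm_equality[OF ab px eq])
        then have "u x powr (p + 1) / u x powr (1 - \<gamma>) = P / S" using t P S by (simp add: field_simps)
        moreover have "u x powr (p + 1) / u x powr (1 - \<gamma>) = u x powr (p + \<gamma>)" by (simp flip: powr_diff)
        ultimately have "P / S = u x powr (p + \<gamma>)" by simp
        then show ?thesis using t \<gamma> p by (simp add: powr_powr)
      qed simp
    qed
    have "AE x in lborel. x \<notin> cball 0 R \<longrightarrow> u x = 0"
      using H0_outside(1)[OF H open_dom] by eventually_elim (use sub in blast)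
    from two_valued_zero[OF H0_wgr[OF H] two this] have "AE x in lborel. x \<in> \<Omega> \<longrightarrow> u x = 0"
      by eventually_elim simp
    with ground_nonzero[OF G] show False by (rule notE)
  qed
  then have "1 powr (1 / \<alpha>) < c0 powr (1 / \<alpha>)" using ab by (intro powr_less_mono2) auto
  also have "c0 powr (1 / \<alpha>) = P powr (\<beta> / \<alpha>) * S" unfolding c0_def using P S ab by (simp add: powr_mult powr_powr)
  also have "\<beta> / \<alpha> = (1 + \<gamma>) / (p - 1)" using \<gamma> p by (simp add: \<alpha>_def \<beta>_def)
  finally show ?thesis by (simp add: P_def S_def)
qed

end

text \<open>Hoelder with exponents \<open>2 / (1 + \<gamma>)\<close> and
  \<open>2 / (1 - \<gamma>)\<close>, carried out by Young's inequality after scaling with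
  \<open>N\<close>. Any positive \<open>N\<close> above \<open>d * n2 v\<close> is allowed, so
  \<open>N\<close> may be a full energy.\<close>

lemma integral_powr_holder:
  fixes a v :: "'a::euclidean_space \<Rightarrow> real"
  assumes a: "a \<in> borel_measurable borel" "integrable lborel (\<lambda>x. \<bar>a x\<bar> powr (2 / (1 + \<gamma>)))"
    and v: "L2 v" and N: "0 < N" "d * n2 v \<le> N" "0 < d" and \<gamma>: "0 < \<gamma>" "\<gamma> < 1"
  shows "integrable lborel (\<lambda>x. a x * \<bar>v x\<bar> powr (1 - \<gamma>))"
    "(\<integral>x. a x * \<bar>v x\<bar> powr (1 - \<gamma>) \<partial>lborel) \<le> ((\<integral>x. \<bar>a x\<bar> powr (2 / (1 + \<gamma>)) \<partial>lborel) + 1 / d) * N powr ((1 - \<gamma>) / 2)"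
proof -
  let ?r = "2 / (1 + \<gamma>)" and ?s = "2 / (1 - \<gamma>)" and ?c = "N powr ((1 - \<gamma>) / 2)"
  have c: "?c > 0" using N by simp
  have s0: "1 - \<gamma> \<noteq> 0" using \<gamma> by simp
  note [measurable] = a(1) L2_measurable[OF v]
  have pw: "\<bar>a x * \<bar>v x\<bar> powr (1 - \<gamma>)\<bar> \<le> ?c * (\<bar>a x\<bar> powr ?r + (v x)\<^sup>2 / N)" for x
  proof -
    have "1 / ?r + 1 / ?s = 1" by (simp add: field_simps)
    moreover have "?r > 1" "?s > 1" using \<gamma> by (auto simp: divide_simps)
    ultimately have "\<bar>a x\<bar> * (\<bar>v x\<bar> powr (1 - \<gamma>) / ?c) \<le> \<bar>a x\<bar> powr ?r / ?r + (\<bar>v x\<bar> powr (1 - \<gamma>) / ?c) powr ?s / ?s"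
      by (intro Youngs_inequality) auto
    \<comment> \<open>The factors \<open>1 / ?r\<close> and \<open>1 / ?s\<close> are below 1 and
      are given up; the constant need not be sharp.\<close>
    also have "\<dots> \<le> \<bar>a x\<bar> powr ?r / 1 + (\<bar>v x\<bar> powr (1 - \<gamma>) / ?c) powr ?s / 1"
      using \<open>?r > 1\<close> \<open>?s > 1\<close> \<gamma> by (intro add_mono divide_left_mono) auto
    also have "(\<bar>v x\<bar> powr (1 - \<gamma>) / ?c) powr ?s = (v x)\<^sup>2 / N"
    proof (cases "v x = 0")
      case False
      have "(\<bar>v x\<bar> powr (1 - \<gamma>) / ?c) powr ?s = \<bar>v x\<bar> powr ((1 - \<gamma>) * ?s) / N powr ((1 - \<gamma>) / 2 * ?s)"
        using c by (simp only: powr_divide powr_powr)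
      also have "(1 - \<gamma>) * ?s = 2" using s0 by (metis nonzero_mult_div_cancel_left times_divide_eq_right)
      also have "(1 - \<gamma>) / 2 * ?s = 1" using s0 by simp
      finally show ?thesis using False N by simp
    qed (use \<gamma> in simp)
    finally have "\<bar>a x\<bar> * (\<bar>v x\<bar> powr (1 - \<gamma>) / ?c) \<le> \<bar>a x\<bar> powr ?r + (v x)\<^sup>2 / N" by simp
    then have "?c * (\<bar>a x\<bar> * (\<bar>v x\<bar> powr (1 - \<gamma>) / ?c)) \<le> ?c * (\<bar>a x\<bar> powr ?r + (v x)\<^sup>2 / N)" using c by (intro mult_left_mono) auto
    moreover have "?c * (\<bar>a x\<bar> * (\<bar>v x\<bar> powr (1 - \<gamma>) / ?c)) = \<bar>a x * \<bar>v x\<bar> powr (1 - \<gamma>)\<bar>" using c by (simp add: abs_mult)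
    ultimately show ?thesis by simp
  qed
  have iv: "integrable lborel (\<lambda>x. (v x)\<^sup>2)" using L2_integrable[OF v] by simp
  have ib: "integrable lborel (\<lambda>x. ?c * (\<bar>a x\<bar> powr ?r + (v x)\<^sup>2 / N))" using a(2) iv by simp
  show i: "integrable lborel (\<lambda>x. a x * \<bar>v x\<bar> powr (1 - \<gamma>))"
    by (rule Bochner_Integration.integrable_bound[OF ib]) (use pw in \<open>auto intro!: AE_I2 order_trans[OF pw abs_ge_self]\<close>)
  have "(\<integral>x. a x * \<bar>v x\<bar> powr (1 - \<gamma>) \<partial>lborel) \<le> (\<integral>x. ?c * (\<bar>a x\<bar> powr ?r + (v x)\<^sup>2 / N) \<partial>lborel)"
    using pw by (intro integral_mono[OF i ib]) (meson abs_le_D1)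
  also have "\<dots> = ?c * ((\<integral>x. \<bar>a x\<bar> powr ?r \<partial>lborel) + n2 v / N)" using a(2) iv by (simp add: n2_real)
  also have "\<dots> \<le> ?c * ((\<integral>x. \<bar>a x\<bar> powr ?r \<partial>lborel) + 1 / d)"
    using c N by (intro mult_left_mono add_left_mono) (auto simp: field_simps)
  finally show "(\<integral>x. a x * \<bar>v x\<bar> powr (1 - \<gamma>) \<partial>lborel) \<le> ((\<integral>x. \<bar>a x\<bar> powr ?r \<partial>lborel) + 1 / d) * ?c"
    by (simp add: mult.commute)
qed

section \<open>The singular problem\<close>

text \<open>\<open>a\<close> and \<open>b\<close> are Borel representatives of the data \<open>a0\<close> and \<open>b0\<close>, and \<open>m\<close> is a bounded weight that is positive
  everywhere on \<open>\<Omega>\<close>, zero elsewhere, and almost everywhere on \<open>\<Omega>\<close> equal to the minimum of \<open>a\<close> and \<open>b\<close>.\<close>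

locale singular_problem = dirichlet \<Omega> W m K c R
  for \<Omega> :: "'a::euclidean_space set" and W m :: "'a \<Rightarrow> real" and K c R :: real +
  fixes V a b a0 b0 :: "'a \<Rightarrow> real" and \<gamma> p Cb :: real
  assumes dim: "DIM('a) \<ge> 3"
    and \<gamma>: "0 < \<gamma>" "\<gamma> < 1" and p: "1 < p" "p < 2 * real DIM('a) / (real DIM('a) - 2) - 1"
    and Vm: "V \<in> borel_measurable borel" and Vc: "\<And>x. c \<le> V x"
    and WV: "\<And>x. W x = indicator \<Omega> x * V x"
    and am: "a \<in> borel_measurable borel" and ai: "integrable lborel (\<lambda>x. \<bar>a x\<bar> powr (2 / (1 + \<gamma>)))"
    and apos: "AE x in lborel. 0 < a x"
    and bm: "b \<in> borel_measurable borel" and bb: "AE x in lborel. \<bar>b x\<bar> \<le> Cb"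
    and mab: "AE x in lborel. x \<in> \<Omega> \<longrightarrow> m x = min (a x) (b x)"
    and a0: "AE x in lborel. a0 x = a x" and b0: "AE x in lborel. b0 x = b x"
begin

abbreviation ratio :: "('a \<Rightarrow> real) \<Rightarrow> real" where
  "ratio u \<equiv> X_norm_sq V u powr ((p + \<gamma>) / (p - 1)) /
     ((\<integral>x. b0 x * \<bar>u x\<bar> powr (p + 1) \<partial>lebesgue) powr ((1 + \<gamma>) / (p - 1)) *
      (\<integral>x. a0 x * \<bar>u x\<bar> powr (1 - \<gamma>) \<partial>lebesgue))"

abbreviation admissible :: "('a \<Rightarrow> real) \<Rightarrow> bool" where
  "admissible u \<equiv> u \<in> X_space V \<and> (AE x in lebesgue. 0 \<le> u x) \<and> \<not> (AE x in lebesgue. u x = 0) \<and>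
     0 < (\<integral>x. b0 x * \<bar>u x\<bar> powr (p + 1) \<partial>lebesgue)"

lemma Cb0: "0 \<le> Cb"
proof -
  have "AE x in (lborel::'a measure). 0 \<le> Cb" using bb by eventually_elim (meson abs_ge_zero order_trans)
  then have "AE y in (lborel::'a measure). y \<in> ball 0 1 \<longrightarrow> 0 \<le> Cb" by eventually_elim simp
  from AE_ball_nonempty[OF this] show ?thesis by auto
qed

lemma En_W_integral:
  assumes "L2 u" "L2 g" "L2 v" "L2 h"
  shows "En W u g v h = (\<integral>x. g x \<bullet> h x + W x * u x * v x \<partial>lborel)"
  unfolding En_def wint_def
  by (rule Bochner_Integration.integral_add[symmetric]) (intro L2_inner_integrable wint_integrable bwW assms)+

lemma energy_dom:
  assumes H: "H0 \<Omega> u g" "H0 \<Omega> v h"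
    and u: "AE x in lborel. x \<in> \<Omega> \<longrightarrow> u0 x = u x" "AE x in lborel. x \<in> \<Omega> \<longrightarrow> weak_grad \<Omega> u0 x = g x"
    and v: "AE x in lborel. x \<in> \<Omega> \<longrightarrow> v0 x = v x" "AE x in lborel. x \<in> \<Omega> \<longrightarrow> weak_grad \<Omega> v0 x = h x"
  shows "(\<integral>x. weak_grad \<Omega> u0 x \<bullet> weak_grad \<Omega> v0 x + V x * u0 x * v0 x \<partial>lebesgue_on \<Omega>) = En W u g v h"
    "(\<integral>x. min (a0 x) (b0 x) * u0 x * v0 x \<partial>lebesgue_on \<Omega>) = wint m u v"
proof -
  note L = H0_L2[OF H(1)] H0_L2[OF H(2)]
  note [measurable] = L2_measurable[OF L(1)] L2_measurable[OF L(2)] L2_measurable[OF L(3)] L2_measurable[OF L(4)] Wm mm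
  show "(\<integral>x. weak_grad \<Omega> u0 x \<bullet> weak_grad \<Omega> v0 x + V x * u0 x * v0 x \<partial>lebesgue_on \<Omega>) = En W u g v h"
    unfolding En_W_integral[OF L]
  proof (rule integral_leb_on[OF open_dom])
    show "AE x in lborel. x \<in> \<Omega> \<longrightarrow> weak_grad \<Omega> u0 x \<bullet> weak_grad \<Omega> v0 x + V x * u0 x * v0 x = g x \<bullet> h x + W x * u x * v x"
      using u v by eventually_elim (auto simp: WV)
    show "AE x in lborel. x \<notin> \<Omega> \<longrightarrow> g x \<bullet> h x + W x * u x * v x = 0"
      using H0_outside(1)[OF H(1) open_dom] H0_outside(2)[OF H(1) open_dom] by eventually_elim auto
  qed measurable
  show "(\<integral>x. min (a0 x) (b0 x) * u0 x * v0 x \<partial>lebesgue_on \<Omega>) = wint m u v"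
    unfolding wint_def
  proof (rule integral_leb_on[OF open_dom])
    show "AE x in lborel. x \<in> \<Omega> \<longrightarrow> min (a0 x) (b0 x) * u0 x * v0 x = m x * u x * v x"
      using u(1) v(1) a0 b0 mab by eventually_elim auto
    show "AE x in lborel. x \<notin> \<Omega> \<longrightarrow> m x * u x * v x = 0"
      using H0_outside(1)[OF H(1) open_dom] by eventually_elim auto
  qed measurable
qed

text \<open>An eigenfunction for \<mu> has energy \<mu> times its weighted mass, and nonnegativity
  of \<open>Q\<close> bounds the energy below by \<open>lam\<close> times the same positive
  mass.\<close>

lemma first_eigenvalue: "is_first_eigenvalue \<Omega> V (\<lambda>x. min (a0 x) (b0 x)) lam"
  unfolding is_first_eigenvalue_def
proof (intro conjI allI impI)
  obtain u g where G: "is_ground u g" using ex_ground by blast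
  have H: "H0 \<Omega> u g" and u0: "AE x in lborel. 0 \<le> u x" and eq: "\<And>v h. H0 \<Omega> v h \<Longrightarrow> En q u g v h = 0"
    using G unfolding is_ground_def by auto
  have rfl: "AE x in lborel. x \<in> \<Omega> \<longrightarrow> u x = u x" by simp
  note U = H10_of_H0[OF open_dom H rfl]
  have "is_eigenfunction \<Omega> V (\<lambda>x. min (a0 x) (b0 x)) lam u"
    unfolding is_eigenfunction_def
  proof (intro conjI ballI)
    show "u \<in> H10 \<Omega>" by (rule U(1))
    show "\<not> (AE x in lebesgue_on \<Omega>. u x = 0)" using ground_nonzero[OF G] by (simp add: AE_leb_on open_dom)
    fix \<psi> assume "\<psi> \<in> H10 \<Omega>"
    from H0_of_H10[OF open_dom this] obtain v h where v: "H0 \<Omega> v h" "AE x in lborel. x \<in> \<Omega> \<longrightarrow> \<psi> x = v x"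
      "AE x in lborel. x \<in> \<Omega> \<longrightarrow> weak_grad \<Omega> \<psi> x = h x" by blast
    show "(\<integral>x. weak_grad \<Omega> u x \<bullet> weak_grad \<Omega> \<psi> x + V x * u x * \<psi> x \<partial>lebesgue_on \<Omega>)
          = lam * (\<integral>x. min (a0 x) (b0 x) * u x * \<psi> x \<partial>lebesgue_on \<Omega>)"
      unfolding energy_dom[OF H v(1) rfl U(2) v(2,3)]
      using eq[OF v(1)] En_q[OF H0_L2(1)[OF H] H0_L2(1)[OF v(1)]] by simp
  qed
  moreover have "AE x in lebesgue_on \<Omega>. 0 \<le> u x" unfolding AE_leb_on[OF open_dom] using u0 by eventually_elim simp
  moreover have "connected \<Omega> \<longrightarrow> (AE x in lebesgue_on \<Omega>. 0 < u x)"
    unfolding AE_leb_on[OF open_dom] using ground_positive[OF G] by blast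
  ultimately show "\<exists>u. is_eigenfunction \<Omega> V (\<lambda>x. min (a0 x) (b0 x)) lam u \<and> (AE x in lebesgue_on \<Omega>. 0 \<le> u x) \<and>
      (connected \<Omega> \<longrightarrow> (AE x in lebesgue_on \<Omega>. 0 < u x))" by blast
next
  fix \<mu> w assume e: "is_eigenfunction \<Omega> V (\<lambda>x. min (a0 x) (b0 x)) \<mu> w"
  then have w: "w \<in> H10 \<Omega>" and nz: "\<not> (AE x in lebesgue_on \<Omega>. w x = 0)" by (auto simp: is_eigenfunction_def)
  from H0_of_H10[OF open_dom w] obtain v h where v: "H0 \<Omega> v h" "AE x in lborel. x \<in> \<Omega> \<longrightarrow> w x = v x"
    "AE x in lborel. x \<in> \<Omega> \<longrightarrow> weak_grad \<Omega> w x = h x" by blast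
  have "En W v h v h = \<mu> * wint m v v"
    using e w unfolding is_eigenfunction_def energy_dom[OF v(1) v(1) v(2,3) v(2,3), symmetric] by blast
  moreover have "0 \<le> En W v h v h - lam * wint m v v"
    using Q_nonneg[OF v(1)] by (simp add: Q_eq[OF H0_L2(1)[OF v(1)]] E_def)
  moreover have "0 < wint m v v"
  proof (rule wint_m_pos[OF H0_L2(1)[OF v(1)] H0_outside(1)[OF v(1) open_dom]])
    show "\<not> (AE x in lborel. v x = 0)"
    proof
      assume "AE x in lborel. v x = 0"
      with v(2) have "AE x in lborel. x \<in> \<Omega> \<longrightarrow> w x = 0" by eventually_elim simp
      with nz show False by (simp add: AE_leb_on open_dom)
    qed
  qed
  ultimately show "lam \<le> \<mu>" by (simp add: left_diff_distrib[symmetric] zero_le_mult_iff)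
qed

lemma X_rep:
  assumes "u \<in> X_space V"
  shows "\<exists>v h. wgr v h \<and> (AE x in lborel. u x = v x) \<and> (AE x in lborel. weak_grad UNIV u x = h x)"
  using wgr_on_of_H1[OF open_UNIV, of u] assms by (auto simp: X_space_def wgr_on_UNIV)

text \<open>Approximation by test functions of \<Omega> is also approximation on the whole space, so
  the zero extension has no singular gradient at the boundary. Where \<open>u\<close> lives,
  \<open>V\<close> coincides with the bounded \<open>W\<close>.\<close>

lemma ground_X:
  assumes G: "is_ground u g"
  shows "u \<in> X_space V" "AE x in lborel. weak_grad UNIV u x = g x" "AE x in lborel. V x * u x = W x * u x"
proof -
  have H: "H0 \<Omega> u g" using G unfolding is_ground_def by auto
  have w: "wgr_on UNIV u g" using H0_wgr[OF H] by (simp add: wgr_on_UNIV)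
  note U = H1_of_wgr_on[OF open_UNIV w, of u]
  show "AE x in lborel. weak_grad UNIV u x = g x" using U(2) by simp
  show VW: "AE x in lborel. V x * u x = W x * u x"
    using H0_outside(1)[OF H open_dom] by eventually_elim (auto simp: WV indicator_def)
  have "integrable lebesgue (\<lambda>x. V x * (u x)\<^sup>2)"
  proof (subst integrable_leb[of "\<lambda>x. W x * u x * u x"])
    show "integrable lborel (\<lambda>x. W x * u x * u x)" by (rule wint_integrable[OF bwW H0_L2(1)[OF H] H0_L2(1)[OF H]])
    then show "(\<lambda>x. W x * u x * u x) \<in> borel_measurable borel" using borel_measurable_integrable by force
    show "AE x in lborel. V x * (u x)\<^sup>2 = W x * u x * u x" using VW by eventually_elim (simp add: power2_eq_square)
  qed
  then show "u \<in> X_space V" using U(1) by (simp add: X_space_def)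
qed

lemma no_solution:
  assumes l: "l > lam powr ((p + \<gamma>) / (p - 1)) * ((\<gamma> + 1) / (p - 1)) powr ((\<gamma> + 1) / (p - 1))
                  * ((p - 1) / (p + \<gamma>)) powr ((p + \<gamma>) / (p - 1))"
  shows "\<not> is_solution V a0 b0 \<gamma> p l u"
proof
  assume sol: "is_solution V a0 b0 \<gamma> p l u"
  then have uX: "u \<in> X_space V" and upos: "AE x in lborel. 0 < u x" by (auto simp: is_solution_def AE_completion_iff)
  obtain v h where v: "wgr v h" "AE x in lborel. u x = v x" "AE x in lborel. weak_grad UNIV u x = h x"
    using X_rep[OF uX] by blast
  obtain f g where G: "is_ground f g" using ex_ground by blast
  have H: "H0 \<Omega> f g" and f0: "AE x in lborel. 0 \<le> f x" using G unfolding is_ground_def by auto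
  note F = ground_X[OF G] and Lf = H0_L2[OF H] and Lv = wgr_L2[OF v(1)]
  note [measurable] = L2_measurable[OF Lf(1)] L2_measurable[OF Lf(2)] L2_measurable[OF Lv(1)] L2_measurable[OF Lv(2)] Wm mm
  have ia: "integrable lebesgue (\<lambda>x. a0 x * u x powr (- \<gamma>) * f x)" and ib: "integrable lebesgue (\<lambda>x. b0 x * u x powr p * f x)"
    and eq: "(\<integral>x. weak_grad UNIV u x \<bullet> weak_grad UNIV f x + V x * u x * f x \<partial>lebesgue)
          = l * (\<integral>x. a0 x * u x powr (- \<gamma>) * f x \<partial>lebesgue) + (\<integral>x. b0 x * u x powr p * f x \<partial>lebesgue)"
    using sol F(1) unfolding is_solution_def by blast+
  have "(\<integral>x. weak_grad UNIV u x \<bullet> weak_grad UNIV f x + V x * u x * f x \<partial>lebesgue) = En W v h f g"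
    unfolding En_W_integral[OF Lv Lf]
  proof (rule integral_leb)
    show "AE x in lborel. weak_grad UNIV u x \<bullet> weak_grad UNIV f x + V x * u x * f x = h x \<bullet> g x + W x * v x * f x"
      using v(2,3) F(2,3) by eventually_elim (metis mult.assoc mult.commute)
  qed measurable
  \<comment> \<open>Only an inequality is available, because \<open>v\<close> does not vanish on the
    boundary of \<Omega>; its direction is the one required.\<close>
  moreover have "En q f g v h \<le> 0"
  proof (rule ground_subsolution[OF G v(1)])
    show "AE x in lborel. 0 \<le> v x" using upos v(2) by eventually_elim simp
  qed
  then have "En W v h f g \<le> lam * wint m f v" by (simp add: En_q[OF Lf(1) Lv(1)] En_commute[of W f g])
  moreover have im: "integrable lborel (\<lambda>x. m x * f x * v x)" by (rule wint_integrable[OF bwm Lf(1) Lv(1)])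
  have aem: "AE x in lborel. m x * f x * u x = m x * f x * v x" using v(2) by eventually_elim simp
  have im': "integrable lebesgue (\<lambda>x. m x * f x * u x)"
    using im by (subst integrable_leb[OF _ aem]) measurable
  have wm: "wint m f v = (\<integral>x. m x * f x * u x \<partial>lebesgue)"
    unfolding wint_def by (rule integral_leb[symmetric, OF _ aem]) measurable
  \<comment> \<open>The integrand of the equation tested with \<open>f\<close> minus the subsolution
    bound: its integral is at most 0, while it is pointwise nonnegative and positive wherever
    \<open>f\<close> is nonzero in \<Omega>.\<close>
  let ?D = "\<lambda>x. l * (a0 x * u x powr (- \<gamma>) * f x) + b0 x * u x powr p * f x - lam * (m x * f x * u x)"
  have iD: "integrable lebesgue ?D" using ia ib im' by simp
  have "(\<integral>x. ?D x \<partial>lebesgue) = l * (\<integral>x. a0 x * u x powr (- \<gamma>) * f x \<partial>lebesgue)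
      + (\<integral>x. b0 x * u x powr p * f x \<partial>lebesgue) - lam * wint m f v"
    unfolding wm using ia ib im' by simp
  ultimately have D0: "(\<integral>x. ?D x \<partial>lebesgue) \<le> 0" using eq by simp
  have pw: "AE x in lborel. 0 \<le> ?D x \<and> (x \<in> \<Omega> \<longrightarrow> f x \<noteq> 0 \<longrightarrow> 0 < ?D x)"
    using f0 upos a0 b0 mab H0_outside(1)[OF H open_dom]
  proof eventually_elim
    fix x assume x: "0 \<le> f x" "0 < u x" "a0 x = a x" "b0 x = b x" "x \<in> \<Omega> \<longrightarrow> m x = min (a x) (b x)" "x \<notin> \<Omega> \<longrightarrow> f x = 0"
    show "0 \<le> ?D x \<and> (x \<in> \<Omega> \<longrightarrow> f x \<noteq> 0 \<longrightarrow> 0 < ?D x)"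
    proof (cases "x \<in> \<Omega> \<and> f x \<noteq> 0")
      case True
      then have xo: "x \<in> \<Omega>" and fx: "0 < f x" using x(1) by auto
      have mx: "0 < m x" "m x \<le> a0 x" "m x \<le> b0 x" using mpos[OF xo] x(3,4,5) xo by auto
      have k: "lam * u x < l * u x powr (- \<gamma>) + u x powr p" by (rule singular_superlinear[OF \<gamma>(1) p(1) lam_pos x(2) l])
      have l0: "0 < l"
      proof (rule le_less_trans[OF _ l])
        show "0 \<le> lam powr ((p + \<gamma>) / (p - 1)) * ((\<gamma> + 1) / (p - 1)) powr ((\<gamma> + 1) / (p - 1))
                  * ((p - 1) / (p + \<gamma>)) powr ((p + \<gamma>) / (p - 1))" by simp
      qed
      have "m x * f x * (lam * u x) < m x * f x * (l * u x powr (- \<gamma>) + u x powr p)"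
        using k mx(1) fx by (intro mult_strict_left_mono) auto
      also have "\<dots> = l * (m x * (u x powr (- \<gamma>) * f x)) + m x * (u x powr p * f x)" by (simp add: algebra_simps)
      also have "\<dots> \<le> l * (a0 x * (u x powr (- \<gamma>) * f x)) + b0 x * (u x powr p * f x)"
        using mx l0 fx by (intro add_mono mult_left_mono mult_right_mono) auto
      finally show ?thesis by (simp add: mult_ac)
    next
      case False
      then have "f x = 0" using x(6) by blast
      then show ?thesis by simp
    qed
  qed
  have Dn: "AE x in lebesgue. 0 \<le> ?D x" unfolding AE_completion_iff using pw by eventually_elim simp
  then have "(\<integral>x. ?D x \<partial>lebesgue) = 0" using D0 by (intro antisym integral_nonneg_AE) auto
  then have "AE x in lebesgue. ?D x = 0" by (rule iffD1[OF integral_nonneg_eq_0_iff_AE[OF iD Dn]])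
  then have "AE x in lborel. ?D x = 0" by (simp only: AE_completion_iff)
  with pw have "AE x in lborel. x \<in> \<Omega> \<longrightarrow> f x = 0" by eventually_elim force
  with ground_nonzero[OF G] show False by (rule notE)
qed

lemma p1: "2 \<le> p + 1" "p + 1 < 2 * real DIM('a) / (real DIM('a) - 2)"
  using p by auto

lemma X_norm_rep:
  assumes uX: "u \<in> X_space V" and v: "wgr v h" "AE x in lborel. u x = v x" "AE x in lborel. weak_grad UNIV u x = h x"
  shows "n2 h \<le> X_norm_sq V u" "c * n2 v \<le> X_norm_sq V u"
proof -
  note Lv = wgr_L2[OF v(1)]
  note [measurable] = L2_measurable[OF Lv(1)] L2_measurable[OF Lv(2)] Vm
  have iV: "integrable lborel (\<lambda>x. V x * (v x)\<^sup>2)"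
  proof -
    have "AE x in lborel. V x * (u x)\<^sup>2 = V x * (v x)\<^sup>2" using v(2) by eventually_elim simp
    moreover have "integrable lebesgue (\<lambda>x. V x * (u x)\<^sup>2)" using uX by (simp add: X_space_def)
    ultimately show ?thesis using integrable_leb[of "\<lambda>x. V x * (v x)\<^sup>2" "\<lambda>x. V x * (u x)\<^sup>2"] by simp
  qed
  have V0: "0 \<le> V x" for x using Vc[of x] c by linarith
  have "X_norm_sq V u = (\<integral>x. (norm (h x))\<^sup>2 + V x * (v x)\<^sup>2 \<partial>lborel)"
    unfolding X_norm_sq_def
  proof (rule integral_leb)
    show "AE x in lborel. (norm (weak_grad UNIV u x))\<^sup>2 + V x * (u x)\<^sup>2 = (norm (h x))\<^sup>2 + V x * (v x)\<^sup>2"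
      using v(2,3) by eventually_elim simp
  qed measurable
  also have "\<dots> = n2 h + (\<integral>x. V x * (v x)\<^sup>2 \<partial>lborel)"
    unfolding n2_def by (rule Bochner_Integration.integral_add[OF L2_integrable[OF Lv(2)] iV])
  finally have eq: "X_norm_sq V u = n2 h + (\<integral>x. V x * (v x)\<^sup>2 \<partial>lborel)" .
  have "0 \<le> (\<integral>x. V x * (v x)\<^sup>2 \<partial>lborel)" using V0 by (intro Bochner_Integration.integral_nonneg) simp
  then show "n2 h \<le> X_norm_sq V u" using eq by simp
  have "c * n2 v = (\<integral>x. c * (v x)\<^sup>2 \<partial>lborel)" by (simp add: n2_real)
  also have "\<dots> \<le> (\<integral>x. V x * (v x)\<^sup>2 \<partial>lborel)"
    using iV L2_integrable[OF Lv(1)] Vc by (intro integral_mono) (auto intro: mult_right_mono)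
  finally show "c * n2 v \<le> X_norm_sq V u" using eq n2_nonneg[of h] by linarith
qed

lemma int_b:
  assumes v: "wgr v h" "AE x in lborel. u x = v x"
  shows "(\<integral>x. b0 x * \<bar>u x\<bar> powr (p + 1) \<partial>lebesgue) = (\<integral>x. b x * \<bar>v x\<bar> powr (p + 1) \<partial>lborel)"
    "integrable lborel (\<lambda>x. b x * \<bar>v x\<bar> powr (p + 1))" "integrable lborel (\<lambda>x. \<bar>v x\<bar> powr (p + 1))"
    "(\<integral>x. b x * \<bar>v x\<bar> powr (p + 1) \<partial>lborel) \<le> Cb * (\<integral>x. \<bar>v x\<bar> powr (p + 1) \<partial>lborel)"
proof -
  note Lv = wgr_L2[OF v(1)]
  note [measurable] = L2_measurable[OF Lv(1)] bm
  show "(\<integral>x. b0 x * \<bar>u x\<bar> powr (p + 1) \<partial>lebesgue) = (\<integral>x. b x * \<bar>v x\<bar> powr (p + 1) \<partial>lborel)"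
  proof (rule integral_leb)
    show "AE x in lborel. b0 x * \<bar>u x\<bar> powr (p + 1) = b x * \<bar>v x\<bar> powr (p + 1)" using v(2) b0 by eventually_elim simp
  qed measurable
  have "0 < max 1 (max (n2 v) (n2 h))" by simp
  then show i: "integrable lborel (\<lambda>x. \<bar>v x\<bar> powr (p + 1))"
    using sobolev[OF dim p1] v(1) by (metis max.cobounded1 max.cobounded2 max.coboundedI2)
  have ic: "integrable lborel (\<lambda>x. Cb * \<bar>v x\<bar> powr (p + 1))" using i by simp
  have le: "AE x in lborel. \<bar>b x * \<bar>v x\<bar> powr (p + 1)\<bar> \<le> Cb * \<bar>v x\<bar> powr (p + 1)"
    using bb by eventually_elim (simp add: abs_mult mult_right_mono)
  show ib: "integrable lborel (\<lambda>x. b x * \<bar>v x\<bar> powr (p + 1))"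
  proof (rule Bochner_Integration.integrable_bound[OF ic])
    show "AE x in lborel. norm (b x * \<bar>v x\<bar> powr (p + 1)) \<le> norm (Cb * \<bar>v x\<bar> powr (p + 1))"
      using le by eventually_elim (use Cb0 in \<open>simp add: abs_mult\<close>)
  qed measurable
  have "(\<integral>x. b x * \<bar>v x\<bar> powr (p + 1) \<partial>lborel) \<le> (\<integral>x. Cb * \<bar>v x\<bar> powr (p + 1) \<partial>lborel)"
    by (rule integral_mono_AE[OF ib ic]) (use le in eventually_elim, simp add: abs_le_iff)
  then show "(\<integral>x. b x * \<bar>v x\<bar> powr (p + 1) \<partial>lborel) \<le> Cb * (\<integral>x. \<bar>v x\<bar> powr (p + 1) \<partial>lborel)" by simp
qed

lemma int_a:
  assumes v: "L2 v" "AE x in lborel. u x = v x"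
  shows "(\<integral>x. a0 x * \<bar>u x\<bar> powr (1 - \<gamma>) \<partial>lebesgue) = (\<integral>x. a x * \<bar>v x\<bar> powr (1 - \<gamma>) \<partial>lborel)"
proof (rule integral_leb)
  note [measurable] = L2_measurable[OF v(1)] am
  show "AE x in lborel. a0 x * \<bar>u x\<bar> powr (1 - \<gamma>) = a x * \<bar>v x\<bar> powr (1 - \<gamma>)" using v(2) a0 by eventually_elim simp
  show "(\<lambda>x. a x * \<bar>v x\<bar> powr (1 - \<gamma>)) \<in> borel_measurable borel" by measurable
qed

text \<open>With \<open>N\<close> the squared norm, the two integrals in the denominator grow at
  most like N^((p+1)/2) and N^((1-\<gamma>)/2). The product formed in the quotient has exactly the
  power of \<open>N\<close> in the numerator, so the bound is scale invariant.\<close>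

lemma ratio_lower_bound: "\<exists>d>0. \<forall>u. admissible u \<longrightarrow> d \<le> ratio u"
proof -
  obtain C where C: "C > 0" "\<And>(u::'a \<Rightarrow> real) g D. wgr u g \<Longrightarrow> 0 < D \<Longrightarrow> n2 u \<le> D \<Longrightarrow> n2 g \<le> D \<Longrightarrow>
      (\<integral>x. \<bar>u x\<bar> powr (p + 1) \<partial>lborel) \<le> C * D powr ((p + 1) / 2)"
    using sobolev[OF dim p1] by blast
  define e where "e = (1 + \<gamma>) / (p - 1)"
  have e: "e > 0" using \<gamma> p by (simp add: e_def)
  \<comment> \<open>\<open>sobolev\<close> wants one bound for function and gradient; the energy
    controls the former with \<open>1 / c\<close> and the latter with 1.\<close>
  define M where "M = max 1 (1 / c)"
  have M: "M > 0" by (simp add: M_def)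
  define C1 where "C1 = (Cb + 1) * (C * M powr ((p + 1) / 2))"
  have C1: "C1 > 0" using C Cb0 M by (simp add: C1_def)
  define C2 where "C2 = (\<integral>x. \<bar>a x\<bar> powr (2 / (1 + \<gamma>)) \<partial>lborel) + 1 / c"
  have C2: "C2 > 0" unfolding C2_def using c by (intro add_nonneg_pos Bochner_Integration.integral_nonneg) auto
  have "1 / (C1 powr e * C2) \<le> ratio u" if ad: "admissible u" for u
  proof -
    have uX: "u \<in> X_space V" using ad by simp
    obtain v h where v: "wgr v h" "AE x in lborel. u x = v x" "AE x in lborel. weak_grad UNIV u x = h x"
      using X_rep[OF uX] by blast
    note Lv = wgr_L2[OF v(1)]
    define N where "N = X_norm_sq V u"
    note XN = X_norm_rep[OF uX v, folded N_def]
    have vn: "\<not> (AE x in lborel. v x = 0)"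
    proof
      assume "AE x in lborel. v x = 0"
      with v(2) have "AE x in lborel. u x = 0" by eventually_elim simp
      then show False using ad by (simp add: AE_completion_iff)
    qed
    have "0 < n2 v"
    proof (rule ccontr)
      assume "\<not> 0 < n2 v"
      then have "n2 v \<le> 0" by simp
      with vn show False using n2_zero_AE[OF Lv(1)] by (metis n2_nonneg order_antisym)
    qed
    then have N: "0 < N" using XN(2) c by (meson less_le_trans mult_pos_pos)
    have D: "n2 v \<le> N * M" "n2 h \<le> N * M" "0 < N * M"
    proof -
      have "n2 v \<le> N * (1 / c)" using XN(2) c by (simp add: field_simps)
      also have "\<dots> \<le> N * M" using N by (intro mult_left_mono) (auto simp: M_def)
      finally show "n2 v \<le> N * M" .
      have "N * 1 \<le> N * M" using N by (intro mult_left_mono) (auto simp: M_def)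
      then show "n2 h \<le> N * M" using XN(1) by simp
      show "0 < N * M" using N M by simp
    qed
    define B where "B = (\<integral>x. b0 x * \<bar>u x\<bar> powr (p + 1) \<partial>lebesgue)"
    define A where "A = (\<integral>x. a0 x * \<bar>u x\<bar> powr (1 - \<gamma>) \<partial>lebesgue)"
    have B0: "0 < B" using ad by (simp add: B_def)
    have B1: "B \<le> C1 * N powr ((p + 1) / 2)"
    proof -
      have "B \<le> Cb * (\<integral>x. \<bar>v x\<bar> powr (p + 1) \<partial>lborel)" unfolding B_def int_b(1)[OF v(1,2)] by (rule int_b(4)[OF v(1,2)])
      also have "\<dots> \<le> (Cb + 1) * (C * (N * M) powr ((p + 1) / 2))"
        using Cb0 C(2)[OF v(1) D(3) D(1,2)] by (intro mult_mono) auto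
      also have "\<dots> = C1 * N powr ((p + 1) / 2)" using N M by (simp add: C1_def powr_mult mult_ac)
      finally show ?thesis .
    qed
    note HA = integral_powr_holder[OF am ai Lv(1) N XN(2) c \<gamma>]
    have A1: "A \<le> C2 * N powr ((1 - \<gamma>) / 2)" unfolding A_def int_a[OF Lv(1) v(2)] C2_def by (rule HA(2))
    have A0: "0 < A"
    proof (rule ccontr)
      assume n: "\<not> 0 < A"
      have nn: "AE x in lborel. 0 \<le> a x * \<bar>v x\<bar> powr (1 - \<gamma>)" using apos by eventually_elim simp
      have "0 \<le> A" unfolding A_def int_a[OF Lv(1) v(2)] using nn by (rule integral_nonneg_AE)
      with n have "(\<integral>x. a x * \<bar>v x\<bar> powr (1 - \<gamma>) \<partial>lborel) = 0" unfolding A_def int_a[OF Lv(1) v(2)] by simp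
      then have "AE x in lborel. a x * \<bar>v x\<bar> powr (1 - \<gamma>) = 0" using integral_nonneg_eq_0_iff_AE[OF HA(1) nn] by simp
      with apos have "AE x in lborel. v x = 0" by eventually_elim auto
      with vn show False by (rule notE)
    qed
    have "B powr e * A \<le> (C1 * N powr ((p + 1) / 2)) powr e * (C2 * N powr ((1 - \<gamma>) / 2))"
      using B0 B1 A0 A1 e by (intro mult_mono powr_mono2) auto
    also have "\<dots> = C1 powr e * C2 * (N powr ((p + 1) / 2 * e) * N powr ((1 - \<gamma>) / 2))"
      using C1 N by (simp add: powr_mult powr_powr)
    also have "N powr ((p + 1) / 2 * e) * N powr ((1 - \<gamma>) / 2) = N powr ((p + \<gamma>) / (p - 1))"
    proof -
      have "(p + 1) / 2 * e + (1 - \<gamma>) / 2 = (p + \<gamma>) / (p - 1)"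
        unfolding e_def using p by (simp add: divide_simps) (simp add: algebra_simps)
      then show ?thesis by (simp add: powr_add[symmetric])
    qed
    finally have "B powr e * A \<le> C1 powr e * C2 * N powr ((p + \<gamma>) / (p - 1))" .
    then have "1 / (C1 powr e * C2) \<le> N powr ((p + \<gamma>) / (p - 1)) / (B powr e * A)"
      using C1 C2 A0 B0 by (simp add: field_simps)
    then show ?thesis unfolding N_def B_def A_def e_def .
  qed
  moreover have "1 / (C1 powr e * C2) > 0" using C1 C2 by simp
  ultimately show ?thesis by blast
qed

text \<open>By the normalisation the squared norm of the ground state equals \<open>lam\<close>, so
  the numerator is the claimed bound. Replacing \<open>a\<close> and \<open>b\<close> by the smaller
  \<open>m\<close> decreases the denominator, which still exceeds 1.\<close>

lemma ground_ratio:
  assumes G: "is_ground u g"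
  shows "admissible u" "ratio u < lam powr ((p + \<gamma>) / (p - 1))"
proof -
  have H: "H0 \<Omega> u g" and m1: "wint m u u = 1" and u0: "AE x in lborel. 0 \<le> u x" and Q0: "Q u g = 0"
    using G unfolding is_ground_def Q_def by auto
  note w = H0_wgr[OF H] and Lu = H0_L2[OF H] and F = ground_X[OF G]
  note [measurable] = L2_measurable[OF Lu(1)] L2_measurable[OF Lu(2)] Wm mm am bm
  have rfl: "AE x in lborel. u x = u x" by simp
  note B = int_b[OF w rfl] and A = int_a[OF Lu(1) rfl]
  have mle: "AE x in lborel. u x \<noteq> 0 \<longrightarrow> m x \<le> a x \<and> m x \<le> b x"
    using mab H0_outside(1)[OF H open_dom] by eventually_elim auto
  have mo: "AE x in lborel. x \<notin> \<Omega> \<longrightarrow> u x = 0" by (rule H0_outside(1)[OF H open_dom])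
  have iP: "integrable lborel (\<lambda>x. m x * \<bar>u x\<bar> powr (p + 1))"
  proof (rule Bochner_Integration.integrable_bound)
    show "integrable lborel (\<lambda>x. K * \<bar>u x\<bar> powr (p + 1))" using B(3) by simp
    show "AE x in lborel. norm (m x * \<bar>u x\<bar> powr (p + 1)) \<le> norm (K * \<bar>u x\<bar> powr (p + 1))"
      using m0 mK K0 by (intro AE_I2) (auto simp: abs_mult intro!: mult_right_mono)
  qed measurable
  have iS: "integrable lborel (\<lambda>x. m x * \<bar>u x\<bar> powr (1 - \<gamma>))" using \<gamma> by (intro int_m_powr_low Lu) auto
  define P where "P = (\<integral>x. m x * \<bar>u x\<bar> powr (p + 1) \<partial>lborel)"
  define S where "S = (\<integral>x. m x * \<bar>u x\<bar> powr (1 - \<gamma>) \<partial>lborel)"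
  have P: "0 < P" and S: "0 < S" unfolding P_def S_def by (rule int_m_powr_pos[OF G iP], rule int_m_powr_pos[OF G iS])
  have PB: "P \<le> (\<integral>x. b x * \<bar>u x\<bar> powr (p + 1) \<partial>lborel)"
    unfolding P_def
  proof (rule integral_mono_AE[OF iP B(2)])
    show "AE x in lborel. m x * \<bar>u x\<bar> powr (p + 1) \<le> b x * \<bar>u x\<bar> powr (p + 1)"
      using mle by eventually_elim (metis abs_zero mult_right_mono mult_zero_right powr_ge_zero powr_zero_eq_one powr_0 order_refl)
  qed
  \<comment> \<open>Only integrability is taken from the Hoelder estimate, so any admissible
    positive bound serves.\<close>
  have N0: "0 < max 1 (c * n2 u)" "c * n2 u \<le> max 1 (c * n2 u)" by auto
  have SA: "S \<le> (\<integral>x. a x * \<bar>u x\<bar> powr (1 - \<gamma>) \<partial>lborel)"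
    unfolding S_def
  proof (rule integral_mono_AE[OF iS integral_powr_holder(1)[OF am ai Lu(1) N0 c \<gamma>]])
    show "AE x in lborel. m x * \<bar>u x\<bar> powr (1 - \<gamma>) \<le> a x * \<bar>u x\<bar> powr (1 - \<gamma>)"
      using mle by eventually_elim (metis abs_zero mult_right_mono mult_zero_right powr_ge_zero powr_zero_eq_one powr_0 order_refl)
  qed
  show "admissible u"
  proof (intro conjI)
    show "u \<in> X_space V" by (rule F(1))
    show "AE x in lebesgue. 0 \<le> u x" using u0 by (simp add: AE_completion_iff)
    show "\<not> (AE x in lebesgue. u x = 0)"
    proof
      assume "AE x in lebesgue. u x = 0"
      then have "AE x in lborel. x \<in> \<Omega> \<longrightarrow> u x = 0" unfolding AE_completion_iff by eventually_elim simp
      with ground_nonzero[OF G] show False by (rule notE)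
    qed
    show "0 < (\<integral>x. b0 x * \<bar>u x\<bar> powr (p + 1) \<partial>lebesgue)" unfolding B(1) using P PB by linarith
  qed
  have X: "X_norm_sq V u = lam"
  proof -
    have "X_norm_sq V u = (\<integral>x. g x \<bullet> g x + W x * u x * u x \<partial>lborel)"
      unfolding X_norm_sq_def
    proof (rule integral_leb)
      show "AE x in lborel. (norm (weak_grad UNIV u x))\<^sup>2 + V x * (u x)\<^sup>2 = g x \<bullet> g x + W x * u x * u x"
        using F(2,3)
      proof eventually_elim
        case (elim x)
        have "V x * (u x)\<^sup>2 = W x * u x * u x" using elim(2) by (metis mult.assoc power2_eq_square)
        then show ?case using elim(1) by (simp add: power2_norm_eq_inner)
      qed
    qed measurable
    also have "\<dots> = E u g" unfolding E_def En_W_integral[OF Lu Lu] ..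
    also have "\<dots> = lam" using Q0 Q_eq[OF Lu(1), of g] m1 by simp
    finally show ?thesis .
  qed
  have "1 < P powr ((1 + \<gamma>) / (p - 1)) * S"
    unfolding P_def S_def by (rule ground_holder_strict[OF G \<gamma> p(1) iP])
  also have "\<dots> \<le> (\<integral>x. b x * \<bar>u x\<bar> powr (p + 1) \<partial>lborel) powr ((1 + \<gamma>) / (p - 1)) * (\<integral>x. a x * \<bar>u x\<bar> powr (1 - \<gamma>) \<partial>lborel)"
    using P S PB SA \<gamma> p by (intro mult_mono powr_mono2) auto
  finally have "1 < (\<integral>x. b x * \<bar>u x\<bar> powr (p + 1) \<partial>lborel) powr ((1 + \<gamma>) / (p - 1)) * (\<integral>x. a x * \<bar>u x\<bar> powr (1 - \<gamma>) \<partial>lborel)" .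
  moreover have "0 < lam powr ((p + \<gamma>) / (p - 1))" using lam_pos by simp
  ultimately show "ratio u < lam powr ((p + \<gamma>) / (p - 1))"
    unfolding X A B(1) by (simp add: divide_less_eq)
qed

lemma lambda_lower_bounds:
  "0 < lambda_lower V a0 b0 \<gamma> p"
  "lambda_lower V a0 b0 \<gamma> p < lam powr ((p + \<gamma>) / (p - 1)) * ((\<gamma> + 1) / (p - 1)) powr ((\<gamma> + 1) / (p - 1))
                  * ((p - 1) / (p + \<gamma>)) powr ((p + \<gamma>) / (p - 1))"
proof -
  define k where "k = ((1 + \<gamma>) / (p + \<gamma>)) powr ((1 + \<gamma>) / (p - 1)) * ((p - 1) / (p + \<gamma>))"
  have k: "0 < k" using \<gamma> p by (simp add: k_def)
  have ll: "lambda_lower V a0 b0 \<gamma> p = k * Inf {ratio u | u. admissible u}" unfolding lambda_lower_def k_def ..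
  obtain d where d: "d > 0" "\<And>u. admissible u \<Longrightarrow> d \<le> ratio u" using ratio_lower_bound by blast
  obtain u g where G: "is_ground u g" using ex_ground by blast
  note R = ground_ratio[OF G]
  have ne: "{ratio u | u. admissible u} \<noteq> {}" using R(1) by blast
  have "d \<le> Inf {ratio u | u. admissible u}" using d(2) by (intro cInf_greatest ne) auto
  then have "0 < Inf {ratio u | u. admissible u}" using d(1) by linarith
  then show "0 < lambda_lower V a0 b0 \<gamma> p" unfolding ll using k by simp
  have "Inf {ratio u | u. admissible u} \<le> ratio u"
    using R(1) d(2) by (intro cInf_lower) (auto intro!: bdd_belowI[of _ d])
  then have "Inf {ratio u | u. admissible u} < lam powr ((p + \<gamma>) / (p - 1))" using R(2) by linarith
  then have "lambda_lower V a0 b0 \<gamma> p < k * lam powr ((p + \<gamma>) / (p - 1))" unfolding ll using k by simp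
  \<comment> \<open>One factor \<open>(p - 1) / (p + \<gamma>)\<close> is split off its power, and
    the remaining power merges with that of \<open>(\<gamma> + 1) / (p - 1)\<close>.\<close>
  also have "k * lam powr ((p + \<gamma>) / (p - 1)) = lam powr ((p + \<gamma>) / (p - 1)) * ((\<gamma> + 1) / (p - 1)) powr ((\<gamma> + 1) / (p - 1))
                  * ((p - 1) / (p + \<gamma>)) powr ((p + \<gamma>) / (p - 1))"
  proof -
    have e: "(p + \<gamma>) / (p - 1) = 1 + (\<gamma> + 1) / (p - 1)" using p by (simp add: field_simps)
    have "((p - 1) / (p + \<gamma>)) powr ((p + \<gamma>) / (p - 1)) = ((p - 1) / (p + \<gamma>)) * ((p - 1) / (p + \<gamma>)) powr ((\<gamma> + 1) / (p - 1))"
      unfolding e powr_add using \<gamma> p by simp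
    moreover have "((\<gamma> + 1) / (p - 1)) powr ((\<gamma> + 1) / (p - 1)) * ((p - 1) / (p + \<gamma>)) powr ((\<gamma> + 1) / (p - 1))
        = ((1 + \<gamma>) / (p + \<gamma>)) powr ((1 + \<gamma>) / (p - 1))"
      using \<gamma> p by (simp add: powr_mult[symmetric] add.commute)
    ultimately show ?thesis unfolding k_def by (simp add: mult_ac)
  qed
  finally show "lambda_lower V a0 b0 \<gamma> p < lam powr ((p + \<gamma>) / (p - 1)) * ((\<gamma> + 1) / (p - 1)) powr ((\<gamma> + 1) / (p - 1))
                  * ((p - 1) / (p + \<gamma>)) powr ((p + \<gamma>) / (p - 1))" .
qed

end

theorem theorem1p2:
  fixes V a b :: "real ^ 'n \<Rightarrow> real"
    and \<gamma> p :: real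
    and \<Omega> :: "(real ^ 'n) set"
  assumes "CARD('n) \<ge> 3"
    and "0 < \<gamma>" "\<gamma> < 1" "1 < p" "p < 2 * real CARD('n) / (real CARD('n) - 2) - 1"
    and "in_Lp (2 / (1 + \<gamma>)) UNIV a" "AE x in lebesgue. 0 < a x"
    and "in_Linf UNIV b" "\<not> (AE x in lebesgue. max (b x) 0 = 0)"
    and "continuous_on UNIV V" "\<And>x. 0 < V x" "0 < (INF x. V x)"
    and "filterlim V at_top at_infinity
         \<or> integrable lebesgue (\<lambda>x. 1 / V x)
         \<or> (\<forall>M>0. emeasure lebesgue {x. V x \<le> M} < \<infinity>)"
    and "(AE x in lebesgue. 0 < b x) \<Longrightarrow>
           (\<lambda>x. (a x / b x) powr (1 / (p + \<gamma>))) \<notin> X_space V"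
    and "smooth_bounded_open \<Omega>" "AE x in lebesgue_on \<Omega>. 0 < b x" "in_Linf \<Omega> a"
  shows "\<exists>lam_up>0.
      (\<forall>lam>lam_up. \<not> (\<exists>u. is_solution V a b \<gamma> p lam u)) \<and>
      0 < lambda_lower V a b \<gamma> p \<and> lambda_lower V a b \<gamma> p < lam_up \<and>
      (\<exists>lam1>0. is_first_eigenvalue \<Omega> V (\<lambda>x. min (a x) (b x)) lam1 \<and>
         lam_up = lam1 powr ((p + \<gamma>) / (p - 1))
                  * ((\<gamma> + 1) / (p - 1)) powr ((\<gamma> + 1) / (p - 1))
                  * ((p - 1) / (p + \<gamma>)) powr ((p + \<gamma>) / (p - 1)))"
proof -
  have \<Omega>: "open \<Omega>" "bounded \<Omega>" "\<Omega> \<noteq> {}" using assms(15) by (auto simp: smooth_bounded_open_def)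
  obtain R where R: "\<Omega> \<subseteq> cball 0 R" using \<Omega>(2) unfolding bounded_iff by (auto simp: subset_iff)
  have Vb: "V \<in> borel_measurable borel" by (rule borel_measurable_continuous_onI[OF assms(10)])
  define c where "c = (INF x. V x)"
  have c: "0 < c" "c \<le> V x" for x
    unfolding c_def by (rule assms(12), rule cINF_lower) (auto intro!: bdd_belowI[of _ 0] less_imp_le assms(11))
  \<comment> \<open>Continuity bounds the potential on a ball around \<Omega>, which is the only
    place where an upper bound is used.\<close>
  have "bounded (V ` cball 0 R)" by (intro compact_imp_bounded compact_continuous_image continuous_on_subset[OF assms(10)]) auto
  then obtain KV where KV: "\<And>x. x \<in> cball 0 R \<Longrightarrow> \<bar>V x\<bar> \<le> KV"
    unfolding bounded_iff ball_simps real_norm_def by blast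
  have amL: "a \<in> borel_measurable (lebesgue_on UNIV)" and bmL: "b \<in> borel_measurable (lebesgue_on UNIV)"
    using assms(6,8) by (auto simp: in_Lp_def in_Linf_def)
  obtain a' where a': "a' \<in> borel_measurable borel" "AE x in lborel. a x = a' x"
    using borel_representative[OF open_UNIV amL] by auto
  obtain b' where b': "b' \<in> borel_measurable borel" "AE x in lborel. b x = b' x"
    using borel_representative[OF open_UNIV bmL] by auto
  have apos: "AE x in lborel. 0 < a' x"
    using assms(7) a'(2) unfolding AE_completion_iff by eventually_elim simp
  have ai: "integrable lborel (\<lambda>x. \<bar>a' x\<bar> powr (2 / (1 + \<gamma>)))"
  proof -
    have "integrable (lebesgue_on UNIV) (\<lambda>x. norm (a x) powr (2 / (1 + \<gamma>)))" using assms(6) by (simp add: in_Lp_def)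
    moreover have "(\<lambda>x. \<bar>a' x\<bar> powr (2 / (1 + \<gamma>))) \<in> borel_measurable borel" using a'(1) by measurable
    moreover have "AE x in lborel. x \<in> UNIV \<longrightarrow> norm (a x) powr (2 / (1 + \<gamma>)) = \<bar>a' x\<bar> powr (2 / (1 + \<gamma>))"
      using a'(2) by eventually_elim simp
    ultimately show ?thesis using integrable_leb_on[OF open_UNIV] by fastforce
  qed
  obtain Cb where Cb: "AE x in lborel. \<bar>b' x\<bar> \<le> Cb"
  proof -
    obtain C where "AE x in lebesgue_on UNIV. \<bar>b x\<bar> \<le> C" using assms(8) by (auto simp: in_Linf_def)
    then have "AE x in lborel. \<bar>b x\<bar> \<le> C" by (simp add: AE_leb_on)
    with b'(2) have "AE x in lborel. \<bar>b' x\<bar> \<le> C" by eventually_elim simp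
    then show ?thesis by (rule that)
  qed
  obtain Ca where Ca: "AE x in lborel. x \<in> \<Omega> \<longrightarrow> \<bar>a x\<bar> \<le> Ca"
    using assms(17) \<Omega>(1) by (auto simp: in_Linf_def AE_leb_on)
  have bpos: "AE x in lborel. x \<in> \<Omega> \<longrightarrow> 0 < b x" using assms(16) \<Omega>(1) by (simp add: AE_leb_on)
  define K where "K = max 1 (max KV Ca)"
  define W where "W x = indicator \<Omega> x * V x" for x
  \<comment> \<open>On the exceptional null set the weight is set to \<open>K\<close> instead of the
    minimum, so that positivity and boundedness hold at every point of \<Omega>.\<close>
  define ok where "ok x \<longleftrightarrow> 0 < min (a' x) (b' x) \<and> min (a' x) (b' x) \<le> K" for x
  define m where "m x = (if x \<in> \<Omega> then if ok x then min (a' x) (b' x) else K else 0)" for x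
  have [measurable]: "\<Omega> \<in> sets borel" using \<Omega>(1) by simp
  note [measurable] = a'(1) b'(1) Vb
  interpret singular_problem \<Omega> W m K c R V a' b' a b \<gamma> p Cb
  proof
    show "open \<Omega>" "\<Omega> \<noteq> {}" "\<Omega> \<subseteq> cball 0 R" by (fact \<Omega> R)+
    show "W \<in> borel_measurable borel" unfolding W_def by measurable
    show "0 \<le> W x" for x using c(1) c(2)[of x] by (simp add: W_def)
    show "W x \<le> K" for x
    proof (cases "x \<in> \<Omega>")
      case True
      then have "\<bar>V x\<bar> \<le> KV" using R KV by blast
      then show ?thesis using True by (simp add: W_def K_def)
    qed (simp add: W_def K_def)
    show "c \<le> W x" if "x \<in> \<Omega>" for x using that c(2) by (simp add: W_def)
    show "0 < c" by (rule c(1))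
    show "m \<in> borel_measurable borel" unfolding m_def ok_def by measurable
    show "0 \<le> m x" "m x \<le> K" for x by (auto simp: m_def ok_def K_def)
    show "0 < m x" if "x \<in> \<Omega>" for x using that by (auto simp: m_def ok_def K_def)
    show "m x = 0" if "x \<notin> \<Omega>" for x using that by (simp add: m_def)
    show "3 \<le> DIM(real ^ 'n)" using assms(1) by simp
    show "0 < \<gamma>" "\<gamma> < 1" "1 < p" by (fact assms)+
    show "p < 2 * real DIM(real ^ 'n) / (real DIM(real ^ 'n) - 2) - 1" using assms(5) by simp
    show "V \<in> borel_measurable borel" by (rule Vb)
    show "c \<le> V x" for x by (rule c(2))
    show "W x = indicator \<Omega> x * V x" for x by (rule W_def)
    show "a' \<in> borel_measurable borel" "b' \<in> borel_measurable borel" by (fact a' b')+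
    show "integrable lborel (\<lambda>x. \<bar>a' x\<bar> powr (2 / (1 + \<gamma>)))" by (rule ai)
    show "AE x in lborel. 0 < a' x" by (rule apos)
    show "AE x in lborel. \<bar>b' x\<bar> \<le> Cb" by (rule Cb)
    show "AE x in lborel. x \<in> \<Omega> \<longrightarrow> m x = min (a' x) (b' x)"
      using Ca bpos a'(2) b'(2) apos by eventually_elim (auto simp: m_def ok_def K_def min_def max_def)
    show "AE x in lborel. a x = a' x" "AE x in lborel. b x = b' x" by (fact a' b')+
  qed
  let ?up = "lam powr ((p + \<gamma>) / (p - 1)) * ((\<gamma> + 1) / (p - 1)) powr ((\<gamma> + 1) / (p - 1))
                  * ((p - 1) / (p + \<gamma>)) powr ((p + \<gamma>) / (p - 1))"
  have ev: "\<exists>lam1>0. is_first_eigenvalue \<Omega> V (\<lambda>x. min (a x) (b x)) lam1 \<and>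
         ?up = lam1 powr ((p + \<gamma>) / (p - 1)) * ((\<gamma> + 1) / (p - 1)) powr ((\<gamma> + 1) / (p - 1))
                  * ((p - 1) / (p + \<gamma>)) powr ((p + \<gamma>) / (p - 1))"
    using first_eigenvalue lam_pos by (intro exI[of _ lam] conjI refl)
  have "\<forall>l>?up. \<not> (\<exists>u. is_solution V a b \<gamma> p l u)" using no_solution by blast
  note conjI[OF this conjI[OF lambda_lower_bounds(1) conjI[OF lambda_lower_bounds(2) ev]]]
  moreover have "0 < ?up" using lambda_lower_bounds by linarith
  ultimately show ?thesis by (rule exI[of _ ?up, OF conjI, rotated])
qed

end
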